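(* Let $G$ be a 2-connected non-bipartite cubic graph. Then: (i) $\Upsilon(G)\geq 4$; moreover, $\Upsilon(G)=4$ if and only if $G\in \{K_4\}\cup \mathcal{F}_1\cup\mathcal{F}_2\cup\cdots\cup\mathcal{F}_6$. (ii) If $G$ is 3-connected and $G\neq K_4$, then $\Upsilon(G)\geq 6$; moreover, $\Upsilon(G)=6$ if and only if $G\in \{\overline{C_6},K_{3,3}^\triangle\}\cup \mathcal{G}_1\cup\mathcal{G}_2$.
   Context: All graphs are finite, simple and connected. A subgraph $G'$ of $G$ is nice if $G-V(G')$ has a perfect matching. A vertex $u$ of a cubic graph $G$ is nice if $G-N_G[u]$ has a perfect matching (i.e. $u$ and its neighbours induce a nice subgraph). $\Upsilon(G)$ denotes the number of nice vertices of $G$. $\overline{C_6}$ is the triangular prism (complement of the 6-cycle). Splicing: for vertex-disjoint graphs $G_1,G_2$, vertices $u\in V(G_1)$, $v\in V(G_2)$ of equal degree and a bijection $\phi$ from the edges at $u$ to the edges at $v$, $(G_1\odot G_2)_{u,v,\phi}$ is obtained from $(G_1-u)\cup(G_2-v)$ by joining, for each edge $e$ at $u$, the end of $e$ other than $u$ to the end of $\phi(e)$ other than $v$. $K_{3,3}^\triangle$ is the graph on $\{t_1,t_2,t_3,a_1,a_2,b_1,b_2,b_3\}$ with edges $t_1t_2,t_2t_3,t_3t_1$, $t_ib_i$ ($i=1,2,3$) and $a_jb_i$ ($j=1,2$, $i=1,2,3$) (i.e. $K_{3,3}$ with one vertex replaced by a triangle); its non-nice vertices are exactly $a_1,a_2$.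 Let $\widehat{\mathcal{H}}$ be the set of 3-connected cubic bipartite graphs. $\mathcal{G}_1$ is the set of all graphs $(K_{3,3}^\triangle\odot H)_{u,v,\phi}$ with $u\in\{a_1,a_2\}$, $H\in\widehat{\mathcal{H}}$, $v\in V(H)$ and $\phi$ any bijection; $\mathcal{G}_2$ is the set of all graphs $((K_{3,3}^\triangle\odot H_1)_{a_1,v_1,\phi_1}\odot H_2)_{a_2,v_2,\phi_2}$ with $H_1,H_2\in\widehat{\mathcal{H}}$, $v_i\in V(H_i)$ and bijections $\phi_i$. Edge splicing: for vertex-disjoint graphs $G_1,G_2$ and edges $e_1=x_1x_2\in E(G_1)$, $e_2=y_1y_2\in E(G_2)$, $(G_1\oplus G_2)_{e_1,e_2}$ is obtained from $(G_1-e_1)\cup(G_2-e_2)$ by identifying $x_i$ with $y_i$ for $i=1,2$. $L_n$ ($n\ge1$) is the linear chain of $n$ quadrangles (the ladder $P_2\times P_{n+1}$). A 22-edge is an edge both of whose ends have degree 2. Let $\mathcal{H}$ be the set of cubic bipartite graphs and $\mathcal{H}^\diamond$ the set of all graphs $(L_n\oplus H)_{e,f}$ with $n\ge 1$, $e$ a 22-edge of $L_n$, $H\in\mathcal{H}$, $f\in E(H)$; each graph in $\mathcal{H}^\diamond$ is bipartite with exactly one 22-edge. Replacing an edge $e$ of $K_4$ by $H\in\mathcal{H}^\diamond$ means edge splicing $K_4$ at $e$ and $H$ at its 22-edge. For $1\le i\le 6$, $\mathcal{F}_i$ is the set of graphs obtained from $K_4$ by replacing $i$ distinct edges of $K_4$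 by $i$ (not necessarily distinct) graphs of $\mathcal{H}^\diamond$. *)

theory Defs
  imports Main
begin

section \<open>Graphs\<close>

datatype 'a graph = Graph (verts: "'a set") (edges: "'a set set")

definition simple_graph :: "'a graph \<Rightarrow> bool" where
  "simple_graph G \<longleftrightarrow> finite (verts G) \<and> (\<forall>e\<in>edges G. e \<subseteq> verts G \<and> card e = 2)"

definition adj :: "'a graph \<Rightarrow> 'a \<Rightarrow> 'a \<Rightarrow> bool" where
  "adj G u v \<longleftrightarrow> {u, v} \<in> edges G"

definition edges_at :: "'a graph \<Rightarrow> 'a \<Rightarrow> 'a set set" where
  "edges_at G v = {e \<in> edges G. v \<in> e}"

definition degree :: "'a graph \<Rightarrow> 'a \<Rightarrow> nat" where
  "degree G v = card (edges_at G v)"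

definition closed_nbhd :: "'a graph \<Rightarrow> 'a \<Rightarrow> 'a set" where
  "closed_nbhd G u = insert u {v. adj G u v}"

definition del_verts :: "'a graph \<Rightarrow> 'a set \<Rightarrow> 'a graph" where
  "del_verts G S = Graph (verts G - S) {e \<in> edges G. e \<inter> S = {}}"

definition connected_graph :: "'a graph \<Rightarrow> bool" where
  "connected_graph G \<longleftrightarrow> verts G \<noteq> {} \<and> (\<forall>u\<in>verts G. \<forall>v\<in>verts G. (adj G)\<^sup>*\<^sup>* u v)"

definition k_connected :: "nat \<Rightarrow> 'a graph \<Rightarrow> bool" where
  "k_connected k G \<longleftrightarrow> k < card (verts G) \<and>
     (\<forall>S\<subseteq>verts G. card S < k \<longrightarrow> connected_graph (del_verts G S))"

definition cubic :: "'a graph \<Rightarrow> bool" where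
  "cubic G \<longleftrightarrow> (\<forall>v\<in>verts G. degree G v = 3)"

definition bipartite :: "'a graph \<Rightarrow> bool" where
  "bipartite G \<longleftrightarrow> (\<exists>A B. A \<union> B = verts G \<and> A \<inter> B = {} \<and>
     (\<forall>e\<in>edges G. \<exists>u\<in>A. \<exists>v\<in>B. e = {u, v}))"

definition graph_iso :: "'a graph \<Rightarrow> 'b graph \<Rightarrow> bool" (infix "\<cong>\<^sub>g" 50) where
  "G \<cong>\<^sub>g H \<longleftrightarrow> (\<exists>f. bij_betw f (verts G) (verts H) \<and>
     (\<forall>u\<in>verts G. \<forall>v\<in>verts G. adj G u v \<longleftrightarrow> adj H (f u) (f v)))"


section \<open>Perfect matchings and nice vertices\<close>

text \<open>The graph without vertices has a perfect matching (the empty one); in particular every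
  vertex of \<open>K\<^sub>4\<close> is nice.\<close>

definition perfect_matching :: "'a graph \<Rightarrow> 'a set set \<Rightarrow> bool" where
  "perfect_matching G M \<longleftrightarrow> M \<subseteq> edges G \<and> (\<forall>v\<in>verts G. \<exists>!e. e \<in> M \<and> v \<in> e)"

definition nice_vertex :: "'a graph \<Rightarrow> 'a \<Rightarrow> bool" where
  "nice_vertex G u \<longleftrightarrow> u \<in> verts G \<and> (\<exists>M. perfect_matching (del_verts G (closed_nbhd G u)) M)"

definition Upsilon :: "'a graph \<Rightarrow> nat" where
  "Upsilon G = card {u. nice_vertex G u}"


section \<open>Particular graphs\<close>

definition complete_graph :: "nat \<Rightarrow> nat graph" where
  "complete_graph n = Graph {..<n} {{i, j} | i j. i < n \<and> j < n \<and> i \<noteq> j}"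

definition cycle_graph :: "nat \<Rightarrow> nat graph" where
  "cycle_graph n = Graph {..<n} {{i, Suc i mod n} | i. i < n}"

definition path_graph :: "nat \<Rightarrow> nat graph" where
  "path_graph n = Graph {..<n} {{i, Suc i} | i. Suc i < n}"

definition complement :: "'a graph \<Rightarrow> 'a graph" where
  "complement G = Graph (verts G)
     {{u, v} | u v. u \<in> verts G \<and> v \<in> verts G \<and> u \<noteq> v \<and> {u, v} \<notin> edges G}"

definition cartesian_product :: "'a graph \<Rightarrow> 'b graph \<Rightarrow> ('a \<times> 'b) graph" where
  "cartesian_product G H = Graph (verts G \<times> verts H)
     ({{(x, y), (x, y')} | x y y'. x \<in> verts G \<and> {y, y'} \<in> edges H} \<union>
      {{(x, y), (x', y)} | x x' y. {x, x'} \<in> edges G \<and> y \<in> verts H})"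

abbreviation K4 :: "nat graph" where
  "K4 \<equiv> complete_graph 4"

definition prism :: "nat graph" where
  "prism = complement (cycle_graph 6)"

text \<open>The vertices \<open>t\<^sub>i\<close>, \<open>b\<^sub>i\<close> (\<open>i = 1, 2, 3\<close>) and \<open>a\<^sub>j\<close> (\<open>j = 1, 2\<close>) of
  \<open>K\<^sub>3\<^sub>,\<^sub>3\<close> with one vertex replaced by a triangle are coded as the numbers 1 to 8.\<close>

definition tv :: "nat \<Rightarrow> nat" where "tv i = i"
definition bv :: "nat \<Rightarrow> nat" where "bv i = 3 + i"
definition av :: "nat \<Rightarrow> nat" where "av j = 6 + j"

definition K33tri :: "nat graph" where
  "K33tri = Graph (tv ` {1, 2, 3} \<union> bv ` {1, 2, 3} \<union> av ` {1, 2})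
     ({{tv 1, tv 2}, {tv 2, tv 3}, {tv 3, tv 1}} \<union>
      {{tv i, bv i} | i. i \<in> {1, 2, 3}} \<union>
      {{av j, bv i} | j i. j \<in> {1, 2} \<and> i \<in> {1, 2, 3}})"

definition ladder :: "nat \<Rightarrow> (nat \<times> nat) graph" where
  "ladder n = cartesian_product (path_graph 2) (path_graph (n + 1))"


section \<open>Splicing\<close>

text \<open>Both operations are meant for graphs with disjoint vertex sets; the map \<open>\<phi>\<close> is meant to be
  a bijection from the edges at \<open>u\<close> to the edges at \<open>v\<close>.\<close>

definition splice :: "'a graph \<Rightarrow> 'a graph \<Rightarrow> 'a \<Rightarrow> 'a \<Rightarrow> ('a set \<Rightarrow> 'a set) \<Rightarrow> 'a graph" where
  "splice G1 G2 u v \<phi> = Graph ((verts G1 - {u}) \<union> (verts G2 - {v}))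
     (edges (del_verts G1 {u}) \<union> edges (del_verts G2 {v}) \<union>
      {{x, y} | x y. {u, x} \<in> edges G1 \<and> {v, y} \<in> edges G2 \<and> \<phi> {u, x} = {v, y}})"

text \<open>Edge splicing depends on the order of the ends of the two edges: \<open>y1\<close> is identified with
  \<open>x1\<close>, and \<open>y2\<close> with \<open>x2\<close>. The identified vertices keep the names \<open>x1\<close>, \<open>x2\<close>.\<close>

definition edge_splice :: "'a graph \<Rightarrow> 'a graph \<Rightarrow> 'a \<times> 'a \<Rightarrow> 'a \<times> 'a \<Rightarrow> 'a graph" where
  "edge_splice G1 G2 = (\<lambda>(x1, x2) (y1, y2).
     let r = (\<lambda>z. if z = y1 then x1 else if z = y2 then x2 else z) in
     Graph (verts G1 \<union> r ` verts G2)
       ((edges G1 - {{x1, x2}}) \<union> (\<lambda>e. r ` e) ` (edges G2 - {{y1, y2}})))"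


section \<open>The families of extremal graphs\<close>

text \<open>Graphs are only considered up to isomorphism, so all families consist of graphs whose vertices
  are natural numbers. This leaves room for vertex-disjoint copies of all finite graphs.\<close>

definition cubic_bip :: "nat graph set" where
  "cubic_bip = {H. simple_graph H \<and> connected_graph H \<and> cubic H \<and> bipartite H}"

definition cubic_bip3 :: "nat graph set" where
  "cubic_bip3 = {H. simple_graph H \<and> k_connected 3 H \<and> cubic H \<and> bipartite H}"

definition family_G1 :: "nat graph set" where
  "family_G1 = {splice K33tri H u v \<phi> | H u v \<phi>.
     u \<in> {av 1, av 2} \<and> H \<in> cubic_bip3 \<and> v \<in> verts H \<and>
     verts K33tri \<inter> verts H = {} \<and>
     bij_betw \<phi> (edges_at K33tri u) (edges_at H v)}"

definition family_G2 :: "nat graph set" where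
  "family_G2 = {splice G' H2 (av 2) v2 \<phi>2 | G' H1 H2 v1 v2 \<phi>1 \<phi>2.
     H1 \<in> cubic_bip3 \<and> v1 \<in> verts H1 \<and>
     verts K33tri \<inter> verts H1 = {} \<and>
     bij_betw \<phi>1 (edges_at K33tri (av 1)) (edges_at H1 v1) \<and>
     G' = splice K33tri H1 (av 1) v1 \<phi>1 \<and>
     H2 \<in> cubic_bip3 \<and> v2 \<in> verts H2 \<and>
     verts G' \<inter> verts H2 = {} \<and>
     bij_betw \<phi>2 (edges_at G' (av 2)) (edges_at H2 v2)}"

definition edge22 :: "'a graph \<Rightarrow> 'a set \<Rightarrow> bool" where
  "edge22 G e \<longleftrightarrow> e \<in> edges G \<and> (\<forall>v\<in>e. degree G v = 2)"

text \<open>\<open>L\<close> ranges over all copies of the ladder on natural numbers, so that this family is closed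
  under isomorphism.\<close>

definition H_diamond :: "nat graph set" where
  "H_diamond = {edge_splice L H (x1, x2) (y1, y2) | L H n x1 x2 y1 y2.
     n \<ge> 1 \<and> simple_graph L \<and> L \<cong>\<^sub>g ladder n \<and> edge22 L {x1, x2} \<and>
     H \<in> cubic_bip \<and> {y1, y2} \<in> edges H \<and>
     verts L \<inter> verts H = {}}"

text \<open>\<open>K4_replaced S G\<close>: the graph \<open>G\<close> arises from \<open>K\<^sub>4\<close> by replacing exactly the edges in \<open>S\<close>.
  The vertices of \<open>K\<^sub>4\<close> keep their names, so the edges outside \<open>S\<close> are still edges of \<open>G\<close>.\<close>

inductive K4_replaced :: "nat set set \<Rightarrow> nat graph \<Rightarrow> bool" where
  K4: "K4_replaced {} K4"
| replace: "K4_replaced (insert {x1, x2} S) (edge_splice G H (x1, x2) (y1, y2))"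
  if "K4_replaced S G" "{x1, x2} \<in> edges K4" "{x1, x2} \<notin> S"
    "H \<in> H_diamond" "edge22 H {y1, y2}" "verts G \<inter> verts H = {}"

definition family_F :: "nat \<Rightarrow> nat graph set" where
  "family_F i = {G. \<exists>S. card S = i \<and> K4_replaced S G}"

end

theory Submission
  imports Defs "HOL-Library.Disjoint_Sets"
begin

text \<open>A vertex \<open>v\<close> of a 2-connected cubic graph fails to be nice iff, by Tutte's theorem, some barrier
  \<open>S\<close> contains \<open>N(v)\<close>. Counting edges shows that a barrier is independent and that every odd component
  it leaves has exactly three outgoing edges.

  3-connected case, by induction on the order: if some vertex is not nice, take a maximal barrier around
  its neighbourhood; its nontrivial components are not bipartite. Contracting the outside of such a component
  \<open>C\<close> gives a smaller graph whose nice vertices are nice in \<open>G\<close>. Two nontrivial components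
  give at least 8 nice vertices. With one, either the contracted vertex is not nice and the
  induction hypothesis applies directly, or the three ends in \<open>S\<close> of the edges leaving \<open>C\<close> are nice
  as well. In case of equality \<open>C\<close> is a triangle, and a non-nice vertex of \<open>S\<close> lies in a set
  \<open>Y\<close> with \<open>|N(Y)| = |Y| + 1\<close>. Uncrossing such sets cuts the rest of the graph into
  two bipartite pieces, which is the splicing structure.

  2-edge cuts: replace the far side of a minimal nonbipartite side \<open>Y\<close> of a 2-edge cut by an edge. Nice vertices of
  the reduced graph are nice in \<open>G\<close>, so there are at least four, and at least eight if the far side is not bipartite
  either; otherwise the far side is a gadget inserted into an edge, whence the description by \<open>K\<^sub>4\<close>.\<close>

section \<open>Hall's and Tutte's theorems\<close>

text \<open>Niceness must survive the way back from a smaller graph. The reason it does: in a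
  2-edge-connected cubic graph every edge lies in a perfect matching, and such a matching through an
  edge leaving a barrier component \<open>C\<close> uses no other edge leaving \<open>C\<close>. It
  therefore splits into a matching of \<open>C\<close> minus one end and one of the rest minus the
  other end; the second half completes matchings of the contracted graph. The constants come from
  \<open>K4\<close>, which has only four nice vertices. A triangle \<open>C\<close> contracts to
  \<open>K4\<close> and so is guaranteed 4 - 1 = 3 nice vertices, any other \<open>C\<close> at
  least 6 - 1 = 5, the subtracted one being the contracted vertex. Hence 6 = 3 + 3 can be attained
  only with a triangle when the contracted vertex is nice. The inductions run on edge connectivity,
  since contraction and reduction keep the sizes of the relevant cuts; it is converted to vertex
  connectivity and back only where the theorem or the families speak of the latter. In the converse
  directions the structures \<open>core6\<close> and \<open>k4like\<close> are pulled back to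
  \<open>G\<close> itself, where they exhibit a barrier around every vertex outside a set of six or
  four.\<close>

lemma hall:
  fixes R :: "'a \<Rightarrow> 'b set"
  assumes "finite A" "\<And>x. x \<in> A \<Longrightarrow> finite (R x)"
    and "\<And>X. X \<subseteq> A \<Longrightarrow> card X \<le> card (\<Union>x\<in>X. R x)"
  shows "\<exists>f. inj_on f A \<and> (\<forall>x\<in>A. f x \<in> R x)"
  using assms
proof (induction "card A" arbitrary: A R rule: less_induct)
  case less
  note fin = less.prems(1) and finR = less.prems(2) and hc = less.prems(3)
  have finU: "finite (\<Union>x\<in>X. R x)" if "X \<subseteq> A" for X
    using that fin finR by (meson finite_UN finite_subset subsetD)
  show ?case
  proof (cases "A = {}")
    case True
    then show ?thesis by simp
  next
    case False
    show ?thesis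
    \<comment> \<open>A proper tight set \<open>Y\<close> splits the problem: \<open>Y\<close> is
      served inside its neighbourhood and the rest outside of it. Without one, every nonempty proper
      subset has a neighbour to spare, so an arbitrary choice for one point does no harm.\<close>
    proof (cases "\<exists>Y. Y \<subset> A \<and> Y \<noteq> {} \<and> card (\<Union>x\<in>Y. R x) = card Y")
      case True
      then obtain Y where Y: "Y \<subset> A" "Y \<noteq> {}" "card (\<Union>x\<in>Y. R x) = card Y" by blast
      have finY: "finite Y" using Y(1) fin finite_subset by blast
      have "\<exists>f. inj_on f Y \<and> (\<forall>x\<in>Y. f x \<in> R x)"
      proof (rule less.hyps)
        show "card Y < card A" using Y(1) fin by (simp add: psubset_card_mono)
      qed (use Y(1) finY finR hc in auto)
      then obtain f where f: "inj_on f Y" "\<forall>x\<in>Y. f x \<in> R x" by blast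
      let ?U = "\<Union>x\<in>Y. R x"
      have "\<exists>g. inj_on g (A - Y) \<and> (\<forall>x\<in>A - Y. g x \<in> R x - ?U)"
      proof (rule less.hyps)
        show "card (A - Y) < card A"
          by (rule psubset_card_mono[OF fin]) (use Y(1,2) in auto)
        show "finite (A - Y)" using fin by simp
        show "finite (R x - ?U)" if "x \<in> A - Y" for x using that finR by auto
        fix X assume X: "X \<subseteq> A - Y"
        have "card (X \<union> Y) \<le> card (\<Union>x\<in>X \<union> Y. R x)" by (rule hc) (use X Y(1) in auto)
        moreover have "card (X \<union> Y) = card X + card Y"
          using X finY fin by (intro card_Un_disjoint) (auto intro: finite_subset)
        moreover have "(\<Union>x\<in>X \<union> Y. R x) = (\<Union>x\<in>X. R x - ?U) \<union> ?U" by auto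
        moreover have "card ((\<Union>x\<in>X. R x - ?U) \<union> ?U) = card (\<Union>x\<in>X. R x - ?U) + card ?U"
        proof (rule card_Un_disjoint)
          have "(\<Union>x\<in>X. R x - ?U) \<subseteq> (\<Union>x\<in>X. R x)" by auto
          then show "finite (\<Union>x\<in>X. R x - ?U)"
            using finU[of X] X by (meson Diff_subset finite_subset subset_trans)
          show "finite ?U" using finU Y(1) by blast
        qed auto
        ultimately show "card X \<le> card (\<Union>x\<in>X. R x - ?U)"
          using Y(3) by (metis add_le_cancel_right)
      qed
      then obtain g where g: "inj_on g (A - Y)" "\<forall>x\<in>A - Y. g x \<in> R x - ?U" by blast
      let ?h = "\<lambda>x. if x \<in> Y then f x else g x"
      have fg: "f x \<noteq> g y" if "x \<in> Y" "y \<in> A - Y" for x y using f(2) g(2) that by fastforce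
      have "inj_on ?h A"
      proof (rule inj_onI)
        fix x y assume "x \<in> A" "y \<in> A" "?h x = ?h y"
        then show "x = y"
          using fg[of x y] fg[of y x] inj_onD[OF f(1)] inj_onD[OF g(1)] by (auto split: if_splits)
      qed
      moreover have "\<forall>x\<in>A. ?h x \<in> R x" using f g by auto
      ultimately show ?thesis by blast
    next
      case nt: False
      obtain a where a: "a \<in> A" using False by blast
      have "card {a} \<le> card (R a)" using hc[of "{a}"] a by simp
      then obtain b where b: "b \<in> R a" by fastforce
      have "\<exists>g. inj_on g (A - {a}) \<and> (\<forall>x\<in>A - {a}. g x \<in> R x - {b})"
      proof (rule less.hyps)
        show "card (A - {a}) < card A" using a fin by (meson card_Diff1_less)
        show "finite (A - {a})" using fin by simp
        show "finite (R x - {b})" if "x \<in> A - {a}" for x using that finR by auto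
        fix X assume X: "X \<subseteq> A - {a}"
        show "card X \<le> card (\<Union>x\<in>X. R x - {b})"
        proof (cases "X = {}")
          case False
          have "card X \<noteq> card (\<Union>x\<in>X. R x)" using nt X a False by (metis Diff_iff insertI1 psubsetI subset_Diff_insert subset_iff)
          moreover have "card X \<le> card (\<Union>x\<in>X. R x)" using hc X by blast
          moreover have "(\<Union>x\<in>X. R x - {b}) = (\<Union>x\<in>X. R x) - {b}" by auto
          ultimately show ?thesis by (auto simp: card_Diff_singleton_if)
        qed simp
      qed
      then obtain g where g: "inj_on g (A - {a})" "\<forall>x\<in>A - {a}. g x \<in> R x - {b}" by blast
      have "inj_on (g(a := b)) A"
        using g by (auto simp: inj_on_def)
      moreover have "\<forall>x\<in>A. (g(a := b)) x \<in> R x" using g b by auto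
      ultimately show ?thesis by blast
    qed
  qed
qed

section \<open>Edge counts, matchable vertex sets and odd families\<close>

definition nb :: "'a graph \<Rightarrow> 'a \<Rightarrow> 'a set" where
  "nb G v = {u. adj G v u}"

text \<open>Ordered pairs are counted, so \<open>ec G X X\<close> is twice the number of edges
  inside \<open>X\<close>.\<close>

definition ec :: "'a graph \<Rightarrow> 'a set \<Rightarrow> 'a set \<Rightarrow> nat" where
  "ec G X Y = (\<Sum>x\<in>X. card (nb G x \<inter> Y))"

abbreviation cut :: "'a graph \<Rightarrow> 'a set \<Rightarrow> nat" where
  "cut G X \<equiv> ec G X (verts G - X)"

text \<open>The form of connectivity used by the inductions: cuts of contracted and reduced graphs
  are compared directly with cuts of the original graph. For cubic graphs it follows from vertex
  connectivity by \<open>k_edge_conn\<close>.\<close>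

definition edge_conn :: "nat \<Rightarrow> 'a graph \<Rightarrow> bool" where
  "edge_conn k G \<longleftrightarrow> verts G \<noteq> {} \<and> (\<forall>X. X \<subset> verts G \<and> X \<noteq> {} \<longrightarrow> k \<le> cut G X)"

text \<open>A perfect matching of the subgraph induced by \<open>X\<close>. Describing it by
  disjoint edges with union exactly \<open>X\<close> avoids building subgraphs and makes matchings
  of disjoint sets combine by plain union.\<close>

definition matchable :: "'a graph \<Rightarrow> 'a set \<Rightarrow> bool" where
  "matchable G X \<longleftrightarrow> (\<exists>M \<subseteq> edges G. disjoint M \<and> \<Union>M = X)"

definition bip_on :: "'a graph \<Rightarrow> 'a set \<Rightarrow> 'a set \<Rightarrow> bool" where
  "bip_on G P Q \<longleftrightarrow> P \<inter> Q = {} \<and> (\<forall>x\<in>P. nb G x \<inter> P = {}) \<and> (\<forall>x\<in>Q. nb G x \<inter> Q = {})"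

text \<open>The members of \<open>\<C>\<close> need only be odd and closed in \<open>W - S\<close>, not connected: this replaces
  odd components throughout. The case \<open>card \<C> = card S\<close> is a barrier.\<close>

definition odd_family :: "'a graph \<Rightarrow> 'a set \<Rightarrow> 'a set \<Rightarrow> 'a set set \<Rightarrow> bool" where
  "odd_family G W S \<C> \<longleftrightarrow> S \<subseteq> W \<and> \<C> \<subseteq> Pow (W - S) \<and> disjoint \<C> \<and>
     (\<forall>C\<in>\<C>. odd (card C) \<and> (\<forall>x\<in>C. nb G x \<inter> W \<subseteq> C \<union> S))"

lemma nb_sym: "u \<in> nb G v \<longleftrightarrow> v \<in> nb G u"
  by (simp add: nb_def adj_def insert_commute)

lemma edge_iff_nb: "{u, v} \<in> edges G \<longleftrightarrow> v \<in> nb G u"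
  by (simp add: nb_def adj_def)

lemma bip_on_commute: "bip_on G P Q \<longleftrightarrow> bip_on G Q P"
  unfolding bip_on_def by blast

lemma bip_on_mono: "bip_on G P Q \<Longrightarrow> P' \<subseteq> P \<Longrightarrow> Q' \<subseteq> Q \<Longrightarrow> bip_on G P' Q'"
  unfolding bip_on_def by blast

lemma ec_empty [simp]: "ec G {} Y = 0" "ec G X {} = 0"
  by (auto simp: ec_def)

lemma ec_insert: "finite X \<Longrightarrow> x \<notin> X \<Longrightarrow> ec G (insert x X) Y = card (nb G x \<inter> Y) + ec G X Y"
  by (simp add: ec_def)

lemma ec_single [simp]: "ec G {x} Y = card (nb G x \<inter> Y)"
  by (simp add: ec_def)

lemma ec_Un1: "finite X \<Longrightarrow> finite Y \<Longrightarrow> X \<inter> Y = {} \<Longrightarrow> ec G (X \<union> Y) Z = ec G X Z + ec G Y Z"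
  by (simp add: ec_def sum.union_disjoint)

lemma ec_cong_right: "(\<And>x. x \<in> X \<Longrightarrow> nb G x \<inter> Y = nb G x \<inter> Z) \<Longrightarrow> ec G X Y = ec G X Z"
  by (simp add: ec_def)

lemma matchable_empty [simp]: "matchable G {}"
  unfolding matchable_def by (rule exI[of _ "{}"]) auto

lemma matchable_Un:
  assumes "matchable G X" "matchable G Y" "X \<inter> Y = {}" shows "matchable G (X \<union> Y)"
proof -
  obtain M N where M: "M \<subseteq> edges G" "disjoint M" "\<Union>M = X" and N: "N \<subseteq> edges G" "disjoint N" "\<Union>N = Y"
    using assms(1,2) unfolding matchable_def by blast
  have "disjoint (M \<union> N)" using M N assms(3) by (intro disjoint_union) auto
  then show ?thesis using M N unfolding matchable_def by (intro exI[of _ "M \<union> N"]) auto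
qed

lemma matchable_edge: "v \<in> nb G u \<Longrightarrow> matchable G {u, v}"
  unfolding matchable_def by (rule exI[of _ "{{u,v}}"]) (auto simp: edge_iff_nb)

lemma matchable_match:
  assumes "finite A" "inj_on f A" "\<And>x. x \<in> A \<Longrightarrow> f x \<in> nb G x" "A \<inter> f ` A = {}"
  shows "matchable G (A \<union> f ` A)"
  using assms
proof (induction A rule: finite_induct)
  case (insert a A)
  have "matchable G ({a, f a} \<union> (A \<union> f ` A))"
    by (rule matchable_Un) (use insert in \<open>auto intro: matchable_edge\<close>)
  then show ?case by (simp add: Un_commute insert_commute)
qed simp

locale sgraph =
  fixes G :: "'a graph"
  assumes simple: "simple_graph G"
begin

lemma finV [simp]: "finite (verts G)"
  using simple by (simp add: simple_graph_def)

lemma finite_sub: "X \<subseteq> verts G \<Longrightarrow> finite X"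
  using finV finite_subset by blast

lemma edgeE:
  assumes "e \<in> edges G" obtains u v where "e = {u, v}" "u \<noteq> v" "u \<in> verts G" "v \<in> verts G" "v \<in> nb G u"
proof -
  have "card e = 2" "e \<subseteq> verts G" using assms simple by (auto simp: simple_graph_def)
  then obtain u v where "e = {u,v}" "u \<noteq> v" by (meson card_2_iff)
  then show ?thesis using that[of u v] assms \<open>e \<subseteq> verts G\<close> by (simp add: edge_iff_nb)
qed

lemma nb_irrefl [simp]: "v \<notin> nb G v"
proof
  assume "v \<in> nb G v"
  then have "{v,v} \<in> edges G" by (simp add: nb_def adj_def)
  then show False using simple by (auto simp: simple_graph_def)
qed

lemma nb_verts: "u \<in> nb G v \<Longrightarrow> u \<in> verts G \<and> v \<in> verts G"
  using simple by (force simp: nb_def adj_def simple_graph_def)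

lemma nb_sub: "nb G v \<subseteq> verts G"
  using nb_verts by blast

lemma nb_fin [simp]: "finite (nb G v)"
  using finite_sub nb_sub by blast

lemma ec_Un2: "Y \<inter> Z = {} \<Longrightarrow> ec G X (Y \<union> Z) = ec G X Y + ec G X Z"
  unfolding ec_def sum.distrib[symmetric]
  by (intro sum.cong refl) (subst Int_Un_distrib, rule card_Un_disjoint, auto)

lemma ec_mono2: "Y \<subseteq> Z \<Longrightarrow> ec G X Y \<le> ec G X Z"
  unfolding ec_def by (intro sum_mono card_mono) auto

lemma ec_sym:
  assumes "finite X" "finite Y" shows "ec G X Y = ec G Y X"
proof -
  have *: "card (nb G x \<inter> Z) = (\<Sum>y\<in>Z. if y \<in> nb G x then 1 else 0)" if "finite Z" for x Z
    using that by (simp add: sum.If_cases Int_commute)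
  have "ec G X Y = (\<Sum>x\<in>X. \<Sum>y\<in>Y. if y \<in> nb G x then 1 else 0)"
    unfolding ec_def using * assms by simp
  also have "\<dots> = (\<Sum>y\<in>Y. \<Sum>x\<in>X. if y \<in> nb G x then 1 else 0)" by (rule sum.swap)
  also have "\<dots> = ec G Y X"
    unfolding ec_def using *[OF assms(1)] by (simp add: nb_sym)
  finally show ?thesis .
qed

text \<open>Handshake argument: a new vertex contributes each of its edges into \<open>X\<close>
  twice, once from either end.\<close>

lemma ec_self_even: "finite X \<Longrightarrow> even (ec G X X)"
proof (induction X rule: finite_induct)
  case (insert x X)
  have "ec G (insert x X) (insert x X) = ec G (insert x X) (X \<union> {x})" by simp
  also have "\<dots> = ec G (insert x X) X + ec G (insert x X) {x}"
    by (rule ec_Un2) (use insert in auto)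
  also have "ec G (insert x X) {x} = ec G {x} (insert x X)"
    by (rule ec_sym) (use insert in auto)
  also have "\<dots> = card (nb G x \<inter> X)" by simp
  also have "ec G (insert x X) X = card (nb G x \<inter> X) + ec G X X"
    by (rule ec_insert) (use insert in auto)
  finally show ?case using insert by simp
qed simp

lemma ec_0_iff: "finite X \<Longrightarrow> ec G X Y = 0 \<longleftrightarrow> (\<forall>x\<in>X. nb G x \<inter> Y = {})"
  by (simp add: ec_def)

lemma cut_compl:
  assumes "X \<subseteq> verts G" shows "cut G (verts G - X) = cut G X"
proof -
  have "verts G - (verts G - X) = X" using assms by auto
  then show ?thesis using ec_sym[of "verts G - X" X] assms finite_sub by auto
qed

lemma matchable_even:
  assumes "matchable G X" shows "even (card X)"
proof -
  obtain M where M: "M \<subseteq> edges G" "disjoint M" "\<Union>M = X" using assms matchable_def by metis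
  have c2: "card e = 2" "finite e" if "e \<in> M" for e
    using that M(1) simple finV finite_subset unfolding simple_graph_def by blast+
  have "card X = (\<Sum>e\<in>M. card e)"
    using M c2 by (metis card_Union_disjoint disjoint_def disjnt_def pairwise_def)
  also have "\<dots> = (\<Sum>e\<in>M. 2)" by (rule sum.cong) (use c2 in auto)
  finally show ?thesis by simp
qed

lemma matchable_sub: assumes "matchable G X" shows "X \<subseteq> verts G"
  using assms simple unfolding matchable_def simple_graph_def by blast

lemma matchable_remove:
  assumes "matchable G X" "x \<in> X" obtains y where "y \<in> nb G x" "y \<in> X" "matchable G (X - {x, y})"
proof -
  obtain M where M: "M \<subseteq> edges G" "disjoint M" "\<Union>M = X" using assms matchable_def by metis
  obtain e where e: "e \<in> M" "x \<in> e" using M assms by blast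
  obtain u v where uv: "e = {u,v}" "v \<in> nb G u" using edgeE M(1) e(1) by (metis subsetD)
  define y where "y = (if x = u then v else u)"
  have y: "e = {x,y}" "y \<in> nb G x" using uv e(2) by (auto simp: y_def nb_sym)
  have "disjoint (M - {e})" using M(2) by (metis Diff_subset pairwise_subset)
  moreover have "\<Union>(M - {e}) = X - e"
    using M e unfolding pairwise_def disjnt_def by blast
  ultimately have "matchable G (X - {x,y})" using M(1) y(1) unfolding matchable_def
    by (metis Diff_subset subset_trans)
  then show ?thesis using that y M e by blast
qed

text \<open>Cuts a matching down to \<open>U\<close> once it is known that none of its edges crosses
  the border of \<open>U\<close>.\<close>

lemma matchable_restrict:
  assumes "M \<subseteq> edges G" "disjoint M" "U \<subseteq> \<Union>M" "\<And>e. e \<in> M \<Longrightarrow> e \<inter> U = {} \<or> e \<subseteq> U"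
  shows "matchable G U"
  unfolding matchable_def
proof (intro exI conjI)
  show "{e\<in>M. e \<subseteq> U} \<subseteq> edges G" using assms by auto
  show "disjoint {e\<in>M. e \<subseteq> U}" using assms(2) by (rule pairwise_subset) auto
  show "\<Union>{e\<in>M. e \<subseteq> U} = U"
  proof
    show "U \<subseteq> \<Union>{e\<in>M. e \<subseteq> U}"
    proof
      fix x assume x: "x \<in> U"
      then obtain e where "e \<in> M" "x \<in> e" using assms(3) by blast
      then show "x \<in> \<Union>{e\<in>M. e \<subseteq> U}" using assms(4)[of e] x by auto
    qed
  qed auto
qed

section \<open>Tutte's theorem for odd families\<close>

lemma odd_family_finite:
  assumes "odd_family G W S \<C>" "W \<subseteq> verts G"
  shows "finite \<C>" "finite S" "C \<in> \<C> \<Longrightarrow> finite C" "finite W"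
proof -
  show W: "finite W" using finite_sub assms by simp
  have "\<C> \<subseteq> Pow W" "S \<subseteq> W" using assms unfolding odd_family_def by auto
  then show "finite \<C>" "finite S" "C \<in> \<C> \<Longrightarrow> finite C" using W by (auto intro: finite_subset)
qed

text \<open>The easy half of Tutte's theorem: an odd closed set cannot be matched internally, so a
  matching edge leads from it into \<open>S\<close>, and distinct members use distinct vertices of
  \<open>S\<close>.\<close>

lemma matchable_odd_family_le:
  assumes "matchable G W" "odd_family G W S \<C>"
  shows "card \<C> \<le> card S"
proof -
  have WV: "W \<subseteq> verts G" using matchable_sub assms(1) .
  note f = odd_family_finite[OF assms(2) WV]
  obtain M where M: "M \<subseteq> edges G" "disjoint M" "\<Union>M = W" using assms matchable_def by metis
  have "\<exists>s\<in>S. \<exists>e\<in>M. s \<in> e \<and> e \<inter> C \<noteq> {}" if C: "C \<in> \<C>" for C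
  proof (rule ccontr)
    assume no: "\<not> ?thesis"
    have "matchable G C"
    proof (rule matchable_restrict[OF M(1,2)])
      show "C \<subseteq> \<Union>M" using C assms(2) M unfolding odd_family_def by auto
      fix e assume e: "e \<in> M"
      then obtain u v where uv: "e = {u,v}" "v \<in> nb G u" using edgeE M(1) by (metis subsetD)
      have "u \<in> W" "v \<in> W" using e uv M by auto
      moreover have "u \<in> nb G v" using uv(2) by (simp add: nb_sym)
      moreover have "\<And>x. x \<in> C \<Longrightarrow> nb G x \<inter> W \<subseteq> C \<union> S" using C assms(2) unfolding odd_family_def by blast
      ultimately have "u \<in> C \<Longrightarrow> v \<in> C \<union> S" "v \<in> C \<Longrightarrow> u \<in> C \<union> S" using uv by blast+
      moreover have "u \<in> C \<Longrightarrow> v \<notin> S" "v \<in> C \<Longrightarrow> u \<notin> S"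
        using no e uv(1) by (metis disjoint_iff insertCI)+
      ultimately show "e \<inter> C = {} \<or> e \<subseteq> C" using uv by auto
    qed
    then have "even (card C)" by (rule matchable_even)
    then show False using C assms(2) unfolding odd_family_def by blast
  qed
  then obtain h where h: "\<And>C. C \<in> \<C> \<Longrightarrow> h C \<in> S \<and> (\<exists>e\<in>M. h C \<in> e \<and> e \<inter> C \<noteq> {})" by metis
  have "inj_on h \<C>"
  proof (rule inj_onI)
    fix C D assume CD: "C \<in> \<C>" "D \<in> \<C>" "h C = h D"
    obtain e where e: "e \<in> M" "h C \<in> e" "e \<inter> C \<noteq> {}" using h CD by blast
    obtain e' where e': "e' \<in> M" "h C \<in> e'" "e' \<inter> D \<noteq> {}" using h[OF CD(2)] CD(3) by auto
    have "e = e'" using M(2) e e' unfolding pairwise_def disjnt_def by blast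
    have "C \<subseteq> W - S" "D \<subseteq> W - S" using CD assms(2) unfolding odd_family_def by auto
    then have "h C \<notin> C" "h C \<notin> D" using h CD by auto
    obtain u v where uv: "e = {u,v}" using edgeE M(1) e(1) by (metis subsetD)
    have "C \<inter> D \<noteq> {}" using e e' \<open>e = e'\<close> \<open>h C \<notin> C\<close> \<open>h C \<notin> D\<close> uv by auto
    then show "C = D" using CD assms(2) unfolding odd_family_def pairwise_def disjnt_def by blast
  qed
  moreover have "h ` \<C> \<subseteq> S" using h by blast
  ultimately show ?thesis using f(2) by (metis card_inj_on_le)
qed

text \<open>The vertices outside \<open>S\<close> and all members form a closed set as well. If the
  surplus is exactly one, parity makes this set odd, and it joins the family as a further
  member.\<close>

lemma tutte_parity:
  assumes "odd_family G W S \<C>" "W \<subseteq> verts G" "card \<C> > card S" "even (card W)"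
  shows "\<exists>\<D>. odd_family G W S \<D> \<and> card \<D> \<ge> card S + 2"
proof -
  note f = odd_family_finite[OF assms(1,2)]
  define R where "R = W - S - \<Union>\<C>"
  have CW: "\<Union>\<C> \<subseteq> W - S" "S \<subseteq> W" using assms(1) unfolding odd_family_def by auto
  have "card (\<Union>\<C>) = (\<Sum>C\<in>\<C>. card C)"
    using assms(1) f(3) unfolding odd_family_def by (intro card_Union_disjoint) auto
  moreover have "even ((\<Sum>C\<in>\<C>. card C) + card \<C>)"
  proof -
    have "even (\<Sum>C\<in>\<C>. card C + 1)" by (rule dvd_sum) (use assms(1) in \<open>auto simp: odd_family_def\<close>)
    then show ?thesis unfolding sum.distrib by simp
  qed
  moreover have "card W = card R + card S + card (\<Union>\<C>)"
  proof -
    have "W = R \<union> S \<union> \<Union>\<C>" using CW unfolding R_def by blast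
    moreover have "card (R \<union> S \<union> \<Union>\<C>) = card (R \<union> S) + card (\<Union>\<C>)"
      by (rule card_Un_disjoint) (use CW f in \<open>auto simp: R_def intro: finite_subset\<close>)
    moreover have "card (R \<union> S) = card R + card S"
      by (rule card_Un_disjoint) (use f in \<open>auto simp: R_def\<close>)
    ultimately show ?thesis by simp
  qed
  ultimately have par: "even (card R + card S + card \<C>)" using assms(4) by presburger
  show ?thesis
  proof (cases "card \<C> \<ge> card S + 2")
    case False
    then have "card \<C> = card S + 1" using assms(3) by linarith
    then have "odd (card R)" using par by presburger
    then have "R \<noteq> {}" by auto
    have "R \<notin> \<C>" using \<open>R \<noteq> {}\<close> unfolding R_def by blast
    have "odd_family G W S (insert R \<C>)"
      unfolding odd_family_def
    proof (intro conjI ballI)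
      show "S \<subseteq> W" by (rule CW)
      show "insert R \<C> \<subseteq> Pow (W - S)" using CW unfolding R_def by blast
      have "disjoint \<C>" using assms(1) unfolding odd_family_def by blast
      then show "disjoint (insert R \<C>)" unfolding R_def pairwise_insert disjnt_def by blast
      fix C assume C: "C \<in> insert R \<C>"
      show "odd (card C)" using C assms(1) \<open>odd (card R)\<close> unfolding odd_family_def by blast
      fix x assume x: "x \<in> C"
      show "nb G x \<inter> W \<subseteq> C \<union> S"
      proof (cases "C \<in> \<C>")
        case True then show ?thesis using assms(1) x unfolding odd_family_def by blast
      next
        case False
        then have "x \<in> R" "C = R" using C x by auto
        show ?thesis
        proof
          fix y assume y: "y \<in> nb G x \<inter> W"
          have "y \<notin> D" if "D \<in> \<C>" for D
          proof
            assume "y \<in> D"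
            then have "nb G y \<inter> W \<subseteq> D \<union> S" using that assms(1) unfolding odd_family_def by blast
            moreover have "x \<in> nb G y \<inter> W" using y \<open>x \<in> R\<close> by (auto simp: nb_sym R_def)
            ultimately show False using \<open>x \<in> R\<close> that by (auto simp: R_def)
          qed
          then show "y \<in> C \<union> S" using y \<open>C = R\<close> R_def by blast
        qed
      qed
    qed
    then show ?thesis using \<open>R \<notin> \<C>\<close> f(1) \<open>card \<C> = card S + 1\<close>
      by (intro exI[of _ "insert R \<C>"]) simp
  qed (use assms in blast)
qed

text \<open>A largest \<open>S\<close> with exactly \<open>card S\<close> members is taken. By
  maximality the members are factor-critical and, together with \<open>S\<close>, exhaust
  \<open>W\<close>; Hall's theorem assigns the vertices of \<open>S\<close> to distinct members with
  an edge to each, and the remainders of the members are matchable.\<close>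

theorem tutte:
  assumes "W \<subseteq> verts G" "\<And>S \<C>. odd_family G W S \<C> \<Longrightarrow> card \<C> \<le> card S"
  shows "matchable G W"
  using assms
proof (induction "card W" arbitrary: W rule: less_induct)
  case less
  note WV = less.prems(1) and T = less.prems(2)
  have finW: "finite W" using WV finite_sub by blast
  have evW: "even (card W)"
  proof (rule ccontr)
    assume "odd (card W)"
    then have "odd_family G W {} {W}" unfolding odd_family_def by auto
    from T[OF this] show False by simp
  qed
  let ?P = "\<lambda>S. \<exists>\<C>. odd_family G W S \<C> \<and> card \<C> = card S"
  have "?P {}" by (rule exI[of _ "{}"]) (auto simp: odd_family_def)
  moreover have "\<forall>S. ?P S \<longrightarrow> card S \<le> card W"
    using finW by (auto simp: odd_family_def intro: card_mono)
  ultimately have "\<exists>S. ?P S \<and> (\<forall>S'. ?P S' \<longrightarrow> card S' \<le> card S)"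
    by (intro Lattices_Big.ex_has_greatest_nat[of ?P "{}" card "Suc (card W)"]) (auto simp: less_Suc_eq_le)
  then obtain S where S: "?P S" "\<And>S'. ?P S' \<Longrightarrow> card S' \<le> card S" by blast
  then obtain \<C> where C: "odd_family G W S \<C>" "card \<C> = card S" by blast
  note f = odd_family_finite[OF C(1) WV]
  have SW: "S \<subseteq> W" "\<Union>\<C> \<subseteq> W - S" "disjoint \<C>" using C(1) unfolding odd_family_def by auto
  have Codd: "odd (card X)" and Ccl: "\<And>x. x \<in> X \<Longrightarrow> nb G x \<inter> W \<subseteq> X \<union> S" if "X \<in> \<C>" for X
    using that C(1) unfolding odd_family_def by blast+
  have Cdis: "X \<inter> Y = {}" if "X \<in> \<C>" "Y \<in> \<C>" "X \<noteq> Y" for X Y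
    using SW(3) that unfolding pairwise_def disjnt_def by blast
  \<comment> \<open>Factor-criticality. Otherwise the induction hypothesis and parity give, inside
    \<open>X - {c}\<close>, a set \<open>S'\<close> with two members to spare. These replace
    \<open>X\<close>, while \<open>c\<close> and \<open>S'\<close> move into \<open>S\<close>: minus
    one, plus at least \<open>card S' + 2\<close> members against \<open>card S' + 1\<close> new
    vertices, so the family is tight again with a larger \<open>S\<close>.\<close>
  have fc: "matchable G (X - {c})" if X: "X \<in> \<C>" and c: "c \<in> X" for X c
  proof (rule ccontr)
    assume np: "\<not> matchable G (X - {c})"
    have XW: "X - {c} \<subseteq> verts G" "X \<subseteq> W" "X \<inter> S = {}" using X SW WV by auto
    have "card (X - {c}) < card W"
      using XW c finW by (meson Diff_subset card_Diff1_less card_mono order_less_le_trans finite_subset)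
    then obtain S' \<C>' where "odd_family G (X - {c}) S' \<C>'" "card \<C>' > card S'"
      using less.hyps[of "X - {c}"] np XW(1) by (meson not_le)
    moreover have "even (card (X - {c}))" using Codd[OF X] c f(3)[OF X] by simp
    ultimately obtain \<D> where D: "odd_family G (X - {c}) S' \<D>" "card \<D> \<ge> card S' + 2"
      using tutte_parity XW(1) by blast
    note fD = odd_family_finite[OF D(1) XW(1)]
    have DX: "\<Union>\<D> \<subseteq> X - {c} - S'" "S' \<subseteq> X - {c}" "disjoint \<D>" using D(1) unfolding odd_family_def by auto
    let ?S = "insert c (S \<union> S')" and ?C = "(\<C> - {X}) \<union> \<D>"
    have "odd_family G W ?S ?C"
      unfolding odd_family_def
    proof (intro conjI ballI)
      show "?S \<subseteq> W" using SW DX XW c by blast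
      have "Y \<inter> X = {}" if "Y \<in> \<C> - {X}" for Y using Cdis[of Y X] that X by auto
      then have YX: "Y \<subseteq> W - S - X" if "Y \<in> \<C> - {X}" for Y using that SW by blast
      show "?C \<subseteq> Pow (W - ?S)"
      proof
        fix Y assume "Y \<in> ?C"
        then consider "Y \<in> \<C> - {X}" | "Y \<in> \<D>" by blast
        then show "Y \<in> Pow (W - ?S)"
        proof cases
          case 1 then show ?thesis using YX[OF 1] DX c by auto
        next
          case 2 then show ?thesis using DX XW by auto
        qed
      qed
      show "disjoint ?C"
      proof (rule disjoint_union)
        show "disjoint (\<C> - {X})" using SW(3) by (rule pairwise_subset) auto
        show "disjoint \<D>" by (rule DX)
        show "\<Union> (\<C> - {X}) \<inter> \<Union> \<D> = {}" using YX DX by blast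
      qed
      fix Y assume Y: "Y \<in> ?C"
      show "odd (card Y)" using Y Codd D(1) unfolding odd_family_def by blast
      fix y assume y: "y \<in> Y"
      show "nb G y \<inter> W \<subseteq> Y \<union> ?S"
      proof (cases "Y \<in> \<D>")
        case True
        then have "nb G y \<inter> (X - {c}) \<subseteq> Y \<union> S'" using D(1) y unfolding odd_family_def by blast
        moreover have "nb G y \<inter> W \<subseteq> X \<union> S" using Ccl X True y DX by blast
        ultimately show ?thesis by blast
      next
        case False
        then show ?thesis using Ccl[of Y y] Y y by auto
      qed
    qed
    moreover have "card ?C = card (\<C> - {X}) + card \<D>"
    proof (rule card_Un_disjoint)
      have "Y \<notin> \<D>" if "Y \<in> \<C> - {X}" for Y
      proof
        assume "Y \<in> \<D>"
        then have "Y \<subseteq> X" using DX by blast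
        moreover have "Y \<inter> X = {}" using that Cdis X by blast
        moreover have "Y \<noteq> {}" using Codd[of Y] that by auto
        ultimately show False by auto
      qed
      then show "(\<C> - {X}) \<inter> \<D> = {}" by blast
    qed (use f fD in auto)
    moreover have "card (\<C> - {X}) + 1 = card \<C>" using X f(1) by (metis card_Suc_Diff1 Suc_eq_plus1)
    moreover have "card ?S = card S + card S' + 1"
    proof -
      have "card (S \<union> S') = card S + card S'"
        by (rule card_Un_disjoint) (use f fD DX XW in auto)
      moreover have "c \<notin> S \<union> S'" using DX XW c by auto
      ultimately show ?thesis using f(2) fD(2) by simp
    qed
    ultimately have *: "odd_family G W ?S ?C" "card ?C \<ge> card ?S" "card ?S > card S"
      using C(2) D(2) by auto
    then have "card ?C = card ?S" using T by (simp add: le_antisym)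
    then show False using S(2)[of ?S] * by auto
  qed
  \<comment> \<open>A vertex \<open>r\<close> left over could be moved into \<open>S\<close>; parity
    makes the remaining leftover set odd, and as one more member it keeps the family tight, against
    maximality.\<close>
  have R: "W = S \<union> \<Union>\<C>"
  proof (rule ccontr)
    assume "W \<noteq> S \<union> \<Union>\<C>"
    then obtain r where r: "r \<in> W" "r \<notin> S" "r \<notin> \<Union>\<C>" using SW by blast
    define R where "R = W - insert r S - \<Union>\<C>"
    have "card W = card R + card (insert r S) + card (\<Union>\<C>)"
    proof -
      have "W = R \<union> insert r S \<union> \<Union>\<C>" using SW r unfolding R_def by blast
      moreover have "card (R \<union> insert r S \<union> \<Union>\<C>) = card (R \<union> insert r S) + card (\<Union>\<C>)"
        by (rule card_Un_disjoint) (use SW f r in \<open>auto simp: R_def intro: finite_subset\<close>)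
      moreover have "card (R \<union> insert r S) = card R + card (insert r S)"
        by (rule card_Un_disjoint) (use f in \<open>auto simp: R_def\<close>)
      ultimately show ?thesis by simp
    qed
    moreover have "card (\<Union>\<C>) = (\<Sum>C\<in>\<C>. card C)"
      using SW f(3) by (intro card_Union_disjoint) auto
    moreover have "even ((\<Sum>C\<in>\<C>. card C) + card \<C>)"
    proof -
      have "even (\<Sum>C\<in>\<C>. card C + 1)" by (rule dvd_sum) (use Codd in auto)
      then show ?thesis unfolding sum.distrib by simp
    qed
    ultimately have oR: "odd (card R)" using r(2) f(2) C(2) evW by auto
    then have "R \<noteq> {}" by auto
    have "R \<notin> \<C>" using \<open>R \<noteq> {}\<close> unfolding R_def by blast
    have Rcl: "nb G x \<inter> W \<subseteq> R \<union> insert r S" if "x \<in> R" for x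
    proof
      fix y assume y: "y \<in> nb G x \<inter> W"
      have "y \<notin> D" if "D \<in> \<C>" for D
      proof
        assume "y \<in> D"
        then have "nb G y \<inter> W \<subseteq> D \<union> S" using Ccl that by blast
        moreover have "x \<in> nb G y \<inter> W" using y \<open>x \<in> R\<close> by (auto simp: nb_sym R_def)
        ultimately show False using \<open>x \<in> R\<close> that by (auto simp: R_def)
      qed
      then show "y \<in> R \<union> insert r S" using y R_def by blast
    qed
    have "odd_family G W (insert r S) (insert R \<C>)"
      unfolding odd_family_def
    proof (intro conjI ballI)
      show "disjoint (insert R \<C>)" using SW unfolding R_def pairwise_insert disjnt_def by blast
      show "insert R \<C> \<subseteq> Pow (W - insert r S)" using SW r unfolding R_def by blast
      show "insert r S \<subseteq> W" using SW r by blast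
      fix X x assume X: "X \<in> insert R \<C>"
      then show "odd (card X)" using oR Codd by blast
      assume "x \<in> X"
      then show "nb G x \<inter> W \<subseteq> X \<union> insert r S" using Rcl[of x] Ccl[of X x] X by blast
    qed
    then have "?P (insert r S)" using \<open>R \<notin> \<C>\<close> f C(2) r by auto
    then show False using S(2)[of "insert r S"] r f(2) by simp
  qed
  define H where "H s = {X\<in>\<C>. nb G s \<inter> X \<noteq> {}}" for s
  have "\<exists>h. inj_on h S \<and> (\<forall>s\<in>S. h s \<in> H s)"
  proof (rule hall)
    show "finite (H s)" for s using f(1) unfolding H_def by simp
    fix S1 assume S1: "S1 \<subseteq> S"
    let ?N = "\<Union>s\<in>S1. H s"
    have N: "?N \<subseteq> \<C>" unfolding H_def by auto
    \<comment> \<open>Members without a neighbour in \<open>S1\<close> stay closed when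
      \<open>S1\<close> is dropped from \<open>S\<close>. Tutte's condition bounds their number by
      \<open>card S - card S1\<close>, which is Hall's condition for \<open>S1\<close>.\<close>
    have "odd_family G W (S - S1) (\<C> - ?N)"
      unfolding odd_family_def
    proof (intro conjI ballI)
      show "disjoint (\<C> - ?N)" using SW(3) by (rule pairwise_subset) auto
      fix X assume X: "X \<in> \<C> - ?N"
      then show "odd (card X)" using Codd by blast
      fix x assume x: "x \<in> X"
      have "\<forall>s\<in>S1. nb G s \<inter> X = {}" using X by (auto simp: H_def)
      then have "nb G x \<inter> S1 = {}" using x nb_sym[of _ G x] by blast
      then show "nb G x \<inter> W \<subseteq> X \<union> (S - S1)" using Ccl[of X x] X x by auto
    qed (use SW in auto)
    then have "card (\<C> - ?N) \<le> card (S - S1)" by (rule T)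
    moreover have "card (\<C> - ?N) = card \<C> - card ?N" using N f(1) by (meson card_Diff_subset finite_subset)
    moreover have "card (S - S1) = card S - card S1" using S1 f(2) by (meson card_Diff_subset finite_subset)
    moreover have "card ?N \<le> card \<C>" using N f(1) by (rule card_mono[rotated])
    moreover have "card S1 \<le> card S" using S1 f(2) by (meson card_mono)
    ultimately show "card S1 \<le> card ?N" using C(2) by linarith
  qed (use f in auto)
  then obtain h where h: "inj_on h S" "\<And>s. s \<in> S \<Longrightarrow> h s \<in> \<C> \<and> nb G s \<inter> h s \<noteq> {}"
    unfolding H_def by blast
  have hS: "h ` S = \<C>"
    using h C(2) f by (metis card_image card_subset_eq image_subsetI)
  have "\<forall>s\<in>S. \<exists>y. y \<in> nb G s \<inter> h s" using h(2) by blast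
  from bchoice[OF this] obtain g where g: "\<forall>s\<in>S. g s \<in> nb G s \<inter> h s" by blast
  have "matchable G (\<Union>s\<in>S'. insert s (h s))" if "S' \<subseteq> S" for S'
    using finite_subset[OF that f(2)] that
  proof (induction S' rule: finite_induct)
    case (insert s S')
    have s: "s \<in> S" "S' \<subseteq> S" using insert by auto
    have "h s \<subseteq> W - S" if "s \<in> S" for s using h(2) that SW by blast
    moreover have "h s \<inter> h s' = {}" if "s' \<in> S'" for s'
      using Cdis h s that insert(2) by (metis inj_onD subsetD)
    ultimately have disj: "insert s (h s) \<inter> (\<Union>s\<in>S'. insert s (h s)) = {}"
      using insert(2) s by (auto; blast)
    have "s \<notin> h s" using s h(2) SW by blast
    then have "matchable G ({s, g s} \<union> (h s - {g s}))"
      by (intro matchable_Un) (use g s h(2) fc in \<open>auto intro: matchable_edge\<close>)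
    moreover have "{s, g s} \<union> (h s - {g s}) = insert s (h s)" using g s by auto
    ultimately have "matchable G (insert s (h s) \<union> (\<Union>s\<in>S'. insert s (h s)))"
      using disj insert s by (intro matchable_Un) auto
    then show ?case by simp
  qed simp
  from this[of S] have "matchable G (\<Union>s\<in>S. insert s (h s))" by simp
  moreover have "(\<Union>s\<in>S. insert s (h s)) = W" using R hS by auto
  ultimately show ?case by simp
qed

end

section \<open>Barriers and contractions in cubic graphs\<close>

text \<open>Contracts the complement of \<open>U\<close> to \<open>w\<close>. Parallel edges are lost, so it is only used when
  no vertex of \<open>U\<close> has two neighbours outside.\<close>

definition contract :: "'a graph \<Rightarrow> 'a set \<Rightarrow> 'a \<Rightarrow> 'a graph" where
  "contract G U w = Graph (insert w U)
     ({e \<in> edges G. e \<subseteq> U} \<union> {{x, w} | x. x \<in> U \<and> \<not> nb G x \<subseteq> U})"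

lemma odd_familyD:
  assumes "odd_family G W S \<C>"
  shows "S \<subseteq> W" "disjoint \<C>" "\<Union>\<C> \<subseteq> W - S" "C \<in> \<C> \<Longrightarrow> C \<subseteq> W - S" "C \<in> \<C> \<Longrightarrow> odd (card C)"
    "C \<in> \<C> \<Longrightarrow> x \<in> C \<Longrightarrow> nb G x \<inter> W \<subseteq> C \<union> S"
  using assms unfolding odd_family_def by auto

lemma ec_Union:
  assumes "finite \<C>" "\<And>C. C \<in> \<C> \<Longrightarrow> finite C" "disjoint \<C>"
  shows "ec G (\<Union>\<C>) Y = (\<Sum>C\<in>\<C>. ec G C Y)"
  using assms unfolding ec_def
  by (subst sum.Union_disjoint) (auto simp: pairwise_def disjnt_def)

section \<open>Degrees, niceness and bipartiteness in terms of neighbour sets\<close>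

context sgraph
begin

lemma degree_nb: "degree G v = card (nb G v)"
proof -
  have "edges_at G v = (\<lambda>u. {v, u}) ` nb G v"
  proof
    show "edges_at G v \<subseteq> (\<lambda>u. {v, u}) ` nb G v"
    proof
      fix e assume e: "e \<in> edges_at G v"
      then obtain a b where "e = {a,b}" "b \<in> nb G a" unfolding edges_at_def using edgeE by blast
      then show "e \<in> (\<lambda>u. {v, u}) ` nb G v"
        using e nb_sym[of a G b] by (auto simp: edges_at_def)
    qed
    show "(\<lambda>u. {v, u}) ` nb G v \<subseteq> edges_at G v"
      by (auto simp: edges_at_def edge_iff_nb)
  qed
  moreover have "inj_on (\<lambda>u. {v, u}) (nb G v)" by (auto simp: inj_on_def doubleton_eq_iff)
  ultimately show ?thesis by (simp add: degree_def card_image)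
qed

lemma nice_vertex_iff: "nice_vertex G v \<longleftrightarrow> v \<in> verts G \<and> matchable G (verts G - insert v (nb G v))"
proof -
  have "(\<exists>M. perfect_matching (del_verts G S) M) \<longleftrightarrow> matchable G (verts G - S)" for S
  proof
    assume "\<exists>M. perfect_matching (del_verts G S) M"
    then obtain M where M: "M \<subseteq> {e \<in> edges G. e \<inter> S = {}}" "\<forall>v\<in>verts G - S. \<exists>!e. e \<in> M \<and> v \<in> e"
      unfolding perfect_matching_def del_verts_def by auto
    have sub: "e \<subseteq> verts G - S" if "e \<in> M" for e
      using that M(1) simple unfolding simple_graph_def by blast
    have "disjoint M"
      unfolding pairwise_def disjnt_def
    proof (intro ballI impI, rule ccontr)
      fix e e' assume e: "e \<in> M" "e' \<in> M" "e \<noteq> e'" "e \<inter> e' \<noteq> {}"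
      then obtain x where "x \<in> e" "x \<in> e'" by blast
      then show False using e M(2) sub by blast
    qed
    moreover have "\<Union>M = verts G - S" using M(2) sub by blast
    ultimately show "matchable G (verts G - S)" using M(1) unfolding matchable_def by blast
  next
    assume "matchable G (verts G - S)"
    then obtain M where M: "M \<subseteq> edges G" "disjoint M" "\<Union>M = verts G - S" unfolding matchable_def by blast
    have "perfect_matching (del_verts G S) M"
      unfolding perfect_matching_def del_verts_def graph.sel
    proof (intro conjI ballI)
      show "M \<subseteq> {e \<in> edges G. e \<inter> S = {}}" using M by blast
      fix v assume "v \<in> verts G - S"
      then obtain e where "e \<in> M" "v \<in> e" using M(3) by blast
      moreover have "e' = e" if "e' \<in> M" "v \<in> e'" for e'
        using M(2) that \<open>e \<in> M\<close> \<open>v \<in> e\<close> unfolding pairwise_def disjnt_def by blast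
      ultimately show "\<exists>!e. e \<in> M \<and> v \<in> e" by blast
    qed
    then show "\<exists>M. perfect_matching (del_verts G S) M" by blast
  qed
  then show ?thesis unfolding nice_vertex_def closed_nbhd_def nb_def by simp
qed

lemma bipartite_iff: "bipartite G \<longleftrightarrow> (\<exists>P Q. P \<union> Q = verts G \<and> bip_on G P Q)"
proof
  assume "bipartite G"
  then obtain A B where "A \<union> B = verts G \<and> A \<inter> B = {} \<and> (\<forall>e\<in>edges G. \<exists>u\<in>A. \<exists>v\<in>B. e = {u, v})"
    unfolding bipartite_def by (elim exE)
  then have AB: "A \<union> B = verts G" "A \<inter> B = {}" "\<And>e. e \<in> edges G \<Longrightarrow> \<exists>u\<in>A. \<exists>v\<in>B. e = {u, v}"
    by simp_all
  have *: "x \<in> A \<and> y \<in> B \<or> x \<in> B \<and> y \<in> A" if "y \<in> nb G x" for x y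
  proof -
    have "{x,y} \<in> edges G" using that by (simp add: edge_iff_nb)
    then obtain u v where "u \<in> A" "v \<in> B" "{x,y} = {u,v}" using AB(3) by blast
    then show ?thesis by (auto simp: doubleton_eq_iff)
  qed
  have "bip_on G A B" unfolding bip_on_def
  proof (intro conjI ballI)
    show "nb G x \<inter> A = {}" if "x \<in> A" for x using *[of _ x] that AB(2) by blast
    show "nb G x \<inter> B = {}" if "x \<in> B" for x using *[of _ x] that AB(2) by blast
  qed (rule AB)
  then show "\<exists>P Q. P \<union> Q = verts G \<and> bip_on G P Q" using AB by blast
next
  assume "\<exists>P Q. P \<union> Q = verts G \<and> bip_on G P Q"
  then obtain P Q where PQ: "P \<union> Q = verts G" "bip_on G P Q" by blast
  show "bipartite G"
    unfolding bipartite_def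
  proof (intro exI conjI ballI)
    show "P \<union> Q = verts G" "P \<inter> Q = {}" using PQ unfolding bip_on_def by auto
    fix e assume "e \<in> edges G"
    then obtain u v where uv: "e = {u,v}" "u \<in> verts G" "v \<in> verts G" "v \<in> nb G u" using edgeE by blast
    then consider "u \<in> P" "v \<in> Q" | "u \<in> Q" "v \<in> P" using PQ unfolding bip_on_def by blast
    then show "\<exists>u\<in>P. \<exists>v\<in>Q. e = {u, v}" using uv by (metis insert_commute)
  qed
qed

text \<open>Deleted vertices are counted into \<open>S\<close>. A violation of Tutte's condition in
  a subgraph thereby becomes a family in \<open>G\<close>, where all degrees are 3 and edges can be
  counted.\<close>

lemma odd_family_lift:
  assumes "odd_family G (verts G - U) S \<C>" "U \<subseteq> verts G"
  shows "odd_family G (verts G) (S \<union> U) \<C>"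
  unfolding odd_family_def
proof (intro conjI ballI)
  show "S \<union> U \<subseteq> verts G" "\<C> \<subseteq> Pow (verts G - (S \<union> U))" "disjoint \<C>"
    using assms unfolding odd_family_def by auto
  fix C x assume C: "C \<in> \<C>"
  then show "odd (card C)" by (rule odd_familyD(5)[OF assms(1)])
  assume "x \<in> C"
  then have "nb G x \<inter> (verts G - U) \<subseteq> C \<union> S" by (rule odd_familyD(6)[OF assms(1) C])
  then show "nb G x \<inter> verts G \<subseteq> C \<union> (S \<union> U)" by blast
qed

lemma nb_inter_V [simp]: "nb G x \<inter> verts G = nb G x" "nb G x \<inter> (verts G - X) = nb G x - X"
  using nb_sub by blast+

text \<open>Moving \<open>x\<close> out of \<open>U\<close> trades its edges to the outside for its
  edges into \<open>U\<close>. The equation between sums avoids subtraction of natural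
  numbers.\<close>

lemma cut_remove:
  assumes "U \<subseteq> verts G" "x \<in> U"
  shows "cut G (U - {x}) + card (nb G x - U) = cut G U + card (nb G x \<inter> U)"
proof -
  let ?X = "U - {x}"
  have fin: "finite U" "finite ?X" using assms finite_sub by auto
  have "verts G - ?X = (verts G - U) \<union> {x}" using assms by auto
  then have "cut G ?X = ec G ?X (verts G - U) + ec G ?X {x}"
    using assms by (simp only:) (rule ec_Un2, auto)
  also have "ec G ?X {x} = card (nb G x \<inter> ?X)" using ec_sym[of ?X "{x}"] fin by simp
  also have "nb G x \<inter> ?X = nb G x \<inter> U" using nb_irrefl by blast
  finally have 1: "cut G ?X = ec G ?X (verts G - U) + card (nb G x \<inter> U)" .
  have "cut G (insert x ?X) = card (nb G x \<inter> (verts G - insert x ?X)) + ec G ?X (verts G - insert x ?X)"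
    by (rule ec_insert) (use fin in auto)
  moreover have "insert x ?X = U" using assms by auto
  ultimately show ?thesis using 1 by simp
qed

lemma cut_insert:
  assumes "U \<subseteq> verts G" "x \<in> verts G" "x \<notin> U"
  shows "cut G (insert x U) + card (nb G x \<inter> U) = cut G U + card (nb G x - U)"
proof -
  have "insert x U - {x} = U" using assms by auto
  moreover have "nb G x - insert x U = nb G x - U" "nb G x \<inter> insert x U = nb G x \<inter> U"
    using nb_irrefl by auto
  ultimately show ?thesis using cut_remove[of "insert x U" x] assms by auto
qed

end

section \<open>Barriers in 2-edge-connected cubic graphs\<close>

locale cub = sgraph +
  assumes cub: "cubic G" and conn: "edge_conn 2 G"
begin

lemma nb_card: "v \<in> verts G \<Longrightarrow> card (nb G v) = 3"
  using cub by (simp add: cubic_def degree_nb)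

lemma V_ne: "verts G \<noteq> {}"
  using conn by (simp add: edge_conn_def)

lemma ec_V: "X \<subseteq> verts G \<Longrightarrow> ec G X (verts G) = 3 * card X"
  unfolding ec_def by (simp add: nb_card subset_iff)

lemma ec_split:
  assumes "X \<subseteq> verts G" "Y \<subseteq> verts G" shows "ec G X Y + ec G X (verts G - Y) = 3 * card X"
proof -
  have "Y \<union> (verts G - Y) = verts G" using assms by auto
  then show ?thesis using ec_Un2[of Y "verts G - Y" X] ec_V[OF assms(1)] by auto
qed

lemma cut_parity: "X \<subseteq> verts G \<Longrightarrow> even (cut G X + card X)"
proof -
  assume X: "X \<subseteq> verts G"
  have "ec G X X + cut G X = 3 * card X" by (rule ec_split[OF X X])
  moreover have "even (ec G X X)" by (rule ec_self_even[OF finite_sub[OF X]])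
  ultimately show ?thesis by presburger
qed

lemma cut2: "X \<subseteq> verts G \<Longrightarrow> X \<noteq> {} \<Longrightarrow> X \<noteq> verts G \<Longrightarrow> 2 \<le> cut G X"
  using conn unfolding edge_conn_def by blast

lemma evenV: "even (card (verts G))"
  using cut_parity[of "verts G"] by simp

text \<open>Order and cut size have the same parity in a cubic graph, so the lower bound 2 rises to
  3.\<close>

lemma odd_cut: "X \<subseteq> verts G \<Longrightarrow> odd (card X) \<Longrightarrow> 3 \<le> cut G X"
proof -
  assume X: "X \<subseteq> verts G" and o: "odd (card X)"
  then have "X \<noteq> {}" "X \<noteq> verts G" using evenV by auto
  then have "2 \<le> cut G X" using cut2 X by blast
  moreover have "odd (cut G X)" using cut_parity[OF X] o by simp
  ultimately show ?thesis by presburger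
qed

text \<open>The \<open>3 * card S\<close> edge ends at \<open>S\<close> are sorted by the place of
  the other end: a member, \<open>S\<close> itself, or the rest. Closedness sends every edge that
  leaves a member into \<open>S\<close>.\<close>

lemma odd_family_bound:
  assumes "odd_family G (verts G) S \<C>"
  shows "(\<Sum>C\<in>\<C>. cut G C) + ec G S S + ec G S (verts G - S - \<Union>\<C>) = 3 * card S"
    "C \<in> \<C> \<Longrightarrow> 3 \<le> cut G C" "C \<in> \<C> \<Longrightarrow> cut G C = ec G C S"
proof -
  note f = odd_family_finite[OF assms subset_refl]
  note S = odd_familyD(1,3,2)[OF assms]
  show eq: "cut G C = ec G C S" if "C \<in> \<C>" for C
  proof (rule ec_cong_right)
    fix x assume "x \<in> C"
    then have "nb G x \<inter> verts G \<subseteq> C \<union> S" by (rule odd_familyD(6)[OF assms that])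
    moreover have "C \<inter> S = {}" using S that by blast
    ultimately show "nb G x \<inter> (verts G - C) = nb G x \<inter> S" using S by auto
  qed
  show "3 \<le> cut G C" if "C \<in> \<C>" for C using odd_cut[of C] odd_familyD(4,5)[OF assms that] by blast
  have "(\<Sum>C\<in>\<C>. cut G C) = (\<Sum>C\<in>\<C>. ec G C S)" using eq by simp
  also have "\<dots> = ec G (\<Union>\<C>) S" using f S(3) by (intro ec_Union[symmetric]) auto
  also have "\<dots> = ec G S (\<Union>\<C>)" using f S by (intro ec_sym) auto
  finally have "(\<Sum>C\<in>\<C>. cut G C) = ec G S (\<Union>\<C>)" .
  moreover have "verts G = S \<union> \<Union>\<C> \<union> (verts G - S - \<Union>\<C>)" using S by blast
  then have "ec G S (verts G) = ec G S (S \<union> \<Union>\<C>) + ec G S (verts G - S - \<Union>\<C>)"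
    using ec_Un2[of "S \<union> \<Union>\<C>" "verts G - S - \<Union>\<C>" S] by auto
  moreover have "ec G S (S \<union> \<Union>\<C>) = ec G S S + ec G S (\<Union>\<C>)"
    by (rule ec_Un2) (use S in blast)
  ultimately show "(\<Sum>C\<in>\<C>. cut G C) + ec G S S + ec G S (verts G - S - \<Union>\<C>) = 3 * card S"
    using ec_V S(1) by simp
qed

lemma odd_family_le:
  assumes "odd_family G (verts G) S \<C>"
  shows "3 * card \<C> + ec G S S \<le> 3 * card S"
proof -
  have "(\<Sum>C\<in>\<C>. 3) \<le> (\<Sum>C\<in>\<C>. cut G C)" by (rule sum_mono) (use odd_family_bound(2)[OF assms] in auto)
  then show ?thesis using odd_family_bound(1)[OF assms] by (simp add: mult.commute)
qed

text \<open>Equality in the count of edge ends: every member takes exactly three, nothing remains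
  for edges inside \<open>S\<close> or to the rest. The rest then has an empty cut and must be
  empty, since \<open>S\<close> is not.\<close>

lemma barrier_props:
  assumes "odd_family G (verts G) S \<C>" "card \<C> = card S" "S \<noteq> {}"
  shows "\<And>C. C \<in> \<C> \<Longrightarrow> cut G C = 3" "ec G S S = 0" "verts G = S \<union> \<Union>\<C>"
proof -
  note b = odd_family_bound[OF assms(1)] and f = odd_family_finite[OF assms(1) subset_refl]
  have le: "(\<Sum>C\<in>\<C>. 3) \<le> (\<Sum>C\<in>\<C>. cut G C)" by (rule sum_mono) (use b(2) in auto)
  have sum: "(\<Sum>C\<in>\<C>. cut G C) = (\<Sum>C\<in>\<C>. 3)" and "ec G S S = 0" and R: "ec G S (verts G - S - \<Union>\<C>) = 0"
    using le b(1) assms(2) by auto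
  then show "ec G S S = 0" by simp
  show "cut G C = 3" if C: "C \<in> \<C>" for C
  proof (rule ccontr)
    assume "cut G C \<noteq> 3"
    then have "(\<Sum>C\<in>\<C>. 3) < (\<Sum>C\<in>\<C>. cut G C)"
      using C f(1) b(2) by (intro sum_strict_mono_ex1) (auto intro!: bexI[of _ C] simp: le_less)
    then show False using sum by simp
  qed
  note S = odd_familyD(1,3)[OF assms(1)]
  let ?R = "verts G - S - \<Union>\<C>"
  have "cut G ?R = 0"
  proof (subst ec_0_iff, simp, rule ballI)
    fix x assume x: "x \<in> ?R"
    have "y \<in> ?R" if y: "y \<in> nb G x" for y
    proof (rule ccontr)
      assume "y \<notin> ?R"
      then consider "y \<in> S" | C where "C \<in> \<C>" "y \<in> C" using y nb_verts by blast
      then show False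
      proof cases
        case 1
        have "\<forall>y\<in>S. nb G y \<inter> ?R = {}" by (rule iffD1[OF ec_0_iff[OF f(2)] R])
        then have "nb G y \<inter> ?R = {}" using 1 by (rule bspec)
        then show False using x y by (auto simp: nb_sym)
      next
        case 2
        then have "nb G y \<inter> verts G \<subseteq> C \<union> S" by (rule odd_familyD(6)[OF assms(1)])
        moreover have "x \<in> nb G y" using y by (simp add: nb_sym)
        ultimately show False using x 2 by auto
      qed
    qed
    then show "nb G x \<inter> (verts G - ?R) = {}" by blast
  qed
  then have "?R = {}" using cut2[of ?R] assms(3) S by auto
  then show "verts G = S \<union> \<Union>\<C>" using S by blast
qed

text \<open>A violation for \<open>G\<close> minus \<open>u\<close>, \<open>v\<close> has surplus
  two by parity. With \<open>u\<close> and \<open>v\<close> counted into \<open>S\<close> it has as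
  many members as vertices of \<open>S\<close>, so the edge count leaves no room for an edge inside
  \<open>S\<close>; but \<open>uv\<close> is one.\<close>

lemma matching_covered:
  assumes "v \<in> nb G u"
  shows "matchable G (verts G - {u, v})"
proof (rule ccontr)
  assume np: "\<not> matchable G (verts G - {u, v})"
  have uv: "u \<in> verts G" "v \<in> verts G" "u \<noteq> v" using assms nb_verts nb_irrefl by blast+
  obtain S \<C> where "odd_family G (verts G - {u,v}) S \<C>" "card \<C> > card S"
    using tutte[of "verts G - {u,v}"] np by (meson Diff_subset not_le)
  moreover have "even (card (verts G - {u,v}))" using evenV uv by (simp add: card_Diff_subset)
  ultimately obtain \<D> where D: "odd_family G (verts G - {u,v}) S \<D>" "card \<D> \<ge> card S + 2"
    using tutte_parity by blast
  have o: "odd_family G (verts G) (S \<union> {u,v}) \<D>" by (rule odd_family_lift[OF D(1)]) (use uv in auto)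
  have S: "finite S" "S \<inter> {u,v} = {}" using D(1) finite_sub unfolding odd_family_def by auto
  then have "card (S \<union> {u,v}) = card S + 2" using uv(3) by (subst card_Un_disjoint) auto
  then have "ec G (S \<union> {u,v}) (S \<union> {u,v}) = 0" using odd_family_le[OF o] D(2) by linarith
  then have "nb G u \<inter> (S \<union> {u,v}) = {}" using ec_0_iff[of "S \<union> {u,v}"] S(1) by simp
  then show False using assms by blast
qed

text \<open>A violation in \<open>G\<close> minus the closed neighbourhood of \<open>u\<close> has
  surplus two by parity. Adding the three neighbours to \<open>S\<close> and the point
  \<open>u\<close> to the family uses up the surplus, and the edge count excludes anything beyond
  equality.\<close>

lemma nonnice_barrier:
  assumes "u \<in> verts G" "\<not> nice_vertex G u"
  obtains S \<C> where "odd_family G (verts G) S \<C>" "card \<C> = card S" "nb G u \<subseteq> S" "{u} \<in> \<C>"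
proof -
  let ?N = "insert u (nb G u)"
  have np: "\<not> matchable G (verts G - ?N)" using assms nice_vertex_iff by blast
  have N: "?N \<subseteq> verts G" "card ?N = 4" using assms nb_sub nb_card by auto
  obtain S \<C> where "odd_family G (verts G - ?N) S \<C>" "card \<C> > card S"
    using tutte[of "verts G - ?N"] np by (meson Diff_subset not_le)
  moreover have "even (card (verts G - ?N))" using evenV N by (simp add: card_Diff_subset finite_sub)
  ultimately obtain \<D> where D: "odd_family G (verts G - ?N) S \<D>" "card \<D> \<ge> card S + 2"
    using tutte_parity by blast
  have o: "odd_family G (verts G) (S \<union> ?N) \<D>" by (rule odd_family_lift[OF D(1) N(1)])
  have SN: "S \<inter> ?N = {}" "finite S" "S \<subseteq> verts G" "\<Union>\<D> \<subseteq> verts G - ?N" "finite \<D>"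
    using D(1) finite_sub odd_family_finite[OF D(1)] unfolding odd_family_def by auto
  have o2: "odd_family G (verts G) (S \<union> nb G u) (insert {u} \<D>)"
    unfolding odd_family_def
  proof (intro conjI ballI)
    show "S \<union> nb G u \<subseteq> verts G" using SN nb_sub by auto
    show "insert {u} \<D> \<subseteq> Pow (verts G - (S \<union> nb G u))"
      using SN assms(1) odd_familyD(3)[OF o] by auto
    show "disjoint (insert {u} \<D>)"
      using SN(4) odd_familyD(2)[OF D(1)] unfolding pairwise_insert disjnt_def by blast
    fix C x assume C: "C \<in> insert {u} \<D>"
    then show "odd (card C)" using D(1) unfolding odd_family_def by auto
    assume x: "x \<in> C"
    show "nb G x \<inter> verts G \<subseteq> C \<union> (S \<union> nb G u)"
    proof (cases "C = {u}")
      case False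
      then have CD: "C \<in> \<D>" using C by blast
      then have "nb G x \<inter> verts G \<subseteq> C \<union> (S \<union> ?N)" using x by (rule odd_familyD(6)[OF o])
      moreover have "u \<notin> nb G x" using CD x SN(4) by (auto simp: nb_sym)
      ultimately show ?thesis by auto
    qed (use x in auto)
  qed
  have "card (S \<union> nb G u) = card S + 3"
    using SN nb_card[OF assms(1)] by (subst card_Un_disjoint) auto
  moreover have "{u} \<notin> \<D>" using SN(4) by auto
  ultimately have "card (insert {u} \<D>) = card (S \<union> nb G u)"
    using odd_family_le[OF o2] D(2) SN(5) by simp
  then show ?thesis using that[OF o2] by blast
qed

text \<open>Deleting \<open>u\<close> and its neighbours costs \<open>S\<close> three vertices but
  the family only one member, so Tutte's condition fails in what remains.\<close>

lemma barrier_nonnice: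
  assumes "odd_family G (verts G) S \<C>" "card S \<le> card \<C>" "nb G u \<subseteq> S" "{u} \<in> \<C>"
  shows "\<not> nice_vertex G u"
proof
  assume "nice_vertex G u"
  then have u: "u \<in> verts G" and p: "matchable G (verts G - insert u (nb G u))" using nice_vertex_iff by auto
  have S: "S \<subseteq> verts G" "\<C> \<subseteq> Pow (verts G - S)" "disjoint \<C>" using odd_familyD[OF assms(1)] by auto
  have uS: "u \<notin> S" using S assms(4) by auto
  have "odd_family G (verts G - insert u (nb G u)) (S - nb G u) (\<C> - {{u}})"
    unfolding odd_family_def
  proof (intro conjI ballI)
    show "S - nb G u \<subseteq> verts G - insert u (nb G u)" using S uS by auto
    show "disjoint (\<C> - {{u}})" using S(3) by (rule pairwise_subset) auto
    have "u \<notin> C" if "C \<in> \<C> - {{u}}" for C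
      using that pairwiseD[OF S(3) _ assms(4), of C] by (simp add: disjnt_def)
    moreover have "C \<subseteq> verts G - S" if "C \<in> \<C> - {{u}}" for C using odd_familyD(4)[OF assms(1)] that by simp
    ultimately show "\<C> - {{u}} \<subseteq> Pow (verts G - insert u (nb G u) - (S - nb G u))"
      using assms(3) by fast
    fix C x assume C: "C \<in> \<C> - {{u}}"
    then show "odd (card C)" using assms unfolding odd_family_def by auto
    assume x: "x \<in> C"
    then have "nb G x \<inter> verts G \<subseteq> C \<union> S" using C odd_familyD(6)[OF assms(1), of C x] by blast
    then show "nb G x \<inter> (verts G - insert u (nb G u)) \<subseteq> C \<union> (S - nb G u)" by blast
  qed
  from matchable_odd_family_le[OF p this] have "card (\<C> - {{u}}) \<le> card (S - nb G u)" .
  moreover have "card (\<C> - {{u}}) = card \<C> - 1" using assms(4) by simp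
  moreover have "card (S - nb G u) = card S - 3"
    using assms(3) nb_card[OF u] by (simp add: card_Diff_subset)
  moreover have "card S \<ge> 3" using card_mono[OF finite_sub[OF S(1)] assms(3)] nb_card[OF u] by simp
  ultimately show False using assms(2) by linarith
qed

end

text \<open>\<open>w\<close> is any name outside \<open>U\<close>: a vertex of the contracted side
  in the inductions, a fresh number when graphs are to be spliced. \<open>one\<close> guarantees
  that no vertex sends two edges to \<open>w\<close>, which keeps the contracted graph
  cubic.\<close>

locale contraction = cub +
  fixes U :: "'a set" and w :: 'a
  assumes U: "U \<subset> verts G" and w: "w \<notin> U" and cutU: "cut G U = 3"
    and one: "\<And>x. x \<in> U \<Longrightarrow> card (nb G x - U) \<le> 1"
begin

abbreviation "H \<equiv> contract G U w"

lemma finU [simp]: "finite U"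
  using U finite_sub by blast

lemma vertsH [simp]: "verts H = insert w U"
  by (simp add: contract_def)

lemma simpleH: "simple_graph H"
  using simple finU w unfolding simple_graph_def contract_def by (auto simp: card_2_iff)

sublocale H: sgraph H
  by unfold_locales (rule simpleH)

lemma nb_H: "y \<in> nb H x \<longleftrightarrow> y \<in> nb G x \<and> x \<in> U \<and> y \<in> U \<or>
    x \<in> U \<and> y = w \<and> \<not> nb G x \<subseteq> U \<or> y \<in> U \<and> x = w \<and> \<not> nb G y \<subseteq> U"
  unfolding edge_iff_nb[symmetric] unfolding contract_def by (auto simp: doubleton_eq_iff)

lemma nb_in: "x \<in> U \<Longrightarrow> nb H x = nb G x \<inter> U \<union> (if nb G x \<subseteq> U then {} else {w})"
  using w by (auto simp: nb_H)

lemma nb_w: "nb H w = {x \<in> U. \<not> nb G x \<subseteq> U}"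
  using w by (auto simp: nb_H)

lemma out_card: "x \<in> U \<Longrightarrow> card (nb G x - U) = (if nb G x \<subseteq> U then 0 else 1)"
proof -
  assume x: "x \<in> U"
  show ?thesis
  proof (cases "nb G x \<subseteq> U")
    case False
    then have "card (nb G x - U) > 0" by (auto simp: card_gt_0_iff)
    then show ?thesis using one[OF x] False by simp
  qed (simp add: Diff_eq_empty_iff[THEN iffD2])
qed

text \<open>The possible edge from \<open>x\<close> to the outside of \<open>U\<close> reappears as
  the edge to \<open>w\<close>, so the number of edges leaving a subset of \<open>U\<close> stays
  the same, vertex by vertex.\<close>

lemma card_inter:
  assumes "x \<in> U" "X \<subseteq> U"
  shows "card (nb H x \<inter> (insert w U - X)) = card (nb G x - X)"
proof -
  have "nb H x \<inter> (insert w U - X) = (nb G x \<inter> (U - X)) \<union> (if nb G x \<subseteq> U then {} else {w})"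
    using nb_in[OF assms(1)] w assms by auto
  also have "card \<dots> = card (nb G x \<inter> (U - X)) + card (nb G x - U)"
    using out_card[OF assms(1)] w by (subst card_Un_disjoint) auto
  also have "\<dots> = card ((nb G x \<inter> (U - X)) \<union> (nb G x - U))"
    by (subst card_Un_disjoint) auto
  also have "(nb G x \<inter> (U - X)) \<union> (nb G x - U) = nb G x - X" using assms by auto
  finally show ?thesis .
qed

lemma cutH: "X \<subseteq> U \<Longrightarrow> cut H X = cut G X"
  unfolding ec_def using card_inter by (auto intro!: sum.cong)

lemma card_nb_w: "card (nb H w) = 3"
proof -
  have "cut G U = (\<Sum>x\<in>U. if nb G x \<subseteq> U then 0 else 1)"
    unfolding ec_def using out_card by simp
  also have "\<dots> = card (nb H w)" 
    unfolding nb_w card_eq_sum sum.inter_filter[OF finU] by (rule sum.cong) auto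
  finally show ?thesis using cutU by simp
qed

text \<open>A side containing \<open>w\<close> is exchanged for its complement, whose cut is already
  one of \<open>G\<close>.\<close>

lemma edge_connH: assumes "edge_conn k G" shows "edge_conn k H"
  unfolding edge_conn_def
proof (intro conjI allI impI)
  show "verts H \<noteq> {}" by simp
  fix X assume X: "X \<subset> verts H \<and> X \<noteq> {}"
  have *: "k \<le> cut H Y" if "Y \<subseteq> U" "Y \<noteq> {}" for Y
    using that cutH[OF that(1)] assms U unfolding edge_conn_def by auto
  show "k \<le> cut H X"
  proof (cases "w \<in> X")
    case True
    then have "k \<le> cut H (verts H - X)" using X by (intro *) auto
    then show ?thesis using X by (metis H.cut_compl psubset_imp_subset)
  next
    case False
    then show ?thesis using X by (intro *) auto
  qed
qed

lemma cubicH: "cubic H"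
  unfolding cubic_def
proof
  fix v assume "v \<in> verts H"
  then consider "v = w" | "v \<in> U" by auto
  then show "degree H v = 3"
  proof cases
    case 1 then show ?thesis using card_nb_w H.degree_nb by simp
  next
    case 2
    have "card (nb H v) = card (nb H v \<inter> (insert w U - {}))"
      using H.nb_sub[of v] by (auto simp: Int_absorb2)
    also have "\<dots> = card (nb G v)" using card_inter[OF 2, of "{}"] by simp
    finally show ?thesis using nb_card 2 U H.degree_nb by auto
  qed
qed

sublocale H: cub H
  by unfold_locales (use cubicH edge_connH[OF conn] in auto)

lemma matchable_H_U:
  assumes "matchable H X" "X \<subseteq> U" shows "matchable G X"
proof -
  obtain M where M: "M \<subseteq> edges H" "disjoint M" "\<Union>M = X" using assms matchable_def by metis
  have "M \<subseteq> edges G"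
  proof
    fix e assume e: "e \<in> M"
    then have "e \<subseteq> U" using M assms by blast
    then show "e \<in> edges G" using e M(1) w unfolding contract_def by auto
  qed
  then show ?thesis using M matchable_def by blast
qed

text \<open>If all neighbours of \<open>v\<close> lie in \<open>U\<close>, then \<open>w\<close> is
  matched to some \<open>x\<close>, and the edge \<open>xw\<close> is replaced by the edge from
  \<open>x\<close> to its outer neighbour. If \<open>w\<close> is a neighbour of \<open>v\<close>,
  the outer neighbour of \<open>v\<close> is deleted in its stead. Either way exactly one outer
  vertex is taken, and \<open>mc\<close> matches the others.\<close>

lemma nice_lift:
  assumes v: "v \<in> U" and nice: "nice_vertex H v"
    and mc: "\<And>x y. x \<in> U \<Longrightarrow> y \<in> nb G x \<Longrightarrow> y \<notin> U \<Longrightarrow> matchable G (verts G - U - {y})"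
  shows "nice_vertex G v"
proof -
  have p: "matchable H (insert w U - insert v (nb H v))" using nice H.nice_vertex_iff by simp
  have "matchable G (verts G - insert v (nb G v))"
  proof (cases "nb G v \<subseteq> U")
    case True
    then have nbv: "nb H v = nb G v" using nb_in[OF v] by auto
    then have "w \<in> insert w U - insert v (nb H v)" using w True v by auto
    with p obtain x where x: "x \<in> nb H w" "x \<in> insert w U - insert v (nb H v)"
      "matchable H (insert w U - insert v (nb H v) - {w,x})" using H.matchable_remove by metis
    have xU: "x \<in> U" "\<not> nb G x \<subseteq> U" using x(1) nb_w by auto
    then obtain y where y: "y \<in> nb G x" "y \<notin> U" by blast
    have "matchable G (U - insert v (nb G v) - {x})"
    proof (rule matchable_H_U)
      have "insert w U - insert v (nb H v) - {w,x} = U - insert v (nb G v) - {x}" using nbv w by auto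
      then show "matchable H (U - insert v (nb G v) - {x})" using x(3) by simp
    qed auto
    moreover have "matchable G {x,y}" using y by (rule_tac matchable_edge)
    moreover have "matchable G (verts G - U - {y})" using mc xU y by blast
    moreover have "verts G - insert v (nb G v) = (U - insert v (nb G v) - {x}) \<union> {x,y} \<union> (verts G - U - {y})"
      using True v y xU U x(2) nbv nb_verts by auto
    ultimately show ?thesis using y(2) xU(1)
      by (simp only:) (intro matchable_Un, auto)
  next
    case False
    then have nbv: "nb H v = insert w (nb G v \<inter> U)" using nb_in[OF v] by auto
    obtain y where y: "nb G v - U = {y}" using out_card[OF v] False by (auto simp: card_1_singleton_iff)
    have "matchable G (U - insert v (nb G v))"
    proof (rule matchable_H_U)
      have "insert w U - insert v (nb H v) = U - insert v (nb G v)" using nbv w by auto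
      then show "matchable H (U - insert v (nb G v))" using p by simp
    qed auto
    moreover have "matchable G (verts G - U - {y})" using mc v y by blast
    moreover have "verts G - insert v (nb G v) = (U - insert v (nb G v)) \<union> (verts G - U - {y})"
      using v y U by blast
    ultimately show ?thesis by (simp only:) (intro matchable_Un, auto)
  qed
  then show ?thesis using nice_vertex_iff v U by auto
qed

end

section \<open>Cubic graphs with six nice vertices\<close>

text \<open>\<open>T\<close> is the triangle of \<open>K\<^sub>3\<^sub>,\<^sub>3\<^sup>\<triangle>\<close>, \<open>B\<close> its three neighbours \<open>b\<^sub>i\<close>, and \<open>(P\<^sub>j, Q\<^sub>j)\<close> the
  bipartite piece spliced in at \<open>a\<^sub>j\<close>; an unchanged \<open>a\<^sub>j\<close> is the piece with \<open>P\<^sub>j = {a\<^sub>j}\<close> and \<open>Q\<^sub>j = {}\<close>.\<close>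

definition core6 :: "'a graph \<Rightarrow> 'a set \<Rightarrow> 'a set \<Rightarrow> 'a set \<Rightarrow> 'a set \<Rightarrow> 'a set \<Rightarrow> 'a set \<Rightarrow> bool" where
  "core6 G T B P1 Q1 P2 Q2 \<longleftrightarrow>
     verts G = T \<union> B \<union> P1 \<union> Q1 \<union> P2 \<union> Q2 \<and>
     T \<inter> B = {} \<and> (T \<union> B) \<inter> (P1 \<union> Q1 \<union> P2 \<union> Q2) = {} \<and>
     P1 \<inter> Q1 = {} \<and> P2 \<inter> Q2 = {} \<and> (P1 \<union> Q1) \<inter> (P2 \<union> Q2) = {} \<and>
     card T = 3 \<and> card B = 3 \<and> card P1 = card Q1 + 1 \<and> card P2 = card Q2 + 1 \<and>
     (\<forall>x\<in>T. nb G x \<subseteq> T \<union> B) \<and> (\<forall>x\<in>B. nb G x \<subseteq> T \<union> P1 \<union> P2) \<and>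
     (\<forall>x\<in>P1. nb G x \<subseteq> B \<union> Q1) \<and> (\<forall>x\<in>Q1. nb G x \<subseteq> P1) \<and>
     (\<forall>x\<in>P2. nb G x \<subseteq> B \<union> Q2) \<and> (\<forall>x\<in>Q2. nb G x \<subseteq> P2)"

lemma core6_sym:
  assumes "core6 G T B P1 Q1 P2 Q2" shows "core6 G T B P2 Q2 P1 Q1"
proof -
  have "verts G = T \<union> B \<union> P2 \<union> Q2 \<union> P1 \<union> Q1" using assms unfolding core6_def by (simp add: Un_ac)
  moreover have "(T \<union> B) \<inter> (P2 \<union> Q2 \<union> P1 \<union> Q1) = {}" "(P2 \<union> Q2) \<inter> (P1 \<union> Q1) = {}"
    using assms unfolding core6_def by (simp_all add: Un_ac Int_ac)
  moreover have "\<forall>x\<in>B. nb G x \<subseteq> T \<union> P2 \<union> P1" using assms unfolding core6_def by (simp add: Un_ac)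
  ultimately show ?thesis using assms unfolding core6_def by (intro conjI; simp)
qed

text \<open>\<open>x\<close> and \<open>y\<close> are congruent modulo 3 and add up to 3, so they
  are 0 and 3. They will be the numbers of edges leaving a bipartite component from its two colour
  classes.\<close>

lemma mod3_split: "3 * p = a + x \<Longrightarrow> 3 * q = a + y \<Longrightarrow> x + y = 3 \<Longrightarrow> y = 0 \<or> x = 0" for p q :: nat
  by presburger

context sgraph
begin

text \<open>The form of every barrier that is exhibited explicitly: points whose neighbours all lie
  in \<open>S\<close>, plus one odd remainder.\<close>

lemma odd_family_singles:
  assumes "S \<subseteq> verts G" "A \<subseteq> verts G" "R \<subseteq> verts G" "A \<inter> S = {}" "R \<inter> S = {}" "R \<inter> A = {}" "odd (card R)"
    and "\<And>x. x \<in> A \<Longrightarrow> nb G x \<subseteq> S" "\<And>x. x \<in> R \<Longrightarrow> nb G x \<subseteq> R \<union> S"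
  shows "odd_family G (verts G) S (insert R ((\<lambda>x. {x}) ` A))"
    "card (insert R ((\<lambda>x. {x}) ` A)) = card A + 1"
proof -
  have "R \<noteq> {}" using assms(7) by auto
  then have "R \<notin> (\<lambda>x. {x}) ` A" using assms(6) by auto
  moreover have "card ((\<lambda>x. {x}) ` A) = card A" by (rule card_image) (simp add: inj_on_def)
  ultimately show "card (insert R ((\<lambda>x. {x}) ` A)) = card A + 1"
    using finite_sub[OF assms(2)] by simp
  show "odd_family G (verts G) S (insert R ((\<lambda>x. {x}) ` A))"
    unfolding odd_family_def
  proof (intro conjI ballI)
    show "disjoint (insert R ((\<lambda>x. {x}) ` A))"
      using assms(6) by (auto simp: pairwise_insert disjnt_def pairwise_def)
    fix C x assume C: "C \<in> insert R ((\<lambda>x. {x}) ` A)"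
    then show "odd (card C)" using assms(7) by auto
    assume "x \<in> C"
    then show "nb G x \<inter> verts G \<subseteq> C \<union> S" using C assms(8)[of x] assms(9)[of x] by auto
  qed (use assms(1-6) in auto)
qed

lemma nice_sub: "{v. nice_vertex G v} \<subseteq> verts G"
  using nice_vertex_iff by blast

lemma Upsilon_le: "Upsilon G \<le> card (verts G)"
  unfolding Upsilon_def by (rule card_mono[OF finV nice_sub])

lemma Upsilon_split:
  assumes "C \<subseteq> verts G"
  shows "Upsilon G = card ({v. nice_vertex G v} \<inter> C) + card ({v. nice_vertex G v} - C)"
proof -
  have "finite {v. nice_vertex G v}" using nice_sub finV finite_subset by blast
  then show ?thesis unfolding Upsilon_def
    by (metis card_Int_Diff)
qed

end

section \<open>At most six nice vertices in a core; structure of maximal barriers\<close>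

context cub
begin

text \<open>Two barriers do it. The set \<open>B \<union> Q1 \<union> Q2\<close> isolates the points
  of \<open>P1\<close> and \<open>P2\<close> and leaves the odd set \<open>T\<close>; the set
  \<open>P1\<close> isolates the points of \<open>Q1\<close> and leaves everything else.\<close>

lemma core6_nonnice_aux:
  assumes "core6 G T B P1 Q1 P2 Q2" "v \<in> P1 \<union> Q1"
  shows "\<not> nice_vertex G v"
proof -
  have V: "verts G = T \<union> B \<union> P1 \<union> Q1 \<union> P2 \<union> Q2"
    and dj: "T \<inter> B = {}" "(T \<union> B) \<inter> (P1 \<union> Q1 \<union> P2 \<union> Q2) = {}"
     "P1 \<inter> Q1 = {}" "P2 \<inter> Q2 = {}" "(P1 \<union> Q1) \<inter> (P2 \<union> Q2) = {}"
    and cd: "card T = 3" "card B = 3" "card P1 = card Q1 + 1" "card P2 = card Q2 + 1"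
    and nbs: "\<And>x. x \<in> T \<Longrightarrow> nb G x \<subseteq> T \<union> B" "\<And>x. x \<in> B \<Longrightarrow> nb G x \<subseteq> T \<union> P1 \<union> P2"
     "\<And>x. x \<in> P1 \<Longrightarrow> nb G x \<subseteq> B \<union> Q1" "\<And>x. x \<in> Q1 \<Longrightarrow> nb G x \<subseteq> P1"
     "\<And>x. x \<in> P2 \<Longrightarrow> nb G x \<subseteq> B \<union> Q2" "\<And>x. x \<in> Q2 \<Longrightarrow> nb G x \<subseteq> P2"
    using assms(1) unfolding core6_def by simp_all
  have "finite (T \<union> B \<union> P1 \<union> Q1 \<union> P2 \<union> Q2)" using V finV by simp
  then have fin: "finite T" "finite B" "finite P1" "finite Q1" "finite P2" "finite Q2" by simp_all
  show ?thesis
  proof (cases "v \<in> P1")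
    case True
    let ?S = "B \<union> Q1 \<union> Q2" and ?A = "P1 \<union> P2"
    have 1: "odd_family G (verts G) ?S (insert T ((\<lambda>x. {x}) ` ?A))"
      "card (insert T ((\<lambda>x. {x}) ` ?A)) = card ?A + 1"
    proof -
      have a: "?S \<subseteq> verts G" "?A \<subseteq> verts G" "T \<subseteq> verts G" using V by auto
      have b: "?A \<inter> ?S = {}" "T \<inter> ?S = {}" "T \<inter> ?A = {}" using dj by auto
      have c: "odd (card T)" using cd by simp
      have d: "\<And>x. x \<in> ?A \<Longrightarrow> nb G x \<subseteq> ?S" using nbs(3,5) by blast
      have e: "\<And>x. x \<in> T \<Longrightarrow> nb G x \<subseteq> T \<union> ?S" using nbs(1) by blast
      show "odd_family G (verts G) ?S (insert T ((\<lambda>x. {x}) ` ?A))"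
        "card (insert T ((\<lambda>x. {x}) ` ?A)) = card ?A + 1"
        using odd_family_singles[OF a b c d e] by simp_all
    qed
    have "card (B \<union> Q1) = card B + card Q1" by (rule card_Un_disjoint) (use fin dj in auto)
    moreover have "card ?S = card (B \<union> Q1) + card Q2" by (rule card_Un_disjoint) (use fin dj in auto)
    moreover have "card ?A = card P1 + card P2" by (rule card_Un_disjoint) (use fin dj in auto)
    ultimately have le: "card ?S \<le> card (insert T ((\<lambda>x. {x}) ` ?A))" using 1(2) cd by linarith
    show ?thesis by (rule barrier_nonnice[OF 1(1) le]) (use nbs(3)[OF True] True in auto)
  next
    case False
    then have v: "v \<in> Q1" using assms(2) by blast
    let ?R = "T \<union> B \<union> P2 \<union> Q2"
    have "card (verts G) = card (P1 \<union> Q1) + card ?R"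
      using V dj fin by (subst card_Un_disjoint[symmetric]) (auto intro: arg_cong[where f=card])
    moreover have "card (P1 \<union> Q1) = card P1 + card Q1" by (rule card_Un_disjoint) (use fin dj in auto)
    ultimately have odd: "odd (card ?R)" using evenV cd(3) by presburger
    have a: "P1 \<subseteq> verts G" "Q1 \<subseteq> verts G" "?R \<subseteq> verts G" using V by auto
    have b: "Q1 \<inter> P1 = {}" "?R \<inter> P1 = {}" "?R \<inter> Q1 = {}" using dj by auto
    have e: "\<And>x. x \<in> ?R \<Longrightarrow> nb G x \<subseteq> ?R \<union> P1" using nbs(1,2,5,6) by blast
    note 1 = odd_family_singles[OF a b odd nbs(4) e]
    show ?thesis by (rule barrier_nonnice[OF 1(1)]) (use cd 1(2) nbs(4)[OF v] v in auto)
  qed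
qed

lemma core6_nice_sub:
  assumes "core6 G T B P1 Q1 P2 Q2"
  shows "{v. nice_vertex G v} \<subseteq> T \<union> B" "card (T \<union> B) = 6"
proof -
  show "{v. nice_vertex G v} \<subseteq> T \<union> B"
  proof
    fix v assume v: "v \<in> {v. nice_vertex G v}"
    then have "v \<in> T \<union> B \<union> P1 \<union> Q1 \<union> P2 \<union> Q2" using nice_sub assms unfolding core6_def by auto
    then show "v \<in> T \<union> B"
      using core6_nonnice_aux[OF assms, of v] core6_nonnice_aux[OF core6_sym[OF assms], of v] v by auto
  qed
  have "finite T" "finite B" "T \<inter> B = {}" "card T = 3" "card B = 3"
    using assms finV unfolding core6_def by (simp_all add: card_ge_0_finite)
  then show "card (T \<union> B) = 6" by (simp add: card_Un_disjoint)
qed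

lemma core6_Upsilon_le:
  assumes "core6 G T B P1 Q1 P2 Q2" shows "Upsilon G \<le> 6"
proof -
  have "finite (T \<union> B)" by (rule card_ge_0_finite) (use core6_nice_sub(2)[OF assms] in simp)
  then show ?thesis unfolding Upsilon_def
    using card_mono core6_nice_sub[OF assms] by metis
qed

lemma card4_all_nice:
  assumes "card (verts G) = 4" "v \<in> verts G" shows "nice_vertex G v"
proof -
  have "insert v (nb G v) \<subseteq> verts G" "card (insert v (nb G v)) = 4"
    using nb_sub assms nb_card by auto
  then have "insert v (nb G v) = verts G" using assms(1) finV by (metis card_subset_eq)
  then show ?thesis using nice_vertex_iff assms(2) by simp
qed

lemma card4_Upsilon: "card (verts G) = 4 \<Longrightarrow> Upsilon G = 4"
  unfolding Upsilon_def using card4_all_nice nice_sub by (metis subset_antisym mem_Collect_eq subsetI)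

lemma cardV_ge4: "4 \<le> card (verts G)"
proof -
  obtain v where v: "v \<in> verts G" using V_ne by blast
  have "card (insert v (nb G v)) \<le> card (verts G)"
    by (rule card_mono) (use nb_sub v in auto)
  then show ?thesis using nb_card[OF v] by simp
qed

text \<open>A perfect matching through \<open>xy\<close> crosses the border of \<open>C\<close>
  nowhere else. A second crossing edge would spend another vertex of \<open>S\<close> on
  \<open>C\<close>, leaving \<open>card S - 2\<close> vertices of \<open>S\<close> for
  \<open>card S - 1\<close> other odd members.\<close>

lemma barrier_matchable_split:
  assumes o: "odd_family G (verts G) S \<C>" and cd: "card \<C> = card S" and C: "C \<in> \<C>"
    and x: "x \<in> C" and y: "y \<in> nb G x" "y \<notin> C"
  shows "matchable G (C - {x})" "matchable G (verts G - C - {y})"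
proof -
  note od = odd_familyD[OF o]
  note f = odd_family_finite[OF o subset_refl]
  have yS: "y \<in> S" using od(6)[OF C x] y nb_verts by blast
  have xS: "x \<notin> S" "x \<in> verts G" using od(4)[OF C] x by auto
  obtain M where M: "M \<subseteq> edges G" "disjoint M" "\<Union>M = verts G - {x,y}"
    using matching_covered[OF y(1)] matchable_def by metis
  have nocross: "e \<subseteq> C \<or> e \<inter> C = {}" if e: "e \<in> M" for e
  proof (rule ccontr)
    assume cr: "\<not> ?thesis"
    obtain a b where ab: "e = {a,b}" "b \<in> nb G a" using edgeE M(1) e by (metis subsetD)
    have "\<exists>c s. e = {c,s} \<and> s \<in> nb G c \<and> c \<in> C \<and> s \<notin> C"
    proof (cases "a \<in> C")
      case True
      then have "b \<notin> C" using cr ab(1) by auto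
      then show ?thesis using ab True by blast
    next
      case False
      then have "b \<in> C" using cr ab(1) by auto
      moreover have "e = {b,a}" "a \<in> nb G b" using ab by (auto simp: nb_sym)
      ultimately show ?thesis using False by blast
    qed
    then obtain c s where cs: "e = {c,s}" "s \<in> nb G c" "c \<in> C" "s \<notin> C" by blast
    have sS: "s \<in> S" using od(6)[OF C cs(3)] cs nb_verts by blast
    have em: "e \<subseteq> verts G - {x,y}" using M(3) e by blast
    have "disjoint (M - {e})" using M(2) by (metis Diff_subset pairwise_subset)
    moreover have "\<Union>(M - {e}) = verts G - {x,y} - e"
    proof -
      have "e' \<inter> e = {}" if "e' \<in> M - {e}" for e'
        using that e pairwiseD[OF M(2), of e' e] by (simp add: disjnt_def)
      then have "\<Union>(M - {e}) = \<Union>M - e" using e by auto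
      then show ?thesis using M(3) by simp
    qed
    ultimately have p: "matchable G (verts G - {x,y} - e)" using M(1) unfolding matchable_def by (metis Diff_subset subset_trans)
    have "odd_family G (verts G - {x,y} - e) (S - {y,s}) (\<C> - {C})"
      unfolding odd_family_def
    proof (intro conjI ballI)
      have "c \<notin> S" using od(4)[OF C] cs(3) by blast
      then show "S - {y,s} \<subseteq> verts G - {x,y} - e" using od(1) xS cs by auto
      show "disjoint (\<C> - {C})" using od(2) by (rule pairwise_subset) auto
      show "\<C> - {C} \<subseteq> Pow (verts G - {x,y} - e - (S - {y,s}))"
      proof
        fix D assume D: "D \<in> \<C> - {C}"
        have "D \<subseteq> verts G - S" using od(4) D by blast
        moreover have "D \<inter> C = {}" using pairwiseD[OF od(2), of D C] D C by (simp add: disjnt_def)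
        ultimately show "D \<in> Pow (verts G - {x,y} - e - (S - {y,s}))" using cs x yS sS by auto
      qed
      fix D z assume D: "D \<in> \<C> - {C}"
      then show "odd (card D)" using od(5) by blast
      assume "z \<in> D"
      then have "nb G z \<inter> verts G \<subseteq> D \<union> S" using od(6) D by blast
      then show "nb G z \<inter> (verts G - {x, y} - e) \<subseteq> D \<union> (S - {y, s})" using cs by auto
    qed
    from matchable_odd_family_le[OF p this] have "card (\<C> - {C}) \<le> card (S - {y,s})" .
    moreover have "y \<noteq> s" using em cs by auto
    then have "card (S - {y,s}) + 2 = card S" using yS sS f(2) card_mono[of S "{y,s}"]
      by (simp add: card_Diff_subset)
    moreover have "card (\<C> - {C}) + 1 = card \<C>" using C f(1) by (metis card_Suc_Diff1 Suc_eq_plus1)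
    ultimately show False using cd by linarith
  qed
  show "matchable G (C - {x})"
  proof (rule matchable_restrict[OF M(1,2)])
    show "C - {x} \<subseteq> \<Union>M" using M(3) od(4)[OF C] y by auto
    show "e \<inter> (C - {x}) = {} \<or> e \<subseteq> C - {x}" if "e \<in> M" for e using nocross[OF that] M(3) that by blast
  qed
  show "matchable G (verts G - C - {y})"
  proof (rule matchable_restrict[OF M(1,2)])
    show "verts G - C - {y} \<subseteq> \<Union>M" using M(3) x by auto
    show "e \<inter> (verts G - C - {y}) = {} \<or> e \<subseteq> verts G - C - {y}" if "e \<in> M" for e
      using nocross[OF that] M(3) that by blast
  qed
qed

text \<open>In a bipartite component the three outgoing edges all start in one colour class, by a
  count modulo 3, and this class is larger by one. Replacing the component by the points of the
  larger class and moving the other class into \<open>S\<close> would enlarge the barrier.\<close>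

lemma maximal_barrier_nonbip:
  assumes o: "odd_family G (verts G) S \<C>" and cd: "card \<C> = card S" and S0: "S \<noteq> {}"
    and mx: "\<And>S' \<C>'. odd_family G (verts G) S' \<C>' \<Longrightarrow> card \<C>' = card S' \<Longrightarrow> S \<subseteq> S' \<Longrightarrow> card S' \<le> card S"
    and C: "C \<in> \<C>" "card C \<noteq> 1" "C = P \<union> Q"
  shows "\<not> bip_on G P Q"
proof
  assume bp: "bip_on G P Q"
  note od = odd_familyD[OF o] and f = odd_family_finite[OF o subset_refl]
  have CS: "C \<inter> S = {}" "C \<subseteq> verts G" using od(4)[OF C(1)] by auto
  \<comment> \<open>The case in which \<open>Q\<close> sends no edge to \<open>S\<close>; the other
    case exchanges the two classes.\<close>
  have main: False if bp: "bip_on G P Q" and CPQ: "C = P \<union> Q" and Q0: "ec G Q S = 0" for P Q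
  proof -
    have PQ: "P \<inter> Q = {}" "P \<subseteq> verts G" "Q \<subseteq> verts G" "finite P" "finite Q" "P \<inter> S = {}" "Q \<inter> S = {}"
      using bp CPQ CS finite_sub unfolding bip_on_def by auto
    have nbP: "nb G x \<subseteq> Q \<union> S" if "x \<in> P" for x
      using od(6)[OF C(1), of x] that bp CPQ nb_sub unfolding bip_on_def by fastforce
    have nbQ: "nb G x \<subseteq> P" if "x \<in> Q" for x
    proof -
      have "\<forall>x\<in>Q. nb G x \<inter> S = {}" by (rule iffD1[OF ec_0_iff[OF PQ(5)] Q0])
      then show ?thesis using od(6)[OF C(1), of x] that bp CPQ nb_sub unfolding bip_on_def by fastforce
    qed
    have "3 * card Q = ec G Q P"
      using ec_V[OF PQ(3)] ec_cong_right[of Q G "verts G" P] nbQ nb_sub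
      by (metis Int_absorb2 nb_inter_V(1))
    moreover have "ec G Q P = ec G P Q" using ec_sym PQ by blast
    moreover have "3 * card P = ec G P (Q \<union> S)"
      using ec_V[OF PQ(2)] ec_cong_right[of P G "verts G" "Q \<union> S"] nbP nb_sub
      by (metis Int_absorb2 nb_inter_V(1))
    moreover have "ec G P (Q \<union> S) = ec G P Q + ec G P S" by (rule ec_Un2) (use PQ in auto)
    moreover have "ec G P S + ec G Q S = 3"
      using barrier_props(1)[OF o cd S0 C(1)] odd_family_bound(3)[OF o C(1)] ec_Un1[of P Q] PQ CPQ by simp
    ultimately have cPQ: "card P = card Q + 1" using Q0 by linarith
    have "Q \<noteq> {}"
    proof
      assume "Q = {}"
      then show False using cPQ CPQ C(2) by simp
    qed
    let ?S = "S \<union> Q" and ?C = "(\<C> - {C}) \<union> (\<lambda>x. {x}) ` P"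
    have dis: "D \<inter> C = {}" if "D \<in> \<C> - {C}" for D
      using pairwiseD[OF od(2), of D C] that C(1) by (simp add: disjnt_def)
    have "odd_family G (verts G) ?S ?C"
      unfolding odd_family_def
    proof (intro conjI ballI)
      show "?S \<subseteq> verts G" using od(1) PQ by auto
      show "?C \<subseteq> Pow (verts G - ?S)"
      proof
        fix D assume "D \<in> ?C"
        then consider "D \<in> \<C> - {C}" | x where "x \<in> P" "D = {x}" by blast
        then show "D \<in> Pow (verts G - ?S)"
        proof cases
          case 1
          then show ?thesis using dis[OF 1] od(4)[of D] CPQ by auto
        next
          case 2
          then show ?thesis using PQ by auto
        qed
      qed
      show "disjoint ?C"
      proof (rule disjoint_union)
        show "disjoint (\<C> - {C})" using od(2) by (rule pairwise_subset) auto
        show "disjoint ((\<lambda>x. {x}) ` P)" by (auto simp: pairwise_def disjnt_def)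
        show "\<Union> (\<C> - {C}) \<inter> \<Union> ((\<lambda>x. {x}) ` P) = {}" using dis CPQ by auto
      qed
      fix D x assume D: "D \<in> ?C"
      then show "odd (card D)" using od(5) by auto
      assume x: "x \<in> D"
      show "nb G x \<inter> verts G \<subseteq> D \<union> ?S"
      proof (cases "D \<in> \<C> - {C}")
        case True then show ?thesis using od(6)[of D x] x by auto
      next
        case False
        then have "x \<in> P" using D x by auto
        then show ?thesis using nbP by auto
      qed
    qed
    moreover have "card ?C = card ?S"
    proof -
      have "card ?C = card (\<C> - {C}) + card ((\<lambda>x. {x}) ` P)"
      proof (rule card_Un_disjoint)
        show "(\<C> - {C}) \<inter> (\<lambda>x. {x}) ` P = {}" using dis CPQ by auto
      qed (use f PQ in auto)
      moreover have "card ((\<lambda>x. {x}) ` P) = card P" by (rule card_image) (simp add: inj_on_def)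
      moreover have "card (\<C> - {C}) + 1 = card \<C>" using C f(1) by (metis card_Suc_Diff1 Suc_eq_plus1)
      moreover have "card ?S = card S + card Q" by (rule card_Un_disjoint) (use f PQ in auto)
      ultimately show ?thesis using cd cPQ by linarith
    qed
    ultimately have "card ?S \<le> card S" using mx by blast
    moreover have "card ?S = card S + card Q" by (rule card_Un_disjoint) (use f PQ in auto)
    ultimately show False using \<open>Q \<noteq> {}\<close> PQ by auto
  qed
  have PQ: "P \<inter> Q = {}" "P \<subseteq> verts G" "Q \<subseteq> verts G" "finite P" "finite Q" "P \<inter> S = {}" "Q \<inter> S = {}"
    using bp C CS finite_sub unfolding bip_on_def by auto
  have count: "3 * card P = ec G P Q + ec G P S"
    if bp: "bip_on G P Q" and CPQ: "C = P \<union> Q" and fn: "finite P" "Q \<inter> S = {}" "P \<subseteq> verts G" for P Q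
  proof -
    have nbP: "nb G x \<subseteq> Q \<union> S" if "x \<in> P" for x
      using od(6)[OF C(1), of x] that bp CPQ nb_sub unfolding bip_on_def by fastforce
    have "3 * card P = ec G P (Q \<union> S)"
      using ec_V[OF fn(3)] ec_cong_right[of P G "verts G" "Q \<union> S"] nbP nb_sub
      by (metis Int_absorb2 nb_inter_V(1))
    moreover have "ec G P (Q \<union> S) = ec G P Q + ec G P S" by (rule ec_Un2) (use fn in auto)
    ultimately show ?thesis by simp
  qed
  have 1: "3 * card P = ec G P Q + ec G P S" using count[OF bp C(3)] PQ by blast
  have bp': "bip_on G Q P" using bp bip_on_commute by blast
  have CQP: "C = Q \<union> P" using C(3) by auto
  have 2: "3 * card Q = ec G Q P + ec G Q S" using count[OF bp' CQP] PQ by blast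
  have 3: "ec G P S + ec G Q S = 3"
    using barrier_props(1)[OF o cd S0 C(1)] odd_family_bound(3)[OF o C(1)] ec_Un1[of P Q] PQ C(3) by simp
  have 4: "ec G P Q = ec G Q P" using ec_sym PQ by blast
  have "ec G Q S = 0 \<or> ec G P S = 0"
    using mod3_split[OF 1 2[folded 4] 3] by blast
  then show False using main[OF bp C(3)] main[OF bp' CQP] by blast
qed

end

lemma (in cub) boundary_card:
  assumes "U \<subset> verts G" "cut G U = 3" "\<And>x. x \<in> U \<Longrightarrow> card (nb G x - U) \<le> 1"
  shows "card {x \<in> U. \<not> nb G x \<subseteq> U} = 3"
proof -
  obtain w where "w \<notin> U" using assms(1) by blast
  then interpret c: contraction G U w by unfold_locales (use assms in auto)
  show ?thesis using c.card_nb_w c.nb_w by simp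
qed

section \<open>3-edge-connected cubic graphs and barriers with one nontrivial component\<close>

locale cub3 = cub +
  assumes conn3: "edge_conn 3 G"
begin

lemma cut3: "X \<subseteq> verts G \<Longrightarrow> X \<noteq> {} \<Longrightarrow> X \<noteq> verts G \<Longrightarrow> 3 \<le> cut G X"
  using conn3 unfolding edge_conn_def by blast

lemma nb_split: "x \<in> verts G \<Longrightarrow> card (nb G x \<inter> X) + card (nb G x - X) = 3"
  using nb_card card_Int_Diff[of "nb G x" X] by simp

text \<open>With two neighbours of \<open>x\<close> outside, moving \<open>x\<close> out of
  \<open>C\<close> would lower the cut from 3 to at most 2.\<close>

lemma one_out:
  assumes "C \<subseteq> verts G" "cut G C = 3" "2 \<le> card C" "x \<in> C"
  shows "card (nb G x - C) \<le> 1"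
proof (rule ccontr)
  assume "\<not> ?thesis"
  moreover have "cut G (C - {x}) + card (nb G x - C) = 3 + card (nb G x \<inter> C)"
    using cut_remove[OF assms(1,4)] assms(2) by simp
  moreover have "card (nb G x \<inter> C) + card (nb G x - C) = 3" using nb_split assms by blast
  moreover have "3 \<le> cut G (C - {x})"
  proof (rule cut3)
    show "C - {x} \<noteq> {}"
    proof
      assume "C - {x} = {}"
      then have "C = {x}" using assms(4) by blast
      then show False using assms(3) by simp
    qed
  qed (use assms in auto)
  ultimately show False by linarith
qed

end

text \<open>A barrier \<open>S\<close> with a single nontrivial odd component \<open>C\<close>; the others are the points of \<open>D\<close>.\<close>

locale one_comp = cub3 +
  fixes S C :: "'a set"
  assumes SV: "S \<subseteq> verts G" and CV: "C \<subseteq> verts G" and SC: "S \<inter> C = {}"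
    and nbS: "\<And>x. x \<in> S \<Longrightarrow> nb G x \<inter> S = {}"
    and nbD: "\<And>x. x \<in> verts G - S - C \<Longrightarrow> nb G x \<subseteq> S"
    and nbC: "\<And>x. x \<in> C \<Longrightarrow> nb G x \<subseteq> C \<union> S"
    and cutC: "cut G C = 3" and cardC: "2 \<le> card C"
    and cardD: "card (verts G - S - C) + 1 = card S" and cardS: "3 \<le> card S"
begin

definition "D = verts G - S - C"
text \<open>The three edges leaving \<open>C\<close> join \<open>S0\<close> to \<open>C0\<close> and
  form a matching, later called \<open>mt\<close>; \<open>A\<close> collects the vertices of
  \<open>S\<close> whose neighbours all lie in \<open>D\<close>.\<close>

definition "S0 = {x \<in> S. nb G x \<inter> C \<noteq> {}}"
definition "C0 = {x \<in> C. \<not> nb G x \<subseteq> C}"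
definition "A = S - S0"

lemma fins: "finite S" "finite C" "finite D" "finite S0" "finite C0" "finite A"
proof -
  show "finite S" "finite C" "finite D" using SV CV finite_sub unfolding D_def by auto
  then show "finite S0" "finite C0" "finite A" unfolding S0_def C0_def A_def by auto
qed

lemma V_eq: "verts G = S \<union> D \<union> C" and disj: "S \<inter> D = {}" "D \<inter> C = {}" "S \<inter> C = {}"
  using SV CV SC unfolding D_def by auto

lemma sub: "S0 \<subseteq> S" "A \<subseteq> S" "C0 \<subseteq> C" "S = S0 \<union> A" "S0 \<inter> A = {}"
  unfolding S0_def C0_def A_def by auto

lemma cardD': "card D + 1 = card S" using cardD by (simp add: D_def)

lemma nb_S: "x \<in> S \<Longrightarrow> nb G x \<subseteq> C \<union> D"
  using nbS[of x] nb_sub[of x] V_eq by auto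

lemma nb_D: "x \<in> D \<Longrightarrow> nb G x \<subseteq> S"
  using nbD unfolding D_def by blast

lemma nb_A: "x \<in> A \<Longrightarrow> nb G x \<subseteq> D"
  using nb_S[of x] unfolding A_def S0_def by auto

lemma C_proper: "C \<subset> verts G" "C \<noteq> {}" "S \<noteq> {}"
proof -
  show "S \<noteq> {}" using cardS by auto
  then show "C \<subset> verts G" using CV SC SV by auto
  show "C \<noteq> {}" using cardC by auto
qed

lemma one_C: "x \<in> C \<Longrightarrow> card (nb G x - C) \<le> 1"
  using one_out[OF CV cutC cardC] .

lemma cutcompl: "cut G (verts G - C) = 3" using cut_compl[OF CV] cutC by simp

lemma one_S: assumes "x \<in> verts G - C" shows "card (nb G x \<inter> C) \<le> 1"
proof -
  have "card S \<le> card (verts G - C)" by (rule card_mono) (use SV SC in auto)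
  then have "2 \<le> card (verts G - C)" using cardS by linarith
  from one_out[OF _ cutcompl this assms] have "card (nb G x - (verts G - C)) \<le> 1" by auto
  moreover have "nb G x - (verts G - C) = nb G x \<inter> C" using nb_sub CV by auto
  ultimately show ?thesis by simp
qed

lemma cardC0: "card C0 = 3"
  unfolding C0_def by (rule boundary_card[OF C_proper(1) cutC one_C])

lemma cardS0: "card S0 = 3"
proof -
  have "card {x \<in> verts G - C. \<not> nb G x \<subseteq> verts G - C} = 3"
  proof (rule boundary_card[OF _ cutcompl])
    show "verts G - C \<subset> verts G" using C_proper CV by auto
    fix x assume x: "x \<in> verts G - C"
    have "nb G x - (verts G - C) = nb G x \<inter> C" using nb_sub CV by auto
    then show "card (nb G x - (verts G - C)) \<le> 1" using one_S[OF x] by simp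
  qed
  moreover have "{x \<in> verts G - C. \<not> nb G x \<subseteq> verts G - C} = S0"
  proof -
    have "x \<in> S" if "x \<in> verts G - C" "nb G x \<inter> C \<noteq> {}" for x
      using that V_eq nb_D[of x] SC by auto
    moreover have "nb G x \<subseteq> verts G - C \<longleftrightarrow> nb G x \<inter> C = {}" for x using nb_sub CV by auto
    ultimately show ?thesis unfolding S0_def using SV SC by auto
  qed
  ultimately show ?thesis by simp
qed

lemma cardA: "card A + 3 = card S"
  unfolding A_def using cardS0 fins sub(1) card_mono[of S S0] by (simp add: card_Diff_subset)

lemma S0_nb:
  assumes "x \<in> S0" shows "card (nb G x \<inter> C) = 1" "card (nb G x \<inter> D) = 2"
proof -
  have x: "x \<in> verts G" "x \<in> S" using assms sub SV by auto
  have "nb G x \<inter> C \<noteq> {}" using assms unfolding S0_def by simp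
  then have "card (nb G x \<inter> C) \<noteq> 0" by simp
  moreover have "card (nb G x \<inter> C) \<le> 1" using one_S[of x] x SC by auto
  ultimately show 1: "card (nb G x \<inter> C) = 1" by linarith
  have "nb G x - C = nb G x \<inter> D" using nb_S[OF x(2)] disj by auto
  then show "card (nb G x \<inter> D) = 2" using nb_split[OF x(1), of C] 1 by simp
qed

definition "mt x = (THE c. c \<in> nb G x \<inter> C)"

lemma mt: "x \<in> S0 \<Longrightarrow> nb G x \<inter> C = {mt x}"
proof -
  assume "x \<in> S0"
  then obtain c where "nb G x \<inter> C = {c}" using S0_nb(1) by (auto simp: card_1_singleton_iff)
  then show ?thesis unfolding mt_def by simp
qed

lemma mt_img: "inj_on mt S0" "mt ` S0 = C0"
proof -
  have m: "mt x \<in> C0 \<and> mt x \<in> nb G x" if "x \<in> S0" for x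
  proof -
    have "mt x \<in> C" "x \<in> nb G (mt x)" using mt[OF that] by (auto simp: nb_sym[of x])
    moreover have "x \<notin> C" using that sub SC by auto
    ultimately show ?thesis unfolding C0_def by (auto simp: nb_sym)
  qed
  show inj: "inj_on mt S0"
  proof (rule inj_onI)
    fix x y assume xy: "x \<in> S0" "y \<in> S0" "mt x = mt y"
    have "x \<notin> C" "y \<notin> C" using xy sub SC by auto
    then have "{x,y} \<subseteq> nb G (mt x) - C"
      using m[OF xy(1)] m[OF xy(2)] xy(3) by (auto simp: nb_sym)
    then have "card {x,y} \<le> card (nb G (mt x) - C)" by (intro card_mono) auto
    also have "\<dots> \<le> 1" using one_C[of "mt x"] m[OF xy(1)] sub by blast
    finally show "x = y" by (cases "x = y") auto
  qed
  have "card (mt ` S0) = card C0" using card_image[OF inj] cardC0 cardS0 by simp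
  moreover have "mt ` S0 \<subseteq> C0" using m by blast
  ultimately show "mt ` S0 = C0" using fins by (metis card_subset_eq)
qed

lemma matchable_S0:
  assumes "X \<subseteq> S0" shows "matchable G (X \<union> mt ` X)"
proof (rule matchable_match)
  show "finite X" using assms fins finite_subset by blast
  show "inj_on mt X" using mt_img assms inj_on_subset by blast
  show "mt x \<in> nb G x" if "x \<in> X" for x using mt[of x] that assms by auto
  have "mt ` X \<subseteq> C" using mt_img assms sub by blast
  moreover have "X \<subseteq> S" using assms sub(1) by (rule subset_trans)
  ultimately show "X \<inter> mt ` X = {}" using SC by auto
qed

lemma matchable_A:
  assumes "X \<subseteq> A" "Z \<subseteq> D" "card X = card Z"
    and h: "\<And>Y. Y \<subseteq> X \<Longrightarrow> card Y \<le> card (\<Union>x\<in>Y. nb G x \<inter> Z)"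
  shows "matchable G (X \<union> Z)"
proof -
  have fin: "finite X" "finite Z" using assms fins finite_subset by blast+
  have "\<exists>f. inj_on f X \<and> (\<forall>x\<in>X. f x \<in> nb G x \<inter> Z)"
    by (rule hall) (use fin h in auto)
  then obtain f where f: "inj_on f X" "\<And>x. x \<in> X \<Longrightarrow> f x \<in> nb G x \<inter> Z" by blast
  have "f ` X = Z" using f fin assms(3) by (metis Int_iff card_image card_subset_eq image_subsetI)
  moreover have "X \<inter> Z = {}" using subset_trans[OF assms(1) sub(2)] assms(2) disj(1) by auto
  ultimately show ?thesis using matchable_match[OF fin(1) f(1), of G] f(2) by simp
qed

abbreviation "N X \<equiv> \<Union>x\<in>X. nb G x"

text \<open>\<open>X\<close> sends all its \<open>3 * card X\<close> edges into \<open>N X\<close>,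
  and the remaining edge ends at \<open>N X\<close> form the cut of \<open>X \<union> N X\<close>.
  As this cut is at least 3, \<open>N X\<close> is larger than \<open>X\<close>; a set with surplus
  exactly one has a cut of exactly 3.\<close>

lemma tight:
  assumes "X \<subseteq> A" "X \<noteq> {}"
  shows "cut G (X \<union> N X) + 3 * card X = 3 * card (N X)" "card X + 1 \<le> card (N X)"
proof -
  have ND: "N X \<subseteq> D" using nb_A assms by blast
  have X: "X \<subseteq> S" "X \<subseteq> verts G" "N X \<subseteq> verts G"
    using assms sub SV UN_least[of X "nb G", OF nb_sub] by auto
  have fin: "finite X" "finite (N X)" using X finite_sub by auto
  have dj: "X \<inter> N X = {}" using Int_mono[OF X(1) ND] disj(1) by simp
  let ?Z = "X \<union> N X"
  have "cut G ?Z = ec G X (verts G - ?Z) + ec G (N X) (verts G - ?Z)" by (rule ec_Un1) (use fin dj in auto)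
  moreover have "ec G X (verts G - ?Z) = 0" unfolding ec_0_iff[OF fin(1)] by auto
  moreover have "ec G (N X) ?Z + ec G (N X) (verts G - ?Z) = 3 * card (N X)"
    by (rule ec_split) (use X in auto)
  moreover have "ec G (N X) ?Z = ec G (N X) X"
  proof (rule ec_cong_right)
    fix d assume "d \<in> N X"
    then have "nb G d \<subseteq> S" using nb_D ND by blast
    then show "nb G d \<inter> ?Z = nb G d \<inter> X" using ND disj by auto
  qed
  moreover have "ec G (N X) X = ec G X (N X)" using ec_sym fin by blast
  moreover have "ec G X (N X) = 3 * card X"
  proof -
    have "ec G X (N X) = ec G X (verts G)" by (rule ec_cong_right) auto
    then show ?thesis using ec_V X by simp
  qed
  ultimately show 1: "cut G ?Z + 3 * card X = 3 * card (N X)" by linarith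
  have "3 \<le> cut G ?Z"
  proof (rule cut3)
    show "?Z \<subseteq> verts G" "?Z \<noteq> {}" using X assms by auto
    have "?Z \<inter> C = {}" using X ND disj by auto
    then have "?Z \<inter> C \<noteq> verts G \<inter> C" using C_proper(2) CV by (simp add: Int_absorb1)
    then show "?Z \<noteq> verts G" by metis
  qed
  then show "card X + 1 \<le> card (N X)" using 1 by linarith
qed

text \<open>Outside the closed neighbourhood of \<open>b\<close> the matching is assembled from
  \<open>C - C0\<close>, the two other edges leaving \<open>C\<close>, and a matching of
  \<open>A\<close> with the vertices of \<open>D\<close> not adjacent to \<open>b\<close>, which
  exists by Hall's theorem.\<close>

lemma S0_nice:
  assumes pmC: "matchable G (C - C0)" and b: "b \<in> S0"
  shows "nice_vertex G b"
proof -
  let ?Z = "D - nb G b"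
  have bS: "b \<in> S" "b \<in> verts G" using b sub SV by auto
  have cZ: "card ?Z + 2 = card D"
  proof -
    have "card (D - nb G b \<inter> D) = card D - card (nb G b \<inter> D)" using fins by (intro card_Diff_subset) auto
    moreover have "D - nb G b \<inter> D = ?Z" by auto
    moreover have "card (nb G b \<inter> D) \<le> card D" using fins by (intro card_mono) auto
    ultimately show ?thesis using S0_nb[OF b] by simp
  qed
  have "matchable G (A \<union> ?Z)"
  proof (rule matchable_A)
    show "card A = card ?Z" using cZ cardA cardD' by linarith
    fix X assume X: "X \<subseteq> A"
    show "card X \<le> card (\<Union>x\<in>X. nb G x \<inter> ?Z)"
    proof (cases "X = {}")
      case False
      have "X \<subseteq> verts G" using X sub SV by auto
      have NX: "N X \<subseteq> D" "N X \<subseteq> verts G" using nb_A X nb_sub by blast+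
      have finN: "finite (N X)" "finite X" using NX \<open>X \<subseteq> verts G\<close> finite_sub by auto
      have eq: "(\<Union>x\<in>X. nb G x \<inter> ?Z) = N X - nb G b" using NX by auto
      have s: "card (N X \<inter> nb G b) + card (N X - nb G b) = card (N X)"
        using card_Int_Diff[OF finN(1)] by simp
      have k2: "card (N X \<inter> nb G b) \<le> 2"
        using card_mono[of "nb G b \<inter> D" "N X \<inter> nb G b"] NX S0_nb[OF b] by auto
      show ?thesis
      proof (rule ccontr)
        \<comment> \<open>A violating \<open>X\<close> has surplus one, and both neighbours of
          \<open>b\<close> in \<open>D\<close> lie in \<open>N X\<close>. Adding \<open>b\<close> to
          \<open>X \<union> N X\<close> then turns a cut of 3 into one of 3 + 1 - 2 = 2.\<close>
        assume "\<not> ?thesis"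
        then have "card (N X - nb G b) < card X" unfolding eq by linarith
        then have t: "card (N X) = card X + 1" "card (N X \<inter> nb G b) = 2"
          using tight(2)[OF X False] s k2 by linarith+
        let ?W = "X \<union> N X"
        have W: "?W \<subseteq> verts G" "b \<notin> ?W" "?W \<inter> C = {}"
          using NX X sub b disj bS SV by auto
        have "nb G b \<inter> ?W = N X \<inter> nb G b" using X sub nbS[OF bS(1)] by auto
        then have "card (nb G b \<inter> ?W) = 2" using t by simp
        moreover have "cut G ?W = 3" using tight(1)[OF X False] t by linarith
        moreover have "cut G (insert b ?W) + card (nb G b \<inter> ?W) = cut G ?W + card (nb G b - ?W)"
          by (rule cut_insert) (use W bS in auto)
        moreover have "card (nb G b \<inter> ?W) + card (nb G b - ?W) = 3" using nb_split bS by blast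
        moreover have "3 \<le> cut G (insert b ?W)"
        proof (rule cut3)
          have "insert b ?W \<inter> C = {}" using W bS SC by auto
          then have "insert b ?W \<inter> C \<noteq> verts G \<inter> C" using C_proper(2) CV by (simp add: Int_absorb1)
          then show "insert b ?W \<noteq> verts G" by metis
        qed (use W bS in auto)
        ultimately show False by linarith
      qed
    qed simp
  qed auto
  moreover have "matchable G ((S0 - {b}) \<union> mt ` (S0 - {b}))" by (rule matchable_S0) auto
  moreover have im: "mt ` (S0 - {b}) = C0 - {mt b}"
    using inj_on_image_set_diff[OF mt_img(1), of S0 "{b}"] mt_img(2) b by simp
  moreover have "verts G - insert b (nb G b) = (C - C0) \<union> ((S0 - {b}) \<union> (C0 - {mt b})) \<union> (A \<union> ?Z)"
  proof -
    have "nb G b = insert (mt b) (nb G b \<inter> D)" using mt[OF b] nb_S[OF bS(1)] by auto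
    then have nbb: "x \<in> nb G b \<longleftrightarrow> x = mt b \<or> x \<in> nb G b \<inter> D" for x by auto
    have "mt b \<in> C0" using mt_img b by auto
    then have "mt b \<in> C" using sub by auto
    have "b \<notin> A" using b unfolding A_def by auto
    have "verts G - insert b (nb G b) = (S0 \<union> A \<union> D \<union> C) - insert b (insert (mt b) (nb G b \<inter> D))"
    proof -
      have "verts G = S0 \<union> A \<union> D \<union> C" using V_eq sub(4) by simp
      then show ?thesis using \<open>nb G b = insert (mt b) (nb G b \<inter> D)\<close> by simp
    qed
    also have "\<dots> = (C - C0) \<union> ((S0 - {b}) \<union> (C0 - {mt b})) \<union> (A \<union> ?Z)"
    proof -
      have "b \<notin> D" "b \<notin> C" "mt b \<notin> S0" "mt b \<notin> A" "mt b \<notin> D" "(S0 \<union> A) \<inter> D = {}"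
        using b sub(1,2) disj \<open>mt b \<in> C\<close> by auto
      moreover have "C = (C - C0) \<union> C0" using sub(3) by auto
      ultimately show ?thesis using \<open>mt b \<in> C0\<close> \<open>b \<notin> A\<close> disj(2) sub(3) by auto
    qed
    finally show ?thesis .
  qed
  moreover have "(C - C0) \<inter> ((S0 - {b}) \<union> (C0 - {mt b})) = {}"
    "((C - C0) \<union> ((S0 - {b}) \<union> (C0 - {mt b}))) \<inter> (A \<union> ?Z) = {}"
    using sub disj by auto
  ultimately show ?thesis using pmC bS unfolding nice_vertex_iff by (simp add: matchable_Un)
qed

text \<open>Here all three edges leaving \<open>C\<close> can be used, so only Hall's condition
  between \<open>A - {b}\<close> and \<open>D - nb G b\<close> can fail. For a violating
  \<open>X\<close>, the three neighbours of \<open>b\<close> bring the neighbourhood of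
  \<open>insert b X\<close> to at most \<open>card X + 2\<close>, which is surplus one.\<close>

lemma A_nonnice_tight:
  assumes pmC: "matchable G (C - C0)" and b: "b \<in> A" and nn: "\<not> nice_vertex G b"
  shows "\<exists>Y\<subseteq>A. b \<in> Y \<and> card (N Y) = card Y + 1"
proof -
  let ?Z = "D - nb G b"
  have bS: "b \<in> S" "b \<in> verts G" and nbD: "nb G b \<subseteq> D" using b sub SV nb_A by auto
  have cZ: "card ?Z + 3 = card D"
    using nbD fins nb_card[OF bS(2)] card_mono[of D "nb G b"] by (simp add: card_Diff_subset)
  have cA: "card (A - {b}) = card ?Z" using cZ cardA cardD' b fins by simp
  have "\<not> matchable G ((A - {b}) \<union> ?Z)"
  proof
    assume p: "matchable G ((A - {b}) \<union> ?Z)"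
    have p2: "matchable G (S0 \<union> C0)" using matchable_S0[of S0] mt_img by simp
    have "verts G = S0 \<union> A \<union> D \<union> C" using V_eq sub(4) by simp
    moreover have "nb G b \<inter> (S0 \<union> A \<union> C) = {}" using nbD disj sub(4) by auto
    moreover have "b \<notin> S0" "b \<notin> D" "b \<notin> C" using b sub disj by auto
    ultimately have "verts G - insert b (nb G b) = (C - C0) \<union> (S0 \<union> C0) \<union> ((A - {b}) \<union> ?Z)"
      using sub(3) by auto
    moreover have "(C - C0) \<inter> (S0 \<union> C0) = {}"
      "((C - C0) \<union> (S0 \<union> C0)) \<inter> ((A - {b}) \<union> ?Z) = {}"
      using sub disj by auto
    ultimately have "nice_vertex G b" using p p2 pmC bS unfolding nice_vertex_iff by (simp add: matchable_Un)
    then show False using nn by simp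
  qed
  then obtain X where X: "X \<subseteq> A - {b}" "card (\<Union>x\<in>X. nb G x \<inter> ?Z) < card X"
    using matchable_A[of "A - {b}" ?Z] cA by (meson Diff_subset not_le)
  let ?Y = "insert b X"
  have Y: "?Y \<subseteq> A" using X b by auto
  have NX: "N X \<subseteq> D" using nb_A X by blast
  have finX: "finite X" "finite (N X)"
    using finite_subset[OF X(1)] finite_subset[OF NX] fins by auto
  have "N ?Y = (N X - nb G b) \<union> nb G b" by auto
  then have "card (N ?Y) = card ((N X - nb G b) \<union> nb G b)" by (rule arg_cong)
  moreover have "card ((N X - nb G b) \<union> nb G b) = card (N X - nb G b) + card (nb G b)"
    by (rule card_Un_disjoint) (use finX in auto)
  moreover have "(\<Union>x\<in>X. nb G x \<inter> ?Z) = N X - nb G b" using NX by auto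
  then have "card (\<Union>x\<in>X. nb G x \<inter> ?Z) = card (N X - nb G b)" by (rule arg_cong)
  moreover have "card ?Y = card X + 1" using X finX by (subst card_insert_disjoint) auto
  moreover have "card ?Y + 1 \<le> card (N ?Y)" using tight(2)[OF Y] by auto
  ultimately have "card (N ?Y) = card ?Y + 1" using X(2) nb_card[OF bS(2)] by linarith
  then show ?thesis using Y by blast
qed

text \<open>Neighbourhood size is submodular, so sets of surplus one with intersecting
  neighbourhoods have a union of surplus one. The neighbourhood of a largest such set is therefore
  avoided by every vertex of \<open>A\<close> outside it, and \<open>D\<close> falls into two
  parts.\<close>

lemma uncross:
  assumes t: "\<And>b. b \<in> A \<Longrightarrow> \<exists>Y\<subseteq>A. b \<in> Y \<and> card (N Y) = card Y + 1"
  shows "\<exists>Y P. Y \<subseteq> A \<and> P \<subseteq> D \<and> card P = card Y + 1 \<and> N Y \<subseteq> P \<and> N (A - Y) \<inter> P = {}"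
proof (cases "A = {}")
  \<comment> \<open>\<open>S\<close> consists of the three vertices of \<open>S0\<close> and
    \<open>D\<close> has two points; either of them is a trivial piece.\<close>
  case True
  have "card D \<noteq> 0" using cardD' cardS by linarith
  then obtain d where "d \<in> D" by fastforce
  then show ?thesis using True by (intro exI[of _ "{}"] exI[of _ "{d}"]) auto
next
  case False
  let ?T = "\<lambda>Y. Y \<subseteq> A \<and> Y \<noteq> {} \<and> card (N Y) = card Y + 1"
  obtain b Y0 where "?T Y0" using False t by blast
  moreover have "\<forall>Y. ?T Y \<longrightarrow> card Y < Suc (card A)" using fins by (auto simp: less_Suc_eq_le intro: card_mono)
  ultimately have "\<exists>Y. ?T Y \<and> (\<forall>Y'. ?T Y' \<longrightarrow> card Y' \<le> card Y)"
    by (intro Lattices_Big.ex_has_greatest_nat[of ?T Y0 card "Suc (card A)"]) auto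
  then obtain Y where Y: "?T Y" and mx: "\<And>Y'. ?T Y' \<Longrightarrow> card Y' \<le> card Y" by blast
  have "nb G b \<inter> N Y = {}" if b: "b \<in> A - Y" for b
  proof (rule ccontr)
    assume ne: "nb G b \<inter> N Y \<noteq> {}"
    obtain Z where Z: "Z \<subseteq> A" "b \<in> Z" "card (N Z) = card Z + 1" using t b by blast
    have fin: "finite Y" "finite Z" "finite (N Y)" "finite (N Z)"
      using Y Z fins finite_subset[of _ A] finite_UN[of _ "nb G"] by auto
    have N: "card (N (Y \<union> Z)) + card (N Y \<inter> N Z) = card (N Y) + card (N Z)"
      using card_Un_Int[OF fin(3,4)] by (simp add: Un_Union_image UN_Un)
    have c: "card (Y \<union> Z) + card (Y \<inter> Z) = card Y + card Z" using card_Un_Int[OF fin(1,2)] by simp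
    have "card (Y \<inter> Z) + 1 \<le> card (N Y \<inter> N Z)"
    proof (cases "Y \<inter> Z = {}")
      case True
      have "N Y \<inter> N Z \<noteq> {}" using ne Z by blast
      then have "card (N Y \<inter> N Z) \<noteq> 0" using fin by simp
      then show ?thesis using True by simp
    next
      case False
      have "card (Y \<inter> Z) + 1 \<le> card (N (Y \<inter> Z))" by (rule tight(2)) (use False Z in auto)
      also have "\<dots> \<le> card (N Y \<inter> N Z)" by (rule card_mono) (use fin in auto)
      finally show ?thesis .
    qed
    then have "card (N (Y \<union> Z)) \<le> card (Y \<union> Z) + 1" using N c Y Z by linarith
    moreover have "card (Y \<union> Z) + 1 \<le> card (N (Y \<union> Z))" by (rule tight(2)) (use Y Z in auto)
    ultimately have "?T (Y \<union> Z)" using Y Z by auto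
    then have "card (Y \<union> Z) \<le> card Y" by (rule mx)
    moreover have "card Y < card (Y \<union> Z)" by (rule psubset_card_mono) (use fin b Z in auto)
    ultimately show False by simp
  qed
  then have "N (A - Y) \<inter> N Y = {}" by (simp add: Int_UN_distrib2)
  moreover have "N Y \<subseteq> D" using Y nb_A by blast
  ultimately show ?thesis using Y by (intro exI[of _ Y] exI[of _ "N Y"]) simp
qed

text \<open>Since \<open>card D = card A + 2\<close>, the part of \<open>D\<close> outside
  \<open>P\<close> exceeds \<open>A - Y\<close> by one, just as \<open>P\<close> exceeds
  \<open>Y\<close>; these are the two bipartite pieces.\<close>

lemma core6_of_tight:
  assumes "card C = 3" "Y \<subseteq> A" "P \<subseteq> D" "card P = card Y + 1" "N Y \<subseteq> P" "N (A - Y) \<inter> P = {}"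
  shows "core6 G C S0 P Y (D - P) (A - Y)"
  unfolding core6_def
proof (intro conjI ballI)
  have fY: "finite Y" "finite P" using assms fins finite_subset by blast+
  have YS: "Y \<subseteq> S" using assms(2) sub(2) by (rule subset_trans)
  show "verts G = C \<union> S0 \<union> P \<union> Y \<union> (D - P) \<union> (A - Y)" using V_eq sub assms by auto
  show "C \<inter> S0 = {}" "(C \<union> S0) \<inter> (P \<union> Y \<union> (D - P) \<union> (A - Y)) = {}" "P \<inter> Y = {}"
    "(D - P) \<inter> (A - Y) = {}" "(P \<union> Y) \<inter> (D - P \<union> (A - Y)) = {}"
    using disj sub assms YS by auto
  show "card C = 3" "card S0 = 3" "card P = card Y + 1" using assms cardS0 by auto
  have "card (D - P) = card D - card P" "card P \<le> card D"
    using card_Diff_subset[OF fY(2) assms(3)] card_mono[OF fins(3) assms(3)] by auto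
  moreover have "card (A - Y) = card A - card Y" "card Y \<le> card A"
    using card_Diff_subset[OF fY(1) assms(2)] card_mono[OF fins(6) assms(2)] by auto
  ultimately show "card (D - P) = card (A - Y) + 1" using cardA cardD' assms by linarith
  show "nb G x \<subseteq> C \<union> S0" if x: "x \<in> C" for x
  proof
    fix y assume y: "y \<in> nb G x"
    show "y \<in> C \<union> S0"
    proof (cases "y \<in> C")
      case False
      then have "y \<in> S" using nbC[OF x] y by auto
      moreover have "x \<in> nb G y" using y by (simp add: nb_sym)
      ultimately show ?thesis unfolding S0_def using x by auto
    qed simp
  qed
  show "nb G x \<subseteq> C \<union> P \<union> (D - P)" if "x \<in> S0" for x using nb_S[of x] that sub by auto
  show "nb G x \<subseteq> P" if "x \<in> Y" for x using that assms by auto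
  show "nb G x \<subseteq> D - P" if "x \<in> A - Y" for x using that assms nb_A[of x] by auto
  show "nb G x \<subseteq> S0 \<union> Y" if x: "x \<in> P" for x
  proof
    fix y assume y: "y \<in> nb G x"
    then have "y \<in> S" using nb_D[OF subsetD[OF assms(3) x]] by blast
    moreover have "x \<in> nb G y" using y by (simp add: nb_sym)
    ultimately show "y \<in> S0 \<union> Y" using assms(6) x sub(4) by auto
  qed
  show "nb G x \<subseteq> S0 \<union> (A - Y)" if x: "x \<in> D - P" for x
  proof
    fix y assume y: "y \<in> nb G x"
    then have "y \<in> S" "x \<in> nb G y" using nb_D[of x] x by (auto simp: nb_sym)
    then show "y \<in> S0 \<union> (A - Y)" using assms(5) x sub(4) by auto
  qed
qed

text \<open>Undoing the contraction replaces \<open>w\<close> by the bipartite graph on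
  \<open>S\<close> and \<open>D\<close>. Because \<open>card S = card D + 1\<close>, the imbalance
  of the piece is kept when \<open>S\<close> takes the place of \<open>w\<close> in its colour class
  and \<open>D\<close> joins the other one.\<close>

lemma core6_expand:
  assumes w: "w \<in> S" and c6: "core6 (contract G C w) T B P1 Q1 P2 Q2" and w1: "w \<in> P1 \<union> Q1"
  shows "\<exists>P Q. core6 G T B P Q P2 Q2"
proof -
  interpret c: contraction G C w
    by unfold_locales (use C_proper w SC cutC one_C in auto)
  note d = c6[unfolded core6_def c.vertsH]
  have Veq: "insert w C = T \<union> B \<union> P1 \<union> Q1 \<union> P2 \<union> Q2"
    and dj: "T \<inter> B = {}" "(T \<union> B) \<inter> (P1 \<union> Q1 \<union> P2 \<union> Q2) = {}"
     "P1 \<inter> Q1 = {}" "P2 \<inter> Q2 = {}" "(P1 \<union> Q1) \<inter> (P2 \<union> Q2) = {}"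
    and cd: "card T = 3" "card B = 3" "card P1 = card Q1 + 1" "card P2 = card Q2 + 1"
    and nbs: "\<And>x. x \<in> T \<Longrightarrow> nb c.H x \<subseteq> T \<union> B" "\<And>x. x \<in> B \<Longrightarrow> nb c.H x \<subseteq> T \<union> P1 \<union> P2"
     "\<And>x. x \<in> P1 \<Longrightarrow> nb c.H x \<subseteq> B \<union> Q1" "\<And>x. x \<in> Q1 \<Longrightarrow> nb c.H x \<subseteq> P1"
     "\<And>x. x \<in> P2 \<Longrightarrow> nb c.H x \<subseteq> B \<union> Q2" "\<And>x. x \<in> Q2 \<Longrightarrow> nb c.H x \<subseteq> P2"
    using d by simp_all
  have wC: "w \<notin> C" using w SC by auto
  have "finite (insert w C)" using fins by simp
  then have fin: "finite P1" "finite Q1" unfolding Veq by simp_all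
  have CinH: "nb G x \<subseteq> nb c.H x - {w} \<union> (if w \<in> nb c.H x then S else {})" if "x \<in> C" for x
    using nbC[OF that] c.nb_in[OF that] wC by auto
  have SinH: "nb G x \<subseteq> D \<union> nb c.H w" if "x \<in> S" for x
  proof
    fix y assume y: "y \<in> nb G x"
    show "y \<in> D \<union> nb c.H w"
    proof (cases "y \<in> C")
      case True
      have "x \<in> nb G y" using y by (simp add: nb_sym)
      then have "\<not> nb G y \<subseteq> C" using that SC by auto
      then show ?thesis unfolding c.nb_w using True by simp
    next
      case False
      then show ?thesis using nb_S[OF that] y by auto
    qed
  qed
  have wn: "w \<notin> T" "w \<notin> B" "w \<notin> P2" "w \<notin> Q2" using w1 dj by auto
  have CC: "C = T \<union> B \<union> (P1 - {w}) \<union> (Q1 - {w}) \<union> P2 \<union> Q2"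
  proof -
    have "C = insert w C - {w}" using wC by auto
    also have "\<dots> = T \<union> B \<union> (P1 - {w}) \<union> (Q1 - {w}) \<union> P2 \<union> Q2" unfolding Veq using wn by auto
    finally show ?thesis .
  qed
  have SDn: "(S \<union> D) \<inter> (T \<union> B \<union> (P1 - {w}) \<union> (Q1 - {w}) \<union> P2 \<union> Q2) = {}"
    unfolding CC[symmetric] using disj by auto
  have VG: "verts G = T \<union> B \<union> (P1 - {w}) \<union> (Q1 - {w}) \<union> P2 \<union> Q2 \<union> (S \<union> D)"
    unfolding CC[symmetric] using V_eq by auto
  have off: "x \<in> T \<union> B \<union> (P1 - {w}) \<union> (Q1 - {w}) \<union> P2 \<union> Q2 \<Longrightarrow> x \<in> C" for x using CC by simp
  have T: "nb G x \<subseteq> T \<union> B" if "x \<in> T" for x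
    using CinH[OF off, of x] nbs(1)[OF that] that wn by (auto split: if_splits)
  have P2: "nb G x \<subseteq> B \<union> Q2" if "x \<in> P2" for x
    using CinH[OF off, of x] nbs(5)[OF that] that wn by (auto split: if_splits)
  have Q2: "nb G x \<subseteq> P2" if "x \<in> Q2" for x
    using CinH[OF off, of x] nbs(6)[OF that] that wn by (auto split: if_splits)
  show ?thesis
  proof (cases "w \<in> P1")
    case True
    then have "w \<notin> Q1" using dj by auto
    then have q: "Q1 - {w} = Q1" by auto
    let ?P = "(P1 - {w}) \<union> S" and ?Q = "Q1 \<union> D"
    have "core6 G T B ?P ?Q P2 Q2"
      unfolding core6_def
    proof (intro conjI ballI)
      show "verts G = T \<union> B \<union> ?P \<union> ?Q \<union> P2 \<union> Q2" using VG q by auto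
      show "T \<inter> B = {}" "(T \<union> B) \<inter> (?P \<union> ?Q \<union> P2 \<union> Q2) = {}"
        "?P \<inter> ?Q = {}" "P2 \<inter> Q2 = {}" "(?P \<union> ?Q) \<inter> (P2 \<union> Q2) = {}"
        using dj SDn disj q by auto
      have "card ?P = card (P1 - {w}) + card S" by (rule card_Un_disjoint) (use fin fins SDn in auto)
      moreover have "card ?Q = card Q1 + card D" by (rule card_Un_disjoint) (use fin fins SDn q in auto)
      moreover have "card (P1 - {w}) + 1 = card P1" using True fin by (metis card_Suc_Diff1 Suc_eq_plus1)
      ultimately show "card ?P = card ?Q + 1" using cd cardD' by linarith
      show "card T = 3" "card B = 3" "card P2 = card Q2 + 1" using cd by auto
      show "nb G x \<subseteq> T \<union> ?P \<union> P2" if "x \<in> B" for x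
        using CinH[OF off, of x] nbs(2)[OF that] that wn by (auto split: if_splits)
      show "nb G x \<subseteq> B \<union> ?Q" if "x \<in> ?P" for x
      proof (cases "x \<in> S")
        case xS: True
        then show ?thesis using SinH[OF xS] nbs(3)[OF True] by auto
      next
        case False
        then have x: "x \<in> P1" "x \<noteq> w" using that by auto
        then show ?thesis using CinH[OF off, of x] nbs(3)[OF x(1)] \<open>w \<notin> Q1\<close> wn by (auto split: if_splits)
      qed
      show "nb G x \<subseteq> ?P" if "x \<in> ?Q" for x
      proof (cases "x \<in> D")
        case xD: True
        then show ?thesis using nb_D[OF xD] by auto
      next
        case False
        then have x: "x \<in> Q1" "x \<noteq> w" using that \<open>w \<notin> Q1\<close> by auto
        then show ?thesis using CinH[OF off, of x] nbs(4)[OF x(1)] by (auto split: if_splits)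
      qed
    qed (use T P2 Q2 in auto)
    then show ?thesis by blast
  next
    case False
    then have wQ: "w \<in> Q1" using w1 by auto
    have q: "P1 - {w} = P1" using False by auto
    let ?P = "P1 \<union> D" and ?Q = "(Q1 - {w}) \<union> S"
    have "core6 G T B ?P ?Q P2 Q2"
      unfolding core6_def
    proof (intro conjI ballI)
      show "verts G = T \<union> B \<union> ?P \<union> ?Q \<union> P2 \<union> Q2" using VG q by auto
      show "T \<inter> B = {}" "(T \<union> B) \<inter> (?P \<union> ?Q \<union> P2 \<union> Q2) = {}"
        "?P \<inter> ?Q = {}" "P2 \<inter> Q2 = {}" "(?P \<union> ?Q) \<inter> (P2 \<union> Q2) = {}"
        using dj SDn disj q by auto
      have "card ?Q = card (Q1 - {w}) + card S" by (rule card_Un_disjoint) (use fin fins SDn in auto)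
      moreover have "card ?P = card P1 + card D" by (rule card_Un_disjoint) (use fin fins SDn q in auto)
      moreover have "card (Q1 - {w}) + 1 = card Q1" using wQ fin by (metis card_Suc_Diff1 Suc_eq_plus1)
      ultimately show "card ?P = card ?Q + 1" using cd cardD' by linarith
      show "card T = 3" "card B = 3" "card P2 = card Q2 + 1" using cd by auto
      show "nb G x \<subseteq> T \<union> ?P \<union> P2" if "x \<in> B" for x
        using CinH[OF off, of x] nbs(2)[OF that] that wn False by (auto split: if_splits)
      show "nb G x \<subseteq> B \<union> ?Q" if "x \<in> ?P" for x
      proof (cases "x \<in> D")
        case xD: True
        then show ?thesis using nb_D[OF xD] by auto
      next
        case nD: False
        then have x: "x \<in> P1" "x \<noteq> w" using that False by auto
        then show ?thesis using CinH[OF off, of x] nbs(3)[OF x(1)] by (auto split: if_splits)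
      qed
      show "nb G x \<subseteq> ?P" if "x \<in> ?Q" for x
      proof (cases "x \<in> S")
        case xS: True
        then show ?thesis using SinH[OF xS] nbs(4)[OF wQ] by auto
      next
        case nS: False
        then have x: "x \<in> Q1" "x \<noteq> w" using that by auto
        then show ?thesis using CinH[OF off, of x] nbs(4)[OF x(1)] False by (auto split: if_splits)
      qed
    qed (use T P2 Q2 in auto)
    then show ?thesis by blast
  qed
qed

end

section \<open>The induction for 3-connected graphs\<close>

definition six_struct :: "'a graph \<Rightarrow> bool" where
  "six_struct G \<longleftrightarrow> (\<exists>T B P1 Q1 P2 Q2. core6 G T B P1 Q1 P2 Q2)"

lemma edge_conn_mono: "edge_conn k G \<Longrightarrow> l \<le> k \<Longrightarrow> edge_conn l G"
  unfolding edge_conn_def using order_trans by blast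

lemma (in contraction) bip_down:
  assumes "bip_on H P Q" "P \<union> Q = insert w U"
  shows "bip_on G (P - {w}) (Q - {w})"
  unfolding bip_on_def
proof (intro conjI ballI)
  show "(P - {w}) \<inter> (Q - {w}) = {}" using assms unfolding bip_on_def by auto
  show "nb G x \<inter> (P - {w}) = {}" if "x \<in> P - {w}" for x
  proof -
    have "x \<in> U" "P - {w} \<subseteq> U" using that assms(2) by auto
    then have "nb G x \<inter> (P - {w}) \<subseteq> nb H x \<inter> P" using nb_in by auto
    moreover have "nb H x \<inter> P = {}" using assms(1) that unfolding bip_on_def by simp
    ultimately show ?thesis by simp
  qed
  show "nb G x \<inter> (Q - {w}) = {}" if "x \<in> Q - {w}" for x
  proof -
    have "x \<in> U" "Q - {w} \<subseteq> U" using that assms(2) by auto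
    then have "nb G x \<inter> (Q - {w}) \<subseteq> nb H x \<inter> Q" using nb_in by auto
    moreover have "nb H x \<inter> Q = {}" using assms(1) that unfolding bip_on_def by simp
    ultimately show ?thesis by simp
  qed
qed

text \<open>Only the contracted vertex itself can be lost, and it is not counted in the first place
  if it is not nice.\<close>

lemma (in contraction) Upsilon_lift:
  assumes mc: "\<And>x y. x \<in> U \<Longrightarrow> y \<in> nb G x \<Longrightarrow> y \<notin> U \<Longrightarrow> matchable G (verts G - U - {y})"
  shows "Upsilon H \<le> card ({v. nice_vertex G v} \<inter> U) + 1"
    "\<not> nice_vertex H w \<Longrightarrow> Upsilon H \<le> card ({v. nice_vertex G v} \<inter> U)"
proof -
  have sub: "{v. nice_vertex H v} - {w} \<subseteq> {v. nice_vertex G v} \<inter> U"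
  proof
    fix v assume v: "v \<in> {v. nice_vertex H v} - {w}"
    then have "v \<in> U" using H.nice_vertex_iff by auto
    moreover have "nice_vertex G v" by (rule nice_lift) (use \<open>v \<in> U\<close> v mc in auto)
    ultimately show "v \<in> {v. nice_vertex G v} \<inter> U" by simp
  qed
  then have le: "card ({v. nice_vertex H v} - {w}) \<le> card ({v. nice_vertex G v} \<inter> U)"
    by (intro card_mono) auto
  have fin: "finite {v. nice_vertex H v}" using H.nice_sub H.finV finite_subset by blast
  show "Upsilon H \<le> card ({v. nice_vertex G v} \<inter> U) + 1"
    using le fin unfolding Upsilon_def by (simp add: card_Diff_singleton_if split: if_splits)
  show "Upsilon H \<le> card ({v. nice_vertex G v} \<inter> U)" if "\<not> nice_vertex H w"
  proof -
    have "{v. nice_vertex H v} - {w} = {v. nice_vertex H v}" using that by auto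
    then show ?thesis using le unfolding Upsilon_def by simp
  qed
qed

text \<open>Order 4 is \<open>K4\<close> with its four nice vertices. Order 6 arises when all
  vertices are nice; the graph is identified as the prism by \<open>card6_iso_prism\<close>.\<close>

theorem three_conn_Upsilon:
  assumes "simple_graph G" "cubic G" "edge_conn 3 G" "\<not> bipartite G" "card (verts G) \<noteq> 4"
  shows "6 \<le> Upsilon G \<and> (Upsilon G = 6 \<longrightarrow> card (verts G) = 6 \<or> six_struct G)"
  using assms
proof (induction "card (verts G)" arbitrary: G rule: less_induct)
  case less
  interpret cub3 G
    by unfold_locales (use less.prems edge_conn_mono[of 3 G 2] in auto)
  let ?N = "{v. nice_vertex G v}"
  have finN: "finite ?N" using nice_sub finV finite_subset by blast
  show ?case
  proof (cases "verts G \<subseteq> ?N")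
    case True
    then have "?N = verts G" using nice_sub by auto
    then have "Upsilon G = card (verts G)" unfolding Upsilon_def by simp
    moreover have "6 \<le> card (verts G)" using cardV_ge4 evenV less.prems(5) by presburger
    ultimately show ?thesis by simp
  next
    case False
    then obtain u where u: "u \<in> verts G" "\<not> nice_vertex G u" by blast
    obtain Su \<C>u where Su: "odd_family G (verts G) Su \<C>u" "card \<C>u = card Su" "nb G u \<subseteq> Su"
      using nonnice_barrier[OF u] by blast
    \<comment> \<open>The barrier obtained from \<open>u\<close> is enlarged as far as possible,
      because the nonbipartiteness of its nontrivial components comes from maximality.\<close>
    let ?P = "\<lambda>S. Su \<subseteq> S \<and> (\<exists>\<C>. odd_family G (verts G) S \<C> \<and> card \<C> = card S)"
    have "?P Su" using Su by blast
    moreover have "\<forall>S. ?P S \<longrightarrow> card S < Suc (card (verts G))"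
      using odd_familyD(1) by (metis card_mono finV less_Suc_eq_le)
    ultimately have "\<exists>S. ?P S \<and> (\<forall>S'. ?P S' \<longrightarrow> card S' \<le> card S)"
      by (rule Lattices_Big.ex_has_greatest_nat)
    then obtain S \<C> where o: "odd_family G (verts G) S \<C>" and cd: "card \<C> = card S" and SuS: "Su \<subseteq> S"
      and mx0: "\<And>S'. ?P S' \<Longrightarrow> card S' \<le> card S" by blast
    have mx: "card S' \<le> card S" if "odd_family G (verts G) S' \<C>'" "card \<C>' = card S'" "S \<subseteq> S'" for S' \<C>'
      using mx0[of S'] that SuS by blast
    note od = odd_familyD[OF o] and f = odd_family_finite[OF o subset_refl]
    have cS: "3 \<le> card S"
    proof -
      have "card (nb G u) \<le> card S" using Su(3) SuS f(2) by (intro card_mono) auto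
      then show ?thesis using nb_card u by simp
    qed
    then have S0: "S \<noteq> {}" by auto
    note bp = barrier_props[OF o cd S0]
    have indep: "nb G x \<inter> S = {}" if "x \<in> S" for x
    proof -
      have "\<forall>x\<in>S. nb G x \<inter> S = {}" by (rule iffD1[OF ec_0_iff[OF f(2)] bp(2)])
      then show ?thesis using that by blast
    qed
    have single: "nb G x \<subseteq> S" if x: "x \<in> X" and X: "X \<in> \<C>" "card X = 1" for x X
    proof -
      have "X = {x}" using x X(2) by (auto simp: card_1_singleton_iff)
      then have "nb G x \<subseteq> {x} \<union> S" using od(6)[OF X(1) x] by simp
      then show ?thesis using nb_irrefl by blast
    qed
    \<comment> \<open>With trivial components only, \<open>S\<close> would be a colour class of
      \<open>G\<close>.\<close>
    have "\<exists>C\<in>\<C>. card C \<noteq> 1"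
    proof (rule ccontr)
      assume no: "\<not> ?thesis"
      have "bip_on G S (verts G - S)"
        unfolding bip_on_def
      proof (intro conjI ballI)
        show "nb G x \<inter> (verts G - S) = {}" if x: "x \<in> verts G - S" for x
        proof -
          obtain X where X: "X \<in> \<C>" "x \<in> X" using bp(3) x by blast
          then have "nb G x \<subseteq> S" using no by (intro single[of x X]) auto
          then show ?thesis by auto
        qed
      qed (use indep in auto)
      moreover have "S \<union> (verts G - S) = verts G" using od(1) by auto
      ultimately show False using less.prems(4) bipartite_iff by blast
    qed
    then obtain C where C: "C \<in> \<C>" "card C \<noteq> 1" by blast
    have nbip: "\<not> bip_on G P Q" if "X \<in> \<C>" "card X \<noteq> 1" "X = P \<union> Q" for X P Q
      by (rule maximal_barrier_nonbip[OF o cd S0 _ that]) (rule mx)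
    have big: "3 \<le> card X" if "X \<in> \<C>" "card X \<noteq> 1" for X
      using od(5)[OF that(1)] that(2) by presburger
    have CV: "C \<subseteq> verts G" "S \<inter> C = {}" using od(4)[OF C(1)] by auto
    have cutC: "cut G C = 3" by (rule bp(1)[OF C(1)])
    have finC: "finite C" using f(3)[OF C(1)] .
    have cC: "3 \<le> card C" using big C by blast
    have cSC: "card S \<le> card (verts G - C)"
      by (rule card_mono) (use od(1) CV in auto)
    have cVC: "card (verts G) = card C + card (verts G - C)"
      using CV(1) finC card_mono[OF finV CV(1)] by (simp add: card_Diff_subset)
    have CneV: "C \<noteq> verts G" using od(1) CV S0 by auto
    obtain w where w: "w \<in> S" using S0 by blast
    have wC: "w \<notin> C" using w CV by auto
    have oneC: "card (nb G x - C) \<le> 1" if "x \<in> C" for x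
      using one_out[OF CV(1) cutC _ that] cC by simp
    interpret c: contraction G C w
      by unfold_locales (use CV CneV wC cutC oneC in auto)
    have mcC: "matchable G (verts G - C - {y})" if "x \<in> C" "y \<in> nb G x" "y \<notin> C" for x y
      by (rule barrier_matchable_split(2)[OF o cd C(1) that])
    have cH: "card (verts c.H) = card C + 1" using wC finC by simp
    have nbipH: "\<not> bipartite c.H"
    proof
      assume "bipartite c.H"
      then obtain P Q where PQ: "P \<union> Q = insert w C" "bip_on c.H P Q" using c.H.bipartite_iff by auto
      have "C = (P - {w}) \<union> (Q - {w})" using PQ(1) wC by auto
      then show False using nbip[OF C] c.bip_down[OF PQ(2,1)] by blast
    qed
    \<comment> \<open>For a triangle the contracted graph is \<open>K4\<close>, which the induction
      hypothesis excludes; it contributes through \<open>U4\<close> below.\<close>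
    have IH: "card C = 3 \<or> 6 \<le> Upsilon c.H \<and> (Upsilon c.H = 6 \<longrightarrow> card (verts c.H) = 6 \<or> six_struct c.H)"
    proof (cases "card C = 3")
      case False
      have "6 \<le> Upsilon c.H \<and> (Upsilon c.H = 6 \<longrightarrow> card (verts c.H) = 6 \<or> six_struct c.H)"
      proof (rule less.hyps)
        show "card (verts c.H) < card (verts G)" using cH cVC cSC cS by linarith
        show "simple_graph c.H" by (rule c.simpleH)
        show "cubic c.H" by (rule c.cubicH)
        show "edge_conn 3 c.H" by (rule c.edge_connH[OF conn3])
        show "\<not> bipartite c.H" by (rule nbipH)
        show "card (verts c.H) \<noteq> 4" using cH False by simp
      qed
      then show ?thesis by simp
    qed simp
    have U4: "card C = 3 \<Longrightarrow> Upsilon c.H = 4" using c.H.card4_Upsilon cH by simp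
    \<comment> \<open>All nice vertices of the contracted graph other than \<open>w\<close> count: 4
      - 1 for a triangle, 6 - 1 otherwise.\<close>
    have UC: "3 \<le> card (?N \<inter> C)" "card C \<noteq> 3 \<Longrightarrow> 5 \<le> card (?N \<inter> C)"
  proof -
      have "Upsilon c.H \<le> card (?N \<inter> C) + 1" by (rule c.Upsilon_lift(1)) (rule mcC)
      then show "3 \<le> card (?N \<inter> C)" "card C \<noteq> 3 \<Longrightarrow> 5 \<le> card (?N \<inter> C)"
        using IH U4 by linarith+
    qed
    have Ueq: "Upsilon G = card (?N \<inter> C) + card (?N - C)" by (rule Upsilon_split[OF CV(1)])
    show ?thesis
    proof (cases "\<exists>C'\<in>\<C>. C' \<noteq> C \<and> card C' \<noteq> 1")
      case True
      then obtain C' where C': "C' \<in> \<C>" "C' \<noteq> C" "card C' \<noteq> 1" by blast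
      have dis: "C' \<inter> C = {}" using pairwiseD[OF od(2) C'(1) C(1) C'(2)] by (simp add: disjnt_def)
      have C'V: "C' \<subseteq> verts G - C" "S \<inter> C' = {}" using od(4)[OF C'(1)] dis by auto
      obtain w2 where w2: "w2 \<in> C" using cC by fastforce
      \<comment> \<open>The roles are exchanged: contracting \<open>C\<close> keeps the second
        nontrivial component and hence a nonbipartite graph of order above 4. This yields 5 nice
        vertices outside \<open>C\<close>, so at least 3 + 5 in all.\<close>
      let ?U = "verts G - C"
      have cutU: "cut G ?U = 3" using cut_compl[OF CV(1)] cutC by simp
      have cU: "6 \<le> card ?U"
      proof -
        have "card (S \<union> C') \<le> card ?U" by (rule card_mono) (use od(1) CV C'V in auto)
        moreover have "card (S \<union> C') = card S + card C'"
          by (rule card_Un_disjoint) (use f C' C'V in auto)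
        ultimately show ?thesis using cS big[OF C'(1,3)] by linarith
      qed
      have oneU: "card (nb G x - ?U) \<le> 1" if "x \<in> ?U" for x
        using one_out[OF _ cutU _ that] cU by auto
      interpret d: contraction G ?U w2
        by unfold_locales (use CV w2 cutU oneU in auto)
      have cH2: "card (verts d.H) = card ?U + 1" using w2 by simp
      have nb2: "\<not> bipartite d.H"
      proof
        assume "bipartite d.H"
        then obtain P Q where PQ: "P \<union> Q = insert w2 ?U" "bip_on d.H P Q" using d.H.bipartite_iff by auto
        have b: "bip_on G (P - {w2}) (Q - {w2})" by (rule d.bip_down[OF PQ(2,1)])
        have "C' = (C' \<inter> (P - {w2})) \<union> (C' \<inter> (Q - {w2}))" using PQ(1) C'V w2 by auto
        moreover have "bip_on G (C' \<inter> (P - {w2})) (C' \<inter> (Q - {w2}))" by (rule bip_on_mono[OF b]) auto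
        ultimately show False using nbip[OF C'(1,3)] by blast
      qed
      have "6 \<le> Upsilon d.H \<and> (Upsilon d.H = 6 \<longrightarrow> card (verts d.H) = 6 \<or> six_struct d.H)"
      proof (rule less.hyps)
        show "card (verts d.H) < card (verts G)" using cH2 cVC cC by linarith
        show "simple_graph d.H" by (rule d.simpleH)
        show "cubic d.H" by (rule d.cubicH)
        show "edge_conn 3 d.H" by (rule d.edge_connH[OF conn3])
        show "\<not> bipartite d.H" by (rule nb2)
        show "card (verts d.H) \<noteq> 4" using cH2 cU by simp
      qed
      moreover have "Upsilon d.H \<le> card (?N \<inter> ?U) + 1"
      proof (rule d.Upsilon_lift(1))
        fix x y assume xy: "x \<in> ?U" "y \<in> nb G x" "y \<notin> ?U"
        then have "y \<in> C" "x \<in> nb G y" "x \<notin> C" using nb_verts by (auto simp: nb_sym[of x])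
        then have "matchable G (C - {y})" by (rule barrier_matchable_split(1)[OF o cd C(1)])
        moreover have "verts G - ?U = C" using CV by auto
        ultimately show "matchable G (verts G - ?U - {y})" by simp
      qed
      moreover have "?N \<inter> ?U = ?N - C" using nice_sub by auto
      ultimately have "5 \<le> card (?N - C)" by simp
      then show ?thesis using Ueq UC by linarith
    next
      case nt: False
      interpret oc: one_comp G S C
      proof
        show "S \<subseteq> verts G" "C \<subseteq> verts G" "S \<inter> C = {}" using od(1) CV by auto
        show "nb G x \<inter> S = {}" if "x \<in> S" for x by (rule indep[OF that])
        show "nb G x \<subseteq> S" if x: "x \<in> verts G - S - C" for x
        proof -
          obtain X where "X \<in> \<C>" "x \<in> X" using bp(3) x by blast
          then show ?thesis using nt x by (intro single[of x X]) auto
        qed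
        show "nb G x \<subseteq> C \<union> S" if "x \<in> C" for x using od(6)[OF C(1) that] by simp
        show "cut G C = 3" "2 \<le> card C" "3 \<le> card S" using cutC cC cS by auto
        have "verts G - S - C = \<Union>(\<C> - {C})"
        proof -
          have "X \<inter> C = {}" if "X \<in> \<C> - {C}" for X
            using pairwiseD[OF od(2), of X C] that C(1) by (simp add: disjnt_def)
          then have "\<Union>(\<C> - {C}) \<inter> C = {}" by auto
          moreover have "\<Union>\<C> = \<Union>(\<C> - {C}) \<union> C" using C(1) by auto
          moreover have "verts G - S = \<Union>\<C>" using bp(3) od(3) by auto
          ultimately show ?thesis by auto
        qed
        also have "card \<dots> = (\<Sum>X\<in>\<C> - {C}. card X)"
        proof (rule card_Union_disjoint)
          show "disjoint (\<C> - {C})" using od(2) by (rule pairwise_subset) auto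
        qed (use f in auto)
        also have "\<dots> = (\<Sum>X\<in>\<C> - {C}. 1)" by (rule sum.cong) (use nt in auto)
        finally have "card (verts G - S - C) = card (\<C> - {C})" by simp
        moreover have "card (\<C> - {C}) + 1 = card \<C>" using C(1) f(1) by (metis card_Suc_Diff1 Suc_eq_plus1)
        ultimately show "card (verts G - S - C) + 1 = card S" using cd by simp
      qed
      show ?thesis
      \<comment> \<open>The neighbours of \<open>w\<close> in the contracted graph are exactly
        \<open>C0\<close>, so this asks whether \<open>w\<close> is nice there.\<close>
      proof (cases "matchable G (C - oc.C0)")
        case True
        have S0N: "oc.S0 \<subseteq> ?N - C" using oc.S0_nice[OF True] oc.sub oc.disj by auto
        have le: "card oc.S0 \<le> card (?N - C)" by (rule card_mono) (use finN S0N in auto)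
        then have ge: "6 \<le> Upsilon G" using Ueq UC(1) oc.cardS0 by linarith
        moreover have "six_struct G" if U6: "Upsilon G = 6"
        proof -
          \<comment> \<open>Otherwise the total would be at least 5 + 3.\<close>
          have C3: "card C = 3" using U6 Ueq UC(2) le oc.cardS0 by linarith
          have "card (?N - C) = card oc.S0" using U6 Ueq UC(1) le oc.cardS0 by linarith
          then have eq: "?N - C = oc.S0" using S0N finN by (metis card_subset_eq finite_Diff)
          have nonnice: "\<not> nice_vertex G b" if "b \<in> oc.A" for b
          proof
            assume "nice_vertex G b"
            then have "b \<in> ?N - C" using that oc.sub oc.disj by auto
            then show False using eq that oc.sub by auto
          qed
          obtain Y P where "Y \<subseteq> oc.A" "P \<subseteq> oc.D" "card P = card Y + 1" "oc.N Y \<subseteq> P" "oc.N (oc.A - Y) \<inter> P = {}"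
            using oc.uncross oc.A_nonnice_tight[OF True _ nonnice] by metis
          then show ?thesis using oc.core6_of_tight[OF C3] unfolding six_struct_def by blast
        qed
        ultimately show ?thesis by blast
      next
        case False
        have nw: "\<not> nice_vertex c.H w"
        proof
          assume "nice_vertex c.H w"
          then have "matchable c.H (insert w C - insert w (nb c.H w))" using c.H.nice_vertex_iff by simp
          moreover have "insert w C - insert w (nb c.H w) = C - oc.C0"
            unfolding c.nb_w oc.C0_def using wC by auto
          ultimately have "matchable G (C - oc.C0)" using c.matchable_H_U by auto
          then show False using False by simp
        qed
        have "card C \<noteq> 3" using nw c.H.card4_all_nice[of w] cH by auto
        then have I: "6 \<le> Upsilon c.H" "Upsilon c.H = 6 \<longrightarrow> card (verts c.H) = 6 \<or> six_struct c.H"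
          using IH by auto
        have le: "Upsilon c.H \<le> card (?N \<inter> C)" by (rule c.Upsilon_lift(2)[OF _ nw]) (rule mcC)
        have ge: "6 \<le> Upsilon G" using le I(1) Ueq by linarith
        moreover have "six_struct G" if U6: "Upsilon G = 6"
        proof -
          have H6: "Upsilon c.H = 6" using U6 le I(1) Ueq by linarith
          \<comment> \<open>Six nice vertices in a graph of order 6 would include
            \<open>w\<close>.\<close>
          have "card (verts c.H) \<noteq> 6"
          proof
            assume "card (verts c.H) = 6"
            then have "card {v. nice_vertex c.H v} = card (verts c.H)" using H6 unfolding Upsilon_def by simp
            then have "{v. nice_vertex c.H v} = verts c.H" using c.H.nice_sub c.H.finV by (metis card_subset_eq)
            then show False using nw by auto
          qed
          then obtain T B P1 Q1 P2 Q2 where c6: "core6 c.H T B P1 Q1 P2 Q2"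
            using I(2) H6 unfolding six_struct_def by blast
          note sb = c.H.core6_nice_sub[OF c6]
          have "finite (T \<union> B)" by (rule card_ge_0_finite) (use sb(2) in simp)
          then have "{v. nice_vertex c.H v} = T \<union> B"
            using sb H6 unfolding Upsilon_def by (metis card_subset_eq)
          then have "w \<notin> T \<union> B" using nw by auto
          moreover have "w \<in> T \<union> B \<union> P1 \<union> Q1 \<union> P2 \<union> Q2" using c6 unfolding core6_def by auto
          ultimately consider "w \<in> P1 \<union> Q1" | "w \<in> P2 \<union> Q2" by blast
          then show ?thesis
          proof cases
            case 1
            then show ?thesis using oc.core6_expand[OF w c6] unfolding six_struct_def by blast
          next
            case 2
            then show ?thesis using oc.core6_expand[OF w core6_sym[OF c6]] unfolding six_struct_def by blast
          qed
        qed
        ultimately show ?thesis by blast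
      qed
    qed
  qed
qed

section \<open>Two-edge cuts\<close>

text \<open>The edge \<open>ab\<close> stands for the removed part of the graph. When
  \<open>a\<close> and \<open>b\<close> are nonadjacent and each loses one neighbour, all degrees
  are kept.\<close>

definition reduce :: "'a graph \<Rightarrow> 'a set \<Rightarrow> 'a \<Rightarrow> 'a \<Rightarrow> 'a graph" where
  "reduce G Y a b = Graph Y (insert {a, b} {e \<in> edges G. e \<subseteq> Y})"

definition bip_set :: "'a graph \<Rightarrow> 'a set \<Rightarrow> bool" where
  "bip_set G X \<longleftrightarrow> (\<exists>P Q. P \<union> Q = X \<and> bip_on G P Q)"

text \<open>A vertex with label \<open>(x, y)\<close> belongs to the gadget that replaces the edge \<open>xy\<close> of \<open>K\<^sub>4\<close>, and to
  the colour class of the gadget that contains the neighbour of \<open>x\<close>.\<close>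

definition k4like :: "'a graph \<Rightarrow> 'a set \<Rightarrow> ('a \<Rightarrow> 'a \<times> 'a) \<Rightarrow> bool" where
  "k4like G K l \<longleftrightarrow> K \<subseteq> verts G \<and> card K = 4 \<and>
     (\<forall>v\<in>verts G - K. fst (l v) \<in> K \<and> snd (l v) \<in> K \<and> fst (l v) \<noteq> snd (l v)) \<and>
     (\<forall>u\<in>verts G - K. \<forall>v\<in>nb G u. v = fst (l u) \<or> v \<notin> K \<and> l v = prod.swap (l u)) \<and>
     (\<forall>p. card {v \<in> verts G - K. l v = p} = card {v \<in> verts G - K. l v = prod.swap p})"

text \<open>\<open>k4like\<close> does not demand that any two corners be joined by an edge or by a
  gadget; rebuilding \<open>G\<close> from \<open>K4\<close> relies on this.\<close>

definition k4full :: "'a graph \<Rightarrow> 'a set \<Rightarrow> ('a \<Rightarrow> 'a \<times> 'a) \<Rightarrow> bool" where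
  "k4full G K l \<longleftrightarrow> (\<forall>x\<in>K. \<forall>y\<in>K. x \<noteq> y \<longrightarrow> y \<in> nb G x \<or> (\<exists>v\<in>verts G - K. l v = (x, y)))"

text \<open>The corner \<open>x\<close> together with the class \<open>Q\<close> labelled
  \<open>(y, x)\<close> isolates the points of the class \<open>P\<close> labelled
  \<open>(x, y)\<close>. As the two classes have equal size, the barrier is completed by one odd
  remainder.\<close>

lemma (in cub) k4like_nonnice:
  assumes k: "k4like G K l" and v: "v \<in> verts G - K"
  shows "\<not> nice_vertex G v"
proof -
  obtain x y where l: "l v = (x, y)" by fastforce
  have K: "K \<subseteq> verts G" and lK: "\<And>v. v \<in> verts G - K \<Longrightarrow> fst (l v) \<in> K \<and> snd (l v) \<in> K \<and> fst (l v) \<noteq> snd (l v)"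
    and ln: "\<And>u v. u \<in> verts G - K \<Longrightarrow> v \<in> nb G u \<Longrightarrow> v = fst (l u) \<or> v \<notin> K \<and> l v = prod.swap (l u)"
    and lc: "\<And>p. card {v \<in> verts G - K. l v = p} = card {v \<in> verts G - K. l v = prod.swap p}"
    using k unfolding k4like_def by blast+
  have xy: "x \<in> K" "y \<in> K" "x \<noteq> y" using lK[OF v] l by auto
  define P where "P = {u \<in> verts G - K. l u = (x, y)}"
  define Q where "Q = {u \<in> verts G - K. l u = (y, x)}"
  have PQ: "card P = card Q" "P \<inter> Q = {}" "P \<subseteq> verts G" "Q \<subseteq> verts G" "x \<notin> P" "x \<notin> Q" "finite P" "finite Q"
    using lc[of "(x,y)"] xy unfolding P_def Q_def by auto
  let ?S = "insert x Q" and ?R = "verts G - P - insert x Q"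
  have nP: "nb G u \<subseteq> ?S" if "u \<in> P" for u
    using ln[of u] that nb_verts[of _ u] unfolding P_def Q_def by auto
  have "card ?S = card Q + 1" using PQ by simp
  moreover have "card (P \<union> ?S) = card P + card ?S" by (rule card_Un_disjoint) (use PQ in auto)
  moreover have "card ?R + card (P \<union> ?S) = card (verts G)"
  proof -
    have "P \<union> ?S \<subseteq> verts G" using PQ xy K by auto
    moreover have "?R = verts G - (P \<union> ?S)" by auto
    ultimately show ?thesis using card_Diff_subset[of "P \<union> ?S" "verts G"] card_mono[of "verts G" "P \<union> ?S"] PQ
      by (simp only: finV finite_Un finite_insert simp_thms le_add_diff_inverse2)
  qed
  ultimately have "odd (card ?R)" using evenV PQ(1) by presburger
  have 1: "odd_family G (verts G) ?S (insert ?R ((\<lambda>x. {x}) ` P))" "card (insert ?R ((\<lambda>x. {x}) ` P)) = card P + 1"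
  proof -
    have a: "?S \<subseteq> verts G" "P \<subseteq> verts G" "?R \<subseteq> verts G" "P \<inter> ?S = {}" "?R \<inter> ?S = {}" "?R \<inter> P = {}"
      using PQ xy K by auto
    have e: "nb G r \<subseteq> ?R \<union> ?S" if "r \<in> ?R" for r
    proof
      fix u assume u: "u \<in> nb G r"
      have "u \<notin> P"
      proof
        assume "u \<in> P"
        then have "r \<in> ?S" using nP[of u] u by (auto simp: nb_sym[of u])
        then show False using that by auto
      qed
      then show "u \<in> ?R \<union> ?S" using u nb_verts by blast
    qed
    show "odd_family G (verts G) ?S (insert ?R ((\<lambda>x. {x}) ` P))" "card (insert ?R ((\<lambda>x. {x}) ` P)) = card P + 1"
      using odd_family_singles[OF a \<open>odd (card ?R)\<close> nP e] by simp_all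
  qed
  have vP: "v \<in> P" using v l unfolding P_def by simp
  show ?thesis
  proof (rule barrier_nonnice[OF 1(1)])
    show "card ?S \<le> card (insert ?R ((\<lambda>x. {x}) ` P))" using 1(2) PQ by simp
  qed (use nP vP in auto)
qed

lemma (in cub) k4like_Upsilon:
  assumes k: "k4like G K l" shows "Upsilon G \<le> 4"
proof -
  have "{v. nice_vertex G v} \<subseteq> K" using k4like_nonnice[OF k] nice_sub by blast
  moreover have "finite K" "card K = 4" using k unfolding k4like_def by (auto intro: card_ge_0_finite)
  ultimately show ?thesis unfolding Upsilon_def using card_mono by metis
qed

section \<open>The two sides of a 2-edge cut\<close>

locale two_cut0 = cub +
  fixes Y y1 w1 y2 w2
  assumes YV: "Y \<subseteq> verts G" and y: "y1 \<in> Y" "y2 \<in> Y" "y1 \<noteq> y2"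
    and w: "w1 \<notin> Y" "w2 \<notin> Y" "w1 \<noteq> w2" and e1: "w1 \<in> nb G y1" and e2: "w2 \<in> nb G y2"
    and out: "\<And>x z. x \<in> Y \<Longrightarrow> z \<in> nb G x \<Longrightarrow> z \<notin> Y \<Longrightarrow> x = y1 \<and> z = w1 \<or> x = y2 \<and> z = w2"
begin

lemma finY [simp]: "finite Y"
  using YV finite_sub by blast

lemma wV: "w1 \<in> verts G - Y" "w2 \<in> verts G - Y"
  using w e1 e2 nb_verts by auto

lemma swap: "two_cut0 G Y y2 w2 y1 w1"
  by unfold_locales (use YV y w e1 e2 out in blast)+

lemma compl: "two_cut0 G (verts G - Y) w1 y1 w2 y2"
proof unfold_locales
  fix x z assume x: "x \<in> verts G - Y" "z \<in> nb G x" "z \<notin> verts G - Y"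
  then have "z \<in> Y" "x \<in> nb G z" using nb_verts by (auto simp: nb_sym[of x])
  then show "x = w1 \<and> z = y1 \<or> x = w2 \<and> z = y2" using out[of z x] x by auto
qed (use YV y w wV iffD1[OF nb_sym e1] iffD1[OF nb_sym e2] in auto)

lemma out_card: "x \<in> Y \<Longrightarrow> card (nb G x - Y) = (if x = y1 \<or> x = y2 then 1 else 0)"
proof -
  assume x: "x \<in> Y"
  have "nb G x - Y = (if x = y1 then {w1} else if x = y2 then {w2} else {})"
    using out[OF x] e1 e2 w y x by auto
  then show ?thesis by simp
qed

text \<open>Edges between the classes number \<open>3 * card P\<close>, and also
  \<open>3 * card Q\<close>, each diminished by the cut ends in that class. Both ends in the same
  class would make two multiples of 3 differ by 2.\<close>

lemma opposite:
  assumes bp: "bip_on G P Q" "P \<union> Q = Y"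
  shows "y1 \<in> P \<longleftrightarrow> y2 \<in> Q" "card P = card Q"
proof -
  have PQ: "P \<inter> Q = {}" "P \<subseteq> verts G" "Q \<subseteq> verts G" "finite P" "finite Q"
    using bp YV finite_sub unfolding bip_on_def by auto
  have cnt: "3 * card P = ec G P Q + card (P \<inter> {y1, y2})"
    if bp: "bip_on G P Q" "P \<union> Q = Y" and f: "finite P" "P \<subseteq> verts G" for P Q
  proof -
    have "ec G P (verts G) = ec G P (Q \<union> (verts G - Y))"
    proof (rule ec_cong_right)
      fix x assume "x \<in> P"
      then have "nb G x \<inter> P = {}" using bp unfolding bip_on_def by auto
      then show "nb G x \<inter> verts G = nb G x \<inter> (Q \<union> (verts G - Y))" using bp(2) nb_sub[of x] by auto
    qed
    also have "\<dots> = ec G P Q + ec G P (verts G - Y)" by (rule ec_Un2) (use bp in auto)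
    also have "ec G P (verts G - Y) = (\<Sum>x\<in>P. if x = y1 \<or> x = y2 then 1 else 0)"
      unfolding ec_def
    proof (rule sum.cong[OF refl])
      fix x assume "x \<in> P"
      then have "x \<in> Y" using bp(2) by auto
      then show "card (nb G x \<inter> (verts G - Y)) = (if x = y1 \<or> x = y2 then 1 else 0)" using out_card by simp
    qed
    also have "\<dots> = card (P \<inter> {y1, y2})"
    proof -
      have "P \<inter> {y1, y2} = {x \<in> P. x = y1 \<or> x = y2}" by auto
      then show ?thesis unfolding card_eq_sum by (simp only: sum.inter_filter[OF f(1)])
    qed
    finally show ?thesis using ec_V[OF f(2)] by simp
  qed
  have 1: "3 * card P = ec G P Q + card (P \<inter> {y1, y2})" by (rule cnt[OF bp PQ(4,2)])
  have "3 * card Q = ec G Q P + card (Q \<inter> {y1, y2})"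
    by (rule cnt) (use iffD1[OF bip_on_commute bp(1)] bp(2) PQ in auto)
  then have 2: "3 * card Q = ec G P Q + card (Q \<inter> {y1, y2})" using ec_sym[of P Q] PQ by simp
  consider "y1 \<in> P" "y1 \<notin> Q" "y2 \<in> P" "y2 \<notin> Q" | "y1 \<in> P" "y1 \<notin> Q" "y2 \<in> Q" "y2 \<notin> P"
    | "y1 \<in> Q" "y1 \<notin> P" "y2 \<in> P" "y2 \<notin> Q" | "y1 \<in> Q" "y1 \<notin> P" "y2 \<in> Q" "y2 \<notin> P"
    using y bp(2) PQ(1) by blast
  then have "(y1 \<in> P \<longleftrightarrow> y2 \<in> Q) \<and> card P = card Q"
  proof cases
    case 1
    then have "P \<inter> {y1,y2} = {y1,y2}" "Q \<inter> {y1,y2} = {}" by auto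
    then have "3 * card P = ec G P Q + 2" "3 * card Q = ec G P Q" using \<open>3 * card P = _\<close> 2 y(3) by auto
    then show ?thesis by presburger
  next
    case 2
    then have "P \<inter> {y1,y2} = {y1}" "Q \<inter> {y1,y2} = {y2}" by auto
    then show ?thesis using \<open>3 * card P = _\<close> \<open>3 * card Q = ec G P Q + _\<close> 2 by auto
  next
    case 3
    then have "P \<inter> {y1,y2} = {y2}" "Q \<inter> {y1,y2} = {y1}" by auto
    then show ?thesis using \<open>3 * card P = _\<close> 2 3 by auto
  next
    case 4
    then have "Q \<inter> {y1,y2} = {y1,y2}" "P \<inter> {y1,y2} = {}" by auto
    then have "3 * card Q = ec G P Q + 2" "3 * card P = ec G P Q" using \<open>3 * card P = _\<close> 2 y(3) by auto
    then show ?thesis by presburger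
  qed
  then show "y1 \<in> P \<longleftrightarrow> y2 \<in> Q" "card P = card Q" by auto
qed

lemma combine_aux:
  assumes "bip_on G P Q" "P \<union> Q = Y" "bip_on G P' Q'" "(P' \<union> Q') \<inter> Y = {}"
    and "y1 \<in> P" "y2 \<in> Q" "w1 \<in> Q'" "w2 \<in> P'"
  shows "bip_on G (P \<union> P') (Q \<union> Q')"
proof -
  have no: "z \<notin> nb G x \<and> x \<notin> nb G z" if "x \<in> P \<and> z \<in> P' \<or> x \<in> Q \<and> z \<in> Q'" for x z
  proof -
    have d: "P \<inter> Q = {}" "P' \<inter> Q' = {}" using assms unfolding bip_on_def by auto
    have "x \<in> Y" "z \<notin> Y" using that assms by auto
    then have "z \<in> nb G x \<longrightarrow> x = y1 \<and> z = w1 \<or> x = y2 \<and> z = w2" using out by blast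
    then have "z \<notin> nb G x" using that d assms(5-8) by blast
    then show ?thesis by (simp add: nb_sym[of x])
  qed
  have b: "P \<inter> Q = {}" "\<forall>x\<in>P. nb G x \<inter> P = {}" "\<forall>x\<in>Q. nb G x \<inter> Q = {}"
    "P' \<inter> Q' = {}" "\<forall>x\<in>P'. nb G x \<inter> P' = {}" "\<forall>x\<in>Q'. nb G x \<inter> Q' = {}"
    using assms(1,3) unfolding bip_on_def by simp_all
  show ?thesis
    unfolding bip_on_def
  proof (intro conjI ballI)
    show "(P \<union> P') \<inter> (Q \<union> Q') = {}" using b assms by auto
    have "nb G x \<inter> P' = {}" if "x \<in> P" for x using no[of x] that by blast
    moreover have "nb G x \<inter> P = {}" if "x \<in> P'" for x using no[of _ x] that by blast
    ultimately show "nb G x \<inter> (P \<union> P') = {}" if x: "x \<in> P \<union> P'" for x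
      using x b(2,5) unfolding Int_Un_distrib by blast
    have "nb G x \<inter> Q' = {}" if "x \<in> Q" for x using no[of x] that by blast
    moreover have "nb G x \<inter> Q = {}" if "x \<in> Q'" for x using no[of _ x] that by blast
    ultimately show "nb G x \<inter> (Q \<union> Q') = {}" if x: "x \<in> Q \<union> Q'" for x
      using x b(3,6) unfolding Int_Un_distrib by blast
  qed
qed

text \<open>By \<open>opposite\<close> the ends in \<open>Y\<close> have different colours, and so
  have \<open>w1\<close> and \<open>w2\<close>; one of the two ways of putting the colourings
  together is therefore proper on both cut edges.\<close>

lemma combine:
  assumes bp: "bip_on G P Q" "P \<union> Q = Y" and bp': "bip_on G P' Q'" "(P' \<union> Q') \<inter> Y = {}"
    and ww: "w1 \<in> P' \<and> w2 \<in> Q' \<or> w1 \<in> Q' \<and> w2 \<in> P'"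
  shows "bip_set G (Y \<union> (P' \<union> Q'))"
proof -
  have c: "bip_on G Q P" "Q \<union> P = Y" "bip_on G Q' P'" "(Q' \<union> P') \<inter> Y = {}"
    using assms bip_on_commute by (auto simp: Un_commute)
  have yy: "y1 \<in> P \<and> y2 \<in> Q \<or> y1 \<in> Q \<and> y2 \<in> P"
    using opposite(1)[OF bp] y bp(2) by blast
  have "bip_on G (P \<union> P') (Q \<union> Q') \<or> bip_on G (P \<union> Q') (Q \<union> P') \<or>
     bip_on G (Q \<union> P') (P \<union> Q') \<or> bip_on G (Q \<union> Q') (P \<union> P')"
    using yy ww combine_aux[OF bp bp'] combine_aux[OF bp c(3,4)] combine_aux[OF c(1,2) bp'] combine_aux[OF c]
    by blast
  moreover have "(P \<union> P') \<union> (Q \<union> Q') = Y \<union> (P' \<union> Q')" "(P \<union> Q') \<union> (Q \<union> P') = Y \<union> (P' \<union> Q')"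
    "(Q \<union> P') \<union> (P \<union> Q') = Y \<union> (P' \<union> Q')" "(Q \<union> Q') \<union> (P \<union> P') = Y \<union> (P' \<union> Q')" using bp(2) by auto
  ultimately show ?thesis unfolding bip_set_def by metis
qed

lemma bip_set_V:
  assumes "bip_set G Y" "bip_set G (verts G - Y)" shows "bipartite G"
proof -
  obtain P Q where PQ: "P \<union> Q = Y" "bip_on G P Q" using assms bip_set_def by metis
  obtain P' Q' where PQ': "P' \<union> Q' = verts G - Y" "bip_on G P' Q'" using assms bip_set_def by metis
  interpret c: two_cut0 G "verts G - Y" w1 y1 w2 y2 by (rule compl)
  have "w1 \<in> P' \<and> w2 \<in> Q' \<or> w1 \<in> Q' \<and> w2 \<in> P'"
    using c.opposite(1)[OF PQ'(2,1)] wV PQ' by blast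
  then have "bip_set G (Y \<union> (P' \<union> Q'))" using combine[OF PQ(2,1) PQ'(2)] PQ'(1) by blast
  then show ?thesis using PQ'(1) YV bipartite_iff unfolding bip_set_def by (simp add: Un_absorb1)
qed

end

text \<open>Nonadjacent ends make the edge added by \<open>reduce\<close> a new one, so the reduced
  graph is again cubic.\<close>

locale two_cut = two_cut0 +
  assumes nonadj: "y2 \<notin> nb G y1"
begin

abbreviation "R \<equiv> reduce G Y y1 y2"

lemma swap2: "two_cut G Y y2 w2 y1 w1"
proof -
  interpret s: two_cut0 G Y y2 w2 y1 w1 by (rule swap)
  show ?thesis by unfold_locales (use nonadj nb_sym in metis)
qed

lemma vertsR [simp]: "verts R = Y"
  by (simp add: reduce_def)

lemma simpleR: "simple_graph R"
  using simple y unfolding simple_graph_def reduce_def by auto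

sublocale R: sgraph R
  by unfold_locales (rule simpleR)

lemma nb_R: "z \<in> nb R x \<longleftrightarrow> z \<in> nb G x \<and> x \<in> Y \<and> z \<in> Y \<or> x = y1 \<and> z = y2 \<or> x = y2 \<and> z = y1"
  unfolding edge_iff_nb[symmetric] reduce_def by (auto simp: doubleton_eq_iff)

text \<open>Each end trades its edge to the far side for the new edge. Hence sets that do not
  contain both ends keep their cut size; a set containing both is handled through its
  complement.\<close>

lemma card_nb_R:
  assumes x: "x \<in> Y" and X: "X \<subseteq> Y" "\<not> (y1 \<in> X \<and> y2 \<in> X)" "x \<in> X \<or> X = {}"
  shows "card (nb R x \<inter> (Y - X)) = card (nb G x - X)"
proof -
  have a: "y2 \<notin> nb G y1" "y1 \<notin> nb G y2" using nonadj nb_sym by metis+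
  have "nb R x \<inter> (Y - X) = (nb G x \<inter> (Y - X)) \<union> (if x = y1 then {y2} else if x = y2 then {y1} else {})"
    using x X y by (auto simp: nb_R)
  also have "card \<dots> = card (nb G x \<inter> (Y - X)) + card (nb G x - Y)"
    unfolding out_card[OF x] using a by (subst card_Un_disjoint) auto
  also have "\<dots> = card (nb G x \<inter> (Y - X) \<union> (nb G x - Y))"
    by (subst card_Un_disjoint) auto
  also have "nb G x \<inter> (Y - X) \<union> (nb G x - Y) = nb G x - X" using X by auto
  finally show ?thesis .
qed

sublocale R: cub R
proof
  show "cubic R"
    unfolding cubic_def
  proof
    fix v assume v: "v \<in> verts R"
    then have "card (nb R v \<inter> (Y - {})) = card (nb G v - {})" by (intro card_nb_R) auto
    moreover have "nb R v \<inter> (Y - {}) = nb R v" using R.nb_sub[of v] by auto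
    ultimately show "degree R v = 3" using nb_card[of v] v YV R.degree_nb by auto
  qed
  show "edge_conn 2 R"
    unfolding edge_conn_def
  proof (intro conjI allI impI)
    show "verts R \<noteq> {}" using y by auto
    fix X assume X: "X \<subset> verts R \<and> X \<noteq> {}"
    have *: "2 \<le> cut R Z" if "Z \<subseteq> Y" "Z \<noteq> {}" "\<not> (y1 \<in> Z \<and> y2 \<in> Z)" for Z
    proof -
      have "cut R Z = cut G Z" unfolding ec_def using card_nb_R that by (auto intro!: sum.cong)
      moreover have "Z \<subseteq> verts G" "Z \<noteq> verts G" using that YV y by auto
      ultimately show ?thesis using cut2[of Z] that by simp
    qed
    show "2 \<le> cut R X"
    proof (cases "y1 \<in> X \<and> y2 \<in> X")
      case True
      then have "2 \<le> cut R (verts R - X)" using X by (intro *) auto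
      then show ?thesis using X by (metis R.cut_compl psubset_imp_subset)
    next
      case False
      then show ?thesis using X by (intro *) auto
    qed
  qed
qed

lemma evenY: "even (card Y)"
  using R.evenV by simp

lemma even_compl: "even (card (verts G - Y))"
  using evenY evenV YV by (simp add: card_Diff_subset card_mono)

lemma crossing:
  assumes "e \<in> edges G" "\<not> e \<subseteq> Y" "e \<inter> Y \<noteq> {}"
  shows "e = {y1, w1} \<or> e = {y2, w2}"
proof -
  obtain a b where ab: "e = {a,b}" "b \<in> nb G a" using edgeE assms(1) by metis
  then have "a \<in> nb G b" by (simp add: nb_sym)
  then have "a \<in> Y \<and> b \<notin> Y \<or> b \<in> Y \<and> a \<notin> Y" using ab assms by auto
  then show ?thesis using out[of a b] out[of b a] ab \<open>a \<in> nb G b\<close> by (auto simp: insert_commute)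
qed

text \<open>The far side has even order, so a perfect matching uses both cut edges or neither. One
  through the first cut edge gives the first claim, one through an edge from \<open>y1\<close> into
  \<open>Y\<close> gives the second.\<close>

lemma matchable_W12: "matchable G (verts G - Y - {w1, w2})" and matchable_W: "matchable G (verts G - Y)"
proof -
  show "matchable G (verts G - Y - {w1, w2})"
  proof -
    obtain M where M: "M \<subseteq> edges G" "disjoint M" "\<Union>M = verts G - {y1,w1}"
      using matching_covered[OF e1] matchable_def by metis
    have c: "e = {y2,w2}" if "e \<in> M" "\<not> e \<subseteq> Y" "e \<inter> Y \<noteq> {}" for e
      using crossing[of e] that M by auto
    show ?thesis
    proof (cases "{y2,w2} \<in> M")
      case True
      have dj: "e \<inter> {y2,w2} = {}" if "e \<in> M" "e \<noteq> {y2,w2}" for e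
        using pairwiseD[OF M(2) that(1) True that(2)] by (simp add: disjnt_def)
      show ?thesis
      proof (rule matchable_restrict[of "M - {{y2,w2}}"])
        show "M - {{y2,w2}} \<subseteq> edges G" "disjoint (M - {{y2,w2}})"
          using M(1) pairwise_subset[OF M(2)] by auto
        have "\<Union>(M - {{y2,w2}}) \<union> {y2,w2} = \<Union>M" using True by auto
        then show "verts G - Y - {w1, w2} \<subseteq> \<Union>(M - {{y2,w2}})" using M(3) y by auto
        fix e assume e: "e \<in> M - {{y2,w2}}"
        then have "w1 \<notin> e" "w2 \<notin> e" using M(3) dj by auto
        moreover have "e \<subseteq> verts G" using e M(3) by auto
        ultimately show "e \<inter> (verts G - Y - {w1, w2}) = {} \<or> e \<subseteq> verts G - Y - {w1, w2}"
          using c[of e] e by auto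
      qed
    next
      case False
      have "matchable G (verts G - Y - {w1})"
      proof (rule matchable_restrict[OF M(1,2)])
        show "verts G - Y - {w1} \<subseteq> \<Union>M" using M(3) y by auto
        fix e assume e: "e \<in> M"
        then have "w1 \<notin> e" "e \<subseteq> verts G" using M(3) by auto
        then show "e \<inter> (verts G - Y - {w1}) = {} \<or> e \<subseteq> verts G - Y - {w1}"
          using c[OF e] False e by auto
      qed
      then have "even (card (verts G - Y - {w1}))" by (rule matchable_even)
      moreover have "card (verts G - Y) \<noteq> 0" using wV by auto
      ultimately show ?thesis using even_compl wV(1) by simp
    qed
  qed
  show "matchable G (verts G - Y)"
  proof -
    have "card (nb G y1 \<inter> Y) \<noteq> 0" using card_Int_Diff[of "nb G y1" Y] out_card[OF y(1)] nb_card[of y1] y(1) YV by auto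
    then have "nb G y1 \<inter> Y \<noteq> {}" by (metis card.empty)
    then obtain z where z: "z \<in> nb G y1" "z \<in> Y" by blast
    obtain M where M: "M \<subseteq> edges G" "disjoint M" "\<Union>M = verts G - {y1,z}"
      using matching_covered[OF z(1)] matchable_def by metis
    have c: "e = {y2,w2}" if "e \<in> M" "\<not> e \<subseteq> Y" "e \<inter> Y \<noteq> {}" for e
      using crossing[of e] that M by auto
    have "{y2,w2} \<notin> M"
    proof
      assume T: "{y2,w2} \<in> M"
      have dj: "e \<inter> {y2,w2} = {}" if "e \<in> M" "e \<noteq> {y2,w2}" for e
        using pairwiseD[OF M(2) that(1) T that(2)] by (simp add: disjnt_def)
      have "matchable G (verts G - Y - {w2})"
      proof (rule matchable_restrict[of "M - {{y2,w2}}"])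
        show "M - {{y2,w2}} \<subseteq> edges G" "disjoint (M - {{y2,w2}})"
          using M(1) pairwise_subset[OF M(2)] by auto
        have "\<Union>(M - {{y2,w2}}) \<union> {y2,w2} = \<Union>M" using T by auto
        then show "verts G - Y - {w2} \<subseteq> \<Union>(M - {{y2,w2}})" using M(3) y z by auto
        fix e assume e: "e \<in> M - {{y2,w2}}"
        then have "w2 \<notin> e" "e \<subseteq> verts G" using M(3) dj by auto
        then show "e \<inter> (verts G - Y - {w2}) = {} \<or> e \<subseteq> verts G - Y - {w2}"
          using c[of e] e by auto
      qed
      then have "even (card (verts G - Y - {w2}))" by (rule matchable_even)
      moreover have "card (verts G - Y) \<noteq> 0" using wV by auto
      ultimately show False using even_compl wV(2) by simp
    qed
    show ?thesis
    proof (rule matchable_restrict[OF M(1,2)])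
      show "verts G - Y \<subseteq> \<Union>M" using M(3) y z by auto
      fix e assume e: "e \<in> M"
      then have "e \<subseteq> verts G" using M(3) by auto
      then show "e \<inter> (verts G - Y) = {} \<or> e \<subseteq> verts G - Y"
        using c[OF e] \<open>{y2,w2} \<notin> M\<close> e by auto
    qed
  qed
qed

text \<open>When the new edge is used, its two ends are left to be matched along the cut
  edges.\<close>

lemma matchable_R:
  assumes "matchable R X"
  shows "matchable G X \<or> y1 \<in> X \<and> y2 \<in> X \<and> matchable G (X - {y1, y2})"
proof -
  obtain M where M: "M \<subseteq> edges R" "disjoint M" "\<Union>M = X" using assms matchable_def by metis
  show ?thesis
  proof (cases "{y1,y2} \<in> M")
    case True
    have dj: "e \<inter> {y1,y2} = {}" if "e \<in> M" "e \<noteq> {y1,y2}" for e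
      using pairwiseD[OF M(2) that(1) True that(2)] by (simp add: disjnt_def)
    have "\<Union>(M - {{y1,y2}}) = \<Union>M - {y1,y2}" using dj True by auto
    moreover have "M - {{y1,y2}} \<subseteq> edges G" using M(1) unfolding reduce_def by auto
    moreover have "disjoint (M - {{y1,y2}})" using pairwise_subset[OF M(2)] by auto
    ultimately have "matchable G (X - {y1,y2})" unfolding matchable_def using M(3) by blast
    then show ?thesis using True M(3) by auto
  next
    case False
    then have "M \<subseteq> edges G" using M(1) unfolding reduce_def by auto
    then show ?thesis using M matchable_def by blast
  qed
qed

text \<open>Compared with the reduced graph, the closed neighbourhood of \<open>y1\<close> loses
  \<open>y2\<close> and gains \<open>w1\<close>. So \<open>y2\<close> has to be matched, along its
  cut edge, and the far side is matched without \<open>w1\<close> and \<open>w2\<close>.\<close>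

lemma nice_lift_y1:
  assumes "nice_vertex R y1" shows "nice_vertex G y1"
proof -
  let ?X = "Y - insert y1 (nb R y1)"
  have "matchable R ?X" using assms R.nice_vertex_iff by simp
  then have 1: "matchable G ?X" using matchable_R by auto
  have nbR: "nb R y1 = insert y2 (nb G y1 \<inter> Y)" using y by (auto simp: nb_R)
  have nbG: "nb G y1 = insert w1 (nb G y1 \<inter> Y)" using out[OF y(1)] e1 y(3) by auto
  have "verts G - insert y1 (nb G y1) = ?X \<union> {y2, w2} \<union> (verts G - Y - {w1, w2})"
  proof (rule set_eqI)
    fix x
    have "x \<in> nb G y1 \<longleftrightarrow> x = w1 \<or> x \<in> nb G y1 \<inter> Y" using nbG by blast
    moreover have "x \<in> nb R y1 \<longleftrightarrow> x = y2 \<or> x \<in> nb G y1 \<inter> Y" using nbR by blast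
    moreover have "w2 \<in> verts G" "w2 \<noteq> y1" "y2 \<in> verts G" "w1 \<noteq> y2" "x \<in> Y \<Longrightarrow> x \<in> verts G"
      "x = y2 \<Longrightarrow> x \<notin> nb G y1" using wV YV y w nonadj by auto
    ultimately show "x \<in> verts G - insert y1 (nb G y1) \<longleftrightarrow> x \<in> ?X \<union> {y2, w2} \<union> (verts G - Y - {w1, w2})"
      using y w by auto
  qed
  moreover have "matchable G (?X \<union> {y2, w2} \<union> (verts G - Y - {w1, w2}))"
    by (intro matchable_Un 1 matchable_edge e2 matchable_W12) (use w y nbR in auto)
  ultimately show ?thesis using nice_vertex_iff y YV by auto
qed

lemma nice_lift:
  assumes "nice_vertex R v" shows "nice_vertex G v"
proof -
  have v: "v \<in> Y" and p: "matchable R (Y - insert v (nb R v))" using assms R.nice_vertex_iff by auto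
  consider "v = y1" | "v = y2" | "v \<noteq> y1" "v \<noteq> y2" by blast
  then show ?thesis
  proof cases
    case 1 then show ?thesis using nice_lift_y1 assms by simp
  next
    case 2
    interpret s: two_cut G Y y2 w2 y1 w1 by (rule swap2)
    have "s.R = R" unfolding reduce_def by (simp add: insert_commute)
    then show ?thesis using s.nice_lift_y1 assms 2 by simp
  next
    case 3
    have nbG: "nb G v \<subseteq> Y" using out[OF v] 3 by auto
    then have nbR: "nb R v = nb G v" using v 3 by (auto simp: nb_R)
    let ?X = "Y - insert v (nb G v)"
    \<comment> \<open>If the matching uses the new edge, both cut edges replace it and the far side
      goes without \<open>w1\<close>, \<open>w2\<close>; otherwise the far side is matched on its
      own.\<close>
    have "matchable G (verts G - insert v (nb G v))"
      using matchable_R[OF p[unfolded nbR]]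
    proof
      assume 1: "matchable G ?X"
      have "verts G - insert v (nb G v) = ?X \<union> (verts G - Y)" using nbG v YV by auto
      then show ?thesis using matchable_Un[OF 1 matchable_W] by auto
    next
      assume a: "y1 \<in> ?X \<and> y2 \<in> ?X \<and> matchable G (?X - {y1, y2})"
      have "verts G - insert v (nb G v) = (?X - {y1,y2}) \<union> {y1,w1} \<union> {y2,w2} \<union> (verts G - Y - {w1,w2})"
        using nbG v YV a wV by auto
      moreover have "matchable G ((?X - {y1,y2}) \<union> {y1,w1} \<union> {y2,w2} \<union> (verts G - Y - {w1,w2}))"
        by (intro matchable_Un matchable_edge e1 e2 matchable_W12) (use a w y in auto)
      ultimately show ?thesis by simp
    qed
    then show ?thesis using nice_vertex_iff v YV by auto
  qed
qed

lemma bip_R: "bipartite R \<Longrightarrow> bip_set G Y"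
proof -
  assume "bipartite R"
  then obtain P Q where PQ: "P \<union> Q = Y" "bip_on R P Q" using R.bipartite_iff by auto
  have "nb G x \<inter> Y \<subseteq> nb R x" if "x \<in> Y" for x using that by (auto simp: nb_R)
  then have "nb G x \<inter> Z \<subseteq> nb R x \<inter> Z" if "x \<in> Y" "Z \<subseteq> Y" for x Z using that by blast
  then have "bip_on G P Q" using PQ unfolding bip_on_def by (metis Un_upper1 Un_upper2 subsetD subset_empty)
  then show ?thesis using PQ bip_set_def by metis
qed

lemma Upsilon_R: "Upsilon R \<le> card ({v. nice_vertex G v} \<inter> Y)"
proof -
  have "{v. nice_vertex R v} \<subseteq> {v. nice_vertex G v} \<inter> Y" using nice_lift R.nice_vertex_iff by auto
  then show ?thesis unfolding Upsilon_def by (intro card_mono) auto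
qed

text \<open>Putting the far side back for the edge \<open>y1y2\<close> creates a gadget if both ends
  are corners, and lengthens an existing one otherwise. Its classes are balanced by
  \<open>opposite\<close>, so the label counts stay symmetric.\<close>

lemma k4_extend:
  assumes k: "k4like R K l" "k4full R K l" and W: "bip_on G W1 W2" "W1 \<union> W2 = verts G - Y"
    and w12: "w1 \<in> W1" "w2 \<in> W2"
  shows "\<exists>l'. k4like G K l' \<and> k4full G K l'"
proof -
  have K: "K \<subseteq> Y" "card K = 4"
    and lK: "\<And>v. v \<in> Y - K \<Longrightarrow> fst (l v) \<in> K \<and> snd (l v) \<in> K \<and> fst (l v) \<noteq> snd (l v)"
    and ln: "\<And>u v. u \<in> Y - K \<Longrightarrow> v \<in> nb R u \<Longrightarrow> v = fst (l u) \<or> v \<notin> K \<and> l v = prod.swap (l u)"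
    and lc: "\<And>p. card {v \<in> Y - K. l v = p} = card {v \<in> Y - K. l v = prod.swap p}"
    using k(1) unfolding k4like_def vertsR by blast+
  have W12: "W1 \<inter> W2 = {}" using W unfolding bip_on_def by auto
  interpret c: two_cut0 G "verts G - Y" w1 y1 w2 y2 by (rule compl)
  have cW: "card W1 = card W2" using c.opposite(2)[OF W] .
  have WV: "x \<in> W1 \<or> x \<in> W2 \<longleftrightarrow> x \<in> verts G - Y" for x using W(2) by blast
  have finW: "finite W1" "finite W2" using W(2) finV by (metis finite_Diff finite_Un)+
  \<comment> \<open>The label of \<open>w1\<close> is forced by its neighbour: the swap of the label
    of \<open>y1\<close> unless \<open>y1\<close> is a corner; if only \<open>y1\<close> is a
    corner, the label of \<open>y2\<close>, reached across the opposite class; if both are, a new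
    gadget on \<open>(y1, y2)\<close> begins.\<close>
  define p1 where "p1 = (if y1 \<notin> K then prod.swap (l y1) else if y2 \<notin> K then l y2 else (y1, y2))"
  have y12: "y2 \<in> nb R y1" "y1 \<in> nb R y2" by (auto simp: nb_R)
  have F3: "fst p1 \<in> K" "snd p1 \<in> K" "fst p1 \<noteq> snd p1"
    using lK[of y1] lK[of y2] y unfolding p1_def by auto
  have F1: "y1 = fst p1 \<or> y1 \<notin> K \<and> l y1 = prod.swap p1"
    using ln[of y2 y1] y12 y unfolding p1_def by auto
  have F2: "y2 = snd p1 \<or> y2 \<notin> K \<and> l y2 = p1"
    using ln[of y1 y2] y12 y unfolding p1_def by auto
  have pne: "p1 \<noteq> prod.swap p1" using F3 by (cases p1) auto
  define l' where "l' = (\<lambda>v. if v \<in> Y then l v else if v \<in> W1 then p1 else prod.swap p1)"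
  have l'Y: "v \<in> Y \<Longrightarrow> l' v = l v" and l'1: "v \<in> W1 \<Longrightarrow> l' v = p1" and l'2: "v \<in> W2 \<Longrightarrow> l' v = prod.swap p1" for v
    using WV[of v] W12 unfolding l'_def by auto
  have nK: "v \<notin> K" if "v \<in> W1 \<or> v \<in> W2" for v using WV[of v] that K by auto
  have nbW1: "v \<in> W2 \<or> v = y1 \<and> u = w1" if "u \<in> W1" "v \<in> nb G u" for u v
  proof (cases "v \<in> Y")
    case True
    then show ?thesis using c.out[of u v] that WV[of u] W12 w12 by auto
  next
    case False
    then have "v \<in> W1 \<or> v \<in> W2" using WV nb_verts that by blast
    then show ?thesis using W(1) that unfolding bip_on_def by blast
  qed
  have nbW2: "v \<in> W1 \<or> v = y2 \<and> u = w2" if "u \<in> W2" "v \<in> nb G u" for u v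
  proof (cases "v \<in> Y")
    case True
    then show ?thesis using c.out[of u v] that WV[of u] W12 w12 by auto
  next
    case False
    then have "v \<in> W1 \<or> v \<in> W2" using WV nb_verts that by blast
    then show ?thesis using W(1) that unfolding bip_on_def by blast
  qed
  have "k4like G K l'"
    unfolding k4like_def
  proof (intro conjI ballI allI)
    show "K \<subseteq> verts G" "card K = 4" using K YV by auto
    fix v assume v: "v \<in> verts G - K"
    then consider "v \<in> Y" | "v \<in> W1" | "v \<in> W2" using WV by blast
    then have "fst (l' v) \<in> K \<and> snd (l' v) \<in> K \<and> fst (l' v) \<noteq> snd (l' v)"
    proof cases
      case 1 then show ?thesis using l'Y lK v by auto
    next
      case 2 then show ?thesis using l'1 F3 by auto
    next
      case 3 then show ?thesis using l'2 F3 by auto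
    qed
    then show "fst (l' v) \<in> K" "snd (l' v) \<in> K" "fst (l' v) \<noteq> snd (l' v)" by auto
  next
    fix u v assume u: "u \<in> verts G - K" and v: "v \<in> nb G u"
    consider "u \<in> Y" | "u \<in> W1" | "u \<in> W2" using WV u by blast
    then show "v = fst (l' u) \<or> v \<notin> K \<and> l' v = prod.swap (l' u)"
    proof cases
      case 1
      show ?thesis
      proof (cases "v \<in> Y")
        case True
        then have "v \<in> nb R u" using v 1 by (simp add: nb_R)
        then show ?thesis using ln[of u v] u 1 l'Y True by auto
      next
        case False
        then consider "u = y1" "v = w1" | "u = y2" "v = w2" using out[OF 1 v] by blast
        then show ?thesis
        proof cases
          case 1
          then have "l y1 = prod.swap p1" using F1 F3 u by auto
          then show ?thesis using 1 l'Y[of u] y l'1[OF w12(1)] nK w12 by auto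
        next
          case 2
          then have "l y2 = p1" using F2 F3 u by auto
          then show ?thesis using 2 l'Y[of u] y l'2[OF w12(2)] nK w12 by auto
        qed
      qed
    next
      case 2
      then show ?thesis using nbW1[OF 2 v] l'1 l'2 nK F1 l'Y y by auto
    next
      case 3
      then show ?thesis using nbW2[OF 3 v] l'1 l'2 nK F2 l'Y y by auto
    qed
  next
    fix p
    have cnt: "card {v \<in> verts G - K. l' v = q} = card {v \<in> Y - K. l v = q} +
        ((if q = p1 then card W1 else 0) + (if q = prod.swap p1 then card W2 else 0))" for q
    proof -
      have "{v \<in> verts G - K. l' v = q} = {v \<in> Y - K. l v = q} \<union>
        ((if q = p1 then W1 else {}) \<union> (if q = prod.swap p1 then W2 else {}))"
      proof (rule set_eqI)
        fix v
        consider "v \<in> Y" "v \<notin> W1" "v \<notin> W2" | "v \<in> W1" "v \<notin> Y" "v \<notin> W2" | "v \<in> W2" "v \<notin> Y" "v \<notin> W1"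
          | "v \<notin> Y" "v \<notin> W1" "v \<notin> W2"
          using WV[of v] W12 by blast
        then show "v \<in> {v \<in> verts G - K. l' v = q} \<longleftrightarrow> v \<in> {v \<in> Y - K. l v = q} \<union>
          ((if q = p1 then W1 else {}) \<union> (if q = prod.swap p1 then W2 else {}))"
        proof cases
          case 1 then show ?thesis using YV l'Y by auto
        next
          case 2 then show ?thesis using WV[of v] nK l'1 by auto
        next
          case 3 then show ?thesis using WV[of v] nK l'2 by auto
        next
          case 4 then show ?thesis using WV[of v] by auto
        qed
      qed
      also have "card \<dots> = card {v \<in> Y - K. l v = q} + card
        ((if q = p1 then W1 else {}) \<union> (if q = prod.swap p1 then W2 else {}))"
        by (rule card_Un_disjoint) (use finW WV in auto)
      also have "card ((if q = p1 then W1 else {}) \<union> (if q = prod.swap p1 then W2 else {})) =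
         (if q = p1 then card W1 else 0) + (if q = prod.swap p1 then card W2 else 0)"
        using pne by auto
      finally show ?thesis .
    qed
    have "prod.swap p = p1 \<longleftrightarrow> p = prod.swap p1" "prod.swap p = prod.swap p1 \<longleftrightarrow> p = p1"
      by (cases p; cases p1; auto)+
    then show "card {v \<in> verts G - K. l' v = p} = card {v \<in> verts G - K. l' v = prod.swap p}"
      unfolding cnt using lc[of p] cW by auto
  qed
  moreover have "k4full G K l'"
    unfolding k4full_def
  proof (intro ballI impI)
    fix x z assume xz: "x \<in> K" "z \<in> K" "x \<noteq> z"
    have "z \<in> nb R x \<or> (\<exists>v\<in>Y - K. l v = (x, z))" using k(2) xz unfolding k4full_def by simp
    then show "z \<in> nb G x \<or> (\<exists>v\<in>verts G - K. l' v = (x, z))"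
    proof
      assume "z \<in> nb R x"
      then consider "z \<in> nb G x" | "x = y1" "z = y2" | "x = y2" "z = y1" by (auto simp: nb_R)
      then show ?thesis
      proof cases
        case 2
        then have "l' w1 = (x, z)" using l'1 w12 xz unfolding p1_def by auto
        then show ?thesis using wV nK w12 by blast
      next
        case 3
        then have "l' w2 = (x, z)" using l'2 w12 xz unfolding p1_def by auto
        then show ?thesis using wV nK w12 by blast
      qed simp
    next
      assume "\<exists>v\<in>Y - K. l v = (x, z)"
      then show ?thesis using l'Y YV by (metis Diff_iff subsetD)
    qed
  qed
  ultimately show ?thesis by blast
qed

end

section \<open>Minimal nonbipartite sides of 2-edge cuts\<close>

context cub
begin

text \<open>A vertex carrying two of the cut edges could be moved across, leaving a cut of size at
  most 1. Applied on both sides, this makes the two cut edges disjoint.\<close>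

lemma two_cut_ex:
  assumes Y: "Y \<subset> verts G" "Y \<noteq> {}" "cut G Y = 2"
  shows "\<exists>y1 w1 y2 w2. two_cut0 G Y y1 w1 y2 w2"
proof -
  have one: "card (nb G x - Y) \<le> 1" if Y: "Y \<subset> verts G" "cut G Y = 2" and x: "x \<in> Y" for x Y
  proof (rule ccontr)
    assume k: "\<not> ?thesis"
    have xV: "x \<in> verts G" using x Y by auto
    have a: "cut G (Y - {x}) + card (nb G x - Y) = 2 + card (nb G x \<inter> Y)"
      using cut_remove[of Y x] Y x by auto
    have b: "card (nb G x \<inter> Y) + card (nb G x - Y) = 3"
      using card_Int_Diff[of "nb G x" Y] nb_card[OF xV] by simp
    show False
    proof (cases "Y - {x} = {}")
      case True
      then have "Y = {x}" using x by auto
      then have "cut G Y = card (nb G x)" using nb_irrefl by simp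
      then show False using Y nb_card[OF xV] by simp
    next
      case False
      then have "2 \<le> cut G (Y - {x})" by (intro cut2) (use Y in auto)
      then show False using a b k by linarith
    qed
  qed
  have fY: "finite Y" using Y finite_sub by blast
  let ?B = "{x \<in> Y. \<not> nb G x \<subseteq> Y}"
  have oc: "card (nb G x - Y) = (if nb G x \<subseteq> Y then 0 else 1)" if "x \<in> Y" for x
  proof (cases "nb G x \<subseteq> Y")
    case False
    then have "card (nb G x - Y) > 0" by (auto simp: card_gt_0_iff)
    then show ?thesis using one[OF Y(1,3) that] False by simp
  qed (simp add: Diff_eq_empty_iff[THEN iffD2])
  have "cut G Y = (\<Sum>x\<in>Y. if nb G x \<subseteq> Y then 0 else 1)" unfolding ec_def using oc by simp
  also have "\<dots> = card ?B" unfolding card_eq_sum sum.inter_filter[OF fY] by (rule sum.cong) auto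
  finally have "card ?B = 2" using Y by simp
  then obtain y1 y2 where B: "?B = {y1, y2}" "y1 \<noteq> y2" by (auto simp: card_2_iff)
  then have yB: "y1 \<in> Y" "y2 \<in> Y" "\<not> nb G y1 \<subseteq> Y" "\<not> nb G y2 \<subseteq> Y" by blast+
  obtain w1 where w1: "nb G y1 - Y = {w1}" using oc[OF yB(1)] yB by (auto simp: card_1_singleton_iff)
  obtain w2 where w2: "nb G y2 - Y = {w2}" using oc[OF yB(2)] yB by (auto simp: card_1_singleton_iff)
  have "w1 \<noteq> w2"
  proof
    assume eq: "w1 = w2"
    have "w1 \<in> nb G y1" "w1 \<in> nb G y2" "w1 \<notin> Y" using w1 w2 eq by auto
    then have m: "w1 \<in> verts G - Y" "y1 \<in> nb G w1" "y2 \<in> nb G w1"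
      using nb_verts by (auto simp: nb_sym[of w1])
    have "card (nb G w1 - (verts G - Y)) \<le> 1"
      by (rule one) (use Y cut_compl[of Y] m in auto)
    moreover have "{y1,y2} \<subseteq> nb G w1 - (verts G - Y)" using m yB by auto
    then have "card {y1,y2} \<le> card (nb G w1 - (verts G - Y))" by (intro card_mono) auto
    ultimately show False using B(2) by simp
  qed
  have "two_cut0 G Y y1 w1 y2 w2"
  proof unfold_locales
    show "w1 \<notin> Y" "w2 \<notin> Y" "w1 \<in> nb G y1" "w2 \<in> nb G y2" using w1 w2 by auto
    fix x z assume x: "x \<in> Y" "z \<in> nb G x" "z \<notin> Y"
    then have "x \<in> ?B" by auto
    then have "x = y1 \<or> x = y2" using B by auto
    then show "x = y1 \<and> z = w1 \<or> x = y2 \<and> z = w2" using x w1 w2 by auto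
  qed (use Y yB B \<open>w1 \<noteq> w2\<close> in auto)
  then show ?thesis by blast
qed

text \<open>Were the ends adjacent, removing both would leave a smaller side of a 2-edge cut, whose
  outer ends are just these two vertices. It is bipartite by minimality, and its colouring extends
  over the two removed vertices to all of \<open>Y\<close>.\<close>

lemma two_cut_minimal:
  assumes Y0: "Y0 \<subset> verts G" "cut G Y0 = 2" "\<not> bip_set G Y0"
  obtains Y y1 w1 y2 w2 where "Y \<subseteq> Y0" "two_cut G Y y1 w1 y2 w2" "\<not> bip_set G Y"
proof -
  let ?P = "\<lambda>Y. Y \<subseteq> Y0 \<and> cut G Y = 2 \<and> \<not> bip_set G Y"
  have "?P Y0" using Y0 by simp
  then obtain Y where Y: "?P Y" and mn: "\<And>Y'. ?P Y' \<Longrightarrow> card Y \<le> card Y'"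
    using ex_has_least_nat[of ?P Y0 card] by blast
  have YV: "Y \<subset> verts G" using Y Y0 by auto
  have ne: "Y \<noteq> {}" using Y by auto
  obtain y1 w1 y2 w2 where "two_cut0 G Y y1 w1 y2 w2" using two_cut_ex[OF YV ne] Y by blast
  then interpret t: two_cut0 G Y y1 w1 y2 w2 .
  have "y2 \<notin> nb G y1"
  proof
    assume adj: "y2 \<in> nb G y1"
    then have adj': "y1 \<in> nb G y2" by (simp add: nb_sym)
    let ?Y = "Y - {y1} - {y2}"
    have yV: "y1 \<in> verts G" "y2 \<in> verts G" using t.y t.YV by auto
    have c1: "cut G (Y - {y1}) + card (nb G y1 - Y) = 2 + card (nb G y1 \<inter> Y)"
      using cut_remove[of Y y1] t.YV t.y Y by auto
    have s1: "card (nb G y1 \<inter> Y) + card (nb G y1 - Y) = 3"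
      using card_Int_Diff[of "nb G y1" Y] nb_card[OF yV(1)] by simp
    have c2: "cut G ?Y + card (nb G y2 - (Y - {y1})) = cut G (Y - {y1}) + card (nb G y2 \<inter> (Y - {y1}))"
      by (rule cut_remove) (use t.YV t.y in auto)
    have s2: "card (nb G y2 \<inter> (Y - {y1})) + card (nb G y2 - (Y - {y1})) = 3"
      using card_Int_Diff[of "nb G y2" "Y - {y1}"] nb_card[OF yV(2)] by simp
    have "nb G y2 - (Y - {y1}) = insert y1 (nb G y2 - Y)" using adj' by auto
    then have "card (nb G y2 - (Y - {y1})) = 2" using t.out_card[OF t.y(2)] t.y(1) by simp
    then have cY: "cut G ?Y = 2" using c1 c2 s1 s2 t.out_card[OF t.y(1)] by simp
    have cl: "card ?Y < card Y" by (rule psubset_card_mono) (use t.y in auto)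
    have "bip_set G ?Y"
    proof (rule ccontr)
      assume "\<not> bip_set G ?Y"
      then have "card Y \<le> card ?Y" using cY Y by (intro mn) auto
      then show False using cl by simp
    qed
    then obtain P Q where PQ: "P \<union> Q = ?Y" "bip_on G P Q" using bip_set_def by metis
    have ne': "?Y \<noteq> {}"
    proof
      assume "?Y = {}"
      then have "cut G ?Y = 0" by (simp only: ec_empty)
      then show False using cY by simp
    qed
    have YV': "?Y \<subset> verts G" using YV by auto
    obtain a p b q where "two_cut0 G ?Y a p b q" using two_cut_ex[OF YV' ne' cY] by blast
    then interpret u: two_cut0 G ?Y a p b q .
    have "p \<in> Y" "q \<in> Y"
      using t.out[of a p] t.out[of b q] u.e1 u.e2 u.y by auto
    then have "p \<in> {y1,y2}" "q \<in> {y1,y2}" using u.w by auto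
    then have pq: "{p,q} = {y1,y2}" using u.w(3) by auto
    have "bip_on G {p} {q}" unfolding bip_on_def using u.w(3) by auto
    from u.combine[OF PQ(2,1) this] have "bip_set G (?Y \<union> ({p} \<union> {q}))" using u.w by auto
    moreover have "?Y \<union> ({p} \<union> {q}) = Y" using pq t.y by auto
    ultimately show False using Y by simp
  qed
  then have "two_cut G Y y1 w1 y2 w2" by unfold_locales
  then show ?thesis using that Y by blast
qed

end

theorem two_conn_Upsilon:
  assumes "simple_graph G" "cubic G" "edge_conn 2 G" "\<not> bipartite G"
  shows "4 \<le> Upsilon G \<and> (Upsilon G = 4 \<longrightarrow> (\<exists>K l. k4like G K l \<and> k4full G K l))"
  using assms
proof (induction "card (verts G)" arbitrary: G rule: less_induct)
  case less
  interpret cub G by unfold_locales (use less.prems in auto)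
  let ?N = "{v. nice_vertex G v}"
  have finN: "finite ?N" using nice_sub finV finite_subset by blast
  show ?case
  proof (cases "edge_conn 3 G")
    case True
    show ?thesis
    proof (cases "card (verts G) = 4")
      case c4: True
      have full: "y \<in> nb G x" if xy: "x \<in> verts G" "y \<in> verts G" "x \<noteq> y" for x y
      proof -
        have "insert x (nb G x) \<subseteq> verts G" "card (insert x (nb G x)) = 4"
          using nb_sub xy nb_card by auto
        then have "insert x (nb G x) = verts G" using c4 finV by (metis card_subset_eq)
        then show ?thesis using xy by auto
      qed
      have "k4like G (verts G) l" "k4full G (verts G) l" for l :: "'a \<Rightarrow> 'a \<times> 'a"
        using c4 full unfolding k4like_def k4full_def by auto
      then show ?thesis using card4_Upsilon[OF c4] by auto
    next
      case False
      then show ?thesis using three_conn_Upsilon[OF less.prems(1,2) True less.prems(4)] by simp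
    qed
  next
    case False
    then obtain X where "X \<subset> verts G" "X \<noteq> {}" "\<not> 3 \<le> cut G X"
      using V_ne unfolding edge_conn_def by blast
    then have X: "X \<subset> verts G" "X \<noteq> {}" "cut G X < 3" by simp_all
    have "2 \<le> cut G X" by (rule cut2) (use X in blast)+
    then have cX: "cut G X = 2" using X(3) by linarith
    obtain a p b q where "two_cut0 G X a p b q" using two_cut_ex[OF X(1,2) cX] by blast
    then interpret x: two_cut0 G X a p b q .
    \<comment> \<open>If both sides were bipartite, their colourings would combine to one of
      \<open>G\<close>.\<close>
    have "\<exists>Y0. Y0 \<subset> verts G \<and> cut G Y0 = 2 \<and> \<not> bip_set G Y0"
    proof (cases "bip_set G X")
      case True
      then have "\<not> bip_set G (verts G - X)" using x.bip_set_V less.prems(4) by blast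
      moreover have "verts G - X \<subset> verts G" using X by auto
      moreover have "cut G (verts G - X) = 2" using cut_compl X cX by auto
      ultimately show ?thesis by blast
    qed (use X cX in blast)
    then obtain Y0 where Y0: "Y0 \<subset> verts G" "cut G Y0 = 2" "\<not> bip_set G Y0" by blast
    obtain Y y1 w1 y2 w2 where Y: "Y \<subseteq> Y0" "two_cut G Y y1 w1 y2 w2" "\<not> bip_set G Y"
      using two_cut_minimal[OF Y0] by blast
    have IH: "4 \<le> Upsilon (reduce G Z a b) \<and>
       (Upsilon (reduce G Z a b) = 4 \<longrightarrow> (\<exists>K l. k4like (reduce G Z a b) K l \<and> k4full (reduce G Z a b) K l))"
       "4 \<le> card (?N \<inter> Z)"
      if "two_cut G Z a p b q" "\<not> bip_set G Z" for Z a p b q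
    proof -
      interpret z: two_cut G Z a p b q by (rule that(1))
      show 1: "4 \<le> Upsilon (reduce G Z a b) \<and>
       (Upsilon (reduce G Z a b) = 4 \<longrightarrow> (\<exists>K l. k4like (reduce G Z a b) K l \<and> k4full (reduce G Z a b) K l))"
      proof (rule less.hyps)
        show "card (verts z.R) < card (verts G)"
          unfolding z.vertsR by (rule psubset_card_mono) (use z.YV z.wV in auto)
        show "simple_graph z.R" by (rule z.simpleR)
        show "cubic z.R" "edge_conn 2 z.R" by (rule z.R.cub, rule z.R.conn)
        show "\<not> bipartite z.R" using z.bip_R that(2) by blast
      qed
      show "4 \<le> card (?N \<inter> Z)" using 1 z.Upsilon_R by linarith
    qed
    interpret t: two_cut G Y y1 w1 y2 w2 by (rule Y(2))
    have split: "Upsilon G = card (?N \<inter> Y) + card (?N - Y)" by (rule Upsilon_split[OF t.YV])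
    have ge: "4 \<le> Upsilon G" using split IH(2)[OF Y(2,3)] by linarith
    moreover have "\<exists>K l. k4like G K l \<and> k4full G K l" if U4: "Upsilon G = 4"
    proof -
      have "Upsilon t.R = 4" using IH(1)[OF Y(2,3)] t.Upsilon_R split U4 by linarith
      then obtain K l where kl: "k4like t.R K l" "k4full t.R K l" using IH(1)[OF Y(2,3)] by blast
      have NY0: "card (?N - Y) = 0" using split U4 IH(2)[OF Y(2,3)] by linarith
      \<comment> \<open>Otherwise the far side contains a minimal nonbipartite side \<open>Z\<close>
        of its own, with four further nice vertices.\<close>
      have "bip_set G (verts G - Y)"
      proof (rule ccontr)
        assume nb: "\<not> bip_set G (verts G - Y)"
        have "verts G - Y \<subset> verts G" using t.YV t.y by auto
        moreover have "cut G (verts G - Y) = 2"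
        proof -
          have "cut G Y = (\<Sum>x\<in>Y. if x \<in> {y1, y2} then 1 else 0)"
            unfolding ec_def using t.out_card by (intro sum.cong) auto
          also have "\<dots> = card {x\<in>Y. x \<in> {y1,y2}}" unfolding card_eq_sum by (rule sum.inter_filter[symmetric, OF t.finY])
          also have "{x\<in>Y. x \<in> {y1,y2}} = {y1,y2}" using t.y by auto
          finally have "cut G Y = 2" using t.y by simp
          then show ?thesis using cut_compl[OF t.YV] by simp
        qed
        ultimately obtain Z a p b q where Z: "Z \<subseteq> verts G - Y" "two_cut G Z a p b q" "\<not> bip_set G Z"
          using two_cut_minimal[OF _ _ nb] by blast
        have "card (?N \<inter> Z) \<le> card (?N - Y)" by (rule card_mono) (use finN Z in auto)
        then show False using IH(2)[OF Z(2,3)] NY0 by linarith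
      qed
      then obtain P Q where PQ: "P \<union> Q = verts G - Y" "bip_on G P Q" using bip_set_def by metis
      interpret c: two_cut0 G "verts G - Y" w1 y1 w2 y2 by (rule t.compl)
      have "w1 \<in> P \<and> w2 \<in> Q \<or> w1 \<in> Q \<and> w2 \<in> P"
        using c.opposite(1)[OF PQ(2,1)] t.wV PQ by blast
      then show ?thesis
      proof
        assume "w1 \<in> P \<and> w2 \<in> Q"
        then show ?thesis using t.k4_extend[OF kl PQ(2,1)] by blast
      next
        assume ww: "w1 \<in> Q \<and> w2 \<in> P"
        have "bip_on G Q P" "Q \<union> P = verts G - Y" using PQ bip_on_commute by blast+
        then show ?thesis using t.k4_extend[OF kl] ww by blast
      qed
    qed
    ultimately show ?thesis by blast
  qed
qed

section \<open>Connectivity and isomorphism\<close>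

definition map_graph :: "('a \<Rightarrow> 'b) \<Rightarrow> 'a graph \<Rightarrow> 'b graph" where
  "map_graph f G = Graph (f ` verts G) ((`) f ` edges G)"

lemma connected_closed:
  assumes "connected_graph G" "X \<subseteq> verts G" "X \<noteq> {}" "\<And>x. x \<in> X \<Longrightarrow> nb G x \<subseteq> X"
  shows "X = verts G"
proof -
  obtain x where x: "x \<in> X" using assms(3) by blast
  have "y \<in> X" if "(adj G)\<^sup>*\<^sup>* x y" for y
    using that
  proof (induction rule: rtranclp_induct)
    case (step y z)
    then show ?case using assms(4)[of y] by (auto simp: nb_def)
  qed (rule x)
  then show ?thesis using assms(1,2) x unfolding connected_graph_def by blast
qed

lemma (in sgraph) closed_connected:
  assumes ne: "verts G \<noteq> {}"
    and cl: "\<And>X. X \<subseteq> verts G \<Longrightarrow> X \<noteq> {} \<Longrightarrow> (\<And>x. x \<in> X \<Longrightarrow> nb G x \<subseteq> X) \<Longrightarrow> X = verts G"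
  shows "connected_graph G"
  unfolding connected_graph_def
proof (intro conjI ballI)
  fix u v assume u: "u \<in> verts G" and v: "v \<in> verts G"
  let ?X = "{y \<in> verts G. (adj G)\<^sup>*\<^sup>* u y}"
  have "?X = verts G"
  proof (rule cl)
    show "?X \<noteq> {}" using u by auto
    fix x assume x: "x \<in> ?X"
    show "nb G x \<subseteq> ?X"
    proof
      fix y assume y: "y \<in> nb G x"
      then have "adj G x y" by (simp add: nb_def)
      then show "y \<in> ?X" using x y nb_verts by (auto intro: rtranclp.rtrancl_into_rtrancl)
    qed
  qed auto
  then show "(adj G)\<^sup>*\<^sup>* u v" using v by blast
qed (rule ne)

section \<open>Vertex connectivity against edge connectivity\<close>

context sgraph
begin

lemma simple_del: "simple_graph (del_verts G S)"
  using simple unfolding simple_graph_def del_verts_def by auto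

lemma nb_del: "y \<in> nb (del_verts G S) x \<longleftrightarrow> y \<in> nb G x \<and> x \<notin> S \<and> y \<notin> S"
  unfolding edge_iff_nb[symmetric] del_verts_def by auto

text \<open>Deleting one end of each edge of a small cut separates its sides as long as both keep a
  vertex. They do: of two cut edges the deleted ends are chosen on different sides, and a side with
  a cut below 3 is not a single vertex.\<close>

lemma k_edge_conn:
  assumes c: "cubic G" and k: "k_connected k G" "2 \<le> k" "k \<le> 3"
  shows "edge_conn k G"
  unfolding edge_conn_def
proof (intro conjI allI impI)
  show ne: "verts G \<noteq> {}" using k unfolding k_connected_def by auto
  fix X assume X: "X \<subset> verts G \<and> X \<noteq> {}"
  have n3: "card (nb G v) = 3" if "v \<in> verts G" for v using c that by (simp add: cubic_def degree_nb)
  show "k \<le> cut G X"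
  proof (rule ccontr)
    assume "\<not> ?thesis"
    then have ck: "cut G X < k" by simp
    have fX: "finite X" using X finite_sub by blast
    have two: "\<exists>x\<in>Z. x \<noteq> z" if Z: "Z \<subseteq> verts G" "Z \<noteq> {}" "cut G Z < k" for Z z
    proof (rule ccontr)
      assume "\<not> ?thesis"
      then have "Z = {z}" using Z(2) by auto
      then have "cut G Z = card (nb G z)" by simp
      then show False using n3[of z] Z \<open>Z = {z}\<close> k by simp
    qed
    define B where "B = Sigma X (\<lambda>x. nb G x \<inter> (verts G - X))"
    have cB: "card B = cut G X" unfolding B_def ec_def by (rule card_SigmaI) (use fX in auto)
    have finB: "finite B" unfolding B_def using fX by auto
    have "card B \<le> 2" using cB ck k by linarith
    then consider "B = {}" | x y where "B = {(x,y)}" "card B = 1" | x y x' y' where "B = {(x,y),(x',y')}" "card B = 2"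
    proof -
      assume cc: "card B \<le> 2"
      consider "card B = 0" | "card B = 1" | "card B = 2" using cc by linarith
      then show thesis
      proof cases
        case 1 then show thesis using finB that(1) by simp
      next
        case 2
        then obtain a where "B = {a}" by (auto simp: card_1_singleton_iff)
        then show thesis using that(2)[of "fst a" "snd a"] 2 by simp
      next
        case 3
        then obtain a b where "B = {a,b}" by (auto simp: card_2_iff)
        then show thesis using that(3)[of "fst a" "snd a" "fst b" "snd b"] 3 by simp
      qed
    qed
    then have "\<exists>S. S \<subseteq> verts G \<and> card S < k \<and> \<not> X \<subseteq> S \<and> \<not> verts G - X \<subseteq> S \<and> (\<forall>x y. (x,y) \<in> B \<longrightarrow> x \<in> S \<or> y \<in> S)"
    proof cases
      case 1 then show ?thesis using X k by (intro exI[of _ "{}"]) auto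
    next
      case 2
      then have "(x,y) \<in> B" by simp
      then have xy: "x \<in> X" "y \<in> verts G - X" using nb_verts[of y x] unfolding B_def by simp_all
      have "\<exists>z\<in>X. z \<noteq> x" using two[of X x] ck X by blast
      then show ?thesis using xy X 2(1) k by (intro exI[of _ "{x}"]) auto
    next
      case 3
      then have "(x,y) \<in> B" "(x',y') \<in> B" by simp_all
      then have xy: "x \<in> X" "y \<in> verts G - X" "x' \<in> X" "y' \<in> verts G - X"
        using nb_verts[of y x] nb_verts[of y' x'] unfolding B_def by simp_all
      have "cut G (verts G - X) < k" using cut_compl[of X] X ck by auto
      then have "\<exists>z\<in>verts G - X. z \<noteq> y'" using two[of "verts G - X" y'] xy by auto
      moreover have "\<exists>z\<in>X. z \<noteq> x" using two[of X x] ck X by auto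
      moreover have "card {x,y'} < k" using 3(2) cB ck by (simp add: card_insert_if)
      ultimately show ?thesis using xy X 3(1) by (intro exI[of _ "{x,y'}"]) auto
    qed
    then obtain S where S: "S \<subseteq> verts G" "card S < k" "\<not> X \<subseteq> S" "\<not> verts G - X \<subseteq> S"
      "\<And>x y. (x,y) \<in> B \<Longrightarrow> x \<in> S \<or> y \<in> S" by blast
    have "connected_graph (del_verts G S)" using k S unfolding k_connected_def by blast
    then have "X - S = verts (del_verts G S)"
    proof (rule connected_closed)
      show "X - S \<subseteq> verts (del_verts G S)" using X by (auto simp: del_verts_def)
      show "X - S \<noteq> {}" using S by auto
      fix x assume x: "x \<in> X - S"
      show "nb (del_verts G S) x \<subseteq> X - S"
      proof
        fix y assume "y \<in> nb (del_verts G S) x"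
        then have y: "y \<in> nb G x" "y \<notin> S" by (auto simp: nb_del)
        have "y \<in> X"
        proof (rule ccontr)
          assume "y \<notin> X"
          then have "(x,y) \<in> B" using x y nb_verts unfolding B_def by auto
          then show False using S(5) x y by auto
        qed
        then show "y \<in> X - S" using y by simp
      qed
    qed
    then show False using S(4) by (auto simp: del_verts_def)
  qed
qed

end

context cub3
begin

text \<open>Each side of a separator \<open>S\<close> has at least three edges to \<open>S\<close>,
  but two vertices have only six edge ends. So \<open>S\<close> has two vertices and sends exactly
  three edges to \<open>X\<close>; one vertex carries two of them, and moving it into
  \<open>X\<close> leaves a cut of size 2.\<close>

lemma k_connected3: "k_connected 3 G"
  unfolding k_connected_def
proof (intro conjI allI impI)
  show "3 < card (verts G)" using cardV_ge4 by simp
  fix S assume S: "S \<subseteq> verts G" "card S < 3"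
  interpret d: sgraph "del_verts G S" by unfold_locales (rule simple_del)
  have vd: "verts (del_verts G S) = verts G - S" by (simp add: del_verts_def)
  show "connected_graph (del_verts G S)"
  proof (rule d.closed_connected)
    show "verts (del_verts G S) \<noteq> {}"
    proof
      assume "verts (del_verts G S) = {}"
      then have "verts G \<subseteq> S" using vd by auto
      then have "card (verts G) \<le> card S" using S finite_sub card_mono by blast
      then show False using cardV_ge4 S by linarith
    qed
    fix X assume X: "X \<subseteq> verts (del_verts G S)" "X \<noteq> {}" and cl: "\<And>x. x \<in> X \<Longrightarrow> nb (del_verts G S) x \<subseteq> X"
    show "X = verts (del_verts G S)"
    proof (rule ccontr)
      assume ne: "X \<noteq> verts (del_verts G S)"
      define Y where "Y = verts G - S - X"
      have Y: "Y \<noteq> {}" "Y \<subseteq> verts G" "Y \<inter> X = {}" "Y \<inter> S = {}" using ne X vd unfolding Y_def by auto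
      have XV: "X \<subseteq> verts G" "X \<inter> S = {}" using X vd by auto
      have fin: "finite X" "finite Y" "finite S" using XV Y S finite_sub by auto
      have nbX: "nb G x \<subseteq> X \<union> S" if "x \<in> X" for x
        using cl[OF that] nb_del[of _ S x] that XV by blast
      have nbY: "nb G y \<subseteq> Y \<union> S" if "y \<in> Y" for y
      proof
        fix z assume z: "z \<in> nb G y"
        have "z \<notin> X"
        proof
          assume "z \<in> X"
          then have "y \<in> X \<union> S" using nbX[of z] z by (auto simp: nb_sym[of z])
          then show False using that Y by auto
        qed
        then show "z \<in> Y \<union> S" using z nb_verts unfolding Y_def by auto
      qed
      have cX: "cut G X = ec G S X"
      proof -
        have "cut G X = ec G X S"
        proof (rule ec_cong_right)
          fix x assume "x \<in> X"
          then show "nb G x \<inter> (verts G - X) = nb G x \<inter> S" using nbX[of x] XV S by auto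
        qed
        then show ?thesis using ec_sym fin by simp
      qed
      have cY: "cut G Y = ec G S Y"
      proof -
        have "cut G Y = ec G Y S"
        proof (rule ec_cong_right)
          fix x assume "x \<in> Y"
          then show "nb G x \<inter> (verts G - Y) = nb G x \<inter> S" using nbY[of x] Y S by auto
        qed
        then show ?thesis using ec_sym fin by simp
      qed
      have "ec G S (X \<union> Y) = ec G S X + ec G S Y" by (rule ec_Un2) (use Y in auto)
      moreover have "ec G S (X \<union> Y) \<le> ec G S (verts G)" by (rule ec_mono2) (use XV Y in auto)
      moreover have "ec G S (verts G) = 3 * card S" by (rule ec_V[OF S(1)])
      moreover have "X \<noteq> verts G" "Y \<noteq> verts G" using XV(1) Y(1-3) X(2) by blast+
      then have "3 \<le> cut G X" "3 \<le> cut G Y" using cut3[of X] cut3[of Y] XV Y X by auto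
      ultimately have c3: "ec G S X = 3" "card S = 2" using cX cY S(2) by linarith+
      then obtain s t where st: "S = {s,t}" "s \<noteq> t" by (auto simp: card_2_iff)
      have one: "card (nb G z \<inter> X) \<le> 1" if z: "z \<in> S" for z
      proof -
        have zz: "z \<in> verts G" "z \<notin> X" using z S XV by auto
        have "cut G (insert z X) + card (nb G z \<inter> X) = 3 + card (nb G z - X)"
          using cut_insert[of X z] XV zz cX c3 by simp
        moreover have "card (nb G z \<inter> X) + card (nb G z - X) = 3" using nb_split zz by blast
        moreover have "3 \<le> cut G (insert z X)" by (rule cut3) (use XV zz Y z in auto)
        ultimately show ?thesis by linarith
      qed
      have "ec G S X = card (nb G s \<inter> X) + card (nb G t \<inter> X)"
        using st ec_insert[of "{t}" s] by simp
      then show False using one[of s] one[of t] st c3 by simp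
    qed
  qed
qed

end

lemma (in sgraph) bip_balanced:
  assumes n3: "\<And>v. v \<in> verts G \<Longrightarrow> card (nb G v) = 3" and bp: "bip_on G P Q" "P \<union> Q = verts G"
  shows "card P = card Q"
proof -
  have cnt: "3 * card P = ec G P Q" if "bip_on G P Q" "P \<union> Q = verts G" for P Q
  proof -
    have "ec G P Q = (\<Sum>x\<in>P. 3)"
      unfolding ec_def
    proof (rule sum.cong[OF refl])
      fix x assume x: "x \<in> P"
      then have "nb G x \<inter> P = {}" using that unfolding bip_on_def by auto
      then have "nb G x \<inter> Q = nb G x" using that(2) nb_sub[of x] by auto
      then show "card (nb G x \<inter> Q) = 3" using n3[of x] x that(2) by auto
    qed
    then show ?thesis by simp
  qed
  have "bip_on G Q P" "Q \<union> P = verts G" using iffD1[OF bip_on_commute bp(1)] bp(2) by auto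
  then have "3 * card Q = ec G Q P" by (rule cnt)
  moreover have "finite P" "finite Q" using bp(2) finV by (metis finite_Un)+
  then have "ec G Q P = ec G P Q" by (intro ec_sym)
  ultimately show ?thesis using cnt[OF bp] by simp
qed

section \<open>Injective renaming of vertices\<close>

locale relabel = sgraph G for G :: "'a graph" +
  fixes f :: "'a \<Rightarrow> 'b"
  assumes inj: "inj_on f (verts G)"
begin

abbreviation "F \<equiv> map_graph f G"

lemma verts_map [simp]: "verts F = f ` verts G"
  by (simp add: map_graph_def)

lemma simple_map: "simple_graph F"
  unfolding simple_graph_def
proof (intro conjI ballI)
  fix e assume "e \<in> edges F"
  then obtain e0 where e0: "e = f ` e0" "e0 \<in> edges G" unfolding map_graph_def by auto
  then have s: "e0 \<subseteq> verts G" "card e0 = 2" using simple by (auto simp: simple_graph_def)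
  then show "e \<subseteq> verts F" using e0 by auto
  show "card e = 2" using e0 s inj card_image inj_on_subset by metis
qed simp

sublocale F: sgraph F
  by unfold_locales (rule simple_map)

lemma nb_map: assumes "x \<in> verts G" shows "nb F (f x) = f ` nb G x"
proof
  show "f ` nb G x \<subseteq> nb F (f x)"
  proof
    fix z assume "z \<in> f ` nb G x"
    then obtain y where y: "z = f y" "{x,y} \<in> edges G" by (auto simp: edge_iff_nb)
    then have "f ` {x,y} \<in> edges F" unfolding map_graph_def graph.sel by (rule_tac imageI)
    then show "z \<in> nb F (f x)" using y by (simp add: edge_iff_nb)
  qed
  show "nb F (f x) \<subseteq> f ` nb G x"
  proof
    fix z assume "z \<in> nb F (f x)"
    then have "{f x, z} \<in> (`) f ` edges G" by (simp add: edge_iff_nb[symmetric] map_graph_def)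
    then obtain e where e: "e \<in> edges G" "f ` e = {f x, z}" by auto
    obtain a b where ab: "e = {a,b}" "a \<in> verts G" "b \<in> verts G" "b \<in> nb G a" using edgeE e(1) by metis
    have "f a = f x \<and> f b = z \<or> f b = f x \<and> f a = z" using e(2) ab(1) by (auto simp: doubleton_eq_iff)
    then have "a = x \<and> f b = z \<or> b = x \<and> f a = z" using inj ab assms by (auto dest: inj_onD)
    then show "z \<in> f ` nb G x" using ab(4) by (auto simp: nb_sym[of b])
  qed
qed

lemma iso_map: "G \<cong>\<^sub>g F"
  unfolding graph_iso_def
proof (intro exI[of _ f] conjI ballI)
  show "bij_betw f (verts G) (verts F)" using inj by (simp add: bij_betw_def)
  fix u v assume uv: "u \<in> verts G" "v \<in> verts G"
  have "f v \<in> f ` nb G u \<longleftrightarrow> v \<in> nb G u" by (rule inj_on_image_mem_iff[OF inj uv(2) nb_sub])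
  then show "adj G u v \<longleftrightarrow> adj F (f u) (f v)" using nb_map[OF uv(1)] by (auto simp: nb_def)
qed

lemma card_map: "X \<subseteq> verts G \<Longrightarrow> card (f ` X) = card X"
  by (rule card_image) (rule inj_on_subset[OF inj])

lemma card_nb_map: "x \<in> verts G \<Longrightarrow> card (nb F (f x)) = card (nb G x)"
  using nb_map card_map[OF nb_sub] by simp

lemma cubic_map: "cubic G \<Longrightarrow> cubic F"
  using card_nb_map unfolding cubic_def by (auto simp: degree_nb F.degree_nb)

lemma bip_map:
  assumes "bip_on G P Q" "P \<subseteq> verts G" "Q \<subseteq> verts G" shows "bip_on F (f ` P) (f ` Q)"
proof -
  have *: "f ` A \<inter> f ` B = {}" if "A \<inter> B = {}" "A \<subseteq> verts G" "B \<subseteq> verts G" for A B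
    using inj_on_image_Int[OF inj that(2,3)] that(1) by simp
  show ?thesis
    unfolding bip_on_def
  proof (intro conjI ballI)
    show "f ` P \<inter> f ` Q = {}" using assms unfolding bip_on_def by (intro *) auto
    show "nb F z \<inter> f ` P = {}" if z: "z \<in> f ` P" for z
    proof -
      obtain x where x: "x \<in> P" "z = f x" using z by auto
      then have "nb G x \<inter> P = {}" using assms unfolding bip_on_def by auto
      then have "f ` nb G x \<inter> f ` P = {}" by (rule *) (use nb_sub assms in auto)
      then show ?thesis using nb_map[of x] x assms by auto
    qed
    show "nb F z \<inter> f ` Q = {}" if z: "z \<in> f ` Q" for z
    proof -
      obtain x where x: "x \<in> Q" "z = f x" using z by auto
      then have "nb G x \<inter> Q = {}" using assms unfolding bip_on_def by auto
      then have "f ` nb G x \<inter> f ` Q = {}" by (rule *) (use nb_sub assms in auto)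
      then show ?thesis using nb_map[of x] x assms by auto
    qed
  qed
qed

lemma bipartite_map: "bipartite G \<Longrightarrow> bipartite F"
proof -
  assume "bipartite G"
  then obtain P Q where PQ: "P \<union> Q = verts G" "bip_on G P Q" using bipartite_iff by auto
  then have "bip_on F (f ` P) (f ` Q)" by (intro bip_map) auto
  moreover have "f ` P \<union> f ` Q = verts F" using PQ by auto
  ultimately show ?thesis using F.bipartite_iff by blast
qed

lemma cut_map: assumes "X \<subseteq> verts G" shows "cut F (f ` X) = cut G X"
proof -
  have inj': "inj_on f X" using inj assms inj_on_subset by blast
  have "cut F (f ` X) = (\<Sum>x\<in>X. card (nb F (f x) \<inter> (verts F - f ` X)))"
    unfolding ec_def using sum.reindex[OF inj'] by (simp add: o_def)
  also have "\<dots> = (\<Sum>x\<in>X. card (nb G x \<inter> (verts G - X)))"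
  proof (rule sum.cong[OF refl])
    fix x assume x: "x \<in> X"
    have "verts F - f ` X = f ` (verts G - X)" using inj_on_image_set_diff[OF inj, of "verts G" X] assms by auto
    then have "nb F (f x) \<inter> (verts F - f ` X) = f ` (nb G x \<inter> (verts G - X))"
      using nb_map[of x] x assms inj_on_image_Int[OF inj nb_sub, of "verts G - X" x] by auto
    then show "card (nb F (f x) \<inter> (verts F - f ` X)) = card (nb G x \<inter> (verts G - X))"
      using card_map[of "nb G x \<inter> (verts G - X)"] nb_sub[of x] by auto
  qed
  finally show ?thesis unfolding ec_def .
qed

lemma edge_conn_map: assumes "edge_conn k G" shows "edge_conn k F"
  unfolding edge_conn_def
proof (intro conjI allI impI)
  show "verts F \<noteq> {}" using assms unfolding edge_conn_def by simp
  fix Z assume Z: "Z \<subset> verts F \<and> Z \<noteq> {}"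
  define X where "X = {x \<in> verts G. f x \<in> Z}"
  have "Z = f ` X" using Z unfolding X_def by auto
  then have "X \<subset> verts G" "X \<noteq> {}" using Z unfolding X_def by auto
  then show "k \<le> cut F Z" using assms cut_map[of X] \<open>Z = f ` X\<close> unfolding edge_conn_def by auto
qed

lemma connected_map: assumes "connected_graph G" shows "connected_graph F"
proof (rule F.closed_connected)
  show "verts F \<noteq> {}" using assms unfolding connected_graph_def by simp
  fix Z assume Z: "Z \<subseteq> verts F" "Z \<noteq> {}" "\<And>x. x \<in> Z \<Longrightarrow> nb F x \<subseteq> Z"
  define X where "X = {x \<in> verts G. f x \<in> Z}"
  have ZX: "Z = f ` X" using Z unfolding X_def by auto
  have "X = verts G"
  proof (rule connected_closed[OF assms])
    show "X \<subseteq> verts G" "X \<noteq> {}" using Z unfolding X_def by auto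
    fix x assume "x \<in> X"
    then have "f ` nb G x \<subseteq> Z" using Z(3)[of "f x"] nb_map[of x] unfolding X_def by auto
    then show "nb G x \<subseteq> X" using nb_sub unfolding X_def by auto
  qed
  then show "Z = verts F" using ZX by simp
qed

end

lemma graph_eqI:
  assumes "simple_graph G" "simple_graph H" "verts G = verts H" "\<And>x. x \<in> verts G \<Longrightarrow> nb G x = nb H x"
  shows "G = H"
proof -
  have sub: "edges G \<subseteq> edges H"
    if s: "simple_graph G" "verts G = verts H" "\<And>x. x \<in> verts G \<Longrightarrow> nb G x = nb H x" for G H :: "'a graph"
  proof
    interpret sgraph G by unfold_locales (rule s(1))
    fix e assume "e \<in> edges G"
    then obtain a b where "e = {a,b}" "a \<in> verts G" "b \<in> nb G a" using edgeE by metis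
    then show "e \<in> edges H" using s(3) by (simp add: edge_iff_nb)
  qed
  have "edges G = edges H" using sub[OF assms(1,3,4)] sub[OF assms(2) assms(3)[symmetric]] assms(3,4) by auto
  then show ?thesis using assms(3) by (cases G; cases H) auto
qed

text \<open>For pulling vertex partitions such as \<open>core6\<close> and \<open>k4like\<close>
  back along an isomorphism: neighbourhoods and the sizes of parts carry over to preimages.\<close>

lemma iso_preimage:
  assumes "simple_graph G" "bij_betw f (verts G) (verts F)"
    "\<forall>u\<in>verts G. \<forall>v\<in>verts G. adj G u v \<longleftrightarrow> adj F (f u) (f v)"
  shows "\<And>x y. y \<in> nb G x \<Longrightarrow> x \<in> verts G \<and> y \<in> verts G \<and> f y \<in> nb F (f x)"
    "\<And>A. A \<subseteq> verts F \<Longrightarrow> card {x \<in> verts G. f x \<in> A} = card A"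
proof -
  interpret sgraph G by unfold_locales (rule assms(1))
  show "x \<in> verts G \<and> y \<in> verts G \<and> f y \<in> nb F (f x)" if "y \<in> nb G x" for x y
    using nb_verts[OF that] that assms(3) by (simp add: nb_def)
  show "card {x \<in> verts G. f x \<in> A} = card A" if "A \<subseteq> verts F" for A
  proof (rule bij_betw_same_card)
    show "bij_betw f {x \<in> verts G. f x \<in> A} A"
      using assms(2) that by (auto simp: bij_betw_def inj_on_def)
  qed
qed

lemma core6_iso:
  assumes "simple_graph G" "G \<cong>\<^sub>g F" "core6 F T B P1 Q1 P2 Q2"
  shows "six_struct G"
proof -
  obtain f where f: "bij_betw f (verts G) (verts F)"
    "\<forall>u\<in>verts G. \<forall>v\<in>verts G. adj G u v \<longleftrightarrow> adj F (f u) (f v)"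
    using assms(2) unfolding graph_iso_def by blast
  note pre = iso_preimage[OF assms(1) f]
  define g where "g A = {x \<in> verts G. f x \<in> A}" for A
  have V: "verts F = T \<union> B \<union> P1 \<union> Q1 \<union> P2 \<union> Q2"
    and dj: "T \<inter> B = {}" "(T \<union> B) \<inter> (P1 \<union> Q1 \<union> P2 \<union> Q2) = {}"
     "P1 \<inter> Q1 = {}" "P2 \<inter> Q2 = {}" "(P1 \<union> Q1) \<inter> (P2 \<union> Q2) = {}"
    and cd: "card T = 3" "card B = 3" "card P1 = card Q1 + 1" "card P2 = card Q2 + 1"
    and nbs: "\<And>x. x \<in> T \<Longrightarrow> nb F x \<subseteq> T \<union> B" "\<And>x. x \<in> B \<Longrightarrow> nb F x \<subseteq> T \<union> P1 \<union> P2"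
     "\<And>x. x \<in> P1 \<Longrightarrow> nb F x \<subseteq> B \<union> Q1" "\<And>x. x \<in> Q1 \<Longrightarrow> nb F x \<subseteq> P1"
     "\<And>x. x \<in> P2 \<Longrightarrow> nb F x \<subseteq> B \<union> Q2" "\<And>x. x \<in> Q2 \<Longrightarrow> nb F x \<subseteq> P2"
    using assms(3) unfolding core6_def by simp_all
  have gU: "g (A \<union> A') = g A \<union> g A'" for A A' unfolding g_def by auto
  have gI: "A \<inter> A' = {} \<Longrightarrow> g A \<inter> g A' = {}" for A A' unfolding g_def by auto
  have gn: "nb G x \<subseteq> g A'" if "x \<in> g A" "\<And>y. y \<in> A \<Longrightarrow> nb F y \<subseteq> A'" for x A A'
    using that pre(1) unfolding g_def by blast
  have gc: "card (g A) = card A" if "A \<subseteq> verts F" for A using pre(2)[OF that] unfolding g_def .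
  have sub: "T \<subseteq> verts F" "B \<subseteq> verts F" "P1 \<subseteq> verts F" "Q1 \<subseteq> verts F" "P2 \<subseteq> verts F" "Q2 \<subseteq> verts F"
    using V by auto
  have "core6 G (g T) (g B) (g P1) (g Q1) (g P2) (g Q2)"
    unfolding core6_def
  proof (intro conjI ballI)
    have "verts G = g (verts F)" using f(1) unfolding g_def bij_betw_def by auto
    then show "verts G = g T \<union> g B \<union> g P1 \<union> g Q1 \<union> g P2 \<union> g Q2" using V gU by simp
  qed (use gI[OF dj(1)] gI[OF dj(2)] gI[OF dj(3)] gI[OF dj(4)] gI[OF dj(5)] gc[OF sub(1)] gc[OF sub(2)]
      gc[OF sub(3)] gc[OF sub(4)] gc[OF sub(5)] gc[OF sub(6)] cd
      gn[OF _ nbs(1)] gn[OF _ nbs(2)] gn[OF _ nbs(3)] gn[OF _ nbs(4)] gn[OF _ nbs(5)] gn[OF _ nbs(6)]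
      in \<open>simp_all add: gU\<close>)
  then show ?thesis unfolding six_struct_def by blast
qed

lemma k4like_iso:
  assumes "simple_graph G" "G \<cong>\<^sub>g F" "k4like F K l"
  shows "\<exists>K l. k4like G K l"
proof -
  obtain f where f: "bij_betw f (verts G) (verts F)"
    "\<forall>u\<in>verts G. \<forall>v\<in>verts G. adj G u v \<longleftrightarrow> adj F (f u) (f v)"
    using assms(2) unfolding graph_iso_def by blast
  note pre = iso_preimage[OF assms(1) f]
  have K: "K \<subseteq> verts F" "card K = 4" and lK: "\<And>v. v \<in> verts F - K \<Longrightarrow> fst (l v) \<in> K \<and> snd (l v) \<in> K \<and> fst (l v) \<noteq> snd (l v)"
    and ln: "\<And>u v. u \<in> verts F - K \<Longrightarrow> v \<in> nb F u \<Longrightarrow> v = fst (l u) \<or> v \<notin> K \<and> l v = prod.swap (l u)"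
    and lc: "\<And>p. card {v \<in> verts F - K. l v = p} = card {v \<in> verts F - K. l v = prod.swap p}"
    using assms(3) unfolding k4like_def by blast+
  define g where "g = inv_into (verts G) f"
  have gf: "g (f x) = x" if "x \<in> verts G" for x
    using f(1) that unfolding g_def bij_betw_def by (auto intro: inv_into_f_f)
  have fg: "f (g z) = z" "g z \<in> verts G" if "z \<in> verts F" for z
    using f(1) that unfolding g_def bij_betw_def by (auto intro: f_inv_into_f inv_into_into)
  have fV: "f x \<in> verts F" if "x \<in> verts G" for x using f(1) that unfolding bij_betw_def by auto
  define K' where "K' = {x \<in> verts G. f x \<in> K}"
  define l' where "l' x = map_prod g g (l (f x))" for x
  have lcF: "fst (l (f v)) \<in> verts F" "snd (l (f v)) \<in> verts F" if "v \<in> verts G - K'" for v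
    using lK[of "f v"] that fV[of v] K unfolding K'_def by auto
  have "k4like G K' l'"
    unfolding k4like_def
  proof (intro conjI ballI allI)
    show "K' \<subseteq> verts G" "card K' = 4" using pre(2)[OF K(1)] K unfolding K'_def by auto
    fix v assume v: "v \<in> verts G - K'"
    then have "f v \<in> verts F - K" using fV unfolding K'_def by auto
    note lv = lK[OF this] lcF[OF v]
    show "fst (l' v) \<in> K'" "snd (l' v) \<in> K'" using lv fg unfolding l'_def K'_def by auto
    show "fst (l' v) \<noteq> snd (l' v)"
      using lv fg(1)[OF lv(2)] fg(1)[OF lv(3)] unfolding l'_def by (metis fst_map_prod snd_map_prod)
  next
    fix u v assume u: "u \<in> verts G - K'" and v: "v \<in> nb G u"
    have fu: "f u \<in> verts F - K" using u fV unfolding K'_def by auto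
    have vv: "v \<in> verts G" "f v \<in> nb F (f u)" using pre(1)[OF v] by auto
    from ln[OF fu vv(2)] show "v = fst (l' u) \<or> v \<notin> K' \<and> l' v = prod.swap (l' u)"
    proof
      assume "f v = fst (l (f u))"
      then show ?thesis using gf[OF vv(1)] unfolding l'_def by simp
    next
      assume "f v \<notin> K \<and> l (f v) = prod.swap (l (f u))"
      then show ?thesis unfolding l'_def K'_def by (cases "l (f u)") auto
    qed
  next
    fix p
    \<comment> \<open>Labels of \<open>G\<close> consist of vertices of \<open>G\<close>, so a pair
      with an entry elsewhere never occurs; hence the default 0.\<close>
    have cnt: "card {v \<in> verts G - K'. l' v = q} =
      (if fst q \<in> verts G \<and> snd q \<in> verts G then card {v \<in> verts F - K. l v = map_prod f f q} else 0)" for q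
    proof (cases "fst q \<in> verts G \<and> snd q \<in> verts G")
      case True
      have "{v \<in> verts G - K'. l' v = q} = {x \<in> verts G. f x \<in> {v \<in> verts F - K. l v = map_prod f f q}}"
      proof (rule set_eqI)
        fix x
        have "l' x = q \<longleftrightarrow> l (f x) = map_prod f f q" if "x \<in> verts G - K'"
          using lcF[OF that] fg gf True unfolding l'_def
          by (cases q; cases "l (f x)") auto
        then show "x \<in> {v \<in> verts G - K'. l' v = q} \<longleftrightarrow> x \<in> {x \<in> verts G. f x \<in> {v \<in> verts F - K. l v = map_prod f f q}}"
          using fV unfolding K'_def by auto
      qed
      then show ?thesis using True pre(2)[of "{v \<in> verts F - K. l v = map_prod f f q}"] by auto
    next
      case False
      have "{v \<in> verts G - K'. l' v = q} = {}"
        using lcF fg(2) False unfolding l'_def by fastforce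
      then show ?thesis using False by (auto simp: card_eq_0_iff)
    qed
    have "map_prod f f (prod.swap p) = prod.swap (map_prod f f p)" by (cases p) auto
    then show "card {v \<in> verts G - K'. l' v = p} = card {v \<in> verts G - K'. l' v = prod.swap p}"
      unfolding cnt using lc[of "map_prod f f p"] by auto
  qed
  then show ?thesis by blast
qed

section \<open>The splicing families\<close>

lemma edges_K33: "edges K33tri = {{1,2},{2,3},{3,1},{1,4},{2,5},{3,6},{7,4},{7,5},{7,6},{8,4},{8,5},{8,6}}"
proof -
  have 1: "{{tv i, bv i} | i. i \<in> {1, 2, 3}} = (\<lambda>i. {tv i, bv i}) ` {1, 2, 3}" by blast
  have 2: "{{av j, bv i} | j i. j \<in> {1, 2} \<and> i \<in> {1, 2, 3}} = (\<Union>j\<in>{1, 2}. (\<lambda>i. {av j, bv i}) ` {1, 2, 3})"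
    by blast
  show ?thesis unfolding K33tri_def graph.sel 1 2 by (simp add: tv_def bv_def av_def insert_commute)
qed

lemma verts_K33: "verts K33tri = {1,2,3,4,5,6,7,8}"
  unfolding K33tri_def tv_def bv_def av_def by auto

lemma nb_K33:
  "nb K33tri 1 = {2,3,4}" "nb K33tri 2 = {1,3,5}" "nb K33tri 3 = {1,2,6}"
  "nb K33tri 4 = {1,7,8}" "nb K33tri 5 = {2,7,8}" "nb K33tri 6 = {3,7,8}"
  "nb K33tri 7 = {4,5,6}" "nb K33tri 8 = {4,5,6}"
  unfolding nb_def adj_def edges_K33 by (auto simp: doubleton_eq_iff)

lemma simple_K33: "simple_graph K33tri"
  unfolding simple_graph_def edges_K33 verts_K33 by auto

lemma core6_K33: "core6 K33tri {1,2,3} {4,5,6} {7} {} {8} {}"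
  unfolding core6_def verts_K33
proof (intro conjI)
  show "\<forall>x\<in>{1, 2, 3}. nb K33tri x \<subseteq> {1, 2, 3} \<union> {4, 5, 6}"
    "\<forall>x\<in>{4, 5, 6}. nb K33tri x \<subseteq> {1, 2, 3} \<union> {7} \<union> {8}"
    "\<forall>x\<in>{7}. nb K33tri x \<subseteq> {4, 5, 6} \<union> {}" "\<forall>x\<in>{8}. nb K33tri x \<subseteq> {4, 5, 6} \<union> {}"
    by (simp_all only: ball_simps nb_K33) auto
qed auto

section \<open>Spliced graphs have a core\<close>

lemma nb_splice: "y \<in> nb (splice G1 G2 u v \<phi>) x \<longleftrightarrow>
    y \<in> nb G1 x \<and> x \<noteq> u \<and> y \<noteq> u \<or> y \<in> nb G2 x \<and> x \<noteq> v \<and> y \<noteq> v \<or>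
    x \<in> nb G1 u \<and> y \<in> nb G2 v \<and> \<phi> {u, x} = {v, y} \<or>
    y \<in> nb G1 u \<and> x \<in> nb G2 v \<and> \<phi> {u, y} = {v, x}"
  unfolding edge_iff_nb[symmetric] splice_def del_verts_def
  by (auto simp: doubleton_eq_iff)

lemma verts_splice: "verts (splice G1 G2 u v \<phi>) = (verts G1 - {u}) \<union> (verts G2 - {v})"
  by (simp add: splice_def)

lemma simple_splice:
  assumes "simple_graph G1" "simple_graph G2" "verts G1 \<inter> verts G2 = {}"
  shows "simple_graph (splice G1 G2 u v \<phi>)"
proof -
  interpret a: sgraph G1 by unfold_locales (rule assms)
  interpret b: sgraph G2 by unfold_locales (rule assms)
  show ?thesis
    unfolding simple_graph_def
  proof (intro conjI ballI)
    show "finite (verts (splice G1 G2 u v \<phi>))" by (simp add: verts_splice)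
    fix e assume "e \<in> edges (splice G1 G2 u v \<phi>)"
    then consider "e \<in> edges G1" "u \<notin> e" | "e \<in> edges G2" "v \<notin> e"
      | x y where "e = {x,y}" "x \<in> nb G1 u" "y \<in> nb G2 v"
      unfolding splice_def del_verts_def by (auto simp: edge_iff_nb)
    then have "e \<subseteq> verts (splice G1 G2 u v \<phi>) \<and> card e = 2"
    proof cases
      case 1 then show ?thesis using assms(1) unfolding simple_graph_def verts_splice by auto
    next
      case 2 then show ?thesis using assms(2) unfolding simple_graph_def verts_splice by auto
    next
      case 3
      have "x \<in> verts G1" "x \<noteq> u" "y \<in> verts G2" "y \<noteq> v"
        using 3 a.nb_verts b.nb_verts a.nb_irrefl b.nb_irrefl by blast+
      moreover from this have "x \<noteq> y" using assms(3) by auto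
      ultimately show ?thesis using 3(1) unfolding verts_splice by simp
    qed
    then show "e \<subseteq> verts (splice G1 G2 u v \<phi>)" "card e = 2" by auto
  qed
qed

text \<open>The trivial piece \<open>{a}\<close> is exchanged for \<open>H\<close> without
  \<open>v\<close>. The class of \<open>H\<close> opposite to \<open>v\<close> receives the edges
  from \<open>B\<close>, and the loss of \<open>v\<close> in its own class produces the imbalance of
  one.\<close>

lemma splice_core6:
  assumes c6: "core6 G1 T B {a} {} P2 Q2" and s1: "simple_graph G1"
    and H: "H \<in> cubic_bip3" "v \<in> verts H" and dj: "verts G1 \<inter> verts H = {}"
  shows "\<exists>P Q. core6 (splice G1 H a v \<phi>) T B P Q P2 Q2"
proof -
  interpret g: sgraph G1 by unfold_locales (rule s1)
  interpret h: sgraph H by unfold_locales (use H in \<open>simp add: cubic_bip3_def\<close>)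
  have cH: "cubic H" "bipartite H" using H by (auto simp: cubic_bip3_def)
  obtain P0 Q0 where PQ0: "P0 \<union> Q0 = verts H" "bip_on H P0 Q0" using cH h.bipartite_iff by auto
  obtain Q P where PQ: "Q \<union> P = verts H" "bip_on H Q P" "v \<in> Q"
  proof (cases "v \<in> P0")
    case True then show ?thesis using that[of P0 Q0] PQ0 by auto
  next
    case False
    then have "v \<in> Q0" using PQ0 H by auto
    then show ?thesis using that[of Q0 P0] PQ0 iffD1[OF bip_on_commute PQ0(2)] by auto
  qed
  have b: "Q \<inter> P = {}" "\<And>x. x \<in> Q \<Longrightarrow> nb H x \<subseteq> P" "\<And>x. x \<in> P \<Longrightarrow> nb H x \<subseteq> Q"
    using PQ h.nb_sub unfolding bip_on_def by blast+
  have "card Q = card P"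
    by (rule h.bip_balanced) (use cH PQ in \<open>auto simp: cubic_def h.degree_nb\<close>)
  moreover have "finite Q" using PQ(1) h.finV by (metis finite_Un)
  ultimately have cd: "card P = card (Q - {v}) + 1" using PQ(3) by (metis card_Suc_Diff1 Suc_eq_plus1)
  have V: "verts G1 = T \<union> B \<union> {a} \<union> P2 \<union> Q2" using c6 unfolding core6_def by simp
  have djs: "T \<inter> B = {}" "(T \<union> B) \<inter> ({a} \<union> P2 \<union> Q2) = {}" "P2 \<inter> Q2 = {}" "a \<notin> P2" "a \<notin> Q2"
    "card T = 3" "card B = 3" "card P2 = card Q2 + 1"
    using c6 unfolding core6_def by auto
  have nbs: "\<And>x. x \<in> T \<Longrightarrow> nb G1 x \<subseteq> T \<union> B" "\<And>x. x \<in> B \<Longrightarrow> nb G1 x \<subseteq> T \<union> {a} \<union> P2"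
     "nb G1 a \<subseteq> B" "\<And>x. x \<in> P2 \<Longrightarrow> nb G1 x \<subseteq> B \<union> Q2" "\<And>x. x \<in> Q2 \<Longrightarrow> nb G1 x \<subseteq> P2"
    using c6 unfolding core6_def by auto
  let ?S = "splice G1 H a v \<phi>"
  have nH: "nb H x = {}" if "x \<in> verts G1" for x using that dj h.nb_verts by blast
  have nG: "nb G1 x = {}" if "x \<in> verts H" for x using that dj g.nb_verts by blast
  have s1: "nb ?S x \<subseteq> (nb G1 x - {a}) \<union> (if x \<in> nb G1 a then P else {})" if "x \<in> verts G1" for x
  proof
    fix y assume "y \<in> nb ?S x"
    then show "y \<in> (nb G1 x - {a}) \<union> (if x \<in> nb G1 a then P else {})"
      unfolding nb_splice using nH[OF that] b(2)[OF PQ(3)] h.nb_verts[of x v] that dj by auto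
  qed
  have s2: "nb ?S x \<subseteq> (nb H x - {v}) \<union> (if x \<in> nb H v then nb G1 a else {})" if "x \<in> verts H" for x
  proof
    fix y assume "y \<in> nb ?S x"
    then show "y \<in> (nb H x - {v}) \<union> (if x \<in> nb H v then nb G1 a else {})"
      unfolding nb_splice using nG[OF that] g.nb_verts[of x a] that dj by auto
  qed
  have sub: "T \<subseteq> verts G1" "B \<subseteq> verts G1" "P2 \<subseteq> verts G1" "Q2 \<subseteq> verts G1" "P \<subseteq> verts H" "Q \<subseteq> verts H" using V PQ by auto
  have nT: "nb ?S x \<subseteq> T \<union> B" if "x \<in> T" for x
    using s1[OF subsetD[OF sub(1) that]] that nbs(1)[OF that] nbs(3) djs(1) by (auto split: if_splits)
  have nB: "nb ?S x \<subseteq> T \<union> P \<union> P2" if "x \<in> B" for x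
    using s1[OF subsetD[OF sub(2) that]] that nbs(2)[OF that] by (auto split: if_splits)
  have nP: "nb ?S x \<subseteq> B \<union> (Q - {v})" if "x \<in> P" for x
    using s2[OF subsetD[OF sub(5) that]] that b(3)[OF that] nbs(3) by (auto split: if_splits)
  have nQ: "nb ?S x \<subseteq> P" if "x \<in> Q - {v}" for x
    using s2[OF subsetD[OF sub(6) DiffD1[OF that]]] that b(2)[of x] b(1) b(2)[OF PQ(3)] by (auto split: if_splits)
  have nP2: "nb ?S x \<subseteq> B \<union> Q2" if "x \<in> P2" for x
    using s1[OF subsetD[OF sub(3) that]] that nbs(4)[OF that] nbs(3) djs(2) by (auto split: if_splits)
  have nQ2: "nb ?S x \<subseteq> P2" if "x \<in> Q2" for x
    using s1[OF subsetD[OF sub(4) that]] that nbs(5)[OF that] nbs(3) djs(2) by (auto split: if_splits)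
  have "core6 ?S T B P (Q - {v}) P2 Q2"
    unfolding core6_def
  proof (intro conjI ballI)
    show "verts ?S = T \<union> B \<union> P \<union> (Q - {v}) \<union> P2 \<union> Q2"
      unfolding verts_splice V PQ(1)[symmetric] using djs b PQ(3) by auto
    show "(T \<union> B) \<inter> (P \<union> (Q - {v}) \<union> P2 \<union> Q2) = {}" "(P \<union> (Q - {v})) \<inter> (P2 \<union> Q2) = {}"
      using djs sub dj by auto
    show "P \<inter> (Q - {v}) = {}" using b by auto
  qed (use djs cd nT nB nP nQ nP2 nQ2 in auto)
  then show ?thesis by blast
qed

text \<open>In \<open>K33tri\<close> both pieces are trivial and each splice fills one of them;
  \<open>core6_sym\<close> brings the piece that is still trivial into the position that
  \<open>splice_core6\<close> expects.\<close>

lemma family_core6: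
  assumes "F \<in> {K33tri} \<union> family_G1 \<union> family_G2"
  shows "\<exists>T B P1 Q1 P2 Q2. core6 F T B P1 Q1 P2 Q2"
proof -
  note k1 = core6_K33 and k2 = core6_sym[OF core6_K33]
  consider "F = K33tri" | "F \<in> family_G1" | "F \<in> family_G2" using assms by blast
  then show ?thesis
  proof cases
    case 1 then show ?thesis using k1 by blast
  next
    case 2
    then obtain H u v \<phi> where F: "F = splice K33tri H u v \<phi>" "u \<in> {av 1, av 2}" "H \<in> cubic_bip3"
      "v \<in> verts H" "verts K33tri \<inter> verts H = {}"
      unfolding family_G1_def by blast
    from F(2) consider "u = 7" | "u = 8" by (auto simp: av_def)
    then show ?thesis
    proof cases
      case 1 then show ?thesis using splice_core6[OF k1 simple_K33 F(3-5)] F(1) by blast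
    next
      case 2 then show ?thesis using splice_core6[OF k2 simple_K33 F(3-5)] F(1) by blast
    qed
  next
    case 3
    then obtain G' H1 H2 v1 v2 \<phi>1 \<phi>2 where F: "F = splice G' H2 (av 2) v2 \<phi>2"
      "H1 \<in> cubic_bip3" "v1 \<in> verts H1" "verts K33tri \<inter> verts H1 = {}"
      "G' = splice K33tri H1 (av 1) v1 \<phi>1"
      "H2 \<in> cubic_bip3" "v2 \<in> verts H2" "verts G' \<inter> verts H2 = {}"
      unfolding family_G2_def by blast
    have "av 1 = 7" "av 2 = 8" by (auto simp: av_def)
    then obtain P Q where "core6 G' {1,2,3} {4,5,6} P Q {8} {}"
      using splice_core6[OF k1 simple_K33 F(2-4)] F(5) by metis
    then have c: "core6 G' {1,2,3} {4,5,6} {8} {} P Q" by (rule core6_sym)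
    have "simple_graph H1" using F(2) by (simp add: cubic_bip3_def)
    then have "simple_graph G'" unfolding F(5) using simple_splice[OF simple_K33 _ F(4)] by blast
    from splice_core6[OF c this F(6-8)] show ?thesis using F(1) \<open>av 2 = 8\<close> by metis
  qed
qed

lemma (in sgraph) edges_at_eq: "edges_at G v = (\<lambda>u. {v, u}) ` nb G v"
proof
  show "edges_at G v \<subseteq> (\<lambda>u. {v, u}) ` nb G v"
  proof
    fix e assume e: "e \<in> edges_at G v"
    then obtain a b where "e = {a,b}" "b \<in> nb G a" unfolding edges_at_def using edgeE by blast
    then show "e \<in> (\<lambda>u. {v, u}) ` nb G v"
      using e nb_sym[of a G b] by (auto simp: edges_at_def)
  qed
qed (auto simp: edges_at_def edge_iff_nb)

text \<open>Splicing is inverse to contracting the two sides of a 3-edge cut: each cut edge survives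
  as one edge at \<open>a\<close> and one at \<open>v\<close>, and \<phi> pairs these two.\<close>

lemma (in cub) splice_contract:
  assumes C: "C \<subset> verts G" "C \<noteq> {}" "cut G C = 3" and one: "\<And>x. x \<in> C \<Longrightarrow> card (nb G x - C) \<le> 1"
    and one': "\<And>x. x \<in> verts G - C \<Longrightarrow> card (nb G x \<inter> C) \<le> 1"
    and a: "a \<notin> verts G - C" and v: "v \<notin> C"
  shows "\<exists>\<phi>. bij_betw \<phi> (edges_at (contract G (verts G - C) a) a) (edges_at (contract G C v) v) \<and>
     splice (contract G (verts G - C) a) (contract G C v) a v \<phi> = G"
proof -
  have CV: "C \<subseteq> verts G" using C by auto
  interpret c: contraction G C v by unfold_locales (use C one v in auto)
  interpret d: contraction G "verts G - C" a
  proof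
    show "verts G - C \<subset> verts G" using C by auto
    show "cut G (verts G - C) = 3" using cut_compl[OF CV] C by simp
    fix x assume x: "x \<in> verts G - C"
    have "nb G x - (verts G - C) = nb G x \<inter> C" using nb_sub CV by auto
    then show "card (nb G x - (verts G - C)) \<le> 1" using one'[OF x] by simp
  qed (rule a)
  let ?N = "nb d.H a" and ?M = "nb c.H v"
  have N: "x \<in> ?N \<longleftrightarrow> x \<in> verts G - C \<and> nb G x \<inter> C \<noteq> {}" for x
    unfolding d.nb_w using nb_sub[of x] CV by auto
  have M: "y \<in> ?M \<longleftrightarrow> y \<in> C \<and> \<not> nb G y \<subseteq> C" for y unfolding c.nb_w by auto
  define m where "m x = (THE y. y \<in> nb G x \<inter> C)" for x
  have m: "nb G x \<inter> C = {m x}" if "x \<in> ?N" for x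
  proof -
    have "card (nb G x \<inter> C) \<noteq> 0" "card (nb G x \<inter> C) \<le> 1" using that N one' by auto
    then obtain y where "nb G x \<inter> C = {y}" by (metis One_nat_def card_1_singleton_iff le_Suc_eq le_zero_eq)
    then show ?thesis unfolding m_def by simp
  qed
  have injm: "inj_on m ?N"
  proof (rule inj_onI)
    fix x x' assume x: "x \<in> ?N" "x' \<in> ?N" "m x = m x'"
    have "m x \<in> C" "m x \<in> nb G x" "m x \<in> nb G x'" using m[OF x(1)] m[OF x(2)] x(3) by auto
    then have "x \<in> nb G (m x)" "x' \<in> nb G (m x)" by (simp_all add: nb_sym)
    then have "{x,x'} \<subseteq> nb G (m x) - C" "m x \<in> C" using x(1,2) N \<open>m x \<in> C\<close> by simp_all
    then have "card {x,x'} \<le> 1" using card_mono[of "nb G (m x) - C" "{x,x'}"] one[of "m x"] by simp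
    then show "x = x'" by (cases "x = x'") auto
  qed
  have imm: "m ` ?N = ?M"
  proof
    show "m ` ?N \<subseteq> ?M"
    proof
      fix y assume "y \<in> m ` ?N"
      then obtain x where x: "x \<in> ?N" "y = m x" by auto
      then have "y \<in> C" "y \<in> nb G x" using m by auto
      then have "x \<in> nb G y" by (simp add: nb_sym)
      then show "y \<in> ?M" using M N x \<open>y \<in> C\<close> by blast
    qed
    show "?M \<subseteq> m ` ?N"
    proof
      fix y assume "y \<in> ?M"
      then obtain x where x: "y \<in> C" "x \<in> nb G y" "x \<notin> C" using M by auto
      then have "x \<in> ?N" "y \<in> nb G x" using N nb_verts by (auto simp: nb_sym[of x])
      then show "y \<in> m ` ?N" using m[of x] x by auto
    qed
  qed
  \<comment> \<open>Since \<phi> acts on edges, the end other than \<open>a\<close> is first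
    extracted from the edge and then sent across the cut by \<open>m\<close>.\<close>
  define \<phi> where "\<phi> e = {v, m (THE x. e = {a, x})}" for e
  have phi: "\<phi> {a, x} = {v, m x}" for x
  proof -
    have "(THE z. {a, x} = {a, z}) = x" by (rule the_equality) (auto simp: doubleton_eq_iff)
    then show ?thesis unfolding \<phi>_def by simp
  qed
  have "bij_betw \<phi> (edges_at d.H a) (edges_at c.H v)"
    unfolding d.H.edges_at_eq c.H.edges_at_eq bij_betw_def
  proof
    show "inj_on \<phi> ((\<lambda>u. {a, u}) ` ?N)"
    proof (rule inj_onI)
      fix e e' assume "e \<in> (\<lambda>u. {a, u}) ` ?N" "e' \<in> (\<lambda>u. {a, u}) ` ?N" "\<phi> e = \<phi> e'"
      then obtain x x' where x: "x \<in> ?N" "x' \<in> ?N" "e = {a,x}" "e' = {a,x'}" "{v, m x} = {v, m x'}"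
        using phi by auto
      then have "m x = m x'" by (auto simp: doubleton_eq_iff)
      then show "e = e'" using inj_onD[OF injm] x by blast
    qed
    show "\<phi> ` (\<lambda>u. {a, u}) ` ?N = (\<lambda>u. {v, u}) ` ?M"
      unfolding imm[symmetric] image_image phi ..
  qed
  moreover have "splice d.H c.H a v \<phi> = G"
  proof (rule graph_eqI)
    show sG: "simple_graph G" by (rule simple)
    let ?S = "splice d.H c.H a v \<phi>"
    show vS: "verts ?S = verts G" unfolding verts_splice using a v CV by auto
    have mm: "{v, m x} = {v, y} \<longleftrightarrow> m x = y" for x y by (auto simp: doubleton_eq_iff)
    have iff: "y \<in> nb ?S x \<longleftrightarrow> y \<in> nb G x \<and> x \<in> verts G - C \<and> y \<in> verts G - C \<or> y \<in> nb G x \<and> x \<in> C \<and> y \<in> C \<or>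
        x \<in> ?N \<and> m x = y \<or> y \<in> ?N \<and> m y = x" for x y
    proof -
      have "y \<in> nb d.H x \<and> x \<noteq> a \<and> y \<noteq> a \<longleftrightarrow> y \<in> nb G x \<and> x \<in> verts G - C \<and> y \<in> verts G - C"
        using a by (auto simp: d.nb_H)
      moreover have "y \<in> nb c.H x \<and> x \<noteq> v \<and> y \<noteq> v \<longleftrightarrow> y \<in> nb G x \<and> x \<in> C \<and> y \<in> C"
        using v by (auto simp: c.nb_H)
      moreover have "x \<in> ?N \<Longrightarrow> m x \<in> ?M" for x using imm by auto
      ultimately show ?thesis unfolding nb_splice phi mm by blast
    qed
    have cross: "x \<in> ?N \<and> m x = y \<longleftrightarrow> y \<in> nb G x \<and> x \<notin> C \<and> y \<in> C" for x y
    proof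
      assume "x \<in> ?N \<and> m x = y" then show "y \<in> nb G x \<and> x \<notin> C \<and> y \<in> C" using m N by auto
    next
      assume y: "y \<in> nb G x \<and> x \<notin> C \<and> y \<in> C"
      then have "x \<in> ?N" unfolding N using nb_verts[of y x] by auto
      moreover have "y \<in> nb G x \<inter> C" using y by simp
      ultimately show "x \<in> ?N \<and> m x = y" using m[of x] by auto
    qed
    show "simple_graph ?S"
      unfolding simple_graph_def
    proof (intro conjI ballI)
      show "finite (verts ?S)" using vS by simp
      fix e assume "e \<in> edges ?S"
      then consider "e \<in> edges d.H" "a \<notin> e" | "e \<in> edges c.H" "v \<notin> e"
        | x y where "e = {x,y}" "x \<in> ?N" "y \<in> ?M"
        unfolding splice_def del_verts_def by (auto simp: edge_iff_nb)
      then have "e \<subseteq> verts G \<and> card e = 2"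
      proof cases
        case 1 then show ?thesis using d.simpleH unfolding simple_graph_def by auto
      next
        case 2 then show ?thesis using c.simpleH CV unfolding simple_graph_def by auto
      next
        case 3 then show ?thesis using N M CV by (auto simp: card_2_iff)
      qed
      then show "e \<subseteq> verts ?S" "card e = 2" using vS by auto
    qed
    fix x assume "x \<in> verts ?S"
    show "nb ?S x = nb G x"
    proof (rule set_eqI)
      fix y
      have "x \<in> verts G \<and> y \<in> verts G" if "y \<in> nb G x" using nb_verts[OF that] by auto
      then show "y \<in> nb ?S x \<longleftrightarrow> y \<in> nb G x" unfolding iff cross using nb_sym[of x G y] by blast
    qed
  qed
  ultimately show ?thesis by blast
qed

section \<open>Recognising the splicing families\<close>

context cub3
begin

text \<open>A piece has \<open>3 * (card P - card Q) = 3\<close> edges to \<open>B\<close>; of the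
  nine edge ends at \<open>B\<close>, three remain for \<open>T\<close>. No vertex carries two edges
  of one of these 3-edge cuts, so \<open>T\<close> is a triangle and every vertex of
  \<open>B\<close> has one neighbour in each of \<open>T\<close>, \<open>P1\<close>,
  \<open>P2\<close>.\<close>

lemma core6_counts:
  assumes "core6 G T B P1 Q1 P2 Q2"
  shows "cut G T = 3" "cut G (P1 \<union> Q1) = 3" "cut G (P2 \<union> Q2) = 3"
    "\<And>x. x \<in> T \<Longrightarrow> nb G x \<inter> T = T - {x} \<and> card (nb G x \<inter> B) = 1"
    "\<And>b. b \<in> B \<Longrightarrow> card (nb G b \<inter> T) = 1 \<and> card (nb G b \<inter> P1) = 1 \<and> card (nb G b \<inter> P2) = 1"
    "\<And>x. x \<in> verts G - (P1 \<union> Q1) \<Longrightarrow> card (nb G x \<inter> (P1 \<union> Q1)) \<le> 1"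
    "\<And>x. x \<in> verts G - (P2 \<union> Q2) \<Longrightarrow> card (nb G x \<inter> (P2 \<union> Q2)) \<le> 1"
proof -
  have V: "verts G = T \<union> B \<union> P1 \<union> Q1 \<union> P2 \<union> Q2"
    and dj: "T \<inter> B = {}" "(T \<union> B) \<inter> (P1 \<union> Q1 \<union> P2 \<union> Q2) = {}"
     "P1 \<inter> Q1 = {}" "P2 \<inter> Q2 = {}" "(P1 \<union> Q1) \<inter> (P2 \<union> Q2) = {}"
    and cd: "card T = 3" "card B = 3" "card P1 = card Q1 + 1" "card P2 = card Q2 + 1"
    and nbs: "\<And>x. x \<in> T \<Longrightarrow> nb G x \<subseteq> T \<union> B" "\<And>x. x \<in> B \<Longrightarrow> nb G x \<subseteq> T \<union> P1 \<union> P2"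
     "\<And>x. x \<in> P1 \<Longrightarrow> nb G x \<subseteq> B \<union> Q1" "\<And>x. x \<in> Q1 \<Longrightarrow> nb G x \<subseteq> P1"
     "\<And>x. x \<in> P2 \<Longrightarrow> nb G x \<subseteq> B \<union> Q2" "\<And>x. x \<in> Q2 \<Longrightarrow> nb G x \<subseteq> P2"
    using assms(1) unfolding core6_def by simp_all
  have sub: "T \<subseteq> verts G" "B \<subseteq> verts G" "P1 \<subseteq> verts G" "Q1 \<subseteq> verts G" "P2 \<subseteq> verts G" "Q2 \<subseteq> verts G" using V by auto
  then have fin: "finite T" "finite B" "finite P1" "finite Q1" "finite P2" "finite Q2" using finite_sub by auto
  have side: "cut G (P \<union> Q) = ec G P B \<and> ec G P B = 3"
    if "P \<inter> Q = {}" "B \<inter> (P \<union> Q) = {}" "P \<subseteq> verts G" "Q \<subseteq> verts G" "finite P" "finite Q" "card P = card Q + 1"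
      "\<And>x. x \<in> P \<Longrightarrow> nb G x \<subseteq> B \<union> Q" "\<And>x. x \<in> Q \<Longrightarrow> nb G x \<subseteq> P" for P Q
  proof -
    have "cut G (P \<union> Q) = ec G P (verts G - (P \<union> Q)) + ec G Q (verts G - (P \<union> Q))"
      by (rule ec_Un1) (use that in auto)
    moreover have "ec G Q (verts G - (P \<union> Q)) = 0" unfolding ec_0_iff[OF that(6)] using that(9) by blast
    moreover have "ec G P (verts G - (P \<union> Q)) = ec G P B"
    proof (rule ec_cong_right)
      fix x assume "x \<in> P"
      then show "nb G x \<inter> (verts G - (P \<union> Q)) = nb G x \<inter> B" using that(8)[of x] that(1,2) sub(2) by auto
    qed
    moreover have "ec G P (verts G) = ec G P (B \<union> Q)"
      by (rule ec_cong_right) (use that(8) nb_sub in auto)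
    moreover have "ec G P (B \<union> Q) = ec G P B + ec G P Q" by (rule ec_Un2) (use that(2) in auto)
    moreover have "ec G Q (verts G) = ec G Q P"
      by (rule ec_cong_right) (use that(9) nb_sub in auto)
    moreover have "ec G Q P = ec G P Q" by (rule ec_sym) (use that in auto)
    ultimately show ?thesis using ec_V[OF that(3)] ec_V[OF that(4)] that(7) by linarith
  qed
  have 1: "cut G (P1 \<union> Q1) = ec G P1 B \<and> ec G P1 B = 3" by (rule side) (use dj sub fin cd nbs in auto)
  have 2: "cut G (P2 \<union> Q2) = ec G P2 B \<and> ec G P2 B = 3" by (rule side) (use dj sub fin cd nbs in auto)
  show c1: "cut G (P1 \<union> Q1) = 3" and c2: "cut G (P2 \<union> Q2) = 3" using 1 2 by auto
  have cT: "cut G T = ec G T B"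
  proof (rule ec_cong_right)
    fix x assume "x \<in> T"
    then show "nb G x \<inter> (verts G - T) = nb G x \<inter> B" using nbs(1)[of x] dj(1) sub(2) by auto
  qed
  have "ec G B T + (ec G B P1 + ec G B P2) = 9"
  proof -
    have "ec G B (verts G) = ec G B (T \<union> (P1 \<union> P2))"
      by (rule ec_cong_right) (use nbs(2) nb_sub in fastforce)
    also have "\<dots> = ec G B T + ec G B (P1 \<union> P2)" by (rule ec_Un2) (use dj in auto)
    also have "ec G B (P1 \<union> P2) = ec G B P1 + ec G B P2" by (rule ec_Un2) (use dj in auto)
    finally show ?thesis using ec_V[OF sub(2)] cd by simp
  qed
  moreover have "ec G B P1 = 3" "ec G B P2 = 3" "ec G B T = ec G T B" using 1 2 ec_sym fin by metis+
  ultimately show cT3: "cut G T = 3" using cT by linarith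
  have out: "card (nb G x \<inter> Z) \<le> 1" if "Z \<subseteq> verts G" "cut G Z = 3" "x \<in> verts G - Z" "B \<inter> Z = {}" for x Z
  proof -
    have "card B \<le> card (verts G - Z)" by (rule card_mono) (use sub that in auto)
    then have "2 \<le> card (verts G - Z)" using cd by simp
    then have "card (nb G x - (verts G - Z)) \<le> 1"
      using that cut_compl[OF that(1)] by (intro one_out) auto
    moreover have "nb G x - (verts G - Z) = nb G x \<inter> Z" using nb_sub that(1) by auto
    ultimately show ?thesis by simp
  qed
  show o1: "card (nb G x \<inter> (P1 \<union> Q1)) \<le> 1" if "x \<in> verts G - (P1 \<union> Q1)" for x
    by (rule out) (use sub dj that c1 in auto)
  show o2: "card (nb G x \<inter> (P2 \<union> Q2)) \<le> 1" if "x \<in> verts G - (P2 \<union> Q2)" for x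
    by (rule out) (use sub dj that c2 in auto)
  show "nb G x \<inter> T = T - {x} \<and> card (nb G x \<inter> B) = 1" if x: "x \<in> T" for x
  proof -
    have "card (nb G x - T) \<le> 1" by (rule one_out[OF sub(1) cT3 _ x]) (use cd in simp)
    moreover have "card (nb G x \<inter> T) + card (nb G x - T) = 3" using nb_split x sub by blast
    moreover have "nb G x \<inter> T \<subseteq> T - {x}" by auto
    moreover have "card (T - {x}) = 2" using cd x fin by simp
    moreover have "card (nb G x \<inter> T) \<le> card (T - {x})" by (rule card_mono) (use fin in auto)
    ultimately have "card (nb G x \<inter> T) = card (T - {x})" "card (nb G x - T) = 1" by linarith+
    moreover have "nb G x - T = nb G x \<inter> B" using nbs(1)[OF x] dj(1) by auto
    ultimately show ?thesis using \<open>nb G x \<inter> T \<subseteq> T - {x}\<close> fin by (metis card_subset_eq finite_Diff)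
  qed
  show "card (nb G b \<inter> T) = 1 \<and> card (nb G b \<inter> P1) = 1 \<and> card (nb G b \<inter> P2) = 1" if b: "b \<in> B" for b
  proof -
    have bn: "b \<in> verts G" "b \<notin> T" "b \<notin> P1 \<union> Q1" "b \<notin> P2 \<union> Q2" using b sub dj by auto
    have "card (nb G b \<inter> T) \<le> 1" by (rule out) (use sub cT3 bn dj in auto)
    moreover have "card (nb G b \<inter> P1) \<le> card (nb G b \<inter> (P1 \<union> Q1))" "card (nb G b \<inter> P2) \<le> card (nb G b \<inter> (P2 \<union> Q2))"
      by (rule card_mono; auto)+
    moreover have "card (nb G b) = card (nb G b \<inter> T) + card (nb G b \<inter> P1) + card (nb G b \<inter> P2)"
    proof -
      have "nb G b = (nb G b \<inter> T) \<union> (nb G b \<inter> P1) \<union> (nb G b \<inter> P2)" using nbs(2)[OF b] by auto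
      also have "card \<dots> = card ((nb G b \<inter> T) \<union> (nb G b \<inter> P1)) + card (nb G b \<inter> P2)"
        by (rule card_Un_disjoint) (use dj in auto)
      also have "card ((nb G b \<inter> T) \<union> (nb G b \<inter> P1)) = card (nb G b \<inter> T) + card (nb G b \<inter> P1)"
        by (rule card_Un_disjoint) (use dj in auto)
      finally show ?thesis .
    qed
    ultimately show ?thesis using o1[of b] o2[of b] bn nb_card[of b] by auto
  qed
qed

end

lemma (in relabel) core6_map:
  assumes "core6 G T B P1 Q1 P2 Q2"
  shows "core6 F (f ` T) (f ` B) (f ` P1) (f ` Q1) (f ` P2) (f ` Q2)"
proof -
  have V: "verts G = T \<union> B \<union> P1 \<union> Q1 \<union> P2 \<union> Q2"
    and dj: "T \<inter> B = {}" "(T \<union> B) \<inter> (P1 \<union> Q1 \<union> P2 \<union> Q2) = {}"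
     "P1 \<inter> Q1 = {}" "P2 \<inter> Q2 = {}" "(P1 \<union> Q1) \<inter> (P2 \<union> Q2) = {}"
    and cd: "card T = 3" "card B = 3" "card P1 = card Q1 + 1" "card P2 = card Q2 + 1"
    and nbs: "\<And>x. x \<in> T \<Longrightarrow> nb G x \<subseteq> T \<union> B" "\<And>x. x \<in> B \<Longrightarrow> nb G x \<subseteq> T \<union> P1 \<union> P2"
     "\<And>x. x \<in> P1 \<Longrightarrow> nb G x \<subseteq> B \<union> Q1" "\<And>x. x \<in> Q1 \<Longrightarrow> nb G x \<subseteq> P1"
     "\<And>x. x \<in> P2 \<Longrightarrow> nb G x \<subseteq> B \<union> Q2" "\<And>x. x \<in> Q2 \<Longrightarrow> nb G x \<subseteq> P2"
    using assms unfolding core6_def by simp_all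
  have I: "f ` A \<inter> f ` A' = {}" if "A \<inter> A' = {}" "A \<subseteq> verts G" "A' \<subseteq> verts G" for A A'
    using inj_on_image_Int[OF inj that(2,3)] that(1) by simp
  have n: "nb F z \<subseteq> f ` A'" if z: "z \<in> f ` A" and a: "A \<subseteq> verts G" "\<And>x. x \<in> A \<Longrightarrow> nb G x \<subseteq> A'" for z A A'
  proof -
    obtain x where x: "x \<in> A" "z = f x" using z by auto
    then have "nb F z = f ` nb G x" using nb_map a by auto
    then show ?thesis using a(2)[OF x(1)] by auto
  qed
  have sub: "T \<subseteq> verts G" "B \<subseteq> verts G" "P1 \<subseteq> verts G" "Q1 \<subseteq> verts G" "P2 \<subseteq> verts G" "Q2 \<subseteq> verts G" using V by auto
  show ?thesis
    unfolding core6_def image_Un[symmetric] verts_map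
  proof (intro conjI ballI)
    show "f ` verts G = f ` (T \<union> B \<union> P1 \<union> Q1 \<union> P2 \<union> Q2)" using V by simp
    show "f ` T \<inter> f ` B = {}" "f ` P1 \<inter> f ` Q1 = {}" "f ` P2 \<inter> f ` Q2 = {}"
      by (rule I; use dj sub in auto)+
    show "f ` (T \<union> B) \<inter> f ` (P1 \<union> Q1 \<union> P2 \<union> Q2) = {}" by (rule I[OF dj(2)]) (use sub in auto)
    show "f ` (P1 \<union> Q1) \<inter> f ` (P2 \<union> Q2) = {}" by (rule I[OF dj(5)]) (use sub in auto)
    show "card (f ` T) = 3" "card (f ` B) = 3" "card (f ` P1) = card (f ` Q1) + 1" "card (f ` P2) = card (f ` Q2) + 1"
      using card_map sub cd by simp_all
  qed (use n[OF _ sub(1) nbs(1)] n[OF _ sub(2) nbs(2)] n[OF _ sub(3) nbs(3)] n[OF _ sub(4) nbs(4)]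
      n[OF _ sub(5) nbs(5)] n[OF _ sub(6) nbs(6)] in simp_all)
qed

lemma core6D:
  assumes "core6 G T B P1 Q1 P2 Q2"
  shows "verts G = T \<union> B \<union> P1 \<union> Q1 \<union> P2 \<union> Q2"
    "T \<inter> B = {}" "(T \<union> B) \<inter> (P1 \<union> Q1 \<union> P2 \<union> Q2) = {}"
    "P1 \<inter> Q1 = {}" "P2 \<inter> Q2 = {}" "(P1 \<union> Q1) \<inter> (P2 \<union> Q2) = {}"
    "card T = 3" "card B = 3" "card P1 = card Q1 + 1" "card P2 = card Q2 + 1"
    "x \<in> T \<Longrightarrow> nb G x \<subseteq> T \<union> B" "x \<in> B \<Longrightarrow> nb G x \<subseteq> T \<union> P1 \<union> P2"
    "x \<in> P1 \<Longrightarrow> nb G x \<subseteq> B \<union> Q1" "x \<in> Q1 \<Longrightarrow> nb G x \<subseteq> P1"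
    "x \<in> P2 \<Longrightarrow> nb G x \<subseteq> B \<union> Q2" "x \<in> Q2 \<Longrightarrow> nb G x \<subseteq> P2"
  using assms unfolding core6_def by simp_all

lemma cub3I: "simple_graph G \<Longrightarrow> cubic G \<Longrightarrow> edge_conn 3 G \<Longrightarrow> cub3 G"
  by unfold_locales (auto intro: edge_conn_mono)

text \<open>A piece with \<open>Q2\<close> nonempty hangs on a 3-edge cut. Contracting it to
  \<open>a\<close> leaves a graph in which this piece is trivial; contracting the rest to
  \<open>v\<close> gives the 3-connected cubic bipartite graph that is spliced in. \<open>G\<close>
  is recovered by \<open>splice_contract\<close>.\<close>

lemma (in cub3) peel:
  assumes c6: "core6 G T B P1 Q1 P2 Q2" and Q2: "Q2 \<noteq> {}"
    and a: "a \<notin> verts G - (P2 \<union> Q2)" and v: "v \<notin> P2 \<union> Q2"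
  defines "G' \<equiv> contract G (verts G - (P2 \<union> Q2)) a" and "H \<equiv> contract G (P2 \<union> Q2) v"
  shows "cub3 G'" "core6 G' T B P1 Q1 {a} {}" "verts G' = insert a (T \<union> B \<union> P1 \<union> Q1)"
    "verts H = insert v (P2 \<union> Q2)" "simple_graph H" "k_connected 3 H" "cubic H" "bipartite H"
    "\<And>x y. x \<in> T \<Longrightarrow> y \<in> B \<Longrightarrow> y \<in> nb G x \<Longrightarrow> y \<in> nb G' x"
    "\<exists>\<phi>. bij_betw \<phi> (edges_at G' a) (edges_at H v) \<and> splice G' H a v \<phi> = G"
proof -
  note cnt = core6_counts[OF c6]
  have V: "verts G = T \<union> B \<union> P1 \<union> Q1 \<union> P2 \<union> Q2"
    and dj: "T \<inter> B = {}" "(T \<union> B) \<inter> (P1 \<union> Q1 \<union> P2 \<union> Q2) = {}"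
     "P1 \<inter> Q1 = {}" "P2 \<inter> Q2 = {}" "(P1 \<union> Q1) \<inter> (P2 \<union> Q2) = {}"
    and cd: "card T = 3" "card B = 3" "card P1 = card Q1 + 1" "card P2 = card Q2 + 1"
    and nbs: "\<And>x. x \<in> T \<Longrightarrow> nb G x \<subseteq> T \<union> B" "\<And>x. x \<in> B \<Longrightarrow> nb G x \<subseteq> T \<union> P1 \<union> P2"
     "\<And>x. x \<in> P1 \<Longrightarrow> nb G x \<subseteq> B \<union> Q1" "\<And>x. x \<in> Q1 \<Longrightarrow> nb G x \<subseteq> P1"
     "\<And>x. x \<in> P2 \<Longrightarrow> nb G x \<subseteq> B \<union> Q2" "\<And>x. x \<in> Q2 \<Longrightarrow> nb G x \<subseteq> P2"
    using c6 unfolding core6_def by simp_all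
  let ?C = "P2 \<union> Q2" and ?U = "verts G - (P2 \<union> Q2)"
  have U: "?U = T \<union> B \<union> P1 \<union> Q1" using V dj by auto
  have CV: "?C \<subseteq> verts G" using V by auto
  have fin: "finite P2" "finite Q2" using CV finite_sub by auto
  have c2: "2 \<le> card ?C"
  proof -
    have "card ?C = card P2 + card Q2" by (rule card_Un_disjoint) (use fin dj in auto)
    moreover have "card Q2 \<noteq> 0" using fin Q2 by simp
    ultimately show ?thesis using cd by linarith
  qed
  have oneC: "card (nb G x - ?C) \<le> 1" if "x \<in> ?C" for x by (rule one_out[OF CV cnt(3) c2 that])
  have Tne: "T \<noteq> {}" using cd by auto
  have CpV: "?C \<subset> verts G" using CV V dj Tne by auto
  have Cne: "?C \<noteq> {}" using Q2 by auto
  interpret c: contraction G ?C v by unfold_locales (use CpV cnt(3) oneC v in auto)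
  interpret d: contraction G ?U a
  proof
    show "?U \<subset> verts G" using Cne CV by auto
    show "cut G ?U = 3" using cut_compl[OF CV] cnt(3) by simp
    fix x assume x: "x \<in> ?U"
    have "nb G x - ?U = nb G x \<inter> ?C" using nb_sub CV by auto
    then show "card (nb G x - ?U) \<le> 1" using cnt(7)[OF x] by simp
  qed (rule a)
  have eG': "G' = d.H" and eH: "H = c.H" unfolding G'_def H_def by simp_all
  interpret d3: cub3 d.H by (rule cub3I[OF d.simpleH d.cubicH d.edge_connH[OF conn3]])
  interpret c3: cub3 c.H by (rule cub3I[OF c.simpleH c.cubicH c.edge_connH[OF conn3]])
  show "cub3 G'" unfolding eG' by (rule d3.cub3_axioms)
  show "verts G' = insert a (T \<union> B \<union> P1 \<union> Q1)" using eG' d.vertsH U by simp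
  show "verts H = insert v ?C" unfolding eH by simp
  show "simple_graph H" "k_connected 3 H" "cubic H"
    unfolding eH using c.simpleH c3.k_connected3 c.cubicH by auto
  show "bipartite H"
  proof -
    have nP: "nb c.H x \<subseteq> insert v Q2" if "x \<in> P2" for x
      using c.nb_in[of x] that nbs(5)[OF that] dj by auto
    have nQ: "nb c.H x \<subseteq> P2" if "x \<in> Q2" for x
      using c.nb_in[of x] that nbs(6)[OF that] by auto
    have nv: "nb c.H v \<subseteq> P2" unfolding c.nb_w using nbs(6) by auto
    have "bip_on c.H P2 (insert v Q2)"
      unfolding bip_on_def
    proof (intro conjI ballI)
      show "P2 \<inter> insert v Q2 = {}" using dj v by auto
      show "nb c.H x \<inter> P2 = {}" if "x \<in> P2" for x using nP[OF that] dj v by auto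
      show "nb c.H x \<inter> insert v Q2 = {}" if "x \<in> insert v Q2" for x
      proof -
        have "nb c.H x \<subseteq> P2" using nQ[of x] nv that by auto
        moreover have "P2 \<inter> insert v Q2 = {}" using dj v by auto
        ultimately show ?thesis by blast
      qed
    qed
    moreover have "P2 \<union> insert v Q2 = verts c.H" by auto
    ultimately show ?thesis unfolding eH using c.H.bipartite_iff by blast
  qed
  show "y \<in> nb G' x" if "x \<in> T" "y \<in> B" "y \<in> nb G x" for x y
    unfolding eG' using d.nb_in[of x] that U by auto
  have nd: "nb d.H x \<subseteq> (nb G x - ?C) \<union> (if nb G x \<inter> ?C = {} then {} else {a})" if "x \<in> ?U" for x
  proof -
    have "nb G x \<subseteq> ?U \<longleftrightarrow> nb G x \<inter> ?C = {}" using nb_sub[of x] by auto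
    then show ?thesis using d.nb_in[OF that] by auto
  qed
  have aU: "a \<notin> T \<union> B \<union> P1 \<union> Q1" using a U by simp
  show "core6 G' T B P1 Q1 {a} {}"
    unfolding core6_def eG'
  proof (intro conjI ballI)
    show "verts d.H = T \<union> B \<union> P1 \<union> Q1 \<union> {a} \<union> {}" using d.vertsH U by simp
    show "(T \<union> B) \<inter> (P1 \<union> Q1 \<union> {a} \<union> {}) = {}" "(P1 \<union> Q1) \<inter> ({a} \<union> {}) = {}"
      using dj aU by auto
    show "nb d.H x \<subseteq> T \<union> B" if "x \<in> T" for x
      using nd[of x] nbs(1)[OF that] that dj U by (auto split: if_splits)
    show "nb d.H x \<subseteq> T \<union> P1 \<union> {a}" if "x \<in> B" for x
      using nd[of x] nbs(2)[OF that] that dj U by (auto split: if_splits)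
    show "nb d.H x \<subseteq> B \<union> Q1" if "x \<in> P1" for x
      using nd[of x] nbs(3)[OF that] that dj U by (auto split: if_splits)
    show "nb d.H x \<subseteq> P1" if "x \<in> Q1" for x
      using nd[of x] nbs(4)[OF that] that dj U by (auto split: if_splits)
    show "nb d.H x \<subseteq> B \<union> {}" if "x \<in> {a}" for x
    proof
      fix y assume "y \<in> nb d.H x"
      then have y: "y \<in> ?U" "\<not> nb G y \<subseteq> ?U" using that d.nb_w by auto
      then obtain z where z: "z \<in> nb G y" "z \<in> ?C" using nb_sub[of y] by auto
      then have "y \<in> nb G z" by (simp add: nb_sym)
      then have "y \<in> B \<union> ?C" using nbs(5,6)[of z] z(2) by auto
      then show "y \<in> B \<union> {}" using y by auto
    qed
  qed (use dj cd aU in auto)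
  show "\<exists>\<phi>. bij_betw \<phi> (edges_at G' a) (edges_at H v) \<and> splice G' H a v \<phi> = G"
    unfolding eG' eH by (rule splice_contract[OF CpV Cne cnt(3) oneC cnt(7) a v])
qed

text \<open>With all names fixed, \<open>core6\<close> leaves open only which vertex of the triangle
  is joined to which vertex of \<open>B\<close>; the last three hypotheses settle this.\<close>

lemma K33_char:
  assumes "cub3 G" "core6 G {1,2,3} {4,5,6} {7} {} {8} {}" "4 \<in> nb G 1" "5 \<in> nb G 2" "6 \<in> nb G 3"
  shows "G = K33tri"
proof -
  interpret cub3 G by (rule assms(1))
  note cnt = core6_counts[OF assms(2)]
  have V: "verts G = {1,2,3,4,5,6,7,8}" using assms(2) unfolding core6_def by auto
  note nbs = core6D(11,12)[OF assms(2)]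
  have nbs': "nb G 7 \<subseteq> {4,5,6}" "nb G 8 \<subseteq> {4,5,6}"
    using core6D(13)[OF assms(2), of 7] core6D(15)[OF assms(2), of 8] by simp_all
  have sing: "A = {x}" if "card A = 1" "x \<in> A" for A :: "nat set" and x
    using that by (auto simp: card_1_singleton_iff)
  have T: "nb G x = ({1,2,3} - {x}) \<union> {y}" if "x \<in> {1,2,3}" "y \<in> {4,5,6}" "y \<in> nb G x" for x y
  proof -
    have "nb G x \<inter> {4,5,6} = {y}" using cnt(4)[OF that(1)] that by (intro sing) auto
    moreover have "nb G x = (nb G x \<inter> {1,2,3}) \<union> (nb G x \<inter> {4,5,6})" using nbs(1)[OF that(1)] by auto
    ultimately show ?thesis using cnt(4)[OF that(1)] by simp
  qed
  have B: "nb G x = {y,7,8}" if "x \<in> {4,5,6}" "y \<in> {1,2,3}" "x \<in> nb G y" for x y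
  proof -
    have y: "y \<in> nb G x" using that(3) by (simp add: nb_sym)
    note c = cnt(5)[OF that(1)]
    have "nb G x \<inter> {1,2,3} = {y}" using c that y by (intro sing) auto
    moreover have "nb G x \<inter> {7} = {7}" "nb G x \<inter> {8} = {8}"
      using c by (cases "7 \<in> nb G x"; simp) (use c in \<open>cases "8 \<in> nb G x"; simp\<close>)
    moreover have "nb G x = (nb G x \<inter> {1,2,3}) \<union> (nb G x \<inter> {7}) \<union> (nb G x \<inter> {8})" using nbs(2)[OF that(1)] by auto
    ultimately show ?thesis by auto
  qed
  have n7: "nb G 7 = {4,5,6}" "nb G 8 = {4,5,6}"
    using nbs' nb_card[of 7] nb_card[of 8] V card_subset_eq[of "{4,5,6::nat}"] by auto
  show ?thesis
  proof (rule graph_eqI[OF simple simple_K33])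
    show "verts G = verts K33tri" using V verts_K33 by simp
    fix x assume "x \<in> verts G"
    then have "x \<in> {1,2,3,4,5,6,7,8}" using V by simp
    then show "nb G x = nb K33tri x"
      using T[of 1 4] T[of 2 5] T[of 3 6] B[of 4 1] B[of 5 2] B[of 6 3] n7 assms(3-5)
      by (elim insertE; simp only: nb_K33) auto
  qed
qed

lemma fresh_nat: "finite (X :: nat set) \<Longrightarrow> \<exists>v. v \<notin> X"
  by (metis ex_new_if_finite infinite_UNIV_nat)

text \<open>The family is built from \<open>K33tri\<close> with its literal names 1 to 8. Keeping
  the nontrivial piece off these numbers leaves 8 available as the name of the contracted
  piece.\<close>

lemma family_G1_intro:
  assumes "cub3 G" and c6: "core6 G {1,2,3} {4,5,6} {7} {} P Q" and Q: "Q \<noteq> {}" and PQ: "(P \<union> Q) \<inter> {1..8} = {}"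
    and e: "4 \<in> nb G 1" "5 \<in> nb G 2" "6 \<in> nb G 3"
  shows "G \<in> family_G1"
proof -
  interpret cub3 G by (rule assms(1))
  have V: "verts G = {1,2,3,4,5,6,7} \<union> (P \<union> Q)" using c6 unfolding core6_def by auto
  obtain v where v: "v \<notin> verts G \<union> {1..8}" using fresh_nat[of "verts G \<union> {1..8}"] by auto
  have a: "8 \<notin> verts G - (P \<union> Q)" using V by auto
  have v': "v \<notin> P \<union> Q" using v V by auto
  note p = peel[OF c6 Q a v']
  let ?G' = "contract G (verts G - (P \<union> Q)) 8" and ?H = "contract G (P \<union> Q) v"
  have "?G' = K33tri" by (rule K33_char[OF p(1,2)]) (use p(9) e in auto)
  then obtain \<phi> where phi: "bij_betw \<phi> (edges_at K33tri 8) (edges_at ?H v)" "splice K33tri ?H 8 v \<phi> = G"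
    using p(10) by auto
  have H: "?H \<in> cubic_bip3" using p(5-8) by (simp add: cubic_bip3_def)
  have dj: "verts K33tri \<inter> verts ?H = {}" using p(4) v PQ verts_K33 by auto
  have "v \<in> verts ?H" using p(4) by simp
  then show ?thesis
    unfolding family_G1_def mem_Collect_eq
    by (rule_tac exI[of _ ?H], rule_tac exI[of _ "8"], rule_tac exI[of _ v], rule_tac exI[of _ \<phi>])
      (simp add: phi H dj av_def)
qed

text \<open>The second piece is peeled off first, because in the family it is spliced in
  last.\<close>

lemma family_G2_intro:
  assumes "cub3 G" and c6: "core6 G {1,2,3} {4,5,6} P1 Q1 P2 Q2" and Q: "Q1 \<noteq> {}" "Q2 \<noteq> {}"
    and PQ: "(P1 \<union> Q1 \<union> P2 \<union> Q2) \<inter> {1..8} = {}"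
    and e: "4 \<in> nb G 1" "5 \<in> nb G 2" "6 \<in> nb G 3"
  shows "G \<in> family_G2"
proof -
  interpret cub3 G by (rule assms(1))
  have V: "verts G = {1,2,3,4,5,6} \<union> (P1 \<union> Q1) \<union> (P2 \<union> Q2)" using c6 unfolding core6_def by auto
  have dj: "(P1 \<union> Q1) \<inter> (P2 \<union> Q2) = {}" using c6 unfolding core6_def by auto
  obtain v where v: "v \<notin> verts G \<union> {1..8}" using fresh_nat[of "verts G \<union> {1..8}"] by auto
  have a: "8 \<notin> verts G - (P2 \<union> Q2)" using V PQ by auto
  have v': "v \<notin> P2 \<union> Q2" using v V by auto
  note p = peel[OF c6 Q(2) a v']
  let ?G' = "contract G (verts G - (P2 \<union> Q2)) 8" and ?H2 = "contract G (P2 \<union> Q2) v"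
  interpret g: cub3 ?G' by (rule p(1))
  have c6': "core6 ?G' {1,2,3} {4,5,6} {8} {} P1 Q1" by (rule core6_sym[OF p(2)])
  have a': "7 \<notin> verts ?G' - (P1 \<union> Q1)" using p(3) PQ by auto
  have v1: "v \<notin> P1 \<union> Q1" using v V by auto
  note q = g.peel[OF c6' Q(1) a' v1]
  let ?K = "contract ?G' (verts ?G' - (P1 \<union> Q1)) 7" and ?H1 = "contract ?G' (P1 \<union> Q1) v"
  have "?K = K33tri" by (rule K33_char[OF q(1) core6_sym[OF q(2)]]) (use q(9) p(9) e in auto)
  then obtain \<phi>1 where phi1: "bij_betw \<phi>1 (edges_at K33tri 7) (edges_at ?H1 v)" "splice K33tri ?H1 7 v \<phi>1 = ?G'"
    using q(10) by auto
  obtain \<phi>2 where phi2: "bij_betw \<phi>2 (edges_at ?G' 8) (edges_at ?H2 v)" "splice ?G' ?H2 8 v \<phi>2 = G"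
    using p(10) by auto
  have H1: "?H1 \<in> cubic_bip3" using q(5-8) by (simp add: cubic_bip3_def)
  have H2: "?H2 \<in> cubic_bip3" using p(5-8) by (simp add: cubic_bip3_def)
  have dj1: "verts K33tri \<inter> verts ?H1 = {}" using q(4) v PQ verts_K33 by auto
  have dj2: "verts ?G' \<inter> verts ?H2 = {}"
  proof -
    have "insert 8 ({1,2,3} \<union> {4,5,6}) \<subseteq> {1..8::nat}" by auto
    moreover have "v \<notin> insert 8 ({1,2,3} \<union> {4,5,6} \<union> P1 \<union> Q1)" using v unfolding V by auto
    ultimately show ?thesis unfolding p(3,4) using PQ dj by blast
  qed
  have av: "av 1 = 7" "av 2 = 8" by (auto simp: av_def)
  have vH: "v \<in> verts ?H1" "v \<in> verts ?H2" using q(4) p(4) by auto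
  show ?thesis
    unfolding family_G2_def mem_Collect_eq av
    by (rule exI[of _ ?G'], rule exI[of _ ?H1], rule exI[of _ ?H2], rule exI[of _ v], rule exI[of _ v],
        rule exI[of _ \<phi>1], rule exI[of _ \<phi>2])
      (simp add: phi1 phi2 H1 H2 dj1 dj2 vH)
qed

lemma (in cub3) six_forward:
  assumes c6: "core6 G T B P1 Q1 P2 Q2"
  shows "\<exists>F \<in> {K33tri} \<union> family_G1 \<union> family_G2. G \<cong>\<^sub>g F"
proof -
  \<comment> \<open>By the symmetry of \<open>core6\<close>, a single nontrivial piece may be taken
    to be the second one.\<close>
  have main: "\<exists>F \<in> {K33tri} \<union> family_G1 \<union> family_G2. G \<cong>\<^sub>g F"
    if c6: "core6 G T B P1 Q1 P2 Q2" and ord: "Q2 = {} \<longrightarrow> Q1 = {}" for T B P1 Q1 P2 Q2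
  proof -
    note cnt = core6_counts[OF c6]
    have V: "verts G = T \<union> B \<union> P1 \<union> Q1 \<union> P2 \<union> Q2"
      and dj: "T \<inter> B = {}" "(T \<union> B) \<inter> (P1 \<union> Q1 \<union> P2 \<union> Q2) = {}"
       "P1 \<inter> Q1 = {}" "P2 \<inter> Q2 = {}" "(P1 \<union> Q1) \<inter> (P2 \<union> Q2) = {}"
      and cd: "card T = 3" "card B = 3" "card P1 = card Q1 + 1" "card P2 = card Q2 + 1"
      using c6 unfolding core6_def by simp_all
    obtain t1 t2 t3 where T: "T = {t1,t2,t3}" "t1 \<noteq> t2" "t1 \<noteq> t3" "t2 \<noteq> t3"
      using cd(1) by (auto simp: card_3_iff)
    define be where "be t = (THE b. b \<in> nb G t \<inter> B)" for t
    have be: "nb G t \<inter> B = {be t}" if t: "t \<in> T" for t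
    proof -
      have "card (nb G t \<inter> B) = 1" using cnt(4)[OF t] by simp
      then obtain b where "nb G t \<inter> B = {b}" by (auto simp: card_1_singleton_iff)
      then show ?thesis unfolding be_def by simp
    qed
    have bei: "t = t'" if t: "t \<in> T" "t' \<in> T" "be t = be t'" for t t'
    proof -
      have b: "be t \<in> B" "be t \<in> nb G t" "be t \<in> nb G t'" using be[OF t(1)] be[OF t(2)] t(3) by auto
      then have "{t,t'} \<subseteq> nb G (be t) \<inter> T" using t nb_sym by (metis Int_iff empty_subsetI insert_subset)
      then have "card {t,t'} \<le> card (nb G (be t) \<inter> T)" by (intro card_mono) auto
      then show ?thesis using cnt(5)[OF b(1)] by (cases "t = t'") auto
    qed
    have tT: "t1 \<in> T" "t2 \<in> T" "t3 \<in> T" using T by auto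
    let ?b1 = "be t1" and ?b2 = "be t2" and ?b3 = "be t3"
    have bd: "?b1 \<noteq> ?b2" "?b1 \<noteq> ?b3" "?b2 \<noteq> ?b3" using bei T tT by blast+
    have bB: "be t \<in> B" "be t \<in> nb G t" if "t \<in> T" for t using be[OF that] by auto
    have finB: "finite B" using cd by (simp add: card_ge_0_finite)
    have B: "B = {?b1,?b2,?b3}"
    proof (rule card_subset_eq[OF finB, symmetric])
      show "{?b1,?b2,?b3} \<subseteq> B" using bB tT by auto
      show "card {?b1,?b2,?b3} = card B" using bd cd by simp
    qed
    have tb: "t \<noteq> be t'" if "t \<in> T" "t' \<in> T" for t t' using bB that dj by auto
    obtain h :: "'a \<Rightarrow> nat" where h: "inj_on h (verts G)"
      using finite_imp_inj_to_nat_seg[OF finV] by blast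
    \<comment> \<open>1 to 3 name the triangle and 4 to 6 the neighbours in \<open>B\<close>, in
      matching order; 7 and 8 name trivial pieces; the offset 9 keeps all remaining vertices off the
      names of \<open>K33tri\<close>.\<close>
    define g where "g x = (if x = t1 then 1 else if x = t2 then 2 else if x = t3 then 3 else
       if x = ?b1 then 4 else if x = ?b2 then 5 else if x = ?b3 then 6 else
       if Q1 = {} \<and> x \<in> P1 then 7 else if Q2 = {} \<and> x \<in> P2 then 8 else 9 + h x)" for x
    have gt: "g t1 = 1" "g t2 = 2" "g t3 = 3" "g ?b1 = 4" "g ?b2 = 5" "g ?b3 = 6"
    proof -
      have "t1 \<noteq> ?b1" "t1 \<noteq> ?b2" "t1 \<noteq> ?b3" "t2 \<noteq> ?b1" "t2 \<noteq> ?b2" "t2 \<noteq> ?b3"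
        "t3 \<noteq> ?b1" "t3 \<noteq> ?b2" "t3 \<noteq> ?b3" using tb tT by blast+
      note ne = this T(2-4) bd
      show "g t1 = 1" "g t2 = 2" "g t3 = 3" "g ?b1 = 4" "g ?b2 = 5" "g ?b3 = 6"
        by (simp_all add: g_def ne ne[symmetric])
    qed
    have gO: "g x = (if Q1 = {} \<and> x \<in> P1 then 7 else if Q2 = {} \<and> x \<in> P2 then 8 else 9 + h x)" if "x \<notin> T \<union> B" for x
      using that T B unfolding g_def by auto
    have P1s: "Q1 = {} \<Longrightarrow> \<exists>p. P1 = {p}" using cd(3) by (auto simp: card_1_singleton_iff)
    have P2s: "Q2 = {} \<Longrightarrow> \<exists>p. P2 = {p}" using cd(4) by (auto simp: card_1_singleton_iff)
    have gTB: "g ` (T \<union> B) = {1,2,3,4,5,6}"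
    proof -
      have "T \<union> B = {t1,t2,t3,?b1,?b2,?b3}" using T(1) B by auto
      then show ?thesis using gt by auto
    qed
    have "inj_on g (verts G)"
    proof -
      have a: "inj_on g (T \<union> B)"
      proof (rule eq_card_imp_inj_on)
        show "finite (T \<union> B)" using finB T by simp
        have "card (T \<union> B) = card T + card B" by (rule card_Un_disjoint) (use finB T dj in auto)
        then show "card (g ` (T \<union> B)) = card (T \<union> B)" using gTB cd by simp
      qed
      have b: "inj_on g (verts G - (T \<union> B))"
      proof (rule inj_onI)
        fix x y assume xy: "x \<in> verts G - (T \<union> B)" "y \<in> verts G - (T \<union> B)" "g x = g y"
        have hx: "h x = h y \<Longrightarrow> x = y" using h xy by (auto dest: inj_onD)
        show "x = y"
          using xy(3) gO[of x] gO[of y] xy hx P1s P2s dj(5) by (auto split: if_splits)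
      qed
      have c: "g x \<ge> 7" if "x \<notin> T \<union> B" for x using gO[OF that] by auto
      have "g ` (T \<union> B) \<inter> g ` (verts G - (T \<union> B)) = {}"
      proof -
        have "z \<le> 6" if "z \<in> g ` (T \<union> B)" for z using that unfolding gTB by auto
        moreover have "7 \<le> z" if "z \<in> g ` (verts G - (T \<union> B))" for z using that c by auto
        ultimately show ?thesis by force
      qed
      moreover have "(T \<union> B) - (verts G - (T \<union> B)) = T \<union> B" "(verts G - (T \<union> B)) - (T \<union> B) = verts G - (T \<union> B)"
        by auto
      ultimately have "inj_on g ((T \<union> B) \<union> (verts G - (T \<union> B)))"
        using a b inj_on_Un[of g "T \<union> B" "verts G - (T \<union> B)"] by metis
      moreover have "(T \<union> B) \<union> (verts G - (T \<union> B)) = verts G" using V by auto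
      ultimately show ?thesis by simp
    qed
    then interpret r: relabel G g by unfold_locales
    have "cub3 r.F" by (rule cub3I[OF r.simple_map r.cubic_map[OF cub] r.edge_conn_map[OF conn3]])
    have "core6 r.F (g ` T) (g ` B) (g ` P1) (g ` Q1) (g ` P2) (g ` Q2)" by (rule r.core6_map[OF c6])
    moreover have "g ` T = {1,2,3}" using T gt by auto
    moreover have "g ` B = {4,5,6}" by (subst B) (use gt in auto)
    ultimately have c6': "core6 r.F {1,2,3} {4,5,6} (g ` P1) (g ` Q1) (g ` P2) (g ` Q2)" by simp
    have e: "g (be t) \<in> nb r.F (g t)" if "t \<in> T" for t
      using r.nb_map[of t] bB(2)[OF that] that V by auto
    have e4: "4 \<in> nb r.F 1" "5 \<in> nb r.F 2" "6 \<in> nb r.F 3"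
      using e[OF tT(1)] e[OF tT(2)] e[OF tT(3)] gt by auto
    have out1: "x \<notin> T \<union> B" if "x \<in> P1 \<union> Q1 \<union> P2 \<union> Q2" for x using that dj by auto
    have big1: "Q1 \<noteq> {} \<Longrightarrow> x \<in> P1 \<union> Q1 \<Longrightarrow> 9 \<le> g x" for x
      using gO[OF out1, of x] dj by auto
    have big2: "Q2 \<noteq> {} \<Longrightarrow> x \<in> P2 \<union> Q2 \<Longrightarrow> 9 \<le> g x" for x
      using gO[OF out1, of x] dj by auto
    consider "Q1 = {}" "Q2 = {}" | "Q1 = {}" "Q2 \<noteq> {}" | "Q1 \<noteq> {}" "Q2 \<noteq> {}" using ord by blast
    then have "r.F \<in> {K33tri} \<union> family_G1 \<union> family_G2"
    proof cases
      case 1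
      obtain p1 p2 where p: "P1 = {p1}" "P2 = {p2}" using P1s P2s 1 by blast
      then have "g p1 = 7" "g p2 = 8" using gO[OF out1] 1 dj by auto
      then have "core6 r.F {1,2,3} {4,5,6} {7} {} {8} {}" using c6' p 1 by simp
      then show ?thesis using K33_char[OF \<open>cub3 r.F\<close> _ e4] by blast
    next
      case 2
      obtain p1 where p: "P1 = {p1}" using P1s 2 by blast
      then have "g p1 = 7" using gO[OF out1] 2 by auto
      then have c: "core6 r.F {1,2,3} {4,5,6} {7} {} (g ` P2) (g ` Q2)" using c6' p 2 by simp
      have "(g ` P2 \<union> g ` Q2) \<inter> {1..8} = {}" using big2[OF 2(2)] by fastforce
      then show ?thesis using family_G1_intro[OF \<open>cub3 r.F\<close> c _ _ e4] 2 by blast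
    next
      case 3
      have "(g ` P1 \<union> g ` Q1 \<union> g ` P2 \<union> g ` Q2) \<inter> {1..8} = {}"
        using big1[OF 3(1)] big2[OF 3(2)] by fastforce
      then show ?thesis using family_G2_intro[OF \<open>cub3 r.F\<close> c6' _ _ _ e4] 3 by blast
    qed
    then show ?thesis using r.iso_map by blast
  qed
  show ?thesis
  proof (cases "Q2 = {} \<longrightarrow> Q1 = {}")
    case True then show ?thesis by (rule main[OF c6])
  next
    case False then show ?thesis by (intro main[OF core6_sym[OF c6]]) auto
  qed
qed

section \<open>Ladders and edge splicing\<close>

lemma graph_iso_sym:
  assumes "G \<cong>\<^sub>g F" shows "F \<cong>\<^sub>g G"
proof -
  obtain f where f: "bij_betw f (verts G) (verts F)"
    "\<forall>u\<in>verts G. \<forall>v\<in>verts G. adj G u v \<longleftrightarrow> adj F (f u) (f v)"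
    using assms unfolding graph_iso_def by blast
  let ?g = "inv_into (verts G) f"
  have g: "bij_betw ?g (verts F) (verts G)" by (rule bij_betw_inv_into[OF f(1)])
  have "adj F x y \<longleftrightarrow> adj G (?g x) (?g y)" if "x \<in> verts F" "y \<in> verts F" for x y
  proof -
    have "f (?g x) = x" "f (?g y) = y" "?g x \<in> verts G" "?g y \<in> verts G"
      using f(1) g that bij_betw_inv_into_right[OF f(1)] bij_betw_apply[OF g] by auto
    then show ?thesis using f(2) by metis
  qed
  then show ?thesis using g unfolding graph_iso_def by blast
qed

lemma graph_isoI:
  assumes "simple_graph G" "bij_betw f (verts G) (verts F)" "\<And>x. x \<in> verts G \<Longrightarrow> nb F (f x) = f ` nb G x"
  shows "G \<cong>\<^sub>g F"
proof -
  interpret sgraph G by unfold_locales (rule assms(1))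
  have inj: "inj_on f (verts G)" using assms(2) by (simp add: bij_betw_def)
  show ?thesis
    unfolding graph_iso_def
  proof (intro exI[of _ f] conjI ballI)
    fix u v assume uv: "u \<in> verts G" "v \<in> verts G"
    have "f v \<in> f ` nb G u \<longleftrightarrow> v \<in> nb G u" by (rule inj_on_image_mem_iff[OF inj uv(2) nb_sub])
    then show "adj G u v \<longleftrightarrow> adj F (f u) (f v)" using assms(3)[OF uv(1)] by (auto simp: nb_def)
  qed (rule assms(2))
qed

lemma verts_ladder: "verts (ladder n) = {..<2} \<times> {..n}"
  unfolding ladder_def cartesian_product_def path_graph_def by (auto simp: less_Suc_eq_le)

lemma nb_ladder: "(x', y') \<in> nb (ladder n) (x, y) \<longleftrightarrow>
   x < 2 \<and> x' < 2 \<and> y \<le> n \<and> y' \<le> n \<and> (x = x' \<and> (y' = Suc y \<or> y = Suc y') \<or> y = y' \<and> x \<noteq> x')"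
proof -
  have p2: "{a, b} \<in> edges (path_graph m) \<longleftrightarrow> b = Suc a \<and> b < m \<or> a = Suc b \<and> a < m" for a b m
    unfolding path_graph_def by (auto simp: doubleton_eq_iff)
  have "{(x, y), (x', y')} \<in> edges (ladder n) \<longleftrightarrow>
    x = x' \<and> x < 2 \<and> {y, y'} \<in> edges (path_graph (n + 1)) \<or> y = y' \<and> y < n + 1 \<and> {x, x'} \<in> edges (path_graph 2)"
    (is "_ \<longleftrightarrow> ?A \<or> ?B")
  proof -
    have "{(x, y), (x', y')} \<in> {{(a, b), (a, b')} | a b b'. a \<in> {..<2} \<and> {b, b'} \<in> edges (path_graph (n + 1))} \<longleftrightarrow> ?A"
      (is "?L \<longleftrightarrow> ?A")
    proof
      assume ?A
      then show ?L unfolding mem_Collect_eq by (intro exI[of _ x] exI[of _ y] exI[of _ y']) simp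
    qed (auto simp: doubleton_eq_iff insert_commute)
    moreover have "{(x, y), (x', y')} \<in> {{(a, b), (a', b)} | a a' b. {a, a'} \<in> edges (path_graph 2) \<and> b \<in> {..<n + 1}} \<longleftrightarrow> ?B"
      (is "?R \<longleftrightarrow> ?B")
    proof
      assume ?B
      then show ?R unfolding mem_Collect_eq by (intro exI[of _ x] exI[of _ x'] exI[of _ y]) simp
    qed (auto simp: doubleton_eq_iff insert_commute)
    moreover have "verts (path_graph m) = {..<m}" for m by (simp add: path_graph_def)
    ultimately show ?thesis unfolding ladder_def cartesian_product_def graph.sel Un_iff by simp
  qed
  then show ?thesis unfolding edge_iff_nb[symmetric] p2 by presburger
qed

lemma simple_ladder: "simple_graph (ladder n)"
  unfolding simple_graph_def
proof (intro conjI ballI)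
  show "finite (verts (ladder n))" by (simp add: verts_ladder)
  fix e assume e: "e \<in> edges (ladder n)"
  have "\<exists>a b. e = {a, b}"
    using e unfolding ladder_def cartesian_product_def by auto
  then obtain x y x' y' where "e = {(x,y),(x',y')}" by auto
  then show "e \<subseteq> verts (ladder n)" "card e = 2"
    using e edge_iff_nb[of "(x,y)" "(x',y')" "ladder n"] by (auto simp: nb_ladder verts_ladder card_insert_if)
qed

section \<open>Balanced bipartitions and edge splicing\<close>

definition balanced_bip :: "'a graph \<Rightarrow> 'a set \<Rightarrow> 'a set \<Rightarrow> bool" where
  "balanced_bip G P Q \<longleftrightarrow> P \<union> Q = verts G \<and> bip_on G P Q \<and> card P = card Q"

lemma balanced_bip_commute: "balanced_bip G P Q \<longleftrightarrow> balanced_bip G Q P"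
  unfolding balanced_bip_def using bip_on_commute by (auto simp: Un_commute)

lemma balanced_bip_orient:
  assumes "balanced_bip G P Q" "x \<in> verts G"
  obtains P' Q' where "balanced_bip G P' Q'" "x \<in> P'"
proof (cases "x \<in> P")
  case False
  then have "x \<in> Q" using assms unfolding balanced_bip_def by auto
  then show ?thesis using that[of Q P] assms balanced_bip_commute by metis
qed (use that assms in blast)

lemma ladder_balanced_bip:
  assumes "simple_graph L" "L \<cong>\<^sub>g ladder n"
  shows "\<exists>P Q. balanced_bip L P Q"
proof -
  obtain f where f: "bij_betw f (verts L) (verts (ladder n))"
    "\<forall>u\<in>verts L. \<forall>v\<in>verts L. adj L u v \<longleftrightarrow> adj (ladder n) (f u) (f v)"
    using assms(2) unfolding graph_iso_def by blast
  note pre = iso_preimage[OF assms(1) f]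
  define E where "E = {z \<in> verts (ladder n). even (fst z + snd z)}"
  define D where "D = {z \<in> verts (ladder n). odd (fst z + snd z)}"
  \<comment> \<open>Exchanging the two ends of every rung interchanges the parity classes.\<close>
  have "bij_betw (\<lambda>z. (1 - fst z, snd z)) E D"
  proof (rule bij_betwI[of _ _ _ "\<lambda>z. (1 - fst z, snd z)"])
    have *: "i = 0 \<or> i = 1" if "i < 2" for i :: nat using that by auto
    show "(\<lambda>z. (1 - fst z, snd z)) \<in> E \<rightarrow> D" "(\<lambda>z. (1 - fst z, snd z)) \<in> D \<rightarrow> E"
      unfolding E_def D_def verts_ladder using * by fastforce+
    show "(1 - fst (1 - fst z, snd z), snd (1 - fst z, snd z)) = z" if "z \<in> E" for z
      using that * unfolding E_def verts_ladder by fastforce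
    show "(1 - fst (1 - fst z, snd z), snd (1 - fst z, snd z)) = z" if "z \<in> D" for z
      using that * unfolding D_def verts_ladder by fastforce
  qed
  then have "card E = card D" by (rule bij_betw_same_card)
  let ?P = "{x \<in> verts L. f x \<in> E}" and ?Q = "{x \<in> verts L. f x \<in> D}"
  have "card ?P = card ?Q" using pre(2)[of E] pre(2)[of D] \<open>card E = card D\<close> unfolding E_def D_def by auto
  moreover have "f x \<in> verts (ladder n)" if "x \<in> verts L" for x using f(1) that by (auto simp: bij_betw_def)
  then have "?P \<union> ?Q = verts L" unfolding E_def D_def by auto
  moreover have "even (fst (f y) + snd (f y)) \<longleftrightarrow> odd (fst (f x) + snd (f x))" if "y \<in> nb L x" for x y
  proof -
    have "f y \<in> nb (ladder n) (f x)" using pre(1)[OF that] by auto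
    then show ?thesis by (cases "f x"; cases "f y") (auto simp: nb_ladder less_2_cases_iff)
  qed
  then have "bip_on L ?P ?Q" unfolding bip_on_def E_def D_def by blast
  ultimately show ?thesis unfolding balanced_bip_def by blast
qed

locale esplice =
  G1: sgraph G1 + G2: sgraph G2 for G1 G2 :: "'a graph" +
  fixes x1 x2 y1 y2
  assumes dj: "verts G1 \<inter> verts G2 = {}" and ex: "x2 \<in> nb G1 x1" and ey: "y2 \<in> nb G2 y1"
begin

definition "r z = (if z = y1 then x1 else if z = y2 then x2 else z)"

abbreviation "S \<equiv> edge_splice G1 G2 (x1, x2) (y1, y2)"

lemma ends: "x1 \<noteq> x2" "y1 \<noteq> y2" "x1 \<in> verts G1" "x2 \<in> verts G1" "y1 \<in> verts G2" "y2 \<in> verts G2"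
  using ex ey G1.nb_verts G2.nb_verts G1.nb_irrefl G2.nb_irrefl by blast+

lemma r_simps: "r y1 = x1" "r y2 = x2" "z \<noteq> y1 \<Longrightarrow> z \<noteq> y2 \<Longrightarrow> r z = z"
  using ends by (auto simp: r_def)

lemma r_inj: "inj_on r (verts G2)"
  using ends dj unfolding inj_on_def r_def by auto

lemma S_eq: "S = Graph (verts G1 \<union> r ` verts G2) ((edges G1 - {{x1, x2}}) \<union> (\<lambda>e. r ` e) ` (edges G2 - {{y1, y2}}))"
  unfolding edge_splice_def r_def[abs_def] by (simp add: Let_def)

lemma verts_S: "verts S = verts G1 \<union> (verts G2 - {y1, y2})"
  unfolding S_eq using ends r_simps by (auto simp: r_def)

lemma nb_S: "t \<in> nb S s \<longleftrightarrow> t \<in> nb G1 s \<and> {s, t} \<noteq> {x1, x2} \<or>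
   (\<exists>a b. b \<in> nb G2 a \<and> {a, b} \<noteq> {y1, y2} \<and> s = r a \<and> t = r b)"
proof
  assume "t \<in> nb S s"
  then have "{s, t} \<in> edges S" by (simp add: edge_iff_nb)
  then consider "{s, t} \<in> edges G1" "{s, t} \<noteq> {x1, x2}" | e where "e \<in> edges G2" "e \<noteq> {y1, y2}" "{s, t} = r ` e"
    unfolding S_eq by auto
  then show "t \<in> nb G1 s \<and> {s, t} \<noteq> {x1, x2} \<or> (\<exists>a b. b \<in> nb G2 a \<and> {a, b} \<noteq> {y1, y2} \<and> s = r a \<and> t = r b)"
  proof cases
    case 1 then show ?thesis by (simp add: edge_iff_nb)
  next
    case 2
    obtain a b where ab: "e = {a, b}" "b \<in> nb G2 a" using G2.edgeE 2(1) by metis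
    then have "{s, t} = {r a, r b}" using 2 by simp
    then have "s = r a \<and> t = r b \<or> s = r b \<and> t = r a" by (auto simp: doubleton_eq_iff)
    moreover have "a \<in> nb G2 b" "{b, a} = {a, b}" using ab by (auto simp: nb_sym)
    moreover have "{a, b} \<noteq> {y1, y2}" using ab 2(2) by simp
    ultimately have "\<exists>a b. b \<in> nb G2 a \<and> {a, b} \<noteq> {y1, y2} \<and> s = r a \<and> t = r b"
      using ab(2) by (elim disjE) (rule exI[of _ a], rule exI[of _ b], simp, rule exI[of _ b], rule exI[of _ a], simp)
    then show ?thesis ..
  qed
next
  assume "t \<in> nb G1 s \<and> {s, t} \<noteq> {x1, x2} \<or> (\<exists>a b. b \<in> nb G2 a \<and> {a, b} \<noteq> {y1, y2} \<and> s = r a \<and> t = r b)"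
  then have "{s, t} \<in> edges S"
  proof
    assume "t \<in> nb G1 s \<and> {s, t} \<noteq> {x1, x2}"
    then show ?thesis unfolding S_eq by (simp add: edge_iff_nb)
  next
    assume "\<exists>a b. b \<in> nb G2 a \<and> {a, b} \<noteq> {y1, y2} \<and> s = r a \<and> t = r b"
    then obtain a b where ab: "{a, b} \<in> edges G2" "{a, b} \<noteq> {y1, y2}" "s = r a" "t = r b"
      by (auto simp: edge_iff_nb)
    then have "r ` {a, b} \<in> (\<lambda>e. r ` e) ` (edges G2 - {{y1, y2}})" by (intro imageI) auto
    moreover have "r ` {a, b} = {s, t}" using ab by simp
    ultimately show ?thesis unfolding S_eq by simp
  qed
  then show "t \<in> nb S s" by (simp add: edge_iff_nb)
qed

lemma simple_S: "simple_graph S"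
  unfolding simple_graph_def
proof (intro conjI ballI)
  show "finite (verts S)" unfolding verts_S by simp
  fix e assume "e \<in> edges S"
  then consider "e \<in> edges G1" | e' where "e' \<in> edges G2" "e = r ` e'" unfolding S_eq by auto
  then have "e \<subseteq> verts S \<and> card e = 2"
  proof cases
    case 1 then show ?thesis using G1.simple unfolding simple_graph_def verts_S by auto
  next
    case 2
    then have e': "e' \<subseteq> verts G2" "card e' = 2" using G2.simple unfolding simple_graph_def by auto
    then have "card e = 2" using 2 r_inj card_image inj_on_subset by metis
    moreover have "e \<subseteq> verts S" using 2 e' unfolding S_eq by auto
    ultimately show ?thesis by simp
  qed
  then show "e \<subseteq> verts S" "card e = 2" by auto
qed

text \<open>Once the colourings agree at the first identified vertex, they agree at the second as
  well. Identification removes one vertex from each class, so the balance is kept.\<close>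

lemma balanced_bip_S:
  assumes b1: "balanced_bip G1 P1 Q1" "x1 \<in> P1" and b2: "balanced_bip G2 P2 Q2" "y1 \<in> P2"
  shows "balanced_bip S (P1 \<union> (P2 - {y1})) (Q1 \<union> (Q2 - {y2}))"
proof -
  have u: "P1 \<union> Q1 = verts G1" "P2 \<union> Q2 = verts G2" "card P1 = card Q1" "card P2 = card Q2"
    and n: "P1 \<inter> Q1 = {}" "P2 \<inter> Q2 = {}" "\<And>x. x \<in> P1 \<Longrightarrow> nb G1 x \<inter> P1 = {}" "\<And>x. x \<in> Q1 \<Longrightarrow> nb G1 x \<inter> Q1 = {}"
      "\<And>x. x \<in> P2 \<Longrightarrow> nb G2 x \<inter> P2 = {}" "\<And>x. x \<in> Q2 \<Longrightarrow> nb G2 x \<inter> Q2 = {}"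
    using b1(1) b2(1) unfolding balanced_bip_def bip_on_def by auto
  have x2: "x2 \<in> Q1" "x2 \<notin> P1" "x1 \<notin> Q1" using n(1,3) b1(2) ex u(1) ends by auto
  have y2: "y2 \<in> Q2" "y2 \<notin> P2" "y1 \<notin> Q2" using n(2,5) b2(2) ey u(2) ends by auto
  let ?P = "P1 \<union> (P2 - {y1})" and ?Q = "Q1 \<union> (Q2 - {y2})"
  have sub: "P1 \<subseteq> verts G1" "Q1 \<subseteq> verts G1" "P2 \<subseteq> verts G2" "Q2 \<subseteq> verts G2" using u by auto
  have djs: "P1 \<inter> P2 = {}" "P1 \<inter> Q2 = {}" "Q1 \<inter> P2 = {}" "Q1 \<inter> Q2 = {}" using sub dj by blast+
  have rP: "r a \<in> ?P \<longleftrightarrow> a \<in> P2" and rQ: "r a \<in> ?Q \<longleftrightarrow> a \<in> Q2" if "a \<in> verts G2" for a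
  proof -
    have a: "a \<notin> P1" "a \<notin> Q1" using that sub dj by blast+
    have ends': "x1 \<notin> P2" "x1 \<notin> Q2" "x2 \<notin> P2" "x2 \<notin> Q2" using ends sub dj by blast+
    show "r a \<in> ?P \<longleftrightarrow> a \<in> P2" "r a \<in> ?Q \<longleftrightarrow> a \<in> Q2"
      using a ends' x2 y2 b1(2) b2(2) unfolding r_def by auto
  qed
  have in1: "s \<in> ?P \<longleftrightarrow> s \<in> P1" "s \<in> ?Q \<longleftrightarrow> s \<in> Q1" if "s \<in> verts G1" for s
    using that sub dj by blast+
  have "bip_on S ?P ?Q"
    unfolding bip_on_def
  proof (intro conjI ballI)
    show "?P \<inter> ?Q = {}" using n(1,2) djs by blast
    show "nb S s \<inter> ?P = {}" if s: "s \<in> ?P" for s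
    proof (rule ccontr)
      assume "nb S s \<inter> ?P \<noteq> {}"
      then obtain t where t: "t \<in> nb S s" "t \<in> ?P" by blast
      from t(1) consider "t \<in> nb G1 s" | a b where "b \<in> nb G2 a" "s = r a" "t = r b" unfolding nb_S by blast
      then show False
      proof cases
        case 1
        then have "s \<in> P1" "t \<in> P1" using in1 s t G1.nb_verts by blast+
        then show False using n(3) 1 by blast
      next
        case 2
        then have "a \<in> P2" "b \<in> P2" using rP s t G2.nb_verts by blast+
        then show False using n(5) 2 by blast
      qed
    qed
    show "nb S s \<inter> ?Q = {}" if s: "s \<in> ?Q" for s
    proof (rule ccontr)
      assume "nb S s \<inter> ?Q \<noteq> {}"
      then obtain t where t: "t \<in> nb S s" "t \<in> ?Q" by blast
      from t(1) consider "t \<in> nb G1 s" | a b where "b \<in> nb G2 a" "s = r a" "t = r b" unfolding nb_S by blast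
      then show False
      proof cases
        case 1
        then have "s \<in> Q1" "t \<in> Q1" using in1 s t G1.nb_verts by blast+
        then show False using n(4) 1 by blast
      next
        case 2
        then have "a \<in> Q2" "b \<in> Q2" using rQ s t G2.nb_verts by blast+
        then show False using n(6) 2 by blast
      qed
    qed
  qed
  moreover have "?P \<union> ?Q = verts S" unfolding verts_S u[symmetric] using y2 b2(2) djs x2 b1 n(2) by auto
  moreover have "card ?P = card ?Q"
  proof -
    have fin: "finite P1" "finite Q1" "finite P2" "finite Q2" using sub G1.finite_sub G2.finite_sub by auto
    have "card ?P = card P1 + card (P2 - {y1})" by (rule card_Un_disjoint) (use fin djs in auto)
    moreover have "card ?Q = card Q1 + card (Q2 - {y2})" by (rule card_Un_disjoint) (use fin djs in auto)
    ultimately show ?thesis using u y2 b2(2) by simp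
  qed
  ultimately show ?thesis unfolding balanced_bip_def by blast
qed

end

text \<open>\<open>u\<close> and \<open>v\<close> run along the two sides, starting at the edge
  \<open>pq\<close>. Rungs are demanded only for \<open>i < n\<close>: the pair at \<open>n\<close>
  is where the ladder may stop, since edge splicing deletes the last rung.\<close>

definition ladder_in :: "'a graph \<Rightarrow> 'a \<Rightarrow> 'a \<Rightarrow> nat \<Rightarrow> (nat \<Rightarrow> 'a) \<Rightarrow> (nat \<Rightarrow> 'a) \<Rightarrow> bool" where
  "ladder_in H p q n u v \<longleftrightarrow> u 0 = p \<and> v 0 = q \<and> inj_on u {..n} \<and> inj_on v {..n} \<and> u ` {..n} \<inter> v ` {..n} = {} \<and>
     (\<forall>i<n. v i \<in> nb H (u i) \<and> u (Suc i) \<in> nb H (u i) \<and> v (Suc i) \<in> nb H (v i))"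

lemma ladder_in_sym: "ladder_in H p q n u v \<Longrightarrow> ladder_in H q p n v u"
  unfolding ladder_in_def using nb_sym by (metis inf_commute)

text \<open>Graphs like this with an edge \<open>pq\<close> between the two vertices of degree 2 are recognised as members
  of \<open>\<H>\<^sup>\<diamond>\<close> by a maximal ladder starting at \<open>pq\<close>: if it stops at rung \<open>n\<close>, the ends of that rung are not adjacent,
  and joining them makes the remainder cubic bipartite.\<close>

locale gadget = sgraph H for H :: "'a graph" +
  fixes A B p q
  assumes AB: "A \<union> B = verts H" "bip_on H A B" and p: "p \<in> A" and q: "q \<in> B" and pq: "q \<in> nb H p"
    and dp: "card (nb H p) = 2" and dq: "card (nb H q) = 2"
    and d3: "\<And>x. x \<in> verts H \<Longrightarrow> x \<noteq> p \<Longrightarrow> x \<noteq> q \<Longrightarrow> card (nb H x) = 3"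
    and conn: "\<And>X. X \<subseteq> verts H \<Longrightarrow> X \<noteq> {} \<Longrightarrow> (\<And>x. x \<in> X \<Longrightarrow> nb H x \<subseteq> X) \<Longrightarrow> X = verts H"
begin

lemma sym: "gadget H B A q p"
proof unfold_locales
  show "B \<union> A = verts H" "bip_on H B A" using AB iffD1[OF bip_on_commute AB(2)] by auto
  show "p \<in> nb H q" using pq by (simp add: nb_sym)
qed (use p q dp dq d3 conn in auto)

lemma bip: "x \<in> A \<Longrightarrow> y \<in> nb H x \<Longrightarrow> y \<in> B" "x \<in> B \<Longrightarrow> y \<in> nb H x \<Longrightarrow> y \<in> A" "A \<inter> B = {}"
  using AB nb_verts unfolding bip_on_def by blast+

lemma no_triangle: "y \<in> nb H x \<Longrightarrow> z \<in> nb H x \<Longrightarrow> z \<notin> nb H y"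
proof
  assume a: "y \<in> nb H x" "z \<in> nb H x" "z \<in> nb H y"
  have "x \<in> A \<or> x \<in> B" using AB nb_verts[OF a(1)] by auto
  then show False using bip a by blast
qed

lemma ladder_in_V: assumes "ladder_in H p q n u v" "i \<le> n" shows "u i \<in> verts H"
proof (cases i)
  case 0
  then show ?thesis using assms nb_verts[OF pq] unfolding ladder_in_def by simp
next
  case (Suc j)
  then have "u i \<in> nb H (u j)" using assms unfolding ladder_in_def by auto
  then show ?thesis using nb_verts by blast
qed

lemma ladder_in_ne: assumes "ladder_in H p q n u v" "i \<le> n" "i \<noteq> 0" shows "u i \<noteq> p" "u i \<noteq> q"
proof -
  have "u i \<noteq> u 0" using assms unfolding ladder_in_def by (metis atMost_iff inj_onD le0)
  then show "u i \<noteq> p" using assms unfolding ladder_in_def by simp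
  have "u i \<in> u ` {..n}" "v 0 \<in> v ` {..n}" using assms by auto
  then show "u i \<noteq> q" using assms(1) unfolding ladder_in_def by (metis disjoint_iff)
qed

text \<open>The listed neighbours are distinct and use up the degree, 2 at the start and 3
  afterwards. Hence the ladder can be left only at its last pair.\<close>

lemma ladder_in_full:
  assumes l: "ladder_in H p q n u v" and i: "i < n"
  shows "nb H (u i) = insert (u (Suc i)) (insert (v i) (if i = 0 then {} else {u (i - 1)}))"
proof -
  let ?R = "insert (u (Suc i)) (insert (v i) (if i = 0 then {} else {u (i - 1)}))"
  have d: "u 0 = p" "inj_on u {..n}" "u ` {..n} \<inter> v ` {..n} = {}"
    "\<And>i. i < n \<Longrightarrow> v i \<in> nb H (u i) \<and> u (Suc i) \<in> nb H (u i)" using l unfolding ladder_in_def by auto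
  have uv: "u a \<noteq> v b" if "a \<le> n" "b \<le> n" for a b using d(3) that by (metis atMost_iff disjoint_iff imageI)
  have sub: "?R \<subseteq> nb H (u i)"
  proof (cases i)
    case 0 then show ?thesis using d(4)[OF i] by auto
  next
    case (Suc j)
    then have "u i \<in> nb H (u j)" using d(4)[of j] i by auto
    then have "u j \<in> nb H (u i)" by (simp add: nb_sym)
    then show ?thesis using d(4)[OF i] Suc by auto
  qed
  have "card ?R = card (nb H (u i))"
  proof (cases "i = 0")
    case True
    then show ?thesis using uv[of "Suc i" i] i d(1) dp by auto
  next
    case False
    have "u (Suc i) \<noteq> u (i - 1)"
    proof
      assume "u (Suc i) = u (i - 1)"
      then have "Suc i = i - 1" using i by (intro inj_onD[OF d(2)]) auto
      then show False by simp
    qed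
    moreover have "card (nb H (u i)) = 3" using d3 ladder_in_V[OF l, of i] ladder_in_ne[OF l, of i] False i by auto
    moreover have "u (i - 1) \<noteq> v i" "u (Suc i) \<noteq> v i" using i by (intro uv; simp)+
    ultimately show ?thesis using False by (simp add: eq_commute[of "v i"])
  qed
  then show ?thesis using sub nb_fin by (metis card_subset_eq)
qed

text \<open>If the last pair is adjacent, rung and predecessor account for two of the three
  neighbours of \<open>u n\<close>. The third is not on the ladder, because all earlier vertices are
  saturated.\<close>

lemma ladder_in_new:
  assumes l: "ladder_in H p q n u v" and n: "1 \<le> n" and r: "v n \<in> nb H (u n)"
  shows "\<exists>z\<in>nb H (u n). z \<notin> u ` {..n} \<union> v ` {..n}"
proof -
  interpret s: gadget H B A q p by (rule sym)
  have inj: "inj_on u {..n}" "inj_on v {..n}" and dj: "u ` {..n} \<inter> v ` {..n} = {}"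
    using l unfolding ladder_in_def by auto
  have uv: "u a \<noteq> v b" if "a \<le> n" "b \<le> n" for a b using dj that by (metis atMost_iff disjoint_iff imageI)
  have ui: "u a = u b \<longleftrightarrow> a = b" if "a \<le> n" "b \<le> n" for a b using inj(1) that by (auto dest: inj_onD)
  have c3: "card (nb H (u n)) = 3" using d3 ladder_in_V[OF l, of n] ladder_in_ne[OF l, of n] n by auto
  have "card {u (n - 1), v n} \<le> 2" by (simp add: card_insert_if)
  then have "\<not> nb H (u n) \<subseteq> {u (n - 1), v n}"
    using c3 card_mono[of "{u (n - 1), v n}" "nb H (u n)"] by fastforce
  then obtain z where z: "z \<in> nb H (u n)" "z \<noteq> u (n - 1)" "z \<noteq> v n" by blast
  have zs: "u n \<in> nb H z" using z by (simp add: nb_sym)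
  have "z \<notin> u ` {..n}"
  proof
    assume "z \<in> u ` {..n}"
    then obtain i where i: "z = u i" "i \<le> n" by auto
    show False
    proof (cases "i = n")
      case True then show False using z i by simp
    next
      case False
      then have "i < n" using i by simp
      have "u n \<in> insert (u (Suc i)) (insert (v i) (if i = 0 then {} else {u (i - 1)}))"
        using zs ladder_in_full[OF l \<open>i < n\<close>] i by simp
      then have "u n = u (Suc i) \<or> u n = u (i - 1)" using uv[of n i] i by (auto split: if_splits)
      then have "n = Suc i" using ui[of n "Suc i"] ui[of n "i - 1"] \<open>i < n\<close> by auto
      then show False using z i by simp
    qed
  qed
  moreover have "z \<notin> v ` {..n}"
  proof
    assume "z \<in> v ` {..n}"
    then obtain i where i: "z = v i" "i \<le> n" by auto
    show False
    proof (cases "i = n")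
      case True then show False using z i by simp
    next
      case False
      then have "i < n" using i by simp
      have "u n \<in> insert (v (Suc i)) (insert (u i) (if i = 0 then {} else {v (i - 1)}))"
        using zs s.ladder_in_full[OF ladder_in_sym[OF l] \<open>i < n\<close>] i by simp
      then have "u n = u i" using uv[of n "Suc i"] uv[of n "i - 1"] \<open>i < n\<close> by (auto split: if_splits)
      then show False using ui[of n i] \<open>i < n\<close> by auto
    qed
  qed
  ultimately show ?thesis using z(1) by blast
qed

text \<open>The new vertices on the two sides differ because there is no triangle. Whether they are
  adjacent remains open, which suits the asymmetric treatment of the last pair in
  \<open>ladder_in\<close>.\<close>

lemma ladder_in_extend:
  assumes l: "ladder_in H p q n u v" and n: "1 \<le> n" and r: "v n \<in> nb H (u n)"
  shows "\<exists>u' v'. ladder_in H p q (Suc n) u' v'"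
proof -
  interpret s: gadget H B A q p by (rule sym)
  have r': "u n \<in> nb H (v n)" using r by (simp add: nb_sym)
  obtain z where z: "z \<in> nb H (u n)" "z \<notin> u ` {..n} \<union> v ` {..n}" using ladder_in_new[OF l n r] by blast
  obtain z' where z': "z' \<in> nb H (v n)" "z' \<notin> v ` {..n} \<union> u ` {..n}"
    using s.ladder_in_new[OF ladder_in_sym[OF l] n r'] by blast
  have zz: "z \<noteq> z'" using no_triangle[OF r, of z] z z' by auto
  let ?u = "u(Suc n := z)" and ?v = "v(Suc n := z')"
  have im: "?u ` {..Suc n} = insert z (u ` {..n})" "?v ` {..Suc n} = insert z' (v ` {..n})"
    by (auto simp: image_iff le_Suc_eq)
  have d: "u 0 = p" "v 0 = q" "inj_on u {..n}" "inj_on v {..n}" "u ` {..n} \<inter> v ` {..n} = {}"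
    "\<And>i. i < n \<Longrightarrow> v i \<in> nb H (u i) \<and> u (Suc i) \<in> nb H (u i) \<and> v (Suc i) \<in> nb H (v i)"
    using l unfolding ladder_in_def by auto
  have "ladder_in H p q (Suc n) ?u ?v"
    unfolding ladder_in_def
  proof (intro conjI allI impI)
    show "inj_on ?u {..Suc n}" using d(3) z(2) by (auto simp: inj_on_def atMost_Suc)
    show "inj_on ?v {..Suc n}" using d(4) z'(2) by (auto simp: inj_on_def atMost_Suc)
    show "?u ` {..Suc n} \<inter> ?v ` {..Suc n} = {}" unfolding im using d(5) z(2) z'(2) zz by auto
    fix i assume i: "i < Suc n"
    show "?v i \<in> nb H (?u i)" "?u (Suc i) \<in> nb H (?u i)" "?v (Suc i) \<in> nb H (?v i)"
      using i d(6)[of i] z(1) z'(1) r by (cases "i = n"; auto)+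
  qed (use d in auto)
  then show ?thesis by blast
qed

text \<open>Length 1 is available from the second neighbours of \<open>p\<close> and
  \<open>q\<close>, and the number of vertices bounds the length. A longest ladder ends in a
  nonadjacent pair, since otherwise it could be extended.\<close>

lemma ladder_in_max:
  obtains n u v where "ladder_in H p q n u v" "1 \<le> n" "v n \<notin> nb H (u n)"
proof -
  have qV: "q \<in> verts H" "p \<in> verts H" "p \<noteq> q" using nb_verts[OF pq] pq by auto
  have "\<exists>w\<in>nb H p. w \<noteq> q"
  proof (rule ccontr)
    assume "\<not> ?thesis"
    then have "nb H p \<subseteq> {q}" by blast
    then show False using dp card_mono[of "{q}" "nb H p"] by simp
  qed
  then obtain w where w: "w \<in> nb H p" "w \<noteq> q" by blast
  have "\<exists>w\<in>nb H q. w \<noteq> p"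
  proof (rule ccontr)
    assume "\<not> ?thesis"
    then have "nb H q \<subseteq> {p}" by blast
    then show False using dq card_mono[of "{p}" "nb H q"] by simp
  qed
  then obtain w' where w': "w' \<in> nb H q" "w' \<noteq> p" by blast
  have ww: "w \<noteq> w'" using no_triangle[OF pq, of w] w w' by auto
  have wp: "w \<noteq> p" "w' \<noteq> q" using w w' by auto
  have base: "ladder_in H p q 1 (\<lambda>i. if i = 0 then p else w) (\<lambda>i. if i = 0 then q else w')"
    unfolding ladder_in_def using w w' ww wp qV pq by (auto simp: inj_on_def atMost_Suc le_Suc_eq)
  let ?P = "\<lambda>n. \<exists>u v. ladder_in H p q n u v"
  have "n < card (verts H)" if "?P n" for n
  proof -
    obtain u v where l: "ladder_in H p q n u v" using \<open>?P n\<close> by blast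
    have "u ` {..n} \<subseteq> verts H" using ladder_in_V[OF l] by auto
    then have "card (u ` {..n}) \<le> card (verts H)" by (intro card_mono) auto
    moreover have "card (u ` {..n}) = Suc n" using l unfolding ladder_in_def by (simp add: card_image)
    ultimately show ?thesis by simp
  qed
  then have "\<exists>n. ?P n \<and> (\<forall>m. ?P m \<longrightarrow> m \<le> n)"
    using base Lattices_Big.ex_has_greatest_nat[of ?P 1 "\<lambda>n. n" "card (verts H)"] by blast
  then obtain n u v where l: "ladder_in H p q n u v" and mx: "\<And>m. ?P m \<Longrightarrow> m \<le> n" by blast
  have "1 \<le> n" using mx[of 1] base by blast
  moreover have "v n \<notin> nb H (u n)"
  proof
    assume "v n \<in> nb H (u n)"
    then have "?P (Suc n)" using ladder_in_extend[OF l \<open>1 \<le> n\<close>] by blast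
    then show False using mx[of "Suc n"] by simp
  qed
  ultimately show ?thesis using that l by blast
qed

end

lemma nb_ladder_set:
  assumes "i \<le> n" "x < 2"
  shows "nb (ladder n) (x, i) =
    insert (1 - x, i) ((if i < n then {(x, Suc i)} else {}) \<union> (if i = 0 then {} else {(x, i - 1)}))"
proof (rule set_eqI)
  fix z :: "nat \<times> nat"
  obtain a b where z: "z = (a, b)" by (cases z)
  have "b = i \<and> x \<noteq> a \<and> a < 2 \<longleftrightarrow> b = i \<and> a = 1 - x" using assms(2) by (auto simp: less_2_cases_iff)
  moreover have "i = Suc b \<longleftrightarrow> i \<noteq> 0 \<and> b = i - 1" by auto
  ultimately show "z \<in> nb (ladder n) (x, i) \<longleftrightarrow> z \<in>
    insert (1 - x, i) ((if i < n then {(x, Suc i)} else {}) \<union> (if i = 0 then {} else {(x, i - 1)}))"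
    unfolding z nb_ladder using assms by auto
qed

lemma gadget_H_diamond:
  fixes H :: "nat graph"
  assumes "gadget H A B p q"
  shows "H \<in> H_diamond"
proof -
  interpret gadget H A B p q by (rule assms)
  interpret s: gadget H B A q p by (rule sym)
  obtain n u v where l: "ladder_in H p q n u v" and n: "1 \<le> n" and na: "v n \<notin> nb H (u n)" by (rule ladder_in_max)
  have d: "u 0 = p" "v 0 = q" "inj_on u {..n}" "inj_on v {..n}" "u ` {..n} \<inter> v ` {..n} = {}"
    "\<And>i. i < n \<Longrightarrow> v i \<in> nb H (u i) \<and> u (Suc i) \<in> nb H (u i) \<and> v (Suc i) \<in> nb H (v i)"
    using l unfolding ladder_in_def by auto
  have uv: "u a \<noteq> v b" if "a \<le> n" "b \<le> n" for a b using d(5) that by (metis atMost_iff disjoint_iff imageI)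
  have ui: "u a = u b \<longleftrightarrow> a = b" and vi: "v a = v b \<longleftrightarrow> a = b" if "a \<le> n" "b \<le> n" for a b
    using d(3,4) that by (auto dest: inj_onD)
  have fu: "nb H (u i) = insert (u (Suc i)) (insert (v i) (if i = 0 then {} else {u (i - 1)}))" if "i < n" for i
    by (rule ladder_in_full[OF l that])
  have fv: "nb H (v i) = insert (v (Suc i)) (insert (u i) (if i = 0 then {} else {v (i - 1)}))" if "i < n" for i
    by (rule s.ladder_in_full[OF ladder_in_sym[OF l] that])
  have uV: "u i \<in> verts H" if "i \<le> n" for i by (rule ladder_in_V[OF l that])
  have vV: "v i \<in> verts H" if "i \<le> n" for i by (rule s.ladder_in_V[OF ladder_in_sym[OF l] that])
  \<comment> \<open>\<open>D\<close> holds the rungs before the last pair, \<open>V0\<close> the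
    last pair and everything beyond; \<open>R0\<close> restores the edge between the last pair that
    edge splicing takes away.\<close>
  define D where "D = u ` {..<n} \<union> v ` {..<n}"
  define V0 where "V0 = verts H - D"
  have un: "u n \<in> V0" "v n \<in> V0" "u n \<noteq> v n"
  proof -
    have "u n \<notin> D" "v n \<notin> D" unfolding D_def by (auto simp: ui vi uv uv[symmetric])
    then show "u n \<in> V0" "v n \<in> V0" "u n \<noteq> v n" using uV[of n] vV[of n] uv[of n n] unfolding V0_def by auto
  qed
  have pqD: "p \<in> D" "q \<in> D" using n d(1,2) unfolding D_def by (metis UnI1 UnI2 imageI lessThan_iff less_le_trans zero_less_one)+
  have DV: "D \<subseteq> verts H" using uV vV unfolding D_def by auto
  \<comment> \<open>By saturation of the earlier rungs, only the two ladder edges into the last pair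
    leave \<open>D\<close>.\<close>
  have crossD: "x = u n \<and> z = u (n - 1) \<or> x = v n \<and> z = v (n - 1)" if x: "x \<in> V0" "z \<in> nb H x" "z \<in> D" for x z
  proof -
    have xz: "x \<in> nb H z" using x(2) by (simp add: nb_sym)
    have xD: "x \<notin> D" using x(1) unfolding V0_def by simp
    have inD: "u i \<in> D" "v i \<in> D" if "i < n" for i using that unfolding D_def by auto
    from x(3) consider i where "z = u i" "i < n" | i where "z = v i" "i < n" unfolding D_def by auto
    then show ?thesis
    proof cases
      case 1
      then have "x = u (Suc i)" using xz fu[OF 1(2)] xD inD by (auto split: if_splits)
      moreover have "Suc i = n" using xD inD[of "Suc i"] calculation 1 by (metis Suc_lessI)
      ultimately show ?thesis using 1 by auto
    next
      case 2
      then have "x = v (Suc i)" using xz fv[OF 2(2)] xD inD by (auto split: if_splits)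
      moreover have "Suc i = n" using xD inD[of "Suc i"] calculation 2 by (metis Suc_lessI)
      ultimately show ?thesis using 2 by auto
    qed
  qed
  have prev: "u (n - 1) \<in> nb H (u n)" "v (n - 1) \<in> nb H (v n)" "u (n - 1) \<in> D" "v (n - 1) \<in> D"
    "v (n - 1) \<in> nb H (u (n - 1))"
    using d(6)[of "n - 1"] n nb_sym[of _ H] unfolding D_def by auto
  define R0 where "R0 = reduce H V0 (u n) (v n)"
  have nbR: "z \<in> nb R0 x \<longleftrightarrow> z \<in> nb H x \<and> x \<in> V0 \<and> z \<in> V0 \<or> x = u n \<and> z = v n \<or> x = v n \<and> z = u n" for x z
    unfolding edge_iff_nb[symmetric] R0_def reduce_def by (auto simp: doubleton_eq_iff)
  have vR: "verts R0 = V0" unfolding R0_def reduce_def by simp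
  have sR: "simple_graph R0"
    using simple un unfolding simple_graph_def R0_def reduce_def V0_def by auto
  interpret R: sgraph R0 by unfold_locales (rule sR)
  have V0V: "V0 \<subseteq> verts H" unfolding V0_def by auto
  have cubR: "cubic R0"
    unfolding cubic_def
  proof
    fix x assume "x \<in> verts R0"
    then have x: "x \<in> V0" "x \<in> verts H" "x \<noteq> p" "x \<noteq> q" using vR V0V pqD unfolding V0_def by auto
    have c3: "card (nb H x) = 3" using d3 x by blast
    have "card (nb R0 x) = 3"
    proof -
      consider "x = u n" | "x = v n" | "x \<noteq> u n" "x \<noteq> v n" by blast
      then show ?thesis
      proof cases
        case 1
        have "nb H x \<inter> D \<subseteq> {u (n - 1)}"
        proof
          fix z assume "z \<in> nb H x \<inter> D"
          then show "z \<in> {u (n - 1)}" using crossD[OF x(1), of z] 1 un(3) by simp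
        qed
        moreover have "u (n - 1) \<in> nb H x \<inter> D" using prev(1,3) 1 by simp
        ultimately have "nb H x \<inter> D = {u (n - 1)}" by blast
        then have "nb H x - {u (n - 1)} = nb H x \<inter> V0" using nb_sub[of x] unfolding V0_def by auto
        then have "nb R0 x = insert (v n) (nb H x - {u (n - 1)})" using nbR[of _ x] 1 un x(1) by auto
        moreover have "v n \<notin> nb H x" "u (n - 1) \<in> nb H x" using na 1 prev by auto
        ultimately show ?thesis using c3 by simp
      next
        case 2
        have "nb H x \<inter> D \<subseteq> {v (n - 1)}"
        proof
          fix z assume "z \<in> nb H x \<inter> D"
          then show "z \<in> {v (n - 1)}" using crossD[OF x(1), of z] 2 un(3) by simp
        qed
        moreover have "v (n - 1) \<in> nb H x \<inter> D" using prev(2,4) 2 by simp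
        ultimately have "nb H x \<inter> D = {v (n - 1)}" by blast
        then have "nb H x - {v (n - 1)} = nb H x \<inter> V0" using nb_sub[of x] unfolding V0_def by auto
        then have "nb R0 x = insert (u n) (nb H x - {v (n - 1)})" using nbR[of _ x] 2 un x(1) by auto
        moreover have "u n \<notin> nb H x" "v (n - 1) \<in> nb H x" using na 2 prev by (auto simp: nb_sym[of "u n"])
        ultimately show ?thesis using c3 by simp
      next
        case 3
        have "nb H x \<inter> D = {}" using crossD[OF x(1)] 3 by blast
        then have "nb R0 x = nb H x" using nbR[of _ x] 3 x(1) nb_sub[of x] unfolding V0_def by auto
        then show ?thesis using c3 by simp
      qed
    qed
    then show "degree R0 x = 3" using R.degree_nb by simp
  qed
  have bipR: "bipartite R0"
  proof -
    have "u (n - 1) \<in> A \<and> v (n - 1) \<in> B \<or> u (n - 1) \<in> B \<and> v (n - 1) \<in> A"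
      using bip(1)[of "u (n - 1)"] bip(2)[of "u (n - 1)"] prev(5) AB(1) nb_verts[OF prev(5)] by blast
    then have un': "u n \<in> A \<and> v n \<in> B \<or> u n \<in> B \<and> v n \<in> A"
    proof -
      have "u n \<in> nb H (u (n - 1))" "v n \<in> nb H (v (n - 1))" using d(6)[of "n - 1"] n by auto
      then show ?thesis using bip(1,2) \<open>u (n - 1) \<in> A \<and> v (n - 1) \<in> B \<or> u (n - 1) \<in> B \<and> v (n - 1) \<in> A\<close> by blast
    qed
    have "bip_on R0 (A \<inter> V0) (B \<inter> V0)"
      unfolding bip_on_def
    proof (intro conjI ballI)
      show "(A \<inter> V0) \<inter> (B \<inter> V0) = {}" using bip(3) by auto
      show "nb R0 x \<inter> (A \<inter> V0) = {}" if x: "x \<in> A \<inter> V0" for x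
        using nbR[of _ x] bip(1)[of x] bip(3) x un' by blast
      show "nb R0 x \<inter> (B \<inter> V0) = {}" if x: "x \<in> B \<inter> V0" for x
        using nbR[of _ x] bip(2)[of x] bip(3) x un' by blast
    qed
    moreover have "A \<inter> V0 \<union> B \<inter> V0 = verts R0" using vR AB(1) V0V by auto
    ultimately show ?thesis using R.bipartite_iff by blast
  qed
  have connR: "connected_graph R0"
  proof (rule R.closed_connected)
    show "verts R0 \<noteq> {}" using vR un by auto
    \<comment> \<open>A closed set that avoids one end of the new edge avoids both, so it is closed
      in \<open>H\<close> as well. A closed set containing that end is treated through its
      complement.\<close>
    have *: "Z = {}" if Z: "Z \<subseteq> V0" "u n \<notin> Z" "\<And>x. x \<in> Z \<Longrightarrow> nb R0 x \<subseteq> Z" for Z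
    proof (rule ccontr)
      assume ne: "Z \<noteq> {}"
      have vn: "v n \<notin> Z" using Z(2) Z(3)[of "v n"] nbR[of "u n" "v n"] by auto
      have "Z = verts H"
      proof (rule conn)
        show "Z \<subseteq> verts H" using Z V0V by auto
        fix x assume x: "x \<in> Z"
        then have "x \<noteq> u n" "x \<noteq> v n" "x \<in> V0" using Z vn by auto
        then have "nb H x \<inter> D = {}" using crossD by blast
        then have "nb H x \<subseteq> nb R0 x" using nbR[of _ x] \<open>x \<in> V0\<close> nb_sub[of x] unfolding V0_def by auto
        then show "nb H x \<subseteq> Z" using Z(3)[OF x] by simp
      qed (rule ne)
      then show False using Z(2) uV[of n] by simp
    qed
    fix X assume X: "X \<subseteq> verts R0" "X \<noteq> {}" "\<And>x. x \<in> X \<Longrightarrow> nb R0 x \<subseteq> X"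
    show "X = verts R0"
    proof (cases "u n \<in> X")
      case False
      then have "X = {}" using X vR by (intro *) auto
      then show ?thesis using X by simp
    next
      case True
      have "verts R0 - X = {}"
      proof (rule *)
        show "verts R0 - X \<subseteq> V0" "u n \<notin> verts R0 - X" using vR True by auto
        fix x assume x: "x \<in> verts R0 - X"
        show "nb R0 x \<subseteq> verts R0 - X"
        proof
          fix y assume y: "y \<in> nb R0 x"
          then have "x \<in> nb R0 y" by (simp add: nb_sym)
          then have "y \<notin> X" using X(3)[of y] x by auto
          then show "y \<in> verts R0 - X" using y R.nb_verts by auto
        qed
      qed
      then show ?thesis using X by auto
    qed
  qed
  \<comment> \<open>The last pair belongs both to the ladder and to the remainder. The remainder
    uses fresh copies \<open>y1\<close>, \<open>y2\<close> of it, so that the vertex sets are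
    disjoint; splicing identifies them again.\<close>
  obtain y1 where y1: "y1 \<notin> verts H" using fresh_nat[OF finV] by blast
  obtain y2 where y2: "y2 \<notin> insert y1 (verts H)" using fresh_nat[of "insert y1 (verts H)"] by auto
  define \<rho> where "\<rho> z = (if z = u n then y1 else if z = v n then y2 else z)" for z
  have rho: "\<rho> (u n) = y1" "\<rho> (v n) = y2" "\<And>z. z \<noteq> u n \<Longrightarrow> z \<noteq> v n \<Longrightarrow> \<rho> z = z" using un unfolding \<rho>_def by auto
  interpret m: relabel R0 \<rho>
  proof
    show "inj_on \<rho> (verts R0)"
      using y1 y2 vR V0V unfolding inj_on_def \<rho>_def by auto
  qed
  have mC: "m.F \<in> cubic_bip"
    unfolding cubic_bip_def using m.simple_map m.connected_map[OF connR] m.cubic_map[OF cubR] m.bipartite_map[OF bipR] by simp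
  have vm: "verts m.F = (V0 - {u n, v n}) \<union> {y1, y2}" using un vR rho by (auto simp: image_iff \<rho>_def)
  have ey: "y2 \<in> nb m.F y1"
    using m.nb_map[of "u n"] vR un nbR[of "v n" "u n"] rho by auto
  define g where "g z = (if fst z = 0 then u (snd z) else v (snd z))" for z :: "nat \<times> nat"
  interpret lg: sgraph "ladder n" by unfold_locales (rule simple_ladder)
  interpret L: relabel "ladder n" g
  proof
    show "inj_on g (verts (ladder n))"
    proof (rule inj_onI)
      fix a b assume ab: "a \<in> verts (ladder n)" "b \<in> verts (ladder n)" "g a = g b"
      obtain i j i' j' where ij: "a = (i,j)" "b = (i',j')" by (cases a; cases b)
      have "j \<le> n" "j' \<le> n" "i = 0 \<or> i = 1" "i' = 0 \<or> i' = 1" using ab(1,2) ij by (auto simp: verts_ladder)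
      then show "a = b" using ab(3) ij ui vi uv uv[symmetric] unfolding g_def by auto
    qed
  qed
  have vL: "verts L.F = D \<union> {u n, v n}"
  proof
    show "verts L.F \<subseteq> D \<union> {u n, v n}"
      unfolding L.verts_map verts_ladder D_def g_def by (auto simp: le_less)
    show "D \<union> {u n, v n} \<subseteq> verts L.F"
    proof -
      have "u i \<in> g ` verts (ladder n)" if "i \<le> n" for i
        using that by (intro image_eqI[of _ _ "(0,i)"]) (auto simp: g_def verts_ladder)
      moreover have "v i \<in> g ` verts (ladder n)" if "i \<le> n" for i
        using that by (intro image_eqI[of _ _ "(1,i)"]) (auto simp: g_def verts_ladder)
      ultimately show ?thesis unfolding L.verts_map D_def by auto
    qed
  qed
  have nLu: "z \<in> nb L.F (u i) \<longleftrightarrow> z = v i \<or> i < n \<and> z = u (Suc i) \<or> (\<exists>j. i = Suc j \<and> z = u j)" if i: "i \<le> n" for i z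
  proof -
    have "nb L.F (u i) = g ` nb (ladder n) (0, i)" using L.nb_map[of "(0,i)"] i by (auto simp: verts_ladder g_def)
    also have "\<dots> = insert (v i) ((if i < n then {u (Suc i)} else {}) \<union> (if i = 0 then {} else {u (i - 1)}))"
      by (subst nb_ladder_set[OF i]) (auto simp: g_def)
    finally show ?thesis by (cases i) auto
  qed
  have nLv: "z \<in> nb L.F (v i) \<longleftrightarrow> z = u i \<or> i < n \<and> z = v (Suc i) \<or> (\<exists>j. i = Suc j \<and> z = v j)" if i: "i \<le> n" for i z
  proof -
    have "nb L.F (v i) = g ` nb (ladder n) (1, i)" using L.nb_map[of "(1,i)"] i by (auto simp: verts_ladder g_def)
    also have "\<dots> = insert (u i) ((if i < n then {v (Suc i)} else {}) \<union> (if i = 0 then {} else {v (i - 1)}))"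
      by (subst nb_ladder_set[OF i]) (auto simp: g_def)
    finally show ?thesis by (cases i) auto
  qed
  have "nb L.F (u i) = nb H (u i)" "nb L.F (v i) = nb H (v i)" if "i < n" for i
  proof -
    show "nb L.F (u i) = nb H (u i)"
    proof (rule set_eqI)
      fix z
      show "z \<in> nb L.F (u i) \<longleftrightarrow> z \<in> nb H (u i)"
        using nLu[of i z] that unfolding fu[OF that] by (cases i) auto
    qed
    show "nb L.F (v i) = nb H (v i)"
    proof (rule set_eqI)
      fix z
      show "z \<in> nb L.F (v i) \<longleftrightarrow> z \<in> nb H (v i)"
        using nLv[of i z] that unfolding fv[OF that] by (cases i) auto
    qed
  qed
  then have fullD: "nb L.F x = nb H x" if "x \<in> D" for x using that unfolding D_def by auto
  have dj: "verts L.F \<inter> verts m.F = {}"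
    unfolding vL vm using y1 y2 DV un V0V unfolding V0_def by auto
  have eL: "v n \<in> nb L.F (u n)" using nLu[of n] by simp
  interpret e: esplice L.F m.F "u n" "v n" y1 y2
    by unfold_locales (use dj eL ey in auto)
  have r\<rho>: "e.r (\<rho> a) = a" if "a \<in> V0" for a
    using that y1 y2 V0V un unfolding e.r_def \<rho>_def by auto
  have second: "(\<exists>a b. b \<in> nb m.F a \<and> {a, b} \<noteq> {y1, y2} \<and> s = e.r a \<and> t = e.r b) \<longleftrightarrow>
      t \<in> nb H s \<and> s \<in> V0 \<and> t \<in> V0" for s t
  proof
    assume "\<exists>a b. b \<in> nb m.F a \<and> {a, b} \<noteq> {y1, y2} \<and> s = e.r a \<and> t = e.r b"
    then obtain a b where ab: "b \<in> nb m.F a" "{a, b} \<noteq> {y1, y2}" "s = e.r a" "t = e.r b" by blast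
    then obtain a' where a': "a = \<rho> a'" "a' \<in> V0" using m.F.nb_verts vR by auto
    then obtain b' where b': "b = \<rho> b'" "b' \<in> nb R0 a'" using ab(1) m.nb_map[of a'] vR by auto
    have st: "s = a'" "t = b'" using r\<rho> a' b' ab R.nb_verts[OF b'(2)] vR by auto
    have "\<not> (a' = u n \<and> b' = v n \<or> a' = v n \<and> b' = u n)" using ab(2) a' b' rho by (auto simp: insert_commute)
    then show "t \<in> nb H s \<and> s \<in> V0 \<and> t \<in> V0" using b'(2) nbR st by blast
  next
    assume st: "t \<in> nb H s \<and> s \<in> V0 \<and> t \<in> V0"
    then have "t \<in> nb R0 s" using nbR by blast
    then have 1: "\<rho> t \<in> nb m.F (\<rho> s)" using m.nb_map[of s] vR st by auto
    have na': "u n \<notin> nb H (v n)" using na by (simp add: nb_sym)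
    have 2: "{\<rho> s, \<rho> t} \<noteq> {y1, y2}"
    proof
      assume "{\<rho> s, \<rho> t} = {y1, y2}"
      then have "\<rho> s = y1 \<and> \<rho> t = y2 \<or> \<rho> s = y2 \<and> \<rho> t = y1" by (auto simp: doubleton_eq_iff)
      then have "e.r (\<rho> s) = u n \<and> e.r (\<rho> t) = v n \<or> e.r (\<rho> s) = v n \<and> e.r (\<rho> t) = u n"
        using e.r_simps by auto
      then show False using r\<rho> st na na' by auto
    qed
    show "\<exists>a b. b \<in> nb m.F a \<and> {a, b} \<noteq> {y1, y2} \<and> s = e.r a \<and> t = e.r b"
      using 1 2 r\<rho> st by metis
  qed
  have first: "t \<in> nb L.F s \<and> {s, t} \<noteq> {u n, v n} \<longleftrightarrow> t \<in> nb H s \<and> (s \<in> D \<or> t \<in> D)" for s t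
  proof
    assume st: "t \<in> nb L.F s \<and> {s, t} \<noteq> {u n, v n}"
    then have "s \<in> verts L.F" "t \<in> verts L.F" "s \<noteq> t" using L.F.nb_verts L.F.nb_irrefl by blast+
    then have "s \<in> D \<or> t \<in> D" using st vL by auto
    then show "t \<in> nb H s \<and> (s \<in> D \<or> t \<in> D)" using st fullD nb_sym by metis
  next
    assume st: "t \<in> nb H s \<and> (s \<in> D \<or> t \<in> D)"
    then have "t \<in> nb L.F s" using fullD nb_sym by metis
    moreover have "u n \<notin> D" "v n \<notin> D" using un unfolding V0_def by auto
    then have "{s, t} \<noteq> {u n, v n}" using st by (auto simp: doubleton_eq_iff)
    ultimately show "t \<in> nb L.F s \<and> {s, t} \<noteq> {u n, v n}" by simp
  qed
  have eq: "e.S = H"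
  proof (rule graph_eqI[OF e.simple_S simple])
    show "verts e.S = verts H" unfolding e.verts_S vL vm using un y1 y2 DV V0V unfolding V0_def by auto
    fix x
    show "nb e.S x = nb H x"
    proof (rule set_eqI)
      fix t
      have "x \<in> V0 \<or> x \<in> D" "t \<in> V0 \<or> t \<in> D" if "t \<in> nb H x" using nb_verts[OF that] unfolding V0_def by auto
      then show "t \<in> nb e.S x \<longleftrightarrow> t \<in> nb H x" unfolding e.nb_S first second by blast
    qed
  qed
  have isoL: "L.F \<cong>\<^sub>g ladder n" by (rule graph_iso_sym[OF L.iso_map])
  have e22: "edge22 L.F {u n, v n}"
  proof -
    obtain k where k: "n = Suc k" using n by (cases n) auto
    have "nb L.F (u n) = {v n, u k}" using nLu[of n] k by auto
    moreover have "nb L.F (v n) = {u n, v k}" using nLv[of n] k by auto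
    moreover have "v n \<noteq> u k" "u n \<noteq> v k" using uv[of k n] uv[of n k] k by auto
    ultimately show ?thesis unfolding edge22_def using eL by (auto simp: L.F.degree_nb edge_iff_nb)
  qed
  have yy: "{y1, y2} \<in> edges m.F" using ey by (simp add: edge_iff_nb)
  show ?thesis
    unfolding H_diamond_def mem_Collect_eq
    by (rule exI[of _ L.F], rule exI[of _ m.F], rule exI[of _ n], rule exI[of _ "u n"], rule exI[of _ "v n"],
        rule exI[of _ y1], rule exI[of _ y2])
      (simp only: eq n L.simple_map isoL e22 mC dj yy simp_thms)
qed

lemma H_diamond_balanced_bip:
  assumes "H \<in> H_diamond"
  shows "simple_graph H" "\<exists>P Q. balanced_bip H P Q"
proof -
  obtain L H0 n x1 x2 y1 y2 where d: "H = edge_splice L H0 (x1, x2) (y1, y2)" "simple_graph L" "L \<cong>\<^sub>g ladder n"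
    "edge22 L {x1, x2}" "H0 \<in> cubic_bip" "{y1, y2} \<in> edges H0" "verts L \<inter> verts H0 = {}"
    using assms unfolding H_diamond_def by blast
  interpret L: sgraph L by unfold_locales (rule d(2))
  interpret H: sgraph H0 by unfold_locales (use d(5) in \<open>simp add: cubic_bip_def\<close>)
  interpret e: esplice L H0 x1 x2 y1 y2
    by unfold_locales (use d(4,6,7) in \<open>auto simp: edge22_def edge_iff_nb\<close>)
  show "simple_graph H" unfolding d(1) by (rule e.simple_S)
  obtain P1 Q1 where b1: "balanced_bip L P1 Q1" "x1 \<in> P1"
    using ladder_balanced_bip[OF d(2,3)] balanced_bip_orient e.ends(3) by metis
  have "cubic H0" "bipartite H0" using d(5) by (auto simp: cubic_bip_def)
  then obtain P Q where "P \<union> Q = verts H0" "bip_on H0 P Q" using H.bipartite_iff by auto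
  moreover from this have "card P = card Q"
    using \<open>cubic H0\<close> by (intro H.bip_balanced) (auto simp: cubic_def H.degree_nb)
  ultimately have "balanced_bip H0 P Q" unfolding balanced_bip_def by simp
  then obtain P2 Q2 where b2: "balanced_bip H0 P2 Q2" "y1 \<in> P2" using balanced_bip_orient e.ends(5) by metis
  show "\<exists>P Q. balanced_bip H P Q" unfolding d(1) using e.balanced_bip_S[OF b1 b2] by blast
qed

section \<open>Labels of graphs obtained from K4\<close>

lemma K4_edges_sub: "edges K4 \<subseteq> {{0,1},{0,2},{0,3},{1,2},{1,3},{2,3}}"
proof
  fix e assume "e \<in> edges K4"
  then obtain i j where e: "e = {i, j}" "i < 4" "j < 4" "i \<noteq> j" unfolding complete_graph_def by auto
  then have "i = 0 \<or> i = 1 \<or> i = 2 \<or> i = 3" "j = 0 \<or> j = 1 \<or> j = 2 \<or> j = 3" by auto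
  then show "e \<in> {{0,1},{0,2},{0,3},{1,2},{1,3},{2,3}}"
    using e(1,4) by (elim disjE) (simp_all add: insert_commute)
qed

lemma K4_edge_iff: "{x, y} \<in> edges K4 \<longleftrightarrow> x < 4 \<and> y < 4 \<and> x \<noteq> y"
  unfolding complete_graph_def by (auto simp: doubleton_eq_iff)

lemma verts_K4: "verts K4 = {..<4}"
  by (simp add: complete_graph_def)

lemma simple_K4: "simple_graph K4"
  unfolding simple_graph_def complete_graph_def by (auto simp: card_2_iff)

lemma K4_replaced_sub: "K4_replaced S F \<Longrightarrow> S \<subseteq> edges K4"
  by (induction rule: K4_replaced.induct) auto

lemma Collect_const_conj: "{w \<in> Z. c} = (if c then Z else {})"
  by simp

text \<open>The last conjunct strengthens the induction: the next splice takes place at an edge of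
  \<open>K4\<close> that must still be an edge of the current graph.\<close>

lemma K4_replaced_k4like:
  assumes "K4_replaced S F"
  shows "simple_graph F \<and> (\<exists>l. k4like F {..<4} l) \<and> (\<forall>e\<in>edges K4. e \<notin> S \<longrightarrow> e \<in> edges F)"
  using assms
proof (induction rule: K4_replaced.induct)
  case K4
  have "k4like K4 {..<4} l" for l unfolding k4like_def verts_K4 by simp
  then show ?case using simple_K4 by blast
next
  case (replace S G x1 x2 H y1 y2)
  obtain l where l: "k4like G {..<4} l" using replace.IH by blast
  have sG: "simple_graph G" and eG: "\<forall>e\<in>edges K4. e \<notin> S \<longrightarrow> e \<in> edges G" using replace.IH by auto
  note sH = H_diamond_balanced_bip(1)[OF \<open>H \<in> H_diamond\<close>]
  interpret g: sgraph G by unfold_locales (rule sG)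
  interpret h: sgraph H by unfold_locales (rule sH)
  have e12: "{x1,x2} \<in> edges G" using eG replace.hyps by blast
  interpret e: esplice G H x1 x2 y1 y2
    by unfold_locales (use replace.hyps e12 in \<open>auto simp: edge22_def edge_iff_nb\<close>)
  obtain P Q where b: "balanced_bip H P Q" "y1 \<in> P"
    using H_diamond_balanced_bip(2)[OF \<open>H \<in> H_diamond\<close>] balanced_bip_orient e.ends(5) by metis
  have PQ: "P \<union> Q = verts H" "card P = card Q" "P \<inter> Q = {}" "\<And>x. x \<in> P \<Longrightarrow> nb H x \<inter> P = {}" "\<And>x. x \<in> Q \<Longrightarrow> nb H x \<inter> Q = {}"
    using b unfolding balanced_bip_def bip_on_def by auto
  have y2: "y2 \<in> Q" "y2 \<notin> P" "y1 \<notin> Q" using e.ends e.ey b PQ by blast+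
  have x4: "x1 < 4" "x2 < 4" "x1 \<noteq> x2" using replace.hyps K4_edge_iff by auto
  have K: "{..<4} \<subseteq> verts G" "card {..<4::nat} = 4"
    and lK: "\<And>v. v \<in> verts G - {..<4} \<Longrightarrow> fst (l v) \<in> {..<4} \<and> snd (l v) \<in> {..<4} \<and> fst (l v) \<noteq> snd (l v)"
    and ln: "\<And>u v. u \<in> verts G - {..<4} \<Longrightarrow> v \<in> nb G u \<Longrightarrow> v = fst (l u) \<or> v \<notin> {..<4} \<and> l v = prod.swap (l u)"
    and lc: "\<And>p. card {v \<in> verts G - {..<4}. l v = p} = card {v \<in> verts G - {..<4}. l v = prod.swap p}"
    using l unfolding k4like_def by blast+
  \<comment> \<open>\<open>y1\<close> becomes the corner \<open>x1\<close> and lies in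
    \<open>P\<close>, so its neighbours in the gadget lie in \<open>Q\<close>; this is the class
    labelled \<open>(x1, x2)\<close>.\<close>
  define l' where "l' v = (if v \<in> verts G then l v else if v \<in> Q then (x1, x2) else (x2, x1))" for v
  have dj: "v \<notin> verts H" if "v \<in> verts G" for v using that e.dj by auto
  have lG: "v \<in> verts G \<Longrightarrow> l' v = l v" and lQ: "v \<in> Q \<Longrightarrow> l' v = (x1, x2)" and lP: "v \<in> P \<Longrightarrow> l' v = (x2, x1)" for v
    using dj PQ(1,3) unfolding l'_def by auto
  have VS: "verts e.S - {..<4} = (verts G - {..<4}) \<union> ((P - {y1}) \<union> (Q - {y2}))"
    unfolding e.verts_S PQ(1)[symmetric] using K(1) e.dj PQ(1) y2 b(2) PQ(3) by auto
  have nK: "v \<notin> {..<4}" if "v \<in> P \<union> Q" for v using that K(1) e.dj PQ(1) by auto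
  have "k4like e.S {..<4} l'"
    unfolding k4like_def
  proof (intro conjI ballI allI)
    show "{..<4} \<subseteq> verts e.S" "card {..<4::nat} = 4" using K unfolding e.verts_S by auto
    fix v assume "v \<in> verts e.S - {..<4}"
    then consider "v \<in> verts G - {..<4}" | "v \<in> P" | "v \<in> Q" unfolding VS by blast
    then have "fst (l' v) \<in> {..<4} \<and> snd (l' v) \<in> {..<4} \<and> fst (l' v) \<noteq> snd (l' v)"
      using lK[of v] lG[of v] lP[of v] lQ[of v] x4 by cases auto
    then show "fst (l' v) \<in> {..<4}" "snd (l' v) \<in> {..<4}" "fst (l' v) \<noteq> snd (l' v)" by auto
  next
    fix u v assume u: "u \<in> verts e.S - {..<4}" and v: "v \<in> nb e.S u"
    from v consider "v \<in> nb G u" | a c where "c \<in> nb H a" "u = e.r a" "v = e.r c" unfolding e.nb_S by blast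
    then show "v = fst (l' u) \<or> v \<notin> {..<4} \<and> l' v = prod.swap (l' u)"
    proof cases
      case 1
      then have "u \<in> verts G" "v \<in> verts G" using g.nb_verts by auto
      then show ?thesis using ln[of u v] 1 u lG by auto
    next
      case 2
      have a: "a \<noteq> y1" "a \<noteq> y2" using 2(2) u x4 e.r_simps by auto
      then have ua: "u = a" using 2 e.r_simps by simp
      have ac: "a \<in> verts H" "c \<in> verts H" using h.nb_verts[OF 2(1)] by auto
      show ?thesis
      proof (cases "a \<in> Q")
        case True
        then have cP: "c \<in> P" using ac PQ 2(1) by blast
        show ?thesis
        proof (cases "c = y1")
          case True
          then show ?thesis using 2 e.r_simps lQ[OF \<open>a \<in> Q\<close>] ua by simp
        next
          case False
          then have "v = c" using 2 e.r_simps cP y2 by auto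
          then show ?thesis using lQ[OF \<open>a \<in> Q\<close>] lP[OF cP] ua nK[of c] cP by simp
        qed
      next
        case False
        then have aP: "a \<in> P" using ac PQ by blast
        then have cQ: "c \<in> Q" using ac PQ 2(1) by blast
        show ?thesis
        proof (cases "c = y2")
          case True
          then show ?thesis using 2 e.r_simps lP[OF aP] ua by simp
        next
          case False
          moreover have "c \<noteq> y1" using cQ y2 by auto
          ultimately have "v = c" using 2 e.r_simps by simp
          then show ?thesis using lP[OF aP] lQ[OF cQ] ua nK[of c] cQ by simp
        qed
      qed
    qed
  next
    fix p
    have fin: "finite P" "finite Q" using PQ(1) h.finV by (metis finite_Un)+
    have x12: "(x1, x2) \<noteq> (x2, x1)" using x4 by simp
    \<comment> \<open>\<open>y1\<close> and \<open>y2\<close> have become corners and drop out, one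
      from each class, so the two counts stay equal.\<close>
    have cnt: "card {v \<in> verts e.S - {..<4}. l' v = q} = card {v \<in> verts G - {..<4}. l v = q} +
        ((if q = (x1,x2) then card (Q - {y2}) else 0) + (if q = (x2,x1) then card (P - {y1}) else 0))" for q
    proof -
      have "{v \<in> verts e.S - {..<4}. l' v = q} = {v \<in> verts G - {..<4}. l v = q} \<union>
        ({w \<in> Q - {y2}. q = (x1,x2)} \<union> {w \<in> P - {y1}. q = (x2,x1)})"
        (is "_ = ?X \<union> ?Y")
      proof (rule set_eqI)
        fix v
        have VSv: "v \<in> verts e.S - {..<4} \<longleftrightarrow> v \<in> verts G - {..<4} \<or> v \<in> P - {y1} \<or> v \<in> Q - {y2}"
          unfolding VS by simp
        have Yv: "v \<in> ?Y \<longleftrightarrow> q = (x1,x2) \<and> v \<in> Q - {y2} \<or> q = (x2,x1) \<and> v \<in> P - {y1}"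
          by blast
        consider "v \<in> verts G" "v \<notin> P" "v \<notin> Q" | "v \<in> P" "v \<notin> verts G" "v \<notin> Q" | "v \<in> Q" "v \<notin> verts G" "v \<notin> P"
          | "v \<notin> verts G" "v \<notin> P" "v \<notin> Q"
          using PQ(1,3) dj by blast
        then show "v \<in> {v \<in> verts e.S - {..<4}. l' v = q} \<longleftrightarrow> v \<in> ?X \<union> ?Y"
        proof cases
          case 1
          then have "l' v = q \<longleftrightarrow> l v = q" using lG[of v] by simp
          then show ?thesis using 1 VSv Yv by blast
        next
          case 2
          then have "l' v = q \<longleftrightarrow> q = (x2, x1)" using lP[of v] by auto
          then show ?thesis using 2 VSv Yv x12 by blast
        next
          case 3
          then have "l' v = q \<longleftrightarrow> q = (x1, x2)" using lQ[of v] by auto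
          then show ?thesis using 3 VSv Yv x12 by blast
        next
          case 4 then show ?thesis using VSv Yv by blast
        qed
      qed
      then have s1: "card {v \<in> verts e.S - {..<4}. l' v = q} = card (?X \<union> ?Y)" by (rule arg_cong)
      have s2: "card (?X \<union> ?Y) = card ?X + card ?Y"
      proof (rule card_Un_disjoint)
        have "?X \<subseteq> verts G" by (rule subsetI) simp
        moreover have "?Y \<subseteq> P \<union> Q" by blast
        ultimately show "?X \<inter> ?Y = {}" using e.dj unfolding PQ(1) by blast
        show "finite ?X" using g.finV by (rule rev_finite_subset) blast
        show "finite ?Y" by (rule finite_subset[OF \<open>?Y \<subseteq> P \<union> Q\<close> finite_UnI[OF fin]])
      qed
      have s3: "card ?Y = (if q = (x1,x2) then card (Q - {y2}) else 0) + (if q = (x2,x1) then card (P - {y1}) else 0)"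
      proof -
        have t1: "card ?Y = card {w \<in> Q - {y2}. q = (x1,x2)} + card {w \<in> P - {y1}. q = (x2,x1)}"
        proof (rule card_Un_disjoint)
          show "finite {w \<in> Q - {y2}. q = (x1,x2)}" by (rule finite_subset[OF _ fin(2)]) blast
          show "finite {w \<in> P - {y1}. q = (x2,x1)}" by (rule finite_subset[OF _ fin(1)]) blast
          show "{w \<in> Q - {y2}. q = (x1,x2)} \<inter> {w \<in> P - {y1}. q = (x2,x1)} = {}" using PQ(3) by blast
        qed
        have t2: "card {w \<in> Q - {y2}. q = (x1,x2)} = (if q = (x1,x2) then card (Q - {y2}) else 0)"
          by (subst Collect_const_conj) simp
        have t3: "card {w \<in> P - {y1}. q = (x2,x1)} = (if q = (x2,x1) then card (P - {y1}) else 0)"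
          by (subst Collect_const_conj) simp
        show ?thesis unfolding t1 t2 t3 ..
      qed
      show ?thesis unfolding s1 s2 s3 ..
    qed
    have sw: "prod.swap p = (x1,x2) \<longleftrightarrow> p = (x2,x1)" "prod.swap p = (x2,x1) \<longleftrightarrow> p = (x1,x2)"
      by (cases p; auto)+
    have "card (Q - {y2}) = card Q - 1" by (rule card_Diff_singleton[OF y2(1)])
    moreover have "card (P - {y1}) = card P - 1" by (rule card_Diff_singleton[OF b(2)])
    ultimately have ab: "card (Q - {y2}) = card (P - {y1})" using PQ(2) by (simp only:)
    show "card {v \<in> verts e.S - {..<4}. l' v = p} = card {v \<in> verts e.S - {..<4}. l' v = prod.swap p}"
      unfolding cnt sw ab lc[of p] by (simp only: add.commute)
  qed
  moreover have "e \<in> edges e.S" if "e \<in> edges K4" "e \<notin> insert {x1,x2} S" for e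
    using that eG unfolding e.S_eq by auto
  ultimately show ?case using e.simple_S by blast
qed

section \<open>Rebuilding a labelled graph from K4\<close>

context cub
begin

text \<open>Towards each of the three other corners at least one edge leaves \<open>x\<close>,
  directly or into the gadget. As \<open>x\<close> has three edges, there is exactly one in each
  direction.\<close>

lemma k4_unique_exit:
  assumes k: "k4like G K l" "k4full G K l" and x: "x \<in> K" "z \<in> K" "x \<noteq> z"
  shows "card (nb G x \<inter> insert z {v \<in> verts G - K. l v = (x, z)}) = 1"
proof -
  have K: "K \<subseteq> verts G" "card K = 4"
    and lK: "\<And>v. v \<in> verts G - K \<Longrightarrow> fst (l v) \<in> K \<and> snd (l v) \<in> K \<and> fst (l v) \<noteq> snd (l v)"
    and ln: "\<And>u v. u \<in> verts G - K \<Longrightarrow> v \<in> nb G u \<Longrightarrow> v = fst (l u) \<or> v \<notin> K \<and> l v = prod.swap (l u)"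
    and lc: "\<And>p. card {v \<in> verts G - K. l v = p} = card {v \<in> verts G - K. l v = prod.swap p}"
    using k(1) unfolding k4like_def by blast+
  define Z where "Z p = {v \<in> verts G - K. l v = p}" for p
  have ZV: "Z p \<subseteq> verts G" "Z p \<inter> K = {}" "finite (Z p)" for p unfolding Z_def by auto
  have nbZ: "nb G v \<subseteq> insert x (Z (z, x))" if "v \<in> Z (x, z)" for v x z
    using ln[of v] that nb_sub[of v] unfolding Z_def by fastforce
  have ge: "1 \<le> card (nb G x \<inter> insert z (Z (x, z)))" if xz: "x \<in> K" "z \<in> K" "x \<noteq> z" for x z
  proof -
    have "nb G x \<inter> insert z (Z (x, z)) \<noteq> {}"
    proof (cases "z \<in> nb G x")
      case False
      \<comment> \<open>Equal class sizes force equally many exits at both corners, so the cut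
        around the gadget is twice the number at \<open>x\<close>; 2-edge-connectivity makes it
        nonzero.\<close>
      let ?P = "Z (x, z)" and ?Q = "Z (z, x)"
      have "?P \<noteq> {}" using k(2) xz False unfolding k4full_def Z_def by blast
      have cPQ: "card ?P = card ?Q" using lc[of "(x,z)"] unfolding Z_def by simp
      have c: "3 * card P = ec G P Q + ec G P {x}"
        if "P = Z (x, z)" "Q = Z (z, x)" "x \<in> K" for P Q x z
      proof -
        have "ec G P (verts G) = ec G P (Q \<union> {x})"
          by (rule ec_cong_right) (use nbZ[of _ x z] that nb_sub in \<open>auto simp: Int_absorb2\<close>)
        also have "\<dots> = ec G P Q + ec G P {x}" by (rule ec_Un2) (use that ZV(2)[of "(z, x)"] in auto)
        finally show ?thesis using ec_V[of P] ZV that by simp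
      qed
      have cP: "3 * card ?P = ec G ?P ?Q + ec G ?P {x}" by (rule c) (use xz in auto)
      have cQ: "3 * card ?Q = ec G ?Q ?P + ec G ?Q {z}" by (rule c) (use xz in auto)
      have "ec G ?P ?Q = ec G ?Q ?P" by (rule ec_sym) (use ZV in auto)
      then have eq: "ec G ?P {x} = ec G ?Q {z}" using cP cQ cPQ by linarith
      have dis: "?P \<inter> ?Q = {}" using xz unfolding Z_def by auto
      have "cut G (?P \<union> ?Q) = ec G ?P (verts G - (?P \<union> ?Q)) + ec G ?Q (verts G - (?P \<union> ?Q))"
        by (rule ec_Un1) (use ZV dis in auto)
      also have "ec G ?P (verts G - (?P \<union> ?Q)) = ec G ?P {x}"
      proof (rule ec_cong_right)
        fix u assume "u \<in> ?P"
        then show "nb G u \<inter> (verts G - (?P \<union> ?Q)) = nb G u \<inter> {x}"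
          using nbZ[of u x z] xz ZV(2)[of "(x, z)"] ZV(2)[of "(z, x)"] by auto
      qed
      also have "ec G ?Q (verts G - (?P \<union> ?Q)) = ec G ?Q {z}"
      proof (rule ec_cong_right)
        fix u assume "u \<in> ?Q"
        then show "nb G u \<inter> (verts G - (?P \<union> ?Q)) = nb G u \<inter> {z}"
          using nbZ[of u z x] xz ZV(2)[of "(x, z)"] ZV(2)[of "(z, x)"] by auto
      qed
      finally have "cut G (?P \<union> ?Q) = 2 * ec G ?P {x}" using eq by simp
      moreover have "2 \<le> cut G (?P \<union> ?Q)"
      proof (rule cut2)
        show "?P \<union> ?Q \<noteq> verts G" using xz K ZV(2) by blast
      qed (use ZV \<open>?P \<noteq> {}\<close> in auto)
      ultimately have "ec G ?P {x} \<noteq> 0" by simp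
      moreover have "ec G ?P {x} = ec G {x} ?P" by (rule ec_sym) (use ZV in auto)
      ultimately have "card (nb G x \<inter> ?P) \<noteq> 0" by simp
      then show ?thesis by (metis Int_insert_right card.empty insert_not_empty)
    qed auto
    then show ?thesis by (simp add: Suc_le_eq card_gt_0_iff)
  qed
  have finK: "finite K" using K finite_sub by blast
  have xV: "x \<in> verts G" using x K by auto
  have nbx: "nb G x = (\<Union>z\<in>K - {x}. nb G x \<inter> insert z (Z (x, z)))"
  proof
    show "nb G x \<subseteq> (\<Union>z\<in>K - {x}. nb G x \<inter> insert z (Z (x, z)))"
    proof
      fix u assume u: "u \<in> nb G x"
      have uV: "u \<in> verts G" "u \<noteq> x" "x \<in> nb G u" using u nb_verts by (auto simp: nb_sym[of x])
      show "u \<in> (\<Union>z\<in>K - {x}. nb G x \<inter> insert z (Z (x, z)))"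
      proof (cases "u \<in> K")
        case True then show ?thesis using u uV by auto
      next
        case False
        then have "x = fst (l u)" using ln[of u x] uV x by auto
        then have "u \<in> Z (x, snd (l u))" "snd (l u) \<in> K - {x}" using lK[of u] uV False unfolding Z_def by auto
        then show ?thesis using u by blast
      qed
    qed
  qed auto
  have "card (nb G x) = (\<Sum>z\<in>K - {x}. card (nb G x \<inter> insert z (Z (x, z))))"
    by (subst nbx, rule card_UN_disjoint) (use finK ZV in \<open>auto simp: Z_def\<close>)
  then have sum3: "(\<Sum>z\<in>K - {x}. card (nb G x \<inter> insert z (Z (x, z)))) = 3" using nb_card[OF xV] by simp
  have "\<not> 1 < card (nb G x \<inter> insert z (Z (x, z)))"
  proof
    assume a: "1 < card (nb G x \<inter> insert z (Z (x, z)))"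
    have "(\<Sum>z\<in>K - {x}. 1) < (\<Sum>z\<in>K - {x}. card (nb G x \<inter> insert z (Z (x, z))))"
    proof (rule sum_strict_mono_ex1)
      show "\<forall>z\<in>K - {x}. 1 \<le> card (nb G x \<inter> insert z (Z (x, z)))" using ge x(1) by auto
      show "\<exists>z\<in>K - {x}. 1 < card (nb G x \<inter> insert z (Z (x, z)))" using a x by blast
    qed (use finK in simp)
    moreover have "(\<Sum>z\<in>K - {x}. 1) = (3::nat)" using K x finK by simp
    ultimately show False using sum3 by simp
  qed
  then show ?thesis using ge[OF x] unfolding Z_def by simp
qed

end

text \<open>One gadget is traded for an edge between its corners by \<open>reduce\<close>, which
  leaves a smaller graph with the same labels elsewhere. The gadget, closed up to a member of
  \<open>H_diamond\<close>, is then spliced back at that edge.\<close>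

lemma k4_to_K4_replaced:
  fixes G :: "nat graph"
  assumes "cub G" "k4like G {..<4} l" "k4full G {..<4} l"
  shows "K4_replaced {{x, y} | x y. \<exists>v\<in>verts G - {..<4}. l v = (x, y)} G"
  using assms
proof (induction "card (verts G)" arbitrary: G rule: less_induct)
  case less
  interpret cub G by (rule less.prems(1))
  note k = less.prems(2,3)
  have K: "{..<4} \<subseteq> verts G" "card {..<4::nat} = 4"
    and lK: "\<And>v. v \<in> verts G - {..<4} \<Longrightarrow> fst (l v) \<in> {..<4} \<and> snd (l v) \<in> {..<4} \<and> fst (l v) \<noteq> snd (l v)"
    and ln: "\<And>u v. u \<in> verts G - {..<4} \<Longrightarrow> v \<in> nb G u \<Longrightarrow> v = fst (l u) \<or> v \<notin> {..<4} \<and> l v = prod.swap (l u)"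
    and lc: "\<And>p. card {v \<in> verts G - {..<4}. l v = p} = card {v \<in> verts G - {..<4}. l v = prod.swap p}"
    using k(1) unfolding k4like_def by blast+
  show ?case
  proof (cases "verts G = {..<4}")
    case True
    have "G = K4"
    proof (rule graph_eqI[OF simple simple_K4])
      show "verts G = verts K4" using True verts_K4 by simp
      fix x assume x: "x \<in> verts G"
      show "nb G x = nb K4 x"
      proof (rule set_eqI)
        fix y
        have "y \<in> nb G x \<longleftrightarrow> y < 4 \<and> x \<noteq> y"
          using k(2) x True nb_verts[of y x] unfolding k4full_def by auto
        then show "y \<in> nb G x \<longleftrightarrow> y \<in> nb K4 x" using x True K4_edge_iff[of x y] by (auto simp: edge_iff_nb)
      qed
    qed
    then show ?thesis using True K4_replaced.K4 by simp
  next
    case False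
    then obtain v0 where v0: "v0 \<in> verts G - {..<4}" using K by auto
    obtain x y where lv0: "l v0 = (x, y)" by fastforce
    have xy: "x < 4" "y < 4" "x \<noteq> y" using lK[OF v0] lv0 by auto
    define P where "P = {v \<in> verts G - {..<4}. l v = (x, y)}"
    define Q where "Q = {v \<in> verts G - {..<4}. l v = (y, x)}"
    have fin: "finite P" "finite Q" unfolding P_def Q_def by auto
    have cPQ: "card P = card Q" using lc[of "(x,y)"] unfolding P_def Q_def by simp
    have "P \<noteq> {}" using v0 lv0 unfolding P_def by auto
    then have "card P \<noteq> 0" using fin by simp
    then have "Q \<noteq> {}" using cPQ fin by auto
    have PQ: "P \<inter> Q = {}" "P \<subseteq> verts G" "Q \<subseteq> verts G" "P \<inter> {..<4} = {}" "Q \<inter> {..<4} = {}"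
      using xy unfolding P_def Q_def by auto
    have nbP: "nb G u \<subseteq> insert x Q" if "u \<in> P" for u
    proof
      fix v assume v: "v \<in> nb G u"
      then show "v \<in> insert x Q" using ln[of u v] that nb_verts[OF v] unfolding P_def Q_def by auto
    qed
    have nbQ: "nb G u \<subseteq> insert y P" if "u \<in> Q" for u
    proof
      fix v assume v: "v \<in> nb G u"
      then show "v \<in> insert y P" using ln[of u v] that nb_verts[OF v] unfolding P_def Q_def by auto
    qed
    have fsh: "x \<notin> P" "x \<notin> Q" "y \<notin> P" "y \<notin> Q" "x \<in> verts G" "y \<in> verts G" using PQ xy K by auto
    let ?W = "P \<union> Q"
    \<comment> \<open>Formulated for one corner so that it serves both. The single exit from
      \<open>a\<close> towards \<open>b\<close> leads into the gadget, hence the corners are not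
      adjacent, as a \<open>two_cut\<close> requires.\<close>
    have exits: "\<exists>w. nb G a \<inter> A = {w} \<and> b \<notin> nb G a"
      if ab: "a < 4" "b < 4" "a \<noteq> b" "A = {v \<in> verts G - {..<4}. l v = (a, b)}" "A \<noteq> {}"
        "\<And>u. u \<in> A \<Longrightarrow> nb G u \<subseteq> insert a B" "3 * card A = ec G A B + card (nb G a \<inter> A)" "finite A" "finite B" "a \<notin> B"
        "3 * card B = ec G A B + card (nb G b \<inter> B)" "card A = card B" "2 \<le> card (nb G a \<inter> A) + card (nb G b \<inter> B)"
      for a b A B
    proof -
      have one: "card (nb G a \<inter> insert b A) = 1"
        using k4_unique_exit[OF k, of a b] ab by simp
      have "card (nb G a \<inter> A) = card (nb G b \<inter> B)" using ab by linarith
      then have "1 \<le> card (nb G a \<inter> A)" using ab by linarith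
      moreover have "card (nb G a \<inter> A) \<le> card (nb G a \<inter> insert b A)" by (rule card_mono) auto
      ultimately have c1: "card (nb G a \<inter> A) = 1" using one by linarith
      then obtain w where w: "nb G a \<inter> A = {w}" by (auto simp: card_1_singleton_iff)
      have "b \<notin> A" using ab by auto
      have "b \<notin> nb G a"
      proof
        assume "b \<in> nb G a"
        then have "nb G a \<inter> insert b A = insert b (nb G a \<inter> A)" by auto
        then show False using one c1 \<open>b \<notin> A\<close> by simp
      qed
      then show ?thesis using w by blast
    qed
    have cntP: "3 * card P = ec G P Q + card (nb G x \<inter> P)"
    proof -
      have "ec G P (verts G) = ec G P (Q \<union> {x})"
        by (rule ec_cong_right) (use nbP nb_sub in \<open>auto simp: Int_absorb2\<close>)
      also have "\<dots> = ec G P Q + ec G P {x}" by (rule ec_Un2) (use fsh in auto)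
      also have "ec G P {x} = ec G {x} P" by (rule ec_sym) (use fin in auto)
      finally show ?thesis using ec_V[OF PQ(2)] by simp
    qed
    have cntQ: "3 * card Q = ec G Q P + card (nb G y \<inter> Q)"
    proof -
      have "ec G Q (verts G) = ec G Q (P \<union> {y})"
        by (rule ec_cong_right) (use nbQ nb_sub in \<open>auto simp: Int_absorb2\<close>)
      also have "\<dots> = ec G Q P + ec G Q {y}" by (rule ec_Un2) (use fsh in auto)
      also have "ec G Q {y} = ec G {y} Q" by (rule ec_sym) (use fin in auto)
      finally show ?thesis using ec_V[OF PQ(3)] by simp
    qed
    have ePQ: "ec G P Q = ec G Q P" using ec_sym fin by blast
    have cutW: "2 \<le> card (nb G x \<inter> P) + card (nb G y \<inter> Q)"
    proof -
      have "cut G ?W = ec G P (verts G - ?W) + ec G Q (verts G - ?W)" by (rule ec_Un1) (use fin PQ in auto)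
      also have "ec G P (verts G - ?W) = ec G P {x}"
      proof (rule ec_cong_right)
        fix u assume "u \<in> P"
        then show "nb G u \<inter> (verts G - ?W) = nb G u \<inter> {x}" using nbP[of u] fsh by auto
      qed
      also have "ec G Q (verts G - ?W) = ec G Q {y}"
      proof (rule ec_cong_right)
        fix u assume "u \<in> Q"
        then show "nb G u \<inter> (verts G - ?W) = nb G u \<inter> {y}" using nbQ[of u] fsh by auto
      qed
      also have "ec G P {x} = ec G {x} P" by (rule ec_sym) (use fin in auto)
      also have "ec G Q {y} = ec G {y} Q" by (rule ec_sym) (use fin in auto)
      finally have "cut G ?W = card (nb G x \<inter> P) + card (nb G y \<inter> Q)" by simp
      moreover have "2 \<le> cut G ?W" by (rule cut2) (use PQ \<open>P \<noteq> {}\<close> fsh in auto)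
      ultimately show ?thesis by simp
    qed
    obtain wx where wx: "nb G x \<inter> P = {wx}" "y \<notin> nb G x"
      using exits[of x y P Q] xy P_def \<open>P \<noteq> {}\<close> nbP cntP cntQ ePQ fin fsh cPQ cutW by auto
    obtain wy where wy: "nb G y \<inter> Q = {wy}" "x \<notin> nb G y"
      using exits[of y x Q P] xy Q_def \<open>Q \<noteq> {}\<close> nbQ cntP cntQ ePQ fin fsh cPQ cutW by auto
    have wm: "wx \<in> P" "wx \<in> nb G x" "wy \<in> Q" "wy \<in> nb G y" using wx wy by auto
    let ?Y = "verts G - ?W"
    interpret t: two_cut G ?Y x wx y wy
    proof
      show "?Y \<subseteq> verts G" "x \<in> ?Y" "y \<in> ?Y" "x \<noteq> y" "wx \<notin> ?Y" "wy \<notin> ?Y" "wx \<noteq> wy"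
        "wx \<in> nb G x" "wy \<in> nb G y" "y \<notin> nb G x"
        using fsh xy wm PQ wx by auto
      fix u z assume u: "u \<in> ?Y" "z \<in> nb G u" "z \<notin> ?Y"
      then have zW: "z \<in> P \<or> z \<in> Q" and uz: "u \<in> nb G z" using nb_verts by (auto simp: nb_sym[of u])
      from zW show "u = x \<and> z = wx \<or> u = y \<and> z = wy"
      proof
        assume z: "z \<in> P"
        then have "u = x" using nbP[OF z] uz u by auto
        then have "z \<in> nb G x \<inter> P" using u z by simp
        then show ?thesis using wx \<open>u = x\<close> by simp
      next
        assume z: "z \<in> Q"
        then have "u = y" using nbQ[OF z] uz u by auto
        then have "z \<in> nb G y \<inter> Q" using u z by simp
        then show ?thesis using wy \<open>u = y\<close> by simp
      qed
    qed
    have YK: "?Y - {..<4} = {v \<in> verts G - {..<4}. l v \<noteq> (x,y) \<and> l v \<noteq> (y,x)}" unfolding P_def Q_def by auto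
    have KY: "{..<4} \<subseteq> ?Y" using K PQ by auto
    have R1: "k4like t.R {..<4} l"
      unfolding k4like_def t.vertsR
    proof (intro conjI ballI allI)
      fix v assume "v \<in> ?Y - {..<4}"
      then have "v \<in> verts G - {..<4}" by auto
      from lK[OF this] show "fst (l v) \<in> {..<4}" "snd (l v) \<in> {..<4}" "fst (l v) \<noteq> snd (l v)" by auto
    next
      fix u v assume u: "u \<in> ?Y - {..<4}" "v \<in> nb t.R u"
      then have "v \<in> nb G u" using t.nb_R[of v u] xy by auto
      then show "v = fst (l u) \<or> v \<notin> {..<4} \<and> l v = prod.swap (l u)" using ln[of u v] u by auto
    next
      fix p
      have "{v \<in> ?Y - {..<4}. l v = q} = (if q = (x,y) \<or> q = (y,x) then {} else {v \<in> verts G - {..<4}. l v = q})" for q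
        unfolding YK by auto
      moreover have "prod.swap p = (x,y) \<longleftrightarrow> p = (y,x)" "prod.swap p = (y,x) \<longleftrightarrow> p = (x,y)" by (cases p; auto)+
      ultimately show "card {v \<in> ?Y - {..<4}. l v = p} = card {v \<in> ?Y - {..<4}. l v = prod.swap p}"
        using lc[of p] by auto
    qed (use KY in auto)
    have R2: "k4full t.R {..<4} l"
      unfolding k4full_def t.vertsR
    proof (intro ballI impI)
      fix a b assume ab: "a \<in> {..<4::nat}" "b \<in> {..<4}" "a \<noteq> b"
      show "b \<in> nb t.R a \<or> (\<exists>v\<in>?Y - {..<4}. l v = (a, b))"
      proof (cases "(a,b) = (x,y) \<or> (a,b) = (y,x)")
        case True then show ?thesis using t.nb_R by auto
      next
        case False
        have "b \<in> nb G a \<or> (\<exists>v\<in>verts G - {..<4}. l v = (a, b))" using k(2) ab unfolding k4full_def by blast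
        then show ?thesis
        proof
          assume "b \<in> nb G a"
          moreover have "a \<in> ?Y" "b \<in> ?Y" using subsetD[OF KY] ab by blast+
          ultimately have "b \<in> nb t.R a" using t.nb_R by blast
          then show ?thesis ..
        next
          assume "\<exists>v\<in>verts G - {..<4}. l v = (a, b)"
          then show ?thesis unfolding YK using False by auto
        qed
      qed
    qed
    let ?S' = "{{a, b} | a b. \<exists>v\<in>?Y - {..<4}. l v = (a, b)}"
    have IH: "K4_replaced ?S' t.R"
    proof -
      have "card (verts t.R) < card (verts G)"
        unfolding t.vertsR by (rule psubset_card_mono) (use wm PQ in auto)
      from less.hyps[OF this t.R.cub_axioms R1 R2] show ?thesis by simp
    qed
    have Seq: "{{a, b} | a b. \<exists>v\<in>verts G - {..<4}. l v = (a, b)} = insert {x,y} ?S'"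
    proof
      show "{{a, b} | a b. \<exists>v\<in>verts G - {..<4}. l v = (a, b)} \<subseteq> insert {x,y} ?S'"
      proof
        fix e assume "e \<in> {{a, b} | a b. \<exists>v\<in>verts G - {..<4}. l v = (a, b)}"
        then obtain a b v where e: "e = {a,b}" "v \<in> verts G - {..<4}" "l v = (a,b)" by blast
        show "e \<in> insert {x,y} ?S'"
        proof (cases "(a,b) = (x,y) \<or> (a,b) = (y,x)")
          case True then show ?thesis using e by auto
        next
          case False
          then have "v \<in> ?Y - {..<4}" unfolding YK using e by auto
          then show ?thesis using e by blast
        qed
      qed
      show "insert {x,y} ?S' \<subseteq> {{a, b} | a b. \<exists>v\<in>verts G - {..<4}. l v = (a, b)}"
        using v0 lv0 by blast
    qed
    have nS: "{x,y} \<notin> ?S'"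
    proof
      assume "{x,y} \<in> ?S'"
      then obtain a b v where "{x,y} = {a,b}" "v \<in> ?Y - {..<4}" "l v = (a,b)" by blast
      then show False unfolding YK by (auto simp: doubleton_eq_iff)
    qed
    \<comment> \<open>\<open>p\<close> and \<open>q\<close> play the corners \<open>x\<close> and
      \<open>y\<close> in a disjoint copy of the gadget; the edge between them is the 22-edge at
      which it is spliced.\<close>
    obtain p where p: "p \<notin> verts G" using fresh_nat[OF finV] by blast
    obtain q where q: "q \<notin> insert p (verts G)" using fresh_nat[of "insert p (verts G)"] by auto
    have pqW: "p \<notin> ?W" "q \<notin> ?W" "p \<noteq> q" using p q PQ by auto
    define H where "H = Graph (?W \<union> {p, q}) ({e \<in> edges G. e \<subseteq> ?W} \<union> {{p, wx}, {q, wy}, {p, q}})"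
    have vH: "verts H = ?W \<union> {p, q}" unfolding H_def by simp
    have nbH: "b \<in> nb H a \<longleftrightarrow> b \<in> nb G a \<and> a \<in> ?W \<and> b \<in> ?W \<or> a = p \<and> b = wx \<or> a = wx \<and> b = p \<or>
      a = q \<and> b = wy \<or> a = wy \<and> b = q \<or> a = p \<and> b = q \<or> a = q \<and> b = p" for a b
      unfolding edge_iff_nb[symmetric] H_def by (auto simp: doubleton_eq_iff)
    have sH: "simple_graph H"
      unfolding simple_graph_def
    proof (intro conjI ballI)
      show "finite (verts H)" using vH fin by simp
      fix e assume "e \<in> edges H"
      then have "e \<in> edges G \<and> e \<subseteq> ?W \<or> e = {p, wx} \<or> e = {q, wy} \<or> e = {p, q}" unfolding H_def by auto
      moreover have "p \<noteq> wx" "q \<noteq> wy" using wm pqW by auto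
      ultimately show "e \<subseteq> verts H" "card e = 2"
        using vH wm pqW simple unfolding simple_graph_def by auto
    qed
    interpret h: sgraph H by unfold_locales (rule sH)
    have nHp: "nb H p = {wx, q}" "nb H q = {wy, p}" using nbH pqW wm by auto
    have pw: "wx \<noteq> q" "wy \<noteq> p" "wx \<noteq> p" "wy \<noteq> q" using wm pqW by auto
    have nP: "nb H u = (nb G u \<inter> Q) \<union> (if u = wx then {p} else {})" if "u \<in> P" for u
      using nbH[of _ u] nbP[OF that] that PQ wm pqW fsh by auto
    have nQ: "nb H u = (nb G u \<inter> P) \<union> (if u = wy then {q} else {})" if "u \<in> Q" for u
      using nbH[of _ u] nbQ[OF that] that PQ wm pqW fsh by auto
    have gad: "gadget H (P \<union> {q}) (Q \<union> {p}) q p"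
    proof
      show "(P \<union> {q}) \<union> (Q \<union> {p}) = verts H" using vH by auto
      show "bip_on H (P \<union> {q}) (Q \<union> {p})"
        unfolding bip_on_def
      proof (intro conjI ballI)
        show "(P \<union> {q}) \<inter> (Q \<union> {p}) = {}" using PQ pqW by auto
        show "nb H u \<inter> (P \<union> {q}) = {}" if u: "u \<in> P \<union> {q}" for u
        proof (cases "u = q")
          case True
          have "wy \<notin> P" "wy \<noteq> q" using wm(3) PQ(1) pqW by auto
          then show ?thesis unfolding True nHp using pqW by auto
        next
          case False
          then have "nb H u \<subseteq> Q \<union> {p}" using nP[of u] u by auto
          then show ?thesis using PQ(1) pqW by auto
        qed
        show "nb H u \<inter> (Q \<union> {p}) = {}" if u: "u \<in> Q \<union> {p}" for u
        proof (cases "u = p")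
          case True
          have "wx \<notin> Q" "wx \<noteq> p" using wm(1) PQ(1) pqW by auto
          then show ?thesis unfolding True nHp using pqW by auto
        next
          case False
          then have "nb H u \<subseteq> P \<union> {q}" using nQ[of u] u by auto
          then show ?thesis using PQ(1) pqW by auto
        qed
      qed
      show "q \<in> P \<union> {q}" "p \<in> Q \<union> {p}" "p \<in> nb H q" using nHp by auto
      show "card (nb H q) = 2" "card (nb H p) = 2" unfolding nHp using pw by auto
      show "card (nb H u) = 3" if u: "u \<in> verts H" "u \<noteq> q" "u \<noteq> p" for u
      proof -
        have "u \<in> P \<or> u \<in> Q" using u vH by auto
        then show ?thesis
        proof
          assume uP: "u \<in> P"
          have c3: "card (nb G u) = 3" using nb_card uP PQ by auto
          have xu: "x \<in> nb G u \<longleftrightarrow> u = wx" using wx uP wm by (auto simp: nb_sym[of x])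
          show ?thesis
          proof (cases "u = wx")
            case True
            then have "nb G u = insert x (nb G u \<inter> Q)" using nbP[OF uP] xu by auto
            then have "card (nb G u) = card (nb G u \<inter> Q) + 1" using fsh by (metis Int_iff Suc_eq_plus1 card_insert_disjoint finite_Int nb_fin)
            then show ?thesis using nP[OF uP] True c3 pqW fin by simp
          next
            case False
            then have "nb G u \<inter> Q = nb G u" using nbP[OF uP] xu by auto
            then show ?thesis using nP[OF uP] False c3 by simp
          qed
        next
          assume uQ: "u \<in> Q"
          have c3: "card (nb G u) = 3" using nb_card uQ PQ by auto
          have yu: "y \<in> nb G u \<longleftrightarrow> u = wy" using wy uQ wm by (auto simp: nb_sym[of y])
          show ?thesis
          proof (cases "u = wy")
            case True
            then have "nb G u = insert y (nb G u \<inter> P)" using nbQ[OF uQ] yu by auto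
            then have "card (nb G u) = card (nb G u \<inter> P) + 1" using fsh by (metis Int_iff Suc_eq_plus1 card_insert_disjoint finite_Int nb_fin)
            then show ?thesis using nQ[OF uQ] True c3 pqW fin by simp
          next
            case False
            then have "nb G u \<inter> P = nb G u" using nbQ[OF uQ] yu by auto
            then show ?thesis using nQ[OF uQ] False c3 by simp
          qed
        qed
      qed
      show "X = verts H" if X: "X \<subseteq> verts H" "X \<noteq> {}" "\<And>u. u \<in> X \<Longrightarrow> nb H u \<subseteq> X" for X
      proof -
        \<comment> \<open>A closed set avoiding \<open>p\<close> also avoids \<open>q\<close>,
          \<open>wx\<close> and \<open>wy\<close>. It is then closed in \<open>G\<close> and has an
          empty cut there, which is possible only for the empty set.\<close>
        have *: "Z = {}" if Z: "Z \<subseteq> verts H" "p \<notin> Z" "\<And>u. u \<in> Z \<Longrightarrow> nb H u \<subseteq> Z" for Z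
        proof (rule ccontr)
          assume ne: "Z \<noteq> {}"
          have adj: "p \<in> nb H wx" "q \<in> nb H wy" "p \<in> nb H q" using nbH by simp_all
          have "q \<notin> Z" "wx \<notin> Z" using Z(2) Z(3)[of q] Z(3)[of wx] adj by auto
          then have "wy \<notin> Z" using Z(3)[of wy] adj by auto
          have ZW: "Z \<subseteq> ?W" using Z vH \<open>q \<notin> Z\<close> by auto
          have ZV: "Z \<subseteq> verts G" using ZW PQ by auto
          have "nb G u \<subseteq> Z" if u: "u \<in> Z" for u
          proof
            fix v assume v: "v \<in> nb G u"
            have uv: "u \<in> nb G v" using v by (simp add: nb_sym)
            have "u \<in> P \<or> u \<in> Q" using u ZW by auto
            then have "v \<in> ?W"
            proof
              assume uP: "u \<in> P"
              have "v \<noteq> x"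
              proof
                assume "v = x"
                then have "u \<in> nb G x \<inter> P" using uv uP by simp
                then have "u = wx" unfolding wx(1) by simp
                then show False using \<open>wx \<notin> Z\<close> u by simp
              qed
              then show ?thesis using nbP[OF uP] v by auto
            next
              assume uQ: "u \<in> Q"
              have "v \<noteq> y"
              proof
                assume "v = y"
                then have "u \<in> nb G y \<inter> Q" using uv uQ by simp
                then have "u = wy" unfolding wy(1) by simp
                then show False using \<open>wy \<notin> Z\<close> u by simp
              qed
              then show ?thesis using nbQ[OF uQ] v by auto
            qed
            then have "v \<in> nb H u" using nbH v u ZW by blast
            then show "v \<in> Z" using Z(3)[OF u] by auto
          qed
          then have "cut G Z = 0" by (subst ec_0_iff) (use ZV finite_sub in auto)
          moreover have "2 \<le> cut G Z" by (rule cut2) (use ZV ne ZW fsh in auto)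
          ultimately show False by simp
        qed
        show ?thesis
        proof (cases "p \<in> X")
          case False
          then show ?thesis using *[of X] X by blast
        next
          case True
          have "verts H - X = {}"
          proof (rule *)
            fix u assume u: "u \<in> verts H - X"
            show "nb H u \<subseteq> verts H - X"
            proof
              fix v assume v: "v \<in> nb H u"
              then have "u \<in> nb H v" by (simp add: nb_sym)
              then have "v \<notin> X" using X(3)[of v] u by auto
              then show "v \<in> verts H - X" using v h.nb_verts by auto
            qed
          qed (use True in auto)
          then show ?thesis using X by auto
        qed
      qed
    qed
    have HD: "H \<in> H_diamond" by (rule gadget_H_diamond[OF gad])
    have e22: "edge22 H {p, q}"
      unfolding edge22_def
    proof (intro conjI ballI)
      show "{p, q} \<in> edges H" unfolding H_def by simp
      fix v assume "v \<in> {p, q}"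
      then show "degree H v = 2" unfolding h.degree_nb using nHp pw by auto
    qed
    have dj: "verts t.R \<inter> verts H = {}" unfolding t.vertsR vH using p q by auto
    interpret e: esplice t.R H x y p q
      by unfold_locales (use dj t.nb_R nHp in auto)
    have eq: "e.S = G"
    proof (rule graph_eqI[OF e.simple_S simple])
      show "verts e.S = verts G" unfolding e.verts_S t.vertsR vH using PQ pqW by auto
      fix s
      show "nb e.S s = nb G s"
      proof (rule set_eqI)
        fix t'
        have rW: "e.r a = a" if "a \<in> ?W" for a by (rule e.r_simps(3)) (use that pqW in auto)
        have f1: "t' \<in> nb t.R s \<and> {s, t'} \<noteq> {x, y} \<longleftrightarrow> t' \<in> nb G s \<and> s \<in> ?Y \<and> t' \<in> ?Y"
        proof -
          have "\<not> (t' \<in> nb G s \<and> {s, t'} = {x, y})" using wx(2) wy(2) by (auto simp: doubleton_eq_iff)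
          then show ?thesis using t.nb_R[of t' s] by (auto simp: doubleton_eq_iff)
        qed
        have f2: "(\<exists>a b. b \<in> nb H a \<and> {a, b} \<noteq> {p, q} \<and> s = e.r a \<and> t' = e.r b) \<longleftrightarrow>
           t' \<in> nb G s \<and> s \<in> ?W \<and> t' \<in> ?W \<or> s = x \<and> t' = wx \<or> s = wx \<and> t' = x \<or> s = y \<and> t' = wy \<or> s = wy \<and> t' = y"
          (is "?L \<longleftrightarrow> ?R")
        proof
          assume ?L
          then obtain a b where ab: "b \<in> nb H a" "{a, b} \<noteq> {p, q}" "s = e.r a" "t' = e.r b" by blast
          from ab(1)[unfolded nbH] ab(2) consider "b \<in> nb G a" "a \<in> ?W" "b \<in> ?W" | "a = p" "b = wx" | "a = wx" "b = p"
            | "a = q" "b = wy" | "a = wy" "b = q" by (auto simp: insert_commute)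
          then show ?R using ab(3,4) rW[of a] rW[of b] wm e.r_simps(1,2) by cases auto
        next
          assume ?R
          then consider "t' \<in> nb G s" "s \<in> ?W" "t' \<in> ?W" | "s = x" "t' = wx" | "s = wx" "t' = x" | "s = y" "t' = wy" | "s = wy" "t' = y"
            by blast
          then show ?L
          proof cases
            case 1
            then show ?thesis using rW pqW nbH by (intro exI[of _ s] exI[of _ t']) (auto simp: doubleton_eq_iff)
          next
            case 2
            then show ?thesis using rW wm pqW nbH e.r_simps by (intro exI[of _ p] exI[of _ wx]) (auto simp: doubleton_eq_iff)
          next
            case 3
            then show ?thesis using rW wm pqW nbH e.r_simps by (intro exI[of _ wx] exI[of _ p]) (auto simp: doubleton_eq_iff)
          next
            case 4
            then show ?thesis using rW wm pqW nbH e.r_simps by (intro exI[of _ q] exI[of _ wy]) (auto simp: doubleton_eq_iff)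
          next
            case 5
            then show ?thesis using rW wm pqW nbH e.r_simps by (intro exI[of _ wy] exI[of _ q]) (auto simp: doubleton_eq_iff)
          qed
        qed
        have f3: "t' \<in> nb G s \<longleftrightarrow> t' \<in> nb G s \<and> s \<in> ?Y \<and> t' \<in> ?Y \<or> t' \<in> nb G s \<and> s \<in> ?W \<and> t' \<in> ?W \<or>
          s = x \<and> t' = wx \<or> s = wx \<and> t' = x \<or> s = y \<and> t' = wy \<or> s = wy \<and> t' = y" (is "?A \<longleftrightarrow> ?B")
        proof
          assume a: ?A
          then have V: "s \<in> verts G" "t' \<in> verts G" "s \<in> nb G t'" using nb_verts by (auto simp: nb_sym[of s])
          show ?B
          proof (cases "s \<in> ?Y"; cases "t' \<in> ?Y")
            assume "s \<in> ?Y" "t' \<notin> ?Y"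
            then show ?B using t.out[of s t'] a by auto
          next
            assume "s \<notin> ?Y" "t' \<in> ?Y"
            then show ?B using t.out[of t' s] V by auto
          qed (use a V in auto)
        next
          assume ?B
          then show ?A using wm by (auto simp: nb_sym[of x] nb_sym[of y])
        qed
        show "t' \<in> nb e.S s \<longleftrightarrow> t' \<in> nb G s"
          by (rule trans[OF e.nb_S]) (simp only: f1 f2 f3[symmetric])
      qed
    qed
    have "K4_replaced (insert {x, y} ?S') (edge_splice t.R H (x, y) (p, q))"
      by (rule K4_replaced.replace[OF IH _ nS HD e22 dj]) (use xy K4_edge_iff in blast)
    then show ?thesis unfolding Seq eq .
  qed
qed

section \<open>The main theorem\<close>

lemma nb_prism:
  "nb prism 0 = {2,3,4}" "nb prism 1 = {3,4,5}" "nb prism 2 = {0,4,5}"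
  "nb prism 3 = {0,1,5}" "nb prism 4 = {0,1,2}" "nb prism 5 = {1,2,3}"
  and verts_prism: "verts prism = {0,1,2,3,4,5}"
proof -
  have lt: "{..<6::nat} = {0,1,2,3,4,5}" by auto
  have c: "edges (cycle_graph 6) = {{0,1},{1,2},{2,3},{3,4},{4,5},{5,0}}"
  proof -
    have "edges (cycle_graph 6) = (\<lambda>i. {i, Suc i mod 6}) ` {..<6}" unfolding cycle_graph_def by auto
    moreover have "Suc 0 mod 6 = 1" "Suc 1 mod 6 = 2" "Suc 2 mod 6 = 3" "Suc 3 mod 6 = 4" "Suc 4 mod 6 = 5"
      "Suc 5 mod 6 = (0::nat)" by simp_all
    ultimately show ?thesis unfolding lt by (simp only: image_insert image_empty)
  qed
  show v: "verts prism = {0,1,2,3,4,5}" unfolding prism_def complement_def cycle_graph_def using lt by simp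
  have n: "nb prism x = {y \<in> {0,1,2,3,4,5}. x \<noteq> y \<and> {x,y} \<notin> edges (cycle_graph 6)}" if "x \<in> {0,1,2,3,4,5}" for x
  proof (rule set_eqI)
    fix y
    have "verts (cycle_graph 6) = {0,1,2,3,4,5}" unfolding cycle_graph_def using lt by simp
    then have "edges prism = {{u, v} | u v. u \<in> {0,1,2,3,4,5} \<and> v \<in> {0,1,2,3,4,5} \<and> u \<noteq> v \<and> {u, v} \<notin> edges (cycle_graph 6)}"
      unfolding prism_def complement_def graph.sel by simp
    then have "{x, y} \<in> edges prism \<longleftrightarrow> (\<exists>u v. {x, y} = {u, v} \<and> u \<in> {0,1,2,3,4,5} \<and> v \<in> {0,1,2,3,4,5} \<and> u \<noteq> v \<and> {u, v} \<notin> edges (cycle_graph 6))"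
      by (simp only: mem_Collect_eq)
    also have "\<dots> \<longleftrightarrow> x \<in> {0,1,2,3,4,5} \<and> y \<in> {0,1,2,3,4,5} \<and> x \<noteq> y \<and> {x, y} \<notin> edges (cycle_graph 6)"
    proof
      assume "\<exists>u v. {x, y} = {u, v} \<and> u \<in> {0,1,2,3,4,5} \<and> v \<in> {0,1,2,3,4,5} \<and> u \<noteq> v \<and> {u, v} \<notin> edges (cycle_graph 6)"
      then obtain u v where uv: "{x, y} = {u, v}" "u \<in> {0,1,2,3,4,5}" "v \<in> {0,1,2,3,4,5}" "u \<noteq> v" "{u, v} \<notin> edges (cycle_graph 6)"
        by blast
      then have "x = u \<and> y = v \<or> x = v \<and> y = u" by (simp add: doubleton_eq_iff)
      then show "x \<in> {0,1,2,3,4,5} \<and> y \<in> {0,1,2,3,4,5} \<and> x \<noteq> y \<and> {x, y} \<notin> edges (cycle_graph 6)"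
        using uv by metis
    qed blast
    finally show "y \<in> nb prism x \<longleftrightarrow> y \<in> {y \<in> {0,1,2,3,4,5}. x \<noteq> y \<and> {x,y} \<notin> edges (cycle_graph 6)}"
      using that by (simp add: edge_iff_nb)
  qed
  show "nb prism 0 = {2,3,4}" "nb prism 1 = {3,4,5}" "nb prism 2 = {0,4,5}"
    "nb prism 3 = {0,1,5}" "nb prism 4 = {0,1,2}" "nb prism 5 = {1,2,3}"
    by (subst n; simp add: c doubleton_eq_iff; auto)+
qed

context relabel
begin

text \<open>Labels are pairs of vertices, so they are renamed along with the vertices.\<close>

lemma k4_map:
  assumes k: "k4like G K l"
  defines "l' \<equiv> \<lambda>z. map_prod f f (l (inv_into (verts G) f z))"
  shows "k4like F (f ` K) l'" "k4full G K l \<Longrightarrow> k4full F (f ` K) l'"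
proof -
  have K: "K \<subseteq> verts G" "card K = 4"
    and lK: "\<And>v. v \<in> verts G - K \<Longrightarrow> fst (l v) \<in> K \<and> snd (l v) \<in> K \<and> fst (l v) \<noteq> snd (l v)"
    and ln: "\<And>u v. u \<in> verts G - K \<Longrightarrow> v \<in> nb G u \<Longrightarrow> v = fst (l u) \<or> v \<notin> K \<and> l v = prod.swap (l u)"
    and lc: "\<And>p. card {v \<in> verts G - K. l v = p} = card {v \<in> verts G - K. l v = prod.swap p}"
    using k unfolding k4like_def by blast+
  have l': "l' (f x) = map_prod f f (l x)" if "x \<in> verts G" for x
    unfolding l'_def using inv_into_f_f[OF inj that] by simp
  have fK: "f x \<in> f ` K \<longleftrightarrow> x \<in> K" if "x \<in> verts G" for x
    by (rule inj_on_image_mem_iff[OF inj that K(1)])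
  have VK: "verts F - f ` K = f ` (verts G - K)"
    using inj_on_image_set_diff[OF inj, of "verts G" K] K by auto
  have mp: "map_prod f f p = map_prod f f q \<longleftrightarrow> p = q"
    if "fst p \<in> K" "snd p \<in> K" "fst q \<in> K" "snd q \<in> K" for p q
    using that K inj_onD[OF inj] by (cases p; cases q) auto
  show "k4like F (f ` K) l'"
    unfolding k4like_def VK
  proof (intro conjI ballI allI)
    show "f ` K \<subseteq> verts F" "card (f ` K) = 4" using K card_map by auto
    fix v assume "v \<in> f ` (verts G - K)"
    then obtain x where x: "v = f x" "x \<in> verts G - K" by auto
    have "f (fst (l x)) \<noteq> f (snd (l x))" using lK[OF x(2)] inj_onD[OF inj] K by blast
    then show "fst (l' v) \<in> f ` K" "snd (l' v) \<in> f ` K" "fst (l' v) \<noteq> snd (l' v)"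
      using l'[of x] x lK[OF x(2)] by auto
  next
    fix u v assume u: "u \<in> f ` (verts G - K)" and v: "v \<in> nb F u"
    obtain x where x: "u = f x" "x \<in> verts G - K" using u by auto
    then obtain y where y: "v = f y" "y \<in> nb G x" using v nb_map[of x] by auto
    have yV: "y \<in> verts G" using nb_verts[OF y(2)] by simp
    from ln[OF x(2) y(2)] show "v = fst (l' u) \<or> v \<notin> f ` K \<and> l' v = prod.swap (l' u)"
    proof
      assume "y = fst (l x)"
      then show ?thesis using x y l'[of x] by simp
    next
      assume "y \<notin> K \<and> l y = prod.swap (l x)"
      then show ?thesis using x y l'[of x] l'[OF yV] fK[OF yV] by (cases "l x") auto
    qed
  next
    fix p
    have cnt: "card {v \<in> f ` (verts G - K). l' v = map_prod f f q} = card {v \<in> verts G - K. l v = q}"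
      if "fst q \<in> K" "snd q \<in> K" for q
    proof -
      have "{v \<in> f ` (verts G - K). l' v = map_prod f f q} = f ` {v \<in> verts G - K. l v = q}"
      proof (intro set_eqI iffI)
        fix z assume "z \<in> {v \<in> f ` (verts G - K). l' v = map_prod f f q}"
        then obtain x where x: "z = f x" "x \<in> verts G - K" "l' (f x) = map_prod f f q" by auto
        then have "l x = q" using l'[of x] mp[of "l x" q] lK[OF x(2)] that by simp
        then show "z \<in> f ` {v \<in> verts G - K. l v = q}" using x by blast
      next
        fix z assume "z \<in> f ` {v \<in> verts G - K. l v = q}"
        then show "z \<in> {v \<in> f ` (verts G - K). l' v = map_prod f f q}" using l' by auto
      qed
      then show ?thesis using card_map[of "{v \<in> verts G - K. l v = q}"] by auto
    qed
    show "card {v \<in> f ` (verts G - K). l' v = p} = card {v \<in> f ` (verts G - K). l' v = prod.swap p}"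
    proof (cases "\<exists>q. fst q \<in> K \<and> snd q \<in> K \<and> p = map_prod f f q")
      case True
      then obtain q where q: "fst q \<in> K" "snd q \<in> K" "p = map_prod f f q" by blast
      moreover have "prod.swap p = map_prod f f (prod.swap q)" using q(3) by (cases q) auto
      ultimately show ?thesis using cnt[of q] cnt[of "prod.swap q"] lc[of q] by simp
    next
      case False
      \<comment> \<open>A pair that is not the image of two corners occurs as a label neither
        directly nor swapped, so both counts are 0.\<close>
      have "l' v \<noteq> p \<and> l' v \<noteq> prod.swap p" if v: "v \<in> f ` (verts G - K)" for v
      proof -
        obtain x where x: "v = f x" "x \<in> verts G - K" using v by auto
        have a: "fst (l x) \<in> K" "snd (l x) \<in> K" "l' v = map_prod f f (l x)" using lK[OF x(2)] l'[of x] x by auto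
        moreover have "prod.swap (l' v) = map_prod f f (prod.swap (l x))" using a(3) by (cases "l x") auto
        moreover have "l' v = prod.swap p \<Longrightarrow> p = prod.swap (l' v)" by simp
        ultimately show ?thesis using False by (metis fst_swap snd_swap)
      qed
      then have "{v \<in> f ` (verts G - K). l' v = p} = {}" "{v \<in> f ` (verts G - K). l' v = prod.swap p} = {}" by auto
      then show ?thesis by (simp only:)
    qed
  qed
  show "k4full F (f ` K) l'" if full: "k4full G K l"
    unfolding k4full_def VK
  proof (intro ballI impI)
    fix a b assume ab: "a \<in> f ` K" "b \<in> f ` K" "a \<noteq> b"
    then obtain x y where xy: "a = f x" "b = f y" "x \<in> K" "y \<in> K" "x \<noteq> y" by auto
    then have "y \<in> nb G x \<or> (\<exists>v\<in>verts G - K. l v = (x, y))" using full unfolding k4full_def by blast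
    then show "b \<in> nb F a \<or> (\<exists>v\<in>f ` (verts G - K). l' v = (a, b))"
    proof
      assume "y \<in> nb G x"
      then show ?thesis using nb_map[of x] xy K by auto
    next
      assume "\<exists>v\<in>verts G - K. l v = (x, y)"
      then obtain v where v: "v \<in> verts G - K" "l v = (x, y)" by blast
      then have "l' (f v) = (a, b)" using l'[of v] xy by simp
      then show ?thesis using v by blast
    qed
  qed
qed

end

context cub
begin

lemma card4_iso_K4:
  assumes c4: "card (verts G) = 4" shows "G \<cong>\<^sub>g K4"
proof -
  obtain f where f: "bij_betw f (verts G) (verts K4)"
    using finite_same_card_bij[of "verts G" "verts K4"] c4 by (auto simp: verts_K4)
  have full: "nb G x = verts G - {x}" if x: "x \<in> verts G" for x
  proof (rule card_subset_eq)
    show "nb G x \<subseteq> verts G - {x}" using nb_sub by auto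
    show "card (nb G x) = card (verts G - {x})" using nb_card[OF x] c4 x by simp
  qed simp
  show ?thesis
  proof (rule graph_isoI[OF simple f])
    fix x assume x: "x \<in> verts G"
    have "nb K4 (f x) = verts K4 - {f x}"
    proof (rule set_eqI)
      fix z
      have "f x \<in> verts K4" using f x by (auto simp: bij_betw_def)
      then show "z \<in> nb K4 (f x) \<longleftrightarrow> z \<in> verts K4 - {f x}"
        using K4_edge_iff[of "f x" z] by (auto simp: edge_iff_nb verts_K4)
    qed
    also have "\<dots> = f ` (verts G - {x})"
      using f x inj_on_image_set_diff[of f "verts G" "verts G" "{x}"] unfolding bij_betw_def by auto
    finally show "nb K4 (f x) = f ` nb G x" using full[OF x] by simp
  qed
qed

text \<open>The complement is 2-regular of order 6: a hexagon, which gives the prism, or two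
  triangles, whose complement is the bipartite graph with classes of size 3. The complement is
  explored from \<open>v\<close> in both directions, with \<open>cn\<close> as its neighbour
  sets.\<close>

lemma card6_iso_prism:
  assumes c6: "card (verts G) = 6" and nb: "\<not> bipartite G"
  shows "G \<cong>\<^sub>g prism"
proof -
  define cn where "cn x = verts G - {x} - nb G x" for x
  have cc: "card (cn x) = 2" if x: "x \<in> verts G" for x
  proof -
    have "cn x = verts G - insert x (nb G x)" unfolding cn_def by auto
    moreover have "card (verts G - insert x (nb G x)) = card (verts G) - card (insert x (nb G x))"
      by (rule card_Diff_subset) (use x nb_sub in auto)
    ultimately show ?thesis using c6 nb_card[OF x] by simp
  qed
  have cs: "y \<in> cn x \<Longrightarrow> x \<in> verts G \<Longrightarrow> x \<in> cn y" and cV: "y \<in> cn x \<Longrightarrow> y \<in> verts G \<and> y \<noteq> x" for x y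
    unfolding cn_def using nb_sym[of x G y] by auto
  have two: "\<exists>z. cn x = {y, z} \<and> z \<noteq> y" if "x \<in> verts G" "y \<in> cn x" for x y
  proof -
    have "card (cn x - {y}) = 1" using cc[OF that(1)] that(2) by simp
    then obtain z where z: "cn x - {y} = {z}" by (auto simp: card_1_singleton_iff)
    then have "cn x = {y, z}" using that(2) by auto
    then show ?thesis using z by auto
  qed
  obtain v where v: "v \<in> verts G" using V_ne by blast
  obtain a b where ab: "cn v = {a, b}" "a \<noteq> b" using cc[OF v] by (auto simp: card_2_iff)
  have abV: "a \<in> verts G" "b \<in> verts G" "a \<noteq> v" "b \<noteq> v" "v \<in> cn a" "v \<in> cn b"
    using cV[of a v] cV[of b v] cs[of a v] cs[of b v] ab v by auto
  obtain c where c: "cn a = {v, c}" "c \<noteq> v" using two[OF abV(1,5)] by blast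
  have cVV: "c \<in> verts G" "c \<noteq> a" "a \<in> cn c" using cV[of c a] cs[of c a] c abV by auto
  \<comment> \<open>A triangle in the complement: \<open>v\<close>, \<open>a\<close>,
    \<open>b\<close> are pairwise nonadjacent and therefore all joined to each of the other three
    vertices, making \<open>G\<close> bipartite.\<close>
  have cb: "c \<noteq> b"
  proof
    assume "c = b"
    have ba: "a \<in> cn b" using cVV(3) \<open>c = b\<close> by simp
    let ?P = "{v, a, b}" and ?Q = "verts G - {v, a, b}"
    have cP: "card ?P = 3" "?P \<subseteq> verts G" using ab abV v by auto
    have cQ: "card ?Q = 3" using cP c6 card_Diff_subset[of ?P "verts G"] by simp
    have nP: "nb G x \<inter> ?P = {}" if "x \<in> ?P" for x
    proof -
      have "a \<notin> nb G v" "b \<notin> nb G v" "b \<notin> nb G a" using ab(1) c(1) \<open>c = b\<close> unfolding cn_def by blast+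
      then have "y \<notin> nb G x" if "x \<in> ?P" "y \<in> ?P" for x y
        using that nb_sym[of _ G] by auto
      then show ?thesis using that by blast
    qed
    have nPQ: "nb G x = ?Q" if "x \<in> ?P" for x
    proof (rule card_subset_eq)
      show "nb G x \<subseteq> ?Q" using nP[OF that] nb_sub by blast
      show "card (nb G x) = card ?Q" using cQ nb_card[of x] that cP(2) by auto
    qed simp
    have nQP: "nb G x = ?P" if x: "x \<in> ?Q" for x
    proof (rule card_subset_eq[symmetric])
      show "?P \<subseteq> nb G x"
      proof
        fix y assume "y \<in> ?P"
        then have "x \<in> nb G y" using nPQ x by blast
        then show "y \<in> nb G x" by (simp add: nb_sym)
      qed
      show "card ?P = card (nb G x)" using cP nb_card[of x] x by simp
    qed simp
    have "bip_on G ?P ?Q" unfolding bip_on_def using nP nQP by simp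
    moreover have "?P \<union> ?Q = verts G" using cP by auto
    ultimately show False using nb bipartite_iff by blast
  qed
  obtain d where d: "cn b = {v, d}" "d \<noteq> v" using two[OF abV(2,6)] by blast
  have dV: "d \<in> verts G" "d \<noteq> b" "b \<in> cn d" using cV[of d b] cs[of d b] d abV by auto
  have da: "d \<noteq> a" using cs[of d b] d(1) abV c cb ab by auto
  have rest: "\<exists>x\<in>verts G. x \<notin> F" if "finite F" "card F \<le> 5" for F
  proof (rule ccontr)
    assume "\<not> ?thesis"
    then have "card (verts G) \<le> card F" using that by (intro card_mono) auto
    then show False using c6 that by simp
  qed
  \<comment> \<open>A 4-cycle in the complement would leave two further vertices, so
    \<open>e\<close> could have only one neighbour in the complement instead of two.\<close>
  have dc: "d \<noteq> c"
  proof
    assume dc: "d = c"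
    have "cn c = {a, b}"
    proof -
      have "{a, b} \<subseteq> cn c" using cVV dV dc by auto
      moreover have "card {a,b} = card (cn c)" using cc[OF cVV(1)] ab(2) by simp
      moreover have "finite (cn c)" unfolding cn_def by simp
      ultimately show ?thesis by (metis card_subset_eq)
    qed
    let ?F = "{v, a, b, c}"
    have "card ?F \<le> 5" by (simp add: card_insert_if)
    then obtain e where e: "e \<in> verts G" "e \<notin> ?F" using rest[of ?F] by auto
    have sub: "cn e \<subseteq> verts G - insert e ?F"
    proof
      fix y assume y: "y \<in> cn e"
      have ey: "e \<in> cn y" using cs[OF y e(1)] .
      have "y \<notin> ?F" using ey e(2) ab(1) c(1) d(1) dc \<open>cn c = {a,b}\<close> by auto
      then show "y \<in> verts G - insert e ?F" using cV[OF y] by auto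
    qed
    have "card (insert e ?F) = 5" using e(2) ab abV c cb cVV by auto
    moreover have "insert e ?F \<subseteq> verts G" using e abV cVV v by auto
    ultimately have "card (verts G - insert e ?F) = 1" using c6 by (subst card_Diff_subset) auto
    moreover have "card (cn e) \<le> card (verts G - insert e ?F)" by (rule card_mono[OF _ sub]) simp
    ultimately show False using cc[OF e(1)] by simp
  qed
  let ?F = "{v, a, b, c, d}"
  have "card ?F \<le> 5" by (simp add: card_insert_if)
  then obtain e where e: "e \<in> verts G" "e \<notin> ?F" using rest[of ?F] by auto
  have dist: "v \<noteq> a" "v \<noteq> c" "v \<noteq> e" "v \<noteq> d" "v \<noteq> b" "a \<noteq> c" "a \<noteq> e" "a \<noteq> d" "a \<noteq> b"
    "c \<noteq> e" "c \<noteq> d" "c \<noteq> b" "e \<noteq> d" "e \<noteq> b" "d \<noteq> b"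
    using e ab abV c cb cVV dV da dc d by auto
  have V: "verts G = {v, a, c, e, d, b}"
  proof (rule card_subset_eq[symmetric])
    show "{v, a, c, e, d, b} \<subseteq> verts G" using v abV cVV dV e by auto
    show "card {v, a, c, e, d, b} = card (verts G)" using c6 by (simp add: dist dist[symmetric])
  qed simp
  obtain x where x: "cn c = {a, x}" "x \<noteq> a" using two[OF cVV(1,3)] by blast
  have xc: "c \<in> cn x" "x \<in> verts G" "x \<noteq> c" using cs[of x c] cV[of x c] x cVV by auto
  have xde: "x = d \<or> x = e"
  proof -
    have "x \<noteq> v" "x \<noteq> b" using xc(1) ab(1) d(1) dist by auto
    then show ?thesis using xc(2,3) x(2) V by auto
  qed
  obtain y where y: "cn d = {b, y}" "y \<noteq> b" using two[OF dV(1,3)] by blast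
  have yd: "d \<in> cn y" "y \<in> verts G" "y \<noteq> d" using cs[of y d] cV[of y d] y dV by auto
  have "x \<noteq> d"
  proof
    assume "x = d"
    then have "c \<in> cn d" using xc by simp
    then have "cn d = {b, c}" using y dist by auto
    have "cn e \<noteq> {}" using cc[OF e(1)] by auto
    then obtain z where z: "z \<in> cn e" by blast
    then have "e \<in> cn z" "z \<in> verts G" "z \<noteq> e" using cs[OF z e(1)] cV[OF z] by auto
    then show False using V ab(1) c(1) d(1) x(1) \<open>x = d\<close> \<open>cn d = {b, c}\<close> dist by auto
  qed
  then have xe: "cn c = {a, e}" using xde x by auto
  have "y \<noteq> v" "y \<noteq> a" "y \<noteq> c" using yd(1) ab(1) c(1) xe dist by auto
  then have "y = e" using yd y V by auto
  then have cd: "cn d = {b, e}" using y by simp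
  have ce: "cn e = {c, d}"
  proof -
    have "c \<in> cn e" "d \<in> cn e" using cs[of e c] cs[of e d] xe cd cVV dV by auto
    then have "{c, d} \<subseteq> cn e" by auto
    moreover have "card {c,d} = card (cn e)" using cc[OF e(1)] dist by simp
    moreover have "finite (cn e)" unfolding cn_def by simp
    ultimately show ?thesis by (metis card_subset_eq)
  qed
  have ncn: "nb G x = verts G - {x} - cn x" if "x \<in> verts G" for x
    unfolding cn_def using nb_sub[of x] by auto
  have nbs: "nb G v = {c, e, d}" "nb G a = {e, d, b}" "nb G c = {v, d, b}"
    "nb G e = {v, a, b}" "nb G d = {v, a, c}" "nb G b = {a, c, e}"
    using ncn[of v] ncn[of a] ncn[of c] ncn[of e] ncn[of d] ncn[of b] ab(1) c(1) d(1) xe cd ce V dist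
    by auto
  \<comment> \<open>Numbers follow the hexagon \<open>v\<close>, \<open>a\<close>, \<open>c\<close>,
    \<open>e\<close>, \<open>d\<close>, \<open>b\<close> of the complement, in the cyclic order of
    \<open>cycle_graph 6\<close>.\<close>
  define f where "f z = (if z = v then 0 else if z = a then 1 else if z = c then 2 else if z = e then 3 else if z = d then 4 else 5::nat)" for z
  have fv: "f v = 0" "f a = 1" "f c = 2" "f e = 3" "f d = 4" "f b = 5" unfolding f_def using dist by auto
  show ?thesis
  proof (rule graph_isoI[OF simple])
    have im: "f ` verts G = verts prism" unfolding V verts_prism using fv by simp
    then have "card (f ` verts G) = card (verts G)" using c6 by (simp add: verts_prism)
    then show "bij_betw f (verts G) (verts prism)"
      using im eq_card_imp_inj_on[OF finV] unfolding bij_betw_def by blast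
    fix z assume "z \<in> verts G"
    then have "z = v \<or> z = a \<or> z = c \<or> z = e \<or> z = d \<or> z = b" unfolding V by simp
    then show "nb prism (f z) = f ` nb G z"
      by (elim disjE; simp only: nbs fv nb_prism image_insert image_empty)
  qed
qed

end

theorem theorem3p1:
  fixes G :: "'a graph"
  assumes "simple_graph G" and "k_connected 2 G" and "cubic G" and "\<not> bipartite G"
  shows "(Upsilon G \<ge> 4 \<and>
          (Upsilon G = 4 \<longleftrightarrow> (\<exists>F \<in> {K4} \<union> (\<Union>i\<in>{1..6}. family_F i). G \<cong>\<^sub>g F))) \<and>
         (k_connected 3 G \<and> \<not> G \<cong>\<^sub>g K4 \<longrightarrow>
          Upsilon G \<ge> 6 \<and>
          (Upsilon G = 6 \<longleftrightarrow> (\<exists>F \<in> {prism, K33tri} \<union> family_G1 \<union> family_G2. G \<cong>\<^sub>g F)))"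
proof -
  interpret sgraph G by unfold_locales (rule assms(1))
  have e2: "edge_conn 2 G" by (rule k_edge_conn[OF assms(3,2)]) simp_all
  interpret cub G by unfold_locales (use assms(3) e2 in auto)
  note U4 = two_conn_Upsilon[OF assms(1,3) e2 assms(4)]
  have "Upsilon G = 4 \<longleftrightarrow> (\<exists>F \<in> {K4} \<union> (\<Union>i\<in>{1..6}. family_F i). G \<cong>\<^sub>g F)"
  proof
    assume "Upsilon G = 4"
    then obtain K l where k: "k4like G K l" "k4full G K l" using U4 by blast
    have K: "K \<subseteq> verts G" "card K = 4" "finite K" using k(1) finite_sub unfolding k4like_def by auto
    obtain k0 where k0: "bij_betw k0 K {..<4::nat}"
      using finite_same_card_bij[OF K(3), of "{..<4::nat}"] K(2) by auto
    obtain h :: "'a \<Rightarrow> nat" where h: "inj_on h (verts G)" using finite_imp_inj_to_nat_seg[OF finV] by blast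
    \<comment> \<open>The corners take the vertex names 0 to 3 of \<open>K4\<close>, and the shift
      by 4 keeps all other vertices apart from them.\<close>
    define g where "g x = (if x \<in> K then k0 x else 4 + h x)" for x
    have g4: "g x < 4 \<longleftrightarrow> x \<in> K" for x using k0 unfolding g_def bij_betw_def by auto
    have gK: "g ` K = {..<4}" using k0 unfolding g_def bij_betw_def by auto
    have inj: "inj_on g (verts G)"
    proof (rule inj_onI)
      fix x y assume xy: "x \<in> verts G" "y \<in> verts G" "g x = g y"
      then have "x \<in> K \<longleftrightarrow> y \<in> K" using g4[of x] g4[of y] by simp
      then show "x = y" using xy h k0 unfolding g_def bij_betw_def by (auto dest: inj_onD split: if_splits)
    qed
    interpret r: relabel G g by unfold_locales (rule inj)
    interpret rc: cub r.F by unfold_locales (use r.cubic_map[OF cub] r.edge_conn_map[OF conn] in auto)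
    obtain l' where "k4like r.F {..<4} l'" "k4full r.F {..<4} l'"
      using r.k4_map(1)[OF k(1)] r.k4_map(2)[OF k] unfolding gK by blast
    then have S: "K4_replaced {{x, y} | x y. \<exists>v\<in>verts r.F - {..<4}. l' v = (x, y)} r.F" (is "K4_replaced ?S _")
      by (rule k4_to_K4_replaced[OF rc.cub_axioms])
    \<comment> \<open>\<open>K4\<close> has six edges, which bounds the index of the family.\<close>
    have sub: "?S \<subseteq> {{0,1},{0,2},{0,3},{1,2},{1,3},{2,3}}" using K4_replaced_sub[OF S] K4_edges_sub by (rule subset_trans)
    have "card {{0,1},{0,2},{0,3},{1,2},{1,3},{2,3::nat}} \<le> 6" by (simp add: card_insert_if)
    then have "card ?S \<le> 6" using card_mono[OF _ sub] by simp
    show "\<exists>F \<in> {K4} \<union> (\<Union>i\<in>{1..6}. family_F i). G \<cong>\<^sub>g F"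
    proof (cases "?S = {}")
      case True
      have "r.F = K4" using S[unfolded True] by cases auto
      then show ?thesis using r.iso_map by auto
    next
      case False
      have "finite ?S" using sub by (rule finite_subset) simp
      then have "1 \<le> card ?S" using False by (simp add: Suc_le_eq card_gt_0_iff)
      then have "r.F \<in> (\<Union>i\<in>{1..6}. family_F i)"
        using \<open>card ?S \<le> 6\<close> S unfolding family_F_def by auto
      then show ?thesis using r.iso_map by blast
    qed
  next
    assume "\<exists>F \<in> {K4} \<union> (\<Union>i\<in>{1..6}. family_F i). G \<cong>\<^sub>g F"
    then obtain F where F: "F \<in> {K4} \<union> (\<Union>i\<in>{1..6}. family_F i)" "G \<cong>\<^sub>g F" by blast
    then have "\<exists>S. K4_replaced S F" unfolding family_F_def using K4_replaced.K4 by blast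
    then obtain l where "k4like F {..<4} l" using K4_replaced_k4like by blast
    \<comment> \<open>The labels are transported to \<open>G\<close> itself; there the barriers they
      define leave at most four nice vertices, and the general lower bound supplies
      equality.\<close>
    then obtain K l where "k4like G K l" using k4like_iso[OF assms(1) F(2)] by blast
    then show "Upsilon G = 4" using k4like_Upsilon U4 by (metis le_antisym)
  qed
  moreover have "Upsilon G \<ge> 6 \<and> (Upsilon G = 6 \<longleftrightarrow> (\<exists>F \<in> {prism, K33tri} \<union> family_G1 \<union> family_G2. G \<cong>\<^sub>g F))"
    if h: "k_connected 3 G" "\<not> G \<cong>\<^sub>g K4"
  proof -
    have e3: "edge_conn 3 G" by (rule k_edge_conn[OF assms(3) h(1)]) simp_all
    interpret cub3 G by unfold_locales (rule e3)
    have "card (verts G) \<noteq> 4" using card4_iso_K4 h(2) by blast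
    note U6 = three_conn_Upsilon[OF assms(1,3) e3 assms(4) this]
    have "Upsilon G = 6 \<longleftrightarrow> (\<exists>F \<in> {prism, K33tri} \<union> family_G1 \<union> family_G2. G \<cong>\<^sub>g F)"
    proof
      assume "Upsilon G = 6"
      then consider "card (verts G) = 6" | "six_struct G" using U6 by blast
      then show "\<exists>F \<in> {prism, K33tri} \<union> family_G1 \<union> family_G2. G \<cong>\<^sub>g F"
      proof cases
        case 1
        then show ?thesis using card6_iso_prism assms(4) by blast
      next
        case 2
        then show ?thesis using six_forward unfolding six_struct_def by blast
      qed
    next
      assume "\<exists>F \<in> {prism, K33tri} \<union> family_G1 \<union> family_G2. G \<cong>\<^sub>g F"
      then obtain F where F: "F \<in> {prism, K33tri} \<union> family_G1 \<union> family_G2" "G \<cong>\<^sub>g F" by blast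
      \<comment> \<open>The lower bound is already known. The prism has only six vertices, and for
        the other members the core found in \<open>F\<close> is transported to
        \<open>G\<close>.\<close>
      have "Upsilon G \<le> 6"
      proof (cases "F = prism")
        case True
        then have "card (verts G) = card (verts prism)"
          using F(2) bij_betw_same_card unfolding graph_iso_def by blast
        then show ?thesis using Upsilon_le by (simp add: verts_prism)
      next
        case False
        then have "F \<in> {K33tri} \<union> family_G1 \<union> family_G2" using F(1) by blast
        from family_core6[OF this] obtain T B P1 Q1 P2 Q2 where c: "core6 F T B P1 Q1 P2 Q2" by (elim exE)
        have "six_struct G" by (rule core6_iso[OF assms(1) F(2) c])
        then show ?thesis using core6_Upsilon_le unfolding six_struct_def by blast
      qed
      then show "Upsilon G = 6" using U6 by simp
    qed
    then show ?thesis using U6 by blast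
  qed
  ultimately show ?thesis using U4 by blast
qed

end
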